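(* Let $H$ be the Hopf algebra over $\Bbbk=\mathbb C$ associated to a group datum $(G,\chi,g,1)$ of non-nilpotent type, as in the context. For any $i\in\Omega_0$ and $1\le j\le n-1$, $$\mathrm{FPdim}(\overline{M[j,i]})=\dim(V_i)\,F_j\!\left(1,2\cos\tfrac{\pi}{n}\right),$$ where $F_j(Y,Z)$ is the $j$-th Dickson polynomial (of the second type).
   Context: Let $\Bbbk=\mathbb C$; modules are finite-dimensional left modules. Fix a finite group $G$, a $\Bbbk$-linear character $\chi$ of $G$ and a central element $g\in G$; let $n\ge 2$ be the order of $q=\chi(g)$, and assume $\chi^n=1$ and $g^n\neq 1$. $H$ is the Hopf algebra generated as an algebra by $y$ and $G$, with $\Bbbk G$ as a subalgebra and relations $y^n=g^n-1$, $yh=\chi(h)hy$ for $h\in G$; $\Delta(y)=y\otimes g+1\otimes y$, $\varepsilon(y)=0$, $S(y)=-yg^{-1}$, and the elements of $G$ are group-like. It has $\Bbbk$-basis $\{y^ih\mid h\in G,\ 0\le i\le n-1\}$. Let $\{V_i\mid i\in\Omega\}$ be a complete set of simple $\Bbbk G$-modules up to isomorphism and $\Omega_0$ the set of $i\in\Omega$ such that $g^n$ acts as the identity on $V_i$. For $k\ge0$, $x^kV_i=\{x^kv\mid v\in V_i\}$ is a copy of the vector space $V_i$ with $G$-action $h(x^kv)=\chi^{-k}(h)x^k(hv)$. For $i\in\Omega_0$, $1\le j\le n$, $M(j,i)=V_i\oplus xV_i\oplus\cdots\oplus x^{j-1}V_i$ is the $H$-module with this $G$-action and $y(x^sv)=x^{s+1}v$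 for $0\le s\le j-2$, $y(x^{j-1}v)=0$; $M[j,i]$ is its class in the Green ring $r(H)$ (generated by isomorphism classes modulo direct sums, product given by $\otimes$). The stable Green ring $r_{st}(H)$ is the Green ring of the stable module category of $H$; equivalently $r_{st}(H)=r(H)/\mathcal P$, where $\mathcal P$ is the ideal spanned by the classes of indecomposable projective $H$-modules. $\overline{M[j,i]}$ is the image of $M[j,i]$ in $r_{st}(H)$; the elements $\overline{M[j,i]}$ with $i\in\Omega_0$, $1\le j\le n-1$ form a $\mathbb Z$-basis of $r_{st}(H)$. $\mathrm{FPdim}(\overline{M[j,i]})$ (the Frobenius–Perron dimension) is the maximal nonnegative eigenvalue of the matrix of left multiplication by $\overline{M[j,i]}$ on $r_{st}(H)$ with respect to this basis. The Dickson polynomials are defined by $F_1(Y,Z)=1$, $F_2(Y,Z)=Z$ and $F_j(Y,Z)=ZF_{j-1}(Y,Z)-YF_{j-2}(Y,Z)$ for $j\ge3$. *)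

theory Defs
  imports
    "HOL-Algebra.QuotRing"
    "HOL-Library.Countable_Set"
    "HOL-Library.FuncSet"
    "HOL-Library.Poly_Mapping"
    "Jordan_Normal_Form.Char_Poly"
begin


section \<open>Algebras given by a finite basis and structure constants\<close>

definition unit_coord :: "'b \<Rightarrow> 'b \<Rightarrow> complex" where
  "unit_coord b = (\<lambda>x. of_bool (x = b))"

text \<open>Elements are coordinate functions vanishing off the basis \<open>B\<close>; \<open>m x y\<close> is the coordinate
  function of the product of the basis elements \<open>x\<close> and \<open>y\<close>.\<close>

definition based_algebra ::
    "'b set \<Rightarrow> ('b \<Rightarrow> 'b \<Rightarrow> 'b \<Rightarrow> complex) \<Rightarrow> ('b \<Rightarrow> complex) \<Rightarrow> (complex, 'b \<Rightarrow> complex) module" where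
  "based_algebra B m u =
    \<lparr>carrier = {a. \<forall>z. z \<notin> B \<longrightarrow> a z = 0},
     monoid.mult = (\<lambda>a b z. \<Sum>x\<in>B. \<Sum>y\<in>B. a x * b y * m x y z),
     monoid.one = u,
     ring.zero = (\<lambda>_. 0),
     ring.add = (\<lambda>a b z. a z + b z),
     module.smult = (\<lambda>c a z. c * a z)\<rparr>"

lemma based_algebra_ring:
  assumes B: "finite B"
    and m: "\<And>x y z. x \<in> B \<Longrightarrow> y \<in> B \<Longrightarrow> z \<notin> B \<Longrightarrow> m x y z = 0"
    and u: "\<And>z. z \<notin> B \<Longrightarrow> u z = 0"
    and ul: "\<And>y z. y \<in> B \<Longrightarrow> z \<in> B \<Longrightarrow> (\<Sum>x\<in>B. u x * m x y z) = of_bool (z = y)"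
    and ur: "\<And>x z. x \<in> B \<Longrightarrow> z \<in> B \<Longrightarrow> (\<Sum>y\<in>B. u y * m x y z) = of_bool (z = x)"
    and assoc: "\<And>x y w z. x \<in> B \<Longrightarrow> y \<in> B \<Longrightarrow> w \<in> B \<Longrightarrow>
      (\<Sum>t\<in>B. m x y t * m t w z) = (\<Sum>t\<in>B. m y w t * m x t z)"
  shows "ring (based_algebra B m u)"
proof (rule ringI)
  show "abelian_group (based_algebra B m u)"
  proof (rule abelian_groupI, goal_cases)
    case (6 x)
    then show ?case
      by (intro bexI[of _ "\<lambda>z. - x z"]) (auto simp: based_algebra_def)
  qed (auto simp: based_algebra_def fun_eq_iff)
  show "monoid (based_algebra B m u)"
  proof (rule monoidI, goal_cases)
    case (1 x y)
    then show ?case using m by (auto simp: based_algebra_def intro!: sum.neutral)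
  next
    case 2
    then show ?case using u by (auto simp: based_algebra_def)
  next
    case (3 a b c)
    have "(\<Sum>t\<in>B. \<Sum>w\<in>B. (\<Sum>x\<in>B. \<Sum>y\<in>B. a x * b y * m x y t) * c w * m t w z)
       = (\<Sum>x\<in>B. \<Sum>t\<in>B. a x * (\<Sum>y\<in>B. \<Sum>w\<in>B. b y * c w * m y w t) * m x t z)" for z
    proof -
      have "(\<Sum>t\<in>B. \<Sum>w\<in>B. (\<Sum>x\<in>B. \<Sum>y\<in>B. a x * b y * m x y t) * c w * m t w z)
         = (\<Sum>t\<in>B. \<Sum>w\<in>B. \<Sum>x\<in>B. \<Sum>y\<in>B. a x * b y * c w * (m x y t * m t w z))"
        by (simp add: sum_distrib_left sum_distrib_right mult_ac)
      also have "\<dots> = (\<Sum>w\<in>B. \<Sum>t\<in>B. \<Sum>x\<in>B. \<Sum>y\<in>B. a x * b y * c w * (m x y t * m t w z))"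
        by (rule sum.swap)
      also have "\<dots> = (\<Sum>w\<in>B. \<Sum>x\<in>B. \<Sum>t\<in>B. \<Sum>y\<in>B. a x * b y * c w * (m x y t * m t w z))"
        by (rule sum.cong[OF refl], rule sum.swap)
      also have "\<dots> = (\<Sum>w\<in>B. \<Sum>x\<in>B. \<Sum>y\<in>B. \<Sum>t\<in>B. a x * b y * c w * (m x y t * m t w z))"
        by (rule sum.cong[OF refl], rule sum.cong[OF refl], rule sum.swap)
      also have "\<dots> = (\<Sum>w\<in>B. \<Sum>x\<in>B. \<Sum>y\<in>B. \<Sum>t\<in>B. a x * b y * c w * (m y w t * m x t z))"
        by (rule sum.cong[OF refl], rule sum.cong[OF refl], rule sum.cong[OF refl]) (simp add: assoc flip: sum_distrib_left)
      also have "\<dots> = (\<Sum>x\<in>B. \<Sum>w\<in>B. \<Sum>y\<in>B. \<Sum>t\<in>B. a x * b y * c w * (m y w t * m x t z))"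
        by (rule sum.swap)
      also have "\<dots> = (\<Sum>x\<in>B. \<Sum>y\<in>B. \<Sum>w\<in>B. \<Sum>t\<in>B. a x * b y * c w * (m y w t * m x t z))"
        by (rule sum.cong[OF refl], rule sum.swap)
      also have "\<dots> = (\<Sum>x\<in>B. \<Sum>y\<in>B. \<Sum>t\<in>B. \<Sum>w\<in>B. a x * b y * c w * (m y w t * m x t z))"
        by (rule sum.cong[OF refl], rule sum.cong[OF refl], rule sum.swap)
      also have "\<dots> = (\<Sum>x\<in>B. \<Sum>t\<in>B. \<Sum>y\<in>B. \<Sum>w\<in>B. a x * b y * c w * (m y w t * m x t z))"
        by (rule sum.cong[OF refl], rule sum.swap)
      also have "\<dots> = (\<Sum>x\<in>B. \<Sum>t\<in>B. a x * (\<Sum>y\<in>B. \<Sum>w\<in>B. b y * c w * m y w t) * m x t z)"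
        by (simp add: sum_distrib_left sum_distrib_right mult_ac)
      finally show ?thesis .
    qed
    then show ?case by (simp add: based_algebra_def)
  next
    case (4 a)
    have "(\<Sum>x\<in>B. \<Sum>y\<in>B. u x * a y * m x y z) = a z" for z
    proof (cases "z \<in> B")
      case True
      have "(\<Sum>x\<in>B. \<Sum>y\<in>B. u x * a y * m x y z) = (\<Sum>y\<in>B. a y * (\<Sum>x\<in>B. u x * m x y z))"
        by (subst sum.swap) (simp add: sum_distrib_left mult_ac)
      also have "\<dots> = (\<Sum>y\<in>B. if z = y then a y else 0)"
        by (intro sum.cong refl) (simp add: ul True)
      finally show ?thesis using True B by simp
    qed (use 4 m in \<open>simp add: based_algebra_def\<close>)
    then show ?case by (auto simp: based_algebra_def)
  next
    case (5 a)
    have "(\<Sum>x\<in>B. \<Sum>y\<in>B. a x * u y * m x y z) = a z" for z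
    proof (cases "z \<in> B")
      case True
      have "(\<Sum>x\<in>B. \<Sum>y\<in>B. a x * u y * m x y z) = (\<Sum>x\<in>B. a x * (\<Sum>y\<in>B. u y * m x y z))"
        by (simp add: sum_distrib_left mult_ac)
      also have "\<dots> = (\<Sum>x\<in>B. if z = x then a x else 0)"
        by (intro sum.cong refl) (simp add: ur True)
      finally show ?thesis using True B by simp
    qed (use 5 m in \<open>simp add: based_algebra_def\<close>)
    then show ?case by (auto simp: based_algebra_def)
  qed
qed (auto simp: based_algebra_def fun_eq_iff algebra_simps sum.distrib)

lemma based_algebra_mult_unit_coord:
  assumes "finite B" "x \<in> B" "y \<in> B"
  shows "unit_coord x \<otimes>\<^bsub>based_algebra B m u\<^esub> unit_coord y = m x y"
proof -
  have "(\<Sum>x'\<in>B. \<Sum>y'\<in>B. unit_coord x x' * unit_coord y y' * m x' y' z) = m x y z" for z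
  proof -
    have "(\<Sum>x'\<in>B. \<Sum>y'\<in>B. unit_coord x x' * unit_coord y y' * m x' y' z)
       = (\<Sum>x'\<in>B. if x' = x then (\<Sum>y'\<in>B. if y' = y then m x' y' z else 0) else 0)"
      by (intro sum.cong refl) (auto simp: unit_coord_def intro!: sum.cong)
    then show ?thesis using assms by simp
  qed
  then show ?thesis by (simp add: based_algebra_def)
qed


section \<open>Finite-dimensional left modules over a complex algebra\<close>

text \<open>A finite-dimensional left module is taken on the coordinate space \<open>\<complex>\<^sup>d\<close>, as a
  representation by \<open>d \<times> d\<close> matrices; up to isomorphism this is every such module.
  The zero module (\<open>d = 0\<close>) is included.\<close>

datatype 'a fdmod = FDMod (mdim: nat) (act: "'a \<Rightarrow> complex mat")

definition is_fdmod :: "(complex, 'a, 'r) module_scheme \<Rightarrow> 'a fdmod \<Rightarrow> bool" where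
  "is_fdmod A M \<longleftrightarrow>
     (\<forall>a\<in>carrier A. act M a \<in> carrier_mat (mdim M) (mdim M)) \<and>
     (\<forall>a\<in>carrier A. \<forall>b\<in>carrier A. act M (a \<oplus>\<^bsub>A\<^esub> b) = act M a + act M b) \<and>
     (\<forall>c. \<forall>a\<in>carrier A. act M (c \<odot>\<^bsub>A\<^esub> a) = c \<cdot>\<^sub>m act M a) \<and>
     (\<forall>a\<in>carrier A. \<forall>b\<in>carrier A. act M (a \<otimes>\<^bsub>A\<^esub> b) = act M a * act M b) \<and>
     act M \<one>\<^bsub>A\<^esub> = 1\<^sub>m (mdim M)"

definition mod_hom ::
    "(complex, 'a, 'r) module_scheme \<Rightarrow> 'a fdmod \<Rightarrow> 'a fdmod \<Rightarrow> complex mat set" where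
  "mod_hom A M N =
     {T \<in> carrier_mat (mdim N) (mdim M). \<forall>a\<in>carrier A. T * act M a = act N a * T}"

definition mod_iso :: "(complex, 'a, 'r) module_scheme \<Rightarrow> 'a fdmod \<Rightarrow> 'a fdmod \<Rightarrow> bool" where
  "mod_iso A M N \<longleftrightarrow>
     (\<exists>T\<in>mod_hom A M N. \<exists>S\<in>mod_hom A N M. S * T = 1\<^sub>m (mdim M) \<and> T * S = 1\<^sub>m (mdim N))"

definition dsum :: "'a fdmod \<Rightarrow> 'a fdmod \<Rightarrow> 'a fdmod" where
  "dsum M N = FDMod (mdim M + mdim N)
     (\<lambda>a. four_block_mat (act M a) (0\<^sub>m (mdim M) (mdim N)) (0\<^sub>m (mdim N) (mdim M)) (act N a))"

definition submod :: "(complex, 'a, 'r) module_scheme \<Rightarrow> complex vec set \<Rightarrow> 'a fdmod \<Rightarrow> bool" where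
  "submod A W M \<longleftrightarrow>
     W \<subseteq> carrier_vec (mdim M) \<and> 0\<^sub>v (mdim M) \<in> W \<and>
     (\<forall>v\<in>W. \<forall>w\<in>W. v + w \<in> W) \<and> (\<forall>c. \<forall>v\<in>W. c \<cdot>\<^sub>v v \<in> W) \<and>
     (\<forall>a\<in>carrier A. \<forall>v\<in>W. act M a *\<^sub>v v \<in> W)"

definition simple_mod :: "(complex, 'a, 'r) module_scheme \<Rightarrow> 'a fdmod \<Rightarrow> bool" where
  "simple_mod A M \<longleftrightarrow> is_fdmod A M \<and> mdim M > 0 \<and>
     (\<forall>W. submod A W M \<longrightarrow> W = {0\<^sub>v (mdim M)} \<or> W = carrier_vec (mdim M))"

definition indecomposable_mod :: "(complex, 'a, 'r) module_scheme \<Rightarrow> 'a fdmod \<Rightarrow> bool" where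
  "indecomposable_mod A M \<longleftrightarrow> is_fdmod A M \<and> mdim M > 0 \<and>
     (\<forall>K L. is_fdmod A K \<longrightarrow> is_fdmod A L \<longrightarrow> mod_iso A M (dsum K L) \<longrightarrow> mdim K = 0 \<or> mdim L = 0)"

definition surj_hom :: "'a fdmod \<Rightarrow> 'a fdmod \<Rightarrow> complex mat \<Rightarrow> bool" where
  "surj_hom M N T \<longleftrightarrow> (\<lambda>v. T *\<^sub>v v) ` carrier_vec (mdim M) = carrier_vec (mdim N)"

definition projective_mod :: "(complex, 'a, 'r) module_scheme \<Rightarrow> 'a fdmod \<Rightarrow> bool" where
  "projective_mod A P \<longleftrightarrow> is_fdmod A P \<and>
     (\<forall>M N. is_fdmod A M \<longrightarrow> is_fdmod A N \<longrightarrow>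
       (\<forall>f\<in>mod_hom A M N. surj_hom M N f \<longrightarrow>
         (\<forall>h\<in>mod_hom A P N. \<exists>k\<in>mod_hom A P M. f * k = h)))"

definition complete_simples ::
    "(complex, 'a, 'r) module_scheme \<Rightarrow> 'i set \<Rightarrow> ('i \<Rightarrow> 'a fdmod) \<Rightarrow> bool" where
  "complete_simples A \<Omega> V \<longleftrightarrow>
     (\<forall>i\<in>\<Omega>. simple_mod A (V i)) \<and>
     (\<forall>i\<in>\<Omega>. \<forall>j\<in>\<Omega>. mod_iso A (V i) (V j) \<longrightarrow> i = j) \<and>
     (\<forall>M. simple_mod A M \<longrightarrow> (\<exists>i\<in>\<Omega>. mod_iso A M (V i)))"

text \<open>Matrix of \<open>S \<otimes> T\<close> in the basis \<open>e\<^sub>r \<otimes> e\<^sub>s\<close>, numbered by \<open>r * dim N + s\<close>.\<close>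

definition kron :: "complex mat \<Rightarrow> complex mat \<Rightarrow> complex mat" where
  "kron S T = mat (dim_row S * dim_row T) (dim_col S * dim_col T)
     (\<lambda>(r, c). S $$ (r div dim_row T, c div dim_col T) * T $$ (r mod dim_row T, c mod dim_col T))"


section \<open>Perron eigenvalue of left multiplication in a based ring\<close>

text \<open>Integer coordinates with respect to a \<open>\<int>\<close>-basis \<open>(b p)\<close>, \<open>p \<in> I\<close>.\<close>

definition coords :: "('a, 'r) ring_scheme \<Rightarrow> 'p set \<Rightarrow> ('p \<Rightarrow> 'a) \<Rightarrow> 'a \<Rightarrow> 'p \<Rightarrow> int" where
  "coords R I b x =
     (THE c. c \<in> I \<rightarrow>\<^sub>E UNIV \<and> x = (\<Oplus>\<^bsub>R\<^esub>p\<in>I. add_pow R (c p) (b p)))"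

text \<open>The finite index set is enumerated by \<open>from_nat_into I\<close>; the spectrum of the matrix does
  not depend on the enumeration.\<close>

definition left_mult_mat :: "('a, 'r) ring_scheme \<Rightarrow> 'p set \<Rightarrow> ('p \<Rightarrow> 'a) \<Rightarrow> 'a \<Rightarrow> int mat" where
  "left_mult_mat R I b x = mat (card I) (card I)
     (\<lambda>(r, c). coords R I b (x \<otimes>\<^bsub>R\<^esub> b (from_nat_into I c)) (from_nat_into I r))"

definition FPdim :: "('a, 'r) ring_scheme \<Rightarrow> 'p set \<Rightarrow> ('p \<Rightarrow> 'a) \<Rightarrow> 'a \<Rightarrow> real" where
  "FPdim R I b x =
     Max {t. 0 \<le> t \<and> eigenvalue (map_mat complex_of_int (left_mult_mat R I b x)) (complex_of_real t)}"


section \<open>Dickson polynomials of the second type\<close>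

text \<open>The index starts at 1; the value at 0 is a dummy.\<close>

fun dickson :: "nat \<Rightarrow> 'a::comm_ring_1 \<Rightarrow> 'a \<Rightarrow> 'a" where
  "dickson 0 Y Z = 0"
| "dickson (Suc 0) Y Z = 1"
| "dickson (Suc (Suc 0)) Y Z = Z"
| "dickson (Suc (Suc (Suc j))) Y Z = Z * dickson (Suc (Suc j)) Y Z - Y * dickson (Suc j) Y Z"


section \<open>The Hopf algebra of a group datum of non-nilpotent type\<close>

locale non_nilpotent_group_datum = group G for G (structure) +
  fixes \<chi> :: "'a \<Rightarrow> complex" and g :: 'a and n :: nat
  assumes finite_G: "finite (carrier G)"
    and chi_one: "\<chi> \<one> = 1"
    and chi_mult: "\<And>h k. h \<in> carrier G \<Longrightarrow> k \<in> carrier G \<Longrightarrow> \<chi> (h \<otimes> k) = \<chi> h * \<chi> k"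
    and g_closed: "g \<in> carrier G"
    and g_central: "\<And>h. h \<in> carrier G \<Longrightarrow> g \<otimes> h = h \<otimes> g"
    and n_ge_2: "2 \<le> n"
    and q_pow_n: "\<chi> g ^ n = 1"
    and q_pow_less: "\<And>m. 0 < m \<Longrightarrow> m < n \<Longrightarrow> \<chi> g ^ m \<noteq> 1"
    and chi_pow_n: "\<And>h. h \<in> carrier G \<Longrightarrow> \<chi> h ^ n = 1"
    and g_pow_n: "g [^] n \<noteq> \<one>"
begin

definition kG :: "(complex, 'a \<Rightarrow> complex) module" where
  "kG = based_algebra (carrier G) (\<lambda>h k. unit_coord (h \<otimes> k)) (unit_coord \<one>)"

text \<open>The pair \<open>(i, h)\<close> stands for the basis element \<open>y\<^sup>i h\<close> of \<open>H\<close>.\<close>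

definition H_basis :: "(nat \<times> 'a) set" where
  "H_basis = {..<n} \<times> carrier G"

text \<open>From \<open>h y = \<chi>(h)\<inverse> y h\<close> one gets
  \<open>(y\<^sup>i h)(y\<^sup>j k) = \<chi>(h)\<^sup>-\<^sup>j y\<^sup>i\<^sup>+\<^sup>j hk\<close>, reduced by \<open>y\<^sup>n = g\<^sup>n - 1\<close> with \<open>g\<^sup>n\<close> central.\<close>

definition H_bprod :: "nat \<times> 'a \<Rightarrow> nat \<times> 'a \<Rightarrow> nat \<times> 'a \<Rightarrow> complex" where
  "H_bprod = (\<lambda>(i, h) (j, k) z. inverse (\<chi> h) ^ j *
     (if i + j < n then unit_coord (i + j, h \<otimes> k) z
      else unit_coord (i + j - n, g [^] n \<otimes> (h \<otimes> k)) z - unit_coord (i + j - n, h \<otimes> k) z))"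

definition H :: "(complex, nat \<times> 'a \<Rightarrow> complex) module" where
  "H = based_algebra H_basis H_bprod (unit_coord (0, \<one>))"

abbreviation H_y :: "nat \<times> 'a \<Rightarrow> complex" where
  "H_y \<equiv> unit_coord (1, \<one>)"

abbreviation H_grp :: "'a \<Rightarrow> nat \<times> 'a \<Rightarrow> complex" where
  "H_grp h \<equiv> unit_coord (0, h)"

text \<open>\<open>H\<close> is an associative unital algebra in which the elements \<open>y\<close> and \<open>h \<in> G\<close> satisfy the
  defining relations and the monomials \<open>y\<^sup>i h\<close> form the coordinate basis, so it is the algebra
  presented by these generators and relations. \<open>H_nf t w\<close> is the normal form of \<open>y\<^sup>t w\<close> for
  arbitrary \<open>t\<close>.\<close>

function H_nf :: "nat \<Rightarrow> 'a \<Rightarrow> nat \<times> 'a \<Rightarrow> complex" where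
  "H_nf t w z = (if t < n then unit_coord (t, w) z
     else H_nf (t - n) (g [^] n \<otimes> w) z - H_nf (t - n) w z)"
  by auto
termination using n_ge_2 by (relation "measure (\<lambda>(t, w, z). t)") auto

declare H_nf.simps [simp del]

lemma H_bprod_nf:
  "(i, h) \<in> H_basis \<Longrightarrow> (j, k) \<in> H_basis \<Longrightarrow>
    H_bprod (i, h) (j, k) z = inverse (\<chi> h) ^ j * H_nf (i + j) (h \<otimes> k) z"
  using n_ge_2 by (subst H_nf.simps) (auto simp: H_bprod_def H_basis_def H_nf.simps)

lemma gn_closed: "g [^] n \<in> carrier G" using g_closed by simp

lemma gn_central: "h \<in> carrier G \<Longrightarrow> g [^] (m::nat) \<otimes> h = h \<otimes> g [^] m"
proof (induction m)
  case (Suc m)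
  then show ?case using g_closed g_central by (simp add: m_assoc) (simp flip: m_assoc)
qed simp

lemma chi_pow: "h \<in> carrier G \<Longrightarrow> \<chi> (h [^] (m::nat)) = \<chi> h ^ m"
  by (induction m) (auto simp: chi_one chi_mult mult.commute)

lemma chi_gn: "\<chi> (g [^] n) = 1" using chi_pow g_closed q_pow_n by simp

lemma finite_H_basis: "finite H_basis" using finite_G by (simp add: H_basis_def)

lemma H_nf_outside: "w \<in> carrier G \<Longrightarrow> z \<notin> H_basis \<Longrightarrow> H_nf t w z = 0"
proof (induction t arbitrary: w rule: less_induct)
  case (less t)
  show ?case
  proof (cases "t < n")
    case True
    then show ?thesis using less by (subst H_nf.simps) (auto simp: H_basis_def unit_coord_def)
  next
    case False
    then show ?thesis using less gn_closed n_ge_2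
      by (subst H_nf.simps) (auto)
  qed
qed

lemma H_nf_right:
  assumes "w \<in> carrier G" "(l, v) \<in> H_basis"
  shows "(\<Sum>t'\<in>H_basis. H_nf t w t' * H_bprod t' (l, v) z)
    = inverse (\<chi> w) ^ l * H_nf (t + l) (w \<otimes> v) z"
  using assms(1)
proof (induction t arbitrary: w rule: less_induct)
  case (less t)
  have v: "v \<in> carrier G" using assms by (simp add: H_basis_def)
  show ?case
  proof (cases "t < n")
    case True
    then have tw: "(t, w) \<in> H_basis" using less by (simp add: H_basis_def)
    have "(\<Sum>t'\<in>H_basis. H_nf t w t' * H_bprod t' (l, v) z)
        = (\<Sum>t'\<in>H_basis. if t' = (t, w) then H_bprod t' (l, v) z else 0)"
      using True by (intro sum.cong refl) (auto simp: H_nf.simps unit_coord_def)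
    then show ?thesis using tw finite_H_basis assms by (simp add: H_bprod_nf)
  next
    case False
    have lt: "t - n < t" using False n_ge_2 by simp
    have gw: "g [^] n \<otimes> w \<in> carrier G" using less gn_closed by simp
    have "(\<Sum>t'\<in>H_basis. H_nf t w t' * H_bprod t' (l, v) z)
       = (\<Sum>t'\<in>H_basis. H_nf (t - n) (g [^] n \<otimes> w) t' * H_bprod t' (l, v) z)
         - (\<Sum>t'\<in>H_basis. H_nf (t - n) w t' * H_bprod t' (l, v) z)"
      using False by (simp add: H_nf.simps[of t] left_diff_distrib sum_subtractf)
    also have "\<dots> = inverse (\<chi> w) ^ l * H_nf (t - n + l) (g [^] n \<otimes> (w \<otimes> v)) z
         - inverse (\<chi> w) ^ l * H_nf (t - n + l) (w \<otimes> v) z"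
      using less.IH[OF lt gw] less.IH[OF lt less.prems] less.prems v gn_closed
      by (simp add: m_assoc chi_mult chi_gn)
    also have "\<dots> = inverse (\<chi> w) ^ l * H_nf (t + l) (w \<otimes> v) z"
      using False by (subst (3) H_nf.simps) (simp add: right_diff_distrib)
    finally show ?thesis .
  qed
qed

lemma H_nf_left:
  assumes "w \<in> carrier G" "(i, h) \<in> H_basis"
  shows "(\<Sum>t'\<in>H_basis. H_nf t w t' * H_bprod (i, h) t' z)
    = inverse (\<chi> h) ^ t * H_nf (i + t) (h \<otimes> w) z"
  using assms(1)
proof (induction t arbitrary: w rule: less_induct)
  case (less t)
  have h: "h \<in> carrier G" using assms by (simp add: H_basis_def)
  show ?case
  proof (cases "t < n")
    case True
    then have tw: "(t, w) \<in> H_basis" using less by (simp add: H_basis_def)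
    have "(\<Sum>t'\<in>H_basis. H_nf t w t' * H_bprod (i, h) t' z)
        = (\<Sum>t'\<in>H_basis. if t' = (t, w) then H_bprod (i, h) t' z else 0)"
      using True by (intro sum.cong refl) (auto simp: H_nf.simps unit_coord_def)
    then show ?thesis using tw finite_H_basis assms by (simp add: H_bprod_nf)
  next
    case False
    have lt: "t - n < t" using False n_ge_2 by simp
    have gw: "g [^] n \<otimes> w \<in> carrier G" using less gn_closed by simp
    have hgw: "h \<otimes> (g [^] n \<otimes> w) = g [^] n \<otimes> (h \<otimes> w)"
      using h less.prems gn_closed gn_central[OF h, of n] by (simp flip: m_assoc)
    have pw: "inverse (\<chi> h) ^ t = inverse (\<chi> h) ^ (t - n)"
    proof -
      have "inverse (\<chi> h) ^ n = 1" using chi_pow_n[OF h] by (simp add: power_inverse)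
      then show ?thesis using False
        by (metis le_add_diff_inverse2 mult.right_neutral not_less power_add)
    qed
    have "(\<Sum>t'\<in>H_basis. H_nf t w t' * H_bprod (i, h) t' z)
       = (\<Sum>t'\<in>H_basis. H_nf (t - n) (g [^] n \<otimes> w) t' * H_bprod (i, h) t' z)
         - (\<Sum>t'\<in>H_basis. H_nf (t - n) w t' * H_bprod (i, h) t' z)"
      using False by (simp add: H_nf.simps[of t] left_diff_distrib sum_subtractf)
    also have "\<dots> = inverse (\<chi> h) ^ t * H_nf (i + t - n) (g [^] n \<otimes> (h \<otimes> w)) z
         - inverse (\<chi> h) ^ t * H_nf (i + t - n) (h \<otimes> w) z"
      using less.IH[OF lt gw] less.IH[OF lt less.prems] False
      by (simp add: hgw pw)
    also have "\<dots> = inverse (\<chi> h) ^ t * H_nf (i + t) (h \<otimes> w) z"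
      using False by (subst (3) H_nf.simps) (simp add: right_diff_distrib)
    finally show ?thesis .
  qed
qed

lemma H_bprod_assoc:
  assumes "x \<in> H_basis" "y \<in> H_basis" "w \<in> H_basis"
  shows "(\<Sum>t\<in>H_basis. H_bprod x y t * H_bprod t w z) = (\<Sum>t\<in>H_basis. H_bprod y w t * H_bprod x t z)"
proof -
  obtain i h j k l v where e: "x = (i, h)" "y = (j, k)" "w = (l, v)" by (metis surj_pair)
  have c: "h \<in> carrier G" "k \<in> carrier G" "v \<in> carrier G"
    using assms by (auto simp: e H_basis_def)
  have "(\<Sum>t\<in>H_basis. H_bprod x y t * H_bprod t w z)
      = inverse (\<chi> h) ^ j * (inverse (\<chi> (h \<otimes> k)) ^ l * H_nf (i + j + l) (h \<otimes> k \<otimes> v) z)"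
    using assms c by (simp add: e H_bprod_nf H_nf_right mult.assoc flip: sum_distrib_left)
  also have "\<dots> = inverse (\<chi> k) ^ l * (inverse (\<chi> h) ^ (j + l) * H_nf (i + (j + l)) (h \<otimes> (k \<otimes> v)) z)"
    using c by (simp add: chi_mult m_assoc power_add power_mult_distrib add.assoc mult_ac)
  also have "\<dots> = (\<Sum>t\<in>H_basis. H_bprod y w t * H_bprod x t z)"
    using assms c by (simp add: e H_bprod_nf H_nf_left mult.assoc flip: sum_distrib_left)
  finally show ?thesis .
qed

theorem H_ring: "ring H"
  unfolding H_def
proof (rule based_algebra_ring, goal_cases)
  case 1 show ?case by (rule finite_H_basis)
next
  case (2 x y z)
  then show ?case
    by (cases x; cases y) (auto simp: H_bprod_nf intro!: H_nf_outside, auto simp: H_basis_def)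
next
  case (3 z)
  then show ?case using n_ge_2 by (auto simp: unit_coord_def H_basis_def)
next
  case (4 y z)
  have b: "(0, \<one>) \<in> H_basis" using n_ge_2 by (simp add: H_basis_def)
  have "(\<Sum>x\<in>H_basis. unit_coord (0, \<one>) x * H_bprod x y z)
     = (\<Sum>x\<in>H_basis. if x = (0, \<one>) then H_bprod x y z else 0)"
    by (intro sum.cong refl) (auto simp: unit_coord_def)
  also have "\<dots> = of_bool (z = y)"
    using 4 b finite_H_basis
    by (cases y) (auto simp: H_bprod_def H_basis_def chi_one unit_coord_def)
  finally show ?case .
next
  case (5 x z)
  have b: "(0, \<one>) \<in> H_basis" using n_ge_2 by (simp add: H_basis_def)
  have "(\<Sum>y\<in>H_basis. unit_coord (0, \<one>) y * H_bprod x y z)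
     = (\<Sum>y\<in>H_basis. if y = (0, \<one>) then H_bprod x y z else 0)"
    by (intro sum.cong refl) (auto simp: unit_coord_def)
  also have "\<dots> = of_bool (z = x)"
    using 5 b finite_H_basis
    by (cases x) (auto simp: H_bprod_def H_basis_def chi_one unit_coord_def)
  finally show ?case .
next
  case (6 x y w z)
  then show ?case by (rule H_bprod_assoc)
qed

lemma H_mult_unit_coord:
  "u \<in> H_basis \<Longrightarrow> v \<in> H_basis \<Longrightarrow> unit_coord u \<otimes>\<^bsub>H\<^esub> unit_coord v = H_bprod u v"
  using based_algebra_mult_unit_coord finite_H_basis by (simp add: H_def)

lemma chi_nonzero: "h \<in> carrier G \<Longrightarrow> \<chi> h \<noteq> 0"
  using chi_pow_n[of h] n_ge_2 by (auto simp: power_0_left)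

lemma H_grp_mult:
  "h \<in> carrier G \<Longrightarrow> k \<in> carrier G \<Longrightarrow> H_grp h \<otimes>\<^bsub>H\<^esub> H_grp k = H_grp (h \<otimes> k)"
  using n_ge_2 by (subst H_mult_unit_coord) (auto simp: H_basis_def H_bprod_def)

lemma H_smult: "c \<odot>\<^bsub>H\<^esub> a = (\<lambda>z. c * a z)"
  by (simp add: H_def based_algebra_def)

lemma H_y_commute:
  assumes h: "h \<in> carrier G"
  shows "H_y \<otimes>\<^bsub>H\<^esub> H_grp h = \<chi> h \<odot>\<^bsub>H\<^esub> (H_grp h \<otimes>\<^bsub>H\<^esub> H_y)"
proof -
  have "H_y \<otimes>\<^bsub>H\<^esub> H_grp h = H_bprod (1, \<one>) (0, h)"
    "H_grp h \<otimes>\<^bsub>H\<^esub> H_y = H_bprod (0, h) (1, \<one>)"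
    using n_ge_2 h by (auto simp: H_basis_def intro!: H_mult_unit_coord)
  then show ?thesis
    using n_ge_2 h chi_nonzero[OF h]
    by (simp add: H_bprod_def H_smult fun_eq_iff)
qed

lemma H_y_pow_less: "i < n \<Longrightarrow> H_y [^]\<^bsub>H\<^esub> i = unit_coord (i, \<one>)"
proof (induction i)
  case 0
  interpret ring H by (rule H_ring)
  show ?case by (simp add: H_def based_algebra_def)
next
  case (Suc i)
  interpret R: ring H by (rule H_ring)
  have "H_y [^]\<^bsub>H\<^esub> Suc i = H_bprod (i, \<one>) (1, \<one>)"
    using Suc n_ge_2 by (auto simp: H_basis_def intro!: H_mult_unit_coord)
  then show ?case using Suc by (simp add: H_bprod_def chi_one)
qed

lemma H_y_pow_step: "i < n \<Longrightarrow> H_y [^]\<^bsub>H\<^esub> Suc i = H_bprod (i, \<one>) (1, \<one>)"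
  using n_ge_2 H_y_pow_less[of i] H_mult_unit_coord[of "(i, \<one>)" "(1, \<one>)"]
  by (simp add: H_basis_def)

lemma H_basis_elem:
  assumes "i < n" "h \<in> carrier G"
  shows "H_y [^]\<^bsub>H\<^esub> i \<otimes>\<^bsub>H\<^esub> H_grp h = unit_coord (i, h)"
proof -
  have "H_y [^]\<^bsub>H\<^esub> i \<otimes>\<^bsub>H\<^esub> H_grp h = H_bprod (i, \<one>) (0, h)"
    using assms n_ge_2 by (auto simp: H_basis_def H_y_pow_less[unfolded One_nat_def] intro!: H_mult_unit_coord)
  then show ?thesis using assms by (simp add: H_bprod_def)
qed

lemma H_y_pow_n: "H_y [^]\<^bsub>H\<^esub> n = H_grp (g [^] n) \<ominus>\<^bsub>H\<^esub> \<one>\<^bsub>H\<^esub>"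
proof -
  interpret R: ring H by (rule H_ring)
  obtain i where i: "n = Suc i" using n_ge_2 by (cases n) auto
  have p: "H_y [^]\<^bsub>H\<^esub> n = H_bprod (i, \<one>) (1, \<one>)"
    using H_y_pow_step[of i] i by simp
  have q: "H_bprod (i, \<one>) (1, \<one>) \<oplus>\<^bsub>H\<^esub> \<one>\<^bsub>H\<^esub> = H_grp (g [^] n)"
  proof -
    have "H_bprod (i, \<one>) (1, \<one>) z + unit_coord (0, \<one>) z = H_grp (g [^] n) z" for z
    proof -
      have "\<not> i + 1 < n" "i + 1 - n = 0" using i by auto
      then show ?thesis using gn_closed by (simp add: H_bprod_def chi_one del: nat_pow_Suc)
    qed
    then show ?thesis by (simp add: H_def based_algebra_def)
  qed
  have yc: "H_y \<in> carrier H"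
    using n_ge_2 by (auto simp: H_def based_algebra_def unit_coord_def H_basis_def)
  have c: "H_bprod (i, \<one>) (1, \<one>) \<in> carrier H"
    using R.nat_pow_closed[OF yc, of n] p by simp
  show ?thesis
    using p c by (simp add: R.minus_eq R.add.m_assoc R.r_neg flip: q)
qed

definition HH :: "(complex, (nat \<times> 'a) \<times> (nat \<times> 'a) \<Rightarrow> complex) module" where
  "HH = based_algebra (H_basis \<times> H_basis)
     (\<lambda>(u, v) (u', v') (z, w). H_bprod u u' z * H_bprod v v' w)
     (unit_coord ((0, \<one>), (0, \<one>)))"

definition comult_y :: "(nat \<times> 'a) \<times> (nat \<times> 'a) \<Rightarrow> complex" where
  "comult_y = unit_coord ((1, \<one>), (0, g)) \<oplus>\<^bsub>HH\<^esub> unit_coord ((0, \<one>), (1, \<one>))"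

text \<open>\<open>\<Delta>(y\<^sup>i h) = (y \<otimes> g + 1 \<otimes> y)\<^sup>i (h \<otimes> h)\<close> and \<open>\<epsilon>(y\<^sup>i h) = 0\<^sup>i\<close>, extended linearly. The
  antipode (unique, with \<open>S(y) = - y g\<inverse>\<close>) plays no role in the Green ring.\<close>

definition comult :: "(nat \<times> 'a \<Rightarrow> complex) \<Rightarrow> (nat \<times> 'a) \<times> (nat \<times> 'a) \<Rightarrow> complex" where
  "comult a = (\<lambda>z. \<Sum>(i, h)\<in>H_basis.
     a (i, h) * (comult_y [^]\<^bsub>HH\<^esub> i \<otimes>\<^bsub>HH\<^esub> unit_coord ((0, h), (0, h))) z)"

definition counit :: "(nat \<times> 'a \<Rightarrow> complex) \<Rightarrow> complex" where
  "counit a = (\<Sum>(i, h)\<in>H_basis. a (i, h) * 0 ^ i)"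

definition triv_mod :: "(nat \<times> 'a \<Rightarrow> complex) fdmod" where
  "triv_mod = FDMod 1 (\<lambda>a. counit a \<cdot>\<^sub>m 1\<^sub>m 1)"

definition tensor_mod ::
    "(nat \<times> 'a \<Rightarrow> complex) fdmod \<Rightarrow> (nat \<times> 'a \<Rightarrow> complex) fdmod \<Rightarrow> (nat \<times> 'a \<Rightarrow> complex) fdmod" where
  "tensor_mod M N = FDMod (mdim M * mdim N)
     (\<lambda>a. mat (mdim M * mdim N) (mdim M * mdim N) (\<lambda>rc.
        \<Sum>(u, v)\<in>H_basis \<times> H_basis.
          comult a (u, v) * kron (act M (unit_coord u)) (act N (unit_coord v)) $$ rc))"


section \<open>The Green ring and the stable Green ring of \<open>H\<close>\<close>

definition iso_class :: "(nat \<times> 'a \<Rightarrow> complex) fdmod \<Rightarrow> (nat \<times> 'a \<Rightarrow> complex) fdmod set" where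
  "iso_class M = {N. is_fdmod H N \<and> mod_iso H N M}"

definition iso_classes :: "(nat \<times> 'a \<Rightarrow> complex) fdmod set set" where
  "iso_classes = iso_class ` {M. is_fdmod H M}"

definition tensor_class ::
    "(nat \<times> 'a \<Rightarrow> complex) fdmod set \<Rightarrow> (nat \<times> 'a \<Rightarrow> complex) fdmod set
      \<Rightarrow> (nat \<times> 'a \<Rightarrow> complex) fdmod set" where
  "tensor_class C D = (\<Union>M\<in>C. \<Union>N\<in>D. iso_class (tensor_mod M N))"

text \<open>The free abelian group on isomorphism classes, with the bilinear extension of \<open>\<otimes>\<close>; the
  Green ring is its quotient by the relations \<open>[M \<oplus> N] = [M] + [N]\<close>. These relations already
  span an ideal, since \<open>\<otimes>\<close> distributes over \<open>\<oplus>\<close>.\<close>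

definition free_green :: "((nat \<times> 'a \<Rightarrow> complex) fdmod set \<Rightarrow>\<^sub>0 int) ring" where
  "free_green =
    \<lparr>carrier = {x. Poly_Mapping.keys x \<subseteq> iso_classes},
     monoid.mult = (\<lambda>x y. frag_extend (\<lambda>C. frag_extend (\<lambda>D. frag_of (tensor_class C D)) y) x),
     monoid.one = frag_of (iso_class triv_mod),
     ring.zero = 0,
     ring.add = (+)\<rparr>"

definition dsum_ideal :: "((nat \<times> 'a \<Rightarrow> complex) fdmod set \<Rightarrow>\<^sub>0 int) set" where
  "dsum_ideal = Idl\<^bsub>free_green\<^esub>
     {frag_of (iso_class (dsum M N)) - frag_of (iso_class M) - frag_of (iso_class N) | M N.
        is_fdmod H M \<and> is_fdmod H N}"

definition green_ring :: "((nat \<times> 'a \<Rightarrow> complex) fdmod set \<Rightarrow>\<^sub>0 int) set ring" where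
  "green_ring = free_green Quot dsum_ideal"

definition green_class ::
    "(nat \<times> 'a \<Rightarrow> complex) fdmod \<Rightarrow> ((nat \<times> 'a \<Rightarrow> complex) fdmod set \<Rightarrow>\<^sub>0 int) set" where
  "green_class M = dsum_ideal +>\<^bsub>free_green\<^esub> frag_of (iso_class M)"

definition proj_ideal :: "((nat \<times> 'a \<Rightarrow> complex) fdmod set \<Rightarrow>\<^sub>0 int) set set" where
  "proj_ideal = Idl\<^bsub>green_ring\<^esub>
     {green_class P | P. indecomposable_mod H P \<and> projective_mod H P}"

definition stable_green_ring :: "((nat \<times> 'a \<Rightarrow> complex) fdmod set \<Rightarrow>\<^sub>0 int) set set ring" where
  "stable_green_ring = green_ring Quot proj_ideal"

definition stable_class ::
    "(nat \<times> 'a \<Rightarrow> complex) fdmod \<Rightarrow> ((nat \<times> 'a \<Rightarrow> complex) fdmod set \<Rightarrow>\<^sub>0 int) set set" where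
  "stable_class M = proj_ideal +>\<^bsub>green_ring\<^esub> green_class M"


section \<open>The modules \<open>M(j,i)\<close>\<close>

definition Omega0 :: "'i set \<Rightarrow> ('i \<Rightarrow> ('a \<Rightarrow> complex) fdmod) \<Rightarrow> 'i set" where
  "Omega0 \<Omega> V = {i\<in>\<Omega>. act (V i) (unit_coord (g [^] n)) = 1\<^sub>m (mdim (V i))}"

text \<open>For \<open>d = dim U\<close>, the coordinate \<open>s * d + t\<close> (\<open>s < j\<close>, \<open>t < d\<close>) of
  \<open>U \<oplus> xU \<oplus> \<dots> \<oplus> x\<^sup>j\<^sup>-\<^sup>1U\<close> belongs to the basis vector \<open>x\<^sup>s e\<^sub>t\<close>.\<close>

definition ladder_grp :: "nat \<Rightarrow> ('a \<Rightarrow> complex) fdmod \<Rightarrow> 'a \<Rightarrow> complex mat" where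
  "ladder_grp j U h = (let d = mdim U in mat (j * d) (j * d) (\<lambda>(r, c).
     if r div d = c div d
     then inverse (\<chi> h) ^ (c div d) * act U (unit_coord h) $$ (r mod d, c mod d)
     else 0))"

definition ladder_y :: "nat \<Rightarrow> ('a \<Rightarrow> complex) fdmod \<Rightarrow> complex mat" where
  "ladder_y j U = (let d = mdim U in mat (j * d) (j * d) (\<lambda>(r, c). of_bool (r = c + d)))"

definition ladder_mod :: "nat \<Rightarrow> ('a \<Rightarrow> complex) fdmod \<Rightarrow> (nat \<times> 'a \<Rightarrow> complex) fdmod" where
  "ladder_mod j U = FDMod (j * mdim U)
     (\<lambda>a. mat (j * mdim U) (j * mdim U) (\<lambda>rc.
        \<Sum>(s, h)\<in>H_basis. a (s, h) * (ladder_y j U ^\<^sub>m s * ladder_grp j U h) $$ rc))"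

definition M_stable ::
    "('i \<Rightarrow> ('a \<Rightarrow> complex) fdmod) \<Rightarrow> nat \<times> 'i
      \<Rightarrow> ((nat \<times> 'a \<Rightarrow> complex) fdmod set \<Rightarrow>\<^sub>0 int) set set" where
  "M_stable V = (\<lambda>(j, i). stable_class (ladder_mod j (V i)))"

definition stable_FPdim ::
    "'i set \<Rightarrow> ('i \<Rightarrow> ('a \<Rightarrow> complex) fdmod)
      \<Rightarrow> ((nat \<times> 'a \<Rightarrow> complex) fdmod set \<Rightarrow>\<^sub>0 int) set set \<Rightarrow> real" where
  "stable_FPdim \<Omega> V = FPdim stable_green_ring ({1..n - 1} \<times> Omega0 \<Omega> V) (M_stable V)"

end

end

theory Submission
  imports Defs "HOL-Computational_Algebra.Fundamental_Theorem_Algebra"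
begin

text \<open>
  Write \<open>f\<^sub>k\<close> for the stable class of \<open>M(k)\<close> built on the trivial representation and \<open>v\<^sub>i\<close> for that
  of \<open>V\<^sub>i\<close> with \<open>y = 0\<close>. Then \<open>M[k,i] = v\<^sub>i f\<^sub>k\<close>, the \<open>v\<^sub>i\<close> commute with the \<open>f\<^sub>k\<close>, and
  \<open>f\<^sub>2 f\<^sub>k = f\<^sub>k\<^sub>+\<^sub>1 + x f\<^sub>k\<^sub>-\<^sub>1\<close> with \<open>x\<close> the class of \<open>\<chi>\<^sup>-\<^sup>1\<close> and \<open>f\<^sub>n = 0\<close>. Hence products of basis
  elements are nonnegative combinations of basis elements, and the weight
  \<open>M[k,i] \<mapsto> dim V\<^sub>i \<cdot> sin(k\<pi>/n)/sin(\<pi>/n)\<close>, which is positive for \<open>0 < k < n\<close> and vanishes for \<open>k = n\<close>, is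
  multiplicative. It is therefore a positive left eigenvector of every multiplication matrix, so its
  eigenvalue is the largest nonnegative one.

  That the \<open>M[k,i]\<close> are linearly independent in the stable Green ring is seen from additive
  functionals: the traces of \<open>h \<in> G\<close> on \<open>ker y \<inter> y\<^sup>s(ker y\<^sup>n)\<close> for \<open>s < n\<close>. Suitable differences of them vanish
  on every projective module, because projectivity relative to \<open>\<complex>G\<close> forces these spaces to agree for
  all \<open>s < n\<close>, and orthogonality of characters separates the \<open>M[k,i]\<close>.
\<close>

section \<open>Matrices\<close>

text \<open>No decomposition theorem for \<open>H\<close>-modules enters. Only products of the basis
  classes are expanded; there the chain part obeys the recursion of the f_k, and the group part is
  split by Maschke's theorem.

  Independence is the harder half. Stable zero classes form a two-sided ideal, so a functional that
  is to descend must vanish on A \<otimes> P \<otimes> B for every projective P and all A, B.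
  Projectivity is therefore replaced by a condition that visibly passes to tensor products on either
  side: the existence of Z with Zh = \<chi>(h)hZ and y^(n-1)Z + y^(n-2)Zy + ... + Zy^(n-1) = 1.
  Since (y \<otimes> g + 1 \<otimes> y)^n is additive in its q-commuting summands, so is its
  derivative, and Z can be placed in one factor.

  The sine weight is forced: x has finite order, so a positive multiplicative weight gives it the
  value 1. The weights then satisfy the Dickson recursion at Y = 1, and f_n = 0 with positivity
  below n selects 2cos(pi/n) for f_2. Finally f_n = 0 holds because M(n) is induced from the trivial
  module of G, hence projective.\<close>

lemma mat_assoc:
  fixes A :: "'a::semiring_0 mat"
  assumes "dim_col A = dim_row B" "dim_col B = dim_row C"
  shows "A * B * C = A * (B * C)"
  using assms by (intro assoc_mult_mat[of _ "dim_row A" "dim_row B" _ "dim_row C" _ "dim_col C"]) auto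

lemma mat_mult_add_left:
  fixes A :: "'a::semiring_0 mat"
  assumes "dim_row A = dim_row B" "dim_col A = dim_col B" "dim_col B = dim_row C"
  shows "(A + B) * C = A * C + B * C"
  using assms by (intro add_mult_distrib_mat[of _ "dim_row A" "dim_col A" _ _ "dim_col C"]) auto

lemma mat_mult_add_right:
  fixes A :: "'a::semiring_0 mat"
  assumes "dim_row B = dim_row C" "dim_col B = dim_col C" "dim_col A = dim_row B"
  shows "A * (B + C) = A * B + A * C"
  using assms by (intro mult_add_distrib_mat[of _ "dim_row A" "dim_col A" _ "dim_col C"]) auto

lemma mat_smult_left:
  fixes A :: "'a::comm_semiring_0 mat"
  assumes "dim_col A = dim_row B"
  shows "(k \<cdot>\<^sub>m A) * B = k \<cdot>\<^sub>m (A * B)"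
  using assms by (intro mult_smult_assoc_mat[of _ "dim_row A" "dim_col A" _ "dim_col B"]) auto

lemma mat_smult_right:
  fixes A :: "'a::comm_semiring_0 mat"
  assumes "dim_col A = dim_row B"
  shows "A * (k \<cdot>\<^sub>m B) = k \<cdot>\<^sub>m (A * B)"
  using assms by (intro mult_smult_distrib[of _ "dim_row A" "dim_col A" _ "dim_col B"]) auto

lemma mult_mat_index:
  "i < dim_row A \<Longrightarrow> j < dim_col B \<Longrightarrow> dim_col A = dim_row B \<Longrightarrow>
    (A * B) $$ (i, j) = (\<Sum>l<dim_row B. A $$ (i, l) * B $$ (l, j))"
  by (simp add: scalar_prod_def atLeast0LessThan)

lemma pow_mat_Suc_left:
  fixes A :: "'a::semiring_1 mat"
  assumes A: "A \<in> carrier_mat d d"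
  shows "A ^\<^sub>m Suc k = A * A ^\<^sub>m k"
proof (induction k)
  case (Suc k)
  have "A ^\<^sub>m Suc (Suc k) = (A * A ^\<^sub>m k) * A" using Suc by simp
  also have "\<dots> = A * A ^\<^sub>m Suc k" using A by (simp add: mat_assoc)
  finally show ?case .
qed (use A in simp)

lemma pow_mat_add:
  fixes A :: "'a::semiring_1 mat"
  assumes A: "A \<in> carrier_mat d d"
  shows "A ^\<^sub>m (k + l) = A ^\<^sub>m k * A ^\<^sub>m l"
proof (induction l)
  case (Suc l)
  then show ?case using A by (simp add: mat_assoc)
qed (use A in simp)

section \<open>Linear combinations of matrices and modules over an algebra with a basis\<close>

definition lin ::
    "nat \<Rightarrow> nat \<Rightarrow> 'b set \<Rightarrow> ('b \<Rightarrow> complex) \<Rightarrow> ('b \<Rightarrow> complex mat) \<Rightarrow> complex mat" where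
  "lin nr nc B a X = mat nr nc (\<lambda>rc. \<Sum>b\<in>B. a b * X b $$ rc)"

lemma lin_carrier [simp]: "lin nr nc B a X \<in> carrier_mat nr nc"
  by (simp add: lin_def)

lemma lin_dim [simp]: "dim_row (lin nr nc B a X) = nr" "dim_col (lin nr nc B a X) = nc"
  by (simp_all add: lin_def)

lemma lin_index [simp]:
  "r < nr \<Longrightarrow> c < nc \<Longrightarrow> lin nr nc B a X $$ (r, c) = (\<Sum>b\<in>B. a b * X b $$ (r, c))"
  by (simp add: lin_def)

lemma lin_cong:
  "(\<And>b. b \<in> B \<Longrightarrow> a b = a' b) \<Longrightarrow> (\<And>b. b \<in> B \<Longrightarrow> X b = X' b) \<Longrightarrow>
    lin nr nc B a X = lin nr nc B a' X'"
  by (intro eq_matI) auto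

lemma mult_lin:
  assumes "T \<in> carrier_mat m nr" "\<And>b. b \<in> B \<Longrightarrow> X b \<in> carrier_mat nr nc"
  shows "T * lin nr nc B a X = lin m nc B a (\<lambda>b. T * X b)"
proof (rule eq_matI)
  fix i j assume ij: "i < dim_row (lin m nc B a (\<lambda>b. T * X b))" "j < dim_col (lin m nc B a (\<lambda>b. T * X b))"
  have "(T * lin nr nc B a X) $$ (i, j) = (\<Sum>l<nr. \<Sum>b\<in>B. T $$ (i, l) * (a b * X b $$ (l, j)))"
    using assms ij by (subst mult_mat_index) (auto simp: sum_distrib_left intro!: sum.cong)
  also have "\<dots> = (\<Sum>b\<in>B. a b * (\<Sum>l<nr. T $$ (i, l) * X b $$ (l, j)))"
    by (subst sum.swap) (simp add: sum_distrib_left mult_ac)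
  also have "\<dots> = (\<Sum>b\<in>B. a b * (T * X b) $$ (i, j))"
    using assms ij by (intro sum.cong refl, subst mult_mat_index) auto
  finally show "(T * lin nr nc B a X) $$ (i, j) = lin m nc B a (\<lambda>b. T * X b) $$ (i, j)"
    using ij by simp
qed (use assms in auto)

lemma lin_mult:
  assumes "T \<in> carrier_mat nc m" "\<And>b. b \<in> B \<Longrightarrow> X b \<in> carrier_mat nr nc"
  shows "lin nr nc B a X * T = lin nr m B a (\<lambda>b. X b * T)"
proof (rule eq_matI)
  fix i j assume ij: "i < dim_row (lin nr m B a (\<lambda>b. X b * T))" "j < dim_col (lin nr m B a (\<lambda>b. X b * T))"
  have "(lin nr nc B a X * T) $$ (i, j) = (\<Sum>l<nc. \<Sum>b\<in>B. (a b * X b $$ (i, l)) * T $$ (l, j))"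
    using assms ij by (subst mult_mat_index) (auto simp: sum_distrib_right intro!: sum.cong)
  also have "\<dots> = (\<Sum>b\<in>B. a b * (\<Sum>l<nc. X b $$ (i, l) * T $$ (l, j)))"
    by (subst sum.swap) (simp add: sum_distrib_left mult_ac)
  also have "\<dots> = (\<Sum>b\<in>B. a b * (X b * T) $$ (i, j))"
  proof (intro sum.cong refl)
    fix b assume b: "b \<in> B"
    then show "a b * (\<Sum>l<nc. X b $$ (i, l) * T $$ (l, j)) = a b * (X b * T) $$ (i, j)"
      using assms(1) assms(2)[OF b] ij by (subst mult_mat_index) auto
  qed
  finally show "(lin nr nc B a X * T) $$ (i, j) = lin nr m B a (\<lambda>b. X b * T) $$ (i, j)"
    using ij by simp
qed (use assms in auto)

lemma lin_lin:
  "lin nr nc B a (\<lambda>b. lin nr nc C (c b) X) = lin nr nc C (\<lambda>x. \<Sum>b\<in>B. a b * c b x) X"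
proof (rule eq_matI)
  fix i j assume ij: "i < dim_row (lin nr nc C (\<lambda>x. \<Sum>b\<in>B. a b * c b x) X)"
    "j < dim_col (lin nr nc C (\<lambda>x. \<Sum>b\<in>B. a b * c b x) X)"
  have "(\<Sum>b\<in>B. a b * (\<Sum>x\<in>C. c b x * X x $$ (i, j))) = (\<Sum>x\<in>C. (\<Sum>b\<in>B. a b * c b x) * X x $$ (i, j))"
    by (simp only: sum_distrib_left sum_distrib_right, subst sum.swap) (simp add: mult_ac)
  then show "lin nr nc B a (\<lambda>b. lin nr nc C (c b) X) $$ (i, j)
      = lin nr nc C (\<lambda>x. \<Sum>b\<in>B. a b * c b x) X $$ (i, j)"
    using ij by simp
qed auto

lemma lin_add: "lin nr nc B (\<lambda>b. a b + a' b) X = lin nr nc B a X + lin nr nc B a' X"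
  by (intro eq_matI) (auto simp: sum.distrib algebra_simps)

lemma lin_smult: "lin nr nc B (\<lambda>b. c * a b) X = c \<cdot>\<^sub>m lin nr nc B a X"
  by (intro eq_matI) (auto simp: sum_distrib_left mult_ac)

lemma lin_unit_coord:
  assumes "finite B" "b \<in> B" "X b \<in> carrier_mat nr nc"
  shows "lin nr nc B (unit_coord b) X = X b"
proof (rule eq_matI)
  fix i j assume ij: "i < dim_row (X b)" "j < dim_col (X b)"
  have "(\<Sum>x\<in>B. unit_coord b x * X x $$ (i, j)) = (\<Sum>x\<in>B. if x = b then X x $$ (i, j) else 0)"
    by (intro sum.cong) (auto simp: unit_coord_def)
  then show "lin nr nc B (unit_coord b) X $$ (i, j) = X b $$ (i, j)"
    using assms ij by simp
qed (use assms in auto)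

text \<open>Both sides are bilinear in \<open>a\<close> and \<open>b\<close>, so compatibility with
  the structure constants need only be known for pairs of basis elements.\<close>

lemma lin_based_mult:
  assumes "\<And>x. x \<in> B \<Longrightarrow> X x \<in> carrier_mat d d"
    and "\<And>x y. x \<in> B \<Longrightarrow> y \<in> B \<Longrightarrow> X x * X y = lin d d B (m x y) X"
  shows "lin d d B (a \<otimes>\<^bsub>based_algebra B m u\<^esub> b) X = lin d d B a X * lin d d B b X"
proof -
  have "lin d d B a X * lin d d B b X = lin d d B a (\<lambda>x. X x * lin d d B b X)"
    using assms by (subst lin_mult) auto
  also have "\<dots> = lin d d B a (\<lambda>x. lin d d B b (\<lambda>y. X x * X y))"
    using assms by (intro lin_cong refl mult_lin) auto
  also have "\<dots> = lin d d B a (\<lambda>x. lin d d B b (\<lambda>y. lin d d B (m x y) X))"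
    using assms by (intro lin_cong refl) auto
  also have "\<dots> = lin d d B (a \<otimes>\<^bsub>based_algebra B m u\<^esub> b) X"
    by (simp add: lin_lin based_algebra_def sum_distrib_left mult_ac)
  finally show ?thesis by simp
qed

lemma based_algebra_fdmodI:
  assumes "finite B" and X: "\<And>x. x \<in> B \<Longrightarrow> X x \<in> carrier_mat d d"
    and "\<And>x y. x \<in> B \<Longrightarrow> y \<in> B \<Longrightarrow> X x * X y = lin d d B (m x y) X"
    and "lin d d B u X = 1\<^sub>m d"
  shows "is_fdmod (based_algebra B m u) (FDMod d (\<lambda>a. lin d d B a X))"
proof -
  have "lin d d B (a \<otimes>\<^bsub>based_algebra B m u\<^esub> b) X = lin d d B a X * lin d d B b X" for a b
    using assms by (intro lin_based_mult) auto
  then show ?thesis using assms(4)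
    by (auto simp: is_fdmod_def based_algebra_def lin_add lin_smult)
qed

text \<open>Linearity spreads the action from the basis to the whole algebra.
  \<open>is_fdmod\<close> speaks of sums of two elements only, hence the induction on a finite set
  that contains the support of \<open>a\<close>.\<close>

lemma based_algebra_act:
  assumes M: "is_fdmod (based_algebra B m u) M" and B: "finite B"
    and a: "a \<in> carrier (based_algebra B m u)"
  shows "act M a = lin (mdim M) (mdim M) B a (\<lambda>b. act M (unit_coord b))"
proof -
  let ?A = "based_algebra B m u" and ?d = "mdim M" and ?X = "\<lambda>b. act M (unit_coord b)"
  have uc: "unit_coord b \<in> carrier ?A" if "b \<in> B" for b
    using that by (auto simp: based_algebra_def unit_coord_def)
  have car: "act M x \<in> carrier_mat ?d ?d" if "x \<in> carrier ?A" for x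
    using M that by (auto simp: is_fdmod_def)
  have "\<forall>a. (\<forall>z. z \<notin> S \<longrightarrow> a z = 0) \<longrightarrow> act M a = lin ?d ?d S a ?X" if "finite S" "S \<subseteq> B" for S
    using that
  proof (induction S)
    case empty
    have z: "(\<lambda>_. 0) \<in> carrier ?A" by (simp add: based_algebra_def)
    \<comment> \<open>\<open>is_fdmod\<close> has no clause for the zero element, so it is written
      as 0 times itself.\<close>
    have "act M (0 \<odot>\<^bsub>?A\<^esub> (\<lambda>_. 0)) = 0 \<cdot>\<^sub>m act M (\<lambda>_. 0)"
      using M z by (auto simp: is_fdmod_def)
    then have e: "act M (\<lambda>_. 0) = 0 \<cdot>\<^sub>m act M (\<lambda>_. 0)" by (simp add: based_algebra_def)
    have "act M (\<lambda>_. 0) = 0\<^sub>m ?d ?d"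
      by (subst e) (use car[OF z] in \<open>auto intro!: eq_matI\<close>)
    then show ?case by (auto simp: lin_def fun_eq_iff[symmetric] intro!: eq_matI)
  next
    case (insert s S)
    show ?case
    proof (intro allI impI)
      fix a :: "'a \<Rightarrow> complex" assume a: "\<forall>z. z \<notin> insert s S \<longrightarrow> a z = 0"
      have s: "s \<in> B" using insert by auto
      let ?b = "a(s := 0)"
      have "a = ?b \<oplus>\<^bsub>?A\<^esub> (a s \<odot>\<^bsub>?A\<^esub> unit_coord s)"
        by (auto simp: based_algebra_def unit_coord_def)
      moreover have "?b \<in> carrier ?A" "(a s \<odot>\<^bsub>?A\<^esub> unit_coord s) \<in> carrier ?A"
        using a insert by (auto simp: based_algebra_def unit_coord_def)
      ultimately have "act M a = act M ?b + a s \<cdot>\<^sub>m act M (unit_coord s)"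
        using M uc[OF s] unfolding is_fdmod_def by (metis (no_types, lifting))
      also have "act M ?b = lin ?d ?d S ?b ?X" using insert a by auto
      also have "\<dots> + a s \<cdot>\<^sub>m act M (unit_coord s) = lin ?d ?d (insert s S) a ?X"
        using insert car[OF uc[OF s]]
        by (intro eq_matI) (auto simp: add.commute intro!: arg_cong2[of _ _ _ _ "(+)"] sum.cong)
      finally show "act M a = lin ?d ?d (insert s S) a ?X" .
    qed
  qed
  then show ?thesis using B a by (auto simp: based_algebra_def)
qed

lemma based_algebra_mod_hom_iff:
  assumes M: "is_fdmod (based_algebra B m u) M" and N: "is_fdmod (based_algebra B m u) N"
    and B: "finite B"
  shows "T \<in> mod_hom (based_algebra B m u) M N \<longleftrightarrow> T \<in> carrier_mat (mdim N) (mdim M) \<and>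
    (\<forall>b\<in>B. T * act M (unit_coord b) = act N (unit_coord b) * T)"
proof -
  let ?A = "based_algebra B m u"
  have uc: "unit_coord b \<in> carrier ?A" if "b \<in> B" for b
    using that by (auto simp: based_algebra_def unit_coord_def)
  have car: "act K (unit_coord b) \<in> carrier_mat (mdim K) (mdim K)"
    if "b \<in> B" "is_fdmod ?A K" for b K
    using uc[OF that(1)] that by (auto simp: is_fdmod_def)
  have "T * act M a = act N a * T"
    if a: "a \<in> carrier ?A" and T: "T \<in> carrier_mat (mdim N) (mdim M)"
      and h: "\<forall>b\<in>B. T * act M (unit_coord b) = act N (unit_coord b) * T" for a
    unfolding based_algebra_act[OF M B a] based_algebra_act[OF N B a]
    using T h car M N by (subst mult_lin, simp, simp, subst lin_mult) (auto intro!: lin_cong)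
  then show ?thesis using uc by (auto simp: mod_hom_def)
qed

section \<open>Kronecker products and the interchange of tensor factors\<close>

lemma kron_dim [simp]:
  "dim_row (kron S T) = dim_row S * dim_row T" "dim_col (kron S T) = dim_col S * dim_col T"
  by (simp_all add: kron_def)

lemma kron_carrier:
  "S \<in> carrier_mat a b \<Longrightarrow> T \<in> carrier_mat c d \<Longrightarrow> kron S T \<in> carrier_mat (a * c) (b * d)"
  by (intro carrier_matI) auto

lemma kron_index [simp]:
  "r < dim_row S * dim_row T \<Longrightarrow> c < dim_col S * dim_col T \<Longrightarrow>
    kron S T $$ (r, c) = S $$ (r div dim_row T, c div dim_col T) * T $$ (r mod dim_row T, c mod dim_col T)"
  by (simp add: kron_def)

lemma divmod_less:
  fixes r m n :: nat
  assumes "r < m * n"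
  shows "r div n < m" "r mod n < n"
proof -
  have "n > 0" using assms by (cases n) auto
  then show "r div n < m" "r mod n < n" using assms by (auto simp: less_mult_imp_div_less)
qed

lemma pair_index_less:
  fixes i j m n :: nat
  assumes "i < m" "j < n"
  shows "i * n + j < m * n"
proof -
  have "i * n + j < Suc i * n" using assms by simp
  also have "\<dots> \<le> m * n" using assms by (intro mult_le_mono) auto
  finally show ?thesis .
qed

text \<open>Splits an index of a Kronecker product into its coarse and its fine part, by the pairing
  of (i, j) with i * n + j.\<close>

lemma sum_div_mod:
  fixes f :: "nat \<Rightarrow> nat \<Rightarrow> 'a::comm_monoid_add"
  shows "(\<Sum>l<m * n. f (l div n) (l mod n)) = (\<Sum>i<m. \<Sum>j<n. f i j)"
proof -
  have "(\<Sum>i<m. \<Sum>j<n. f i j) = (\<Sum>(i, j)\<in>{..<m} \<times> {..<n}. f i j)"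
    by (simp add: sum.cartesian_product)
  also have "\<dots> = (\<Sum>l<m * n. f (l div n) (l mod n))"
    by (rule sum.reindex_bij_witness[of _ "\<lambda>l. (l div n, l mod n)" "\<lambda>(i, j). i * n + j"])
      (auto simp: divmod_less pair_index_less)
  finally show ?thesis by simp
qed

lemma kron_mult:
  assumes "A \<in> carrier_mat a b" "C \<in> carrier_mat b c" "B \<in> carrier_mat a' b'" "D \<in> carrier_mat b' c'"
  shows "kron (A * C) (B * D) = kron A B * kron C D"
proof (rule eq_matI)
  fix i j assume "i < dim_row (kron A B * kron C D)" "j < dim_col (kron A B * kron C D)"
  then have ij: "i < a * a'" "j < c * c'" using assms by auto
  note l = divmod_less[OF ij(1)] divmod_less[OF ij(2)]
  have "(kron A B * kron C D) $$ (i, j) = (\<Sum>l<b * b'. kron A B $$ (i, l) * kron C D $$ (l, j))"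
    using assms ij by (subst mult_mat_index) auto
  also have "\<dots> = (\<Sum>l<b * b'. (\<lambda>x y. A $$ (i div a', x) * B $$ (i mod a', y) *
      (C $$ (x, j div c') * D $$ (y, j mod c'))) (l div b') (l mod b'))"
    using assms ij by (intro sum.cong) auto
  also have "\<dots> = (\<Sum>x<b. \<Sum>y<b'. A $$ (i div a', x) * B $$ (i mod a', y) *
      (C $$ (x, j div c') * D $$ (y, j mod c')))"
    by (rule sum_div_mod)
  also have "\<dots> = (A * C) $$ (i div a', j div c') * (B * D) $$ (i mod a', j mod c')"
    using assms l by (subst (1 2) mult_mat_index) (auto simp: sum_product mult_ac)
  also have "\<dots> = kron (A * C) (B * D) $$ (i, j)"
    using assms ij by simp
  finally show "kron (A * C) (B * D) $$ (i, j) = (kron A B * kron C D) $$ (i, j)" ..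
qed (use assms in auto)

lemma kron_one: "kron (1\<^sub>m a) (1\<^sub>m b) = 1\<^sub>m (a * b)"
proof (rule eq_matI)
  fix i j assume "i < dim_row (1\<^sub>m (a * b) :: complex mat)" "j < dim_col (1\<^sub>m (a * b) :: complex mat)"
  then have ij: "i < a * b" "j < a * b" by auto
  have "i = j \<longleftrightarrow> i div b = j div b \<and> i mod b = j mod b"
    by (metis div_mult_mod_eq)
  then show "kron (1\<^sub>m a) (1\<^sub>m b) $$ (i, j) = 1\<^sub>m (a * b) $$ (i, j)"
    using ij divmod_less[OF ij(1)] divmod_less[OF ij(2)] by auto
qed auto

lemma kron_assoc: "kron (kron A B) C = kron A (kron B C)"
proof (rule eq_matI)
  fix i j assume "i < dim_row (kron A (kron B C))" "j < dim_col (kron A (kron B C))"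
  then have i: "i < (dim_row A * dim_row B) * dim_row C" and j: "j < (dim_col A * dim_col B) * dim_col C"
    by (simp_all add: mult.assoc)
  have i': "i < dim_row A * (dim_row B * dim_row C)" and j': "j < dim_col A * (dim_col B * dim_col C)"
    using i j by (simp_all add: mult.assoc)
  have d: "x div (p * q) = x div q div p" "x mod (p * q) div q = x div q mod p"
    "x mod (p * q) mod q = x mod q" for x p q :: nat
  proof -
    show "x div (p * q) = x div q div p" by (metis div_mult2_eq mult.commute)
    have m: "x mod (p * q) = q * (x div q mod p) + x mod q" by (metis mod_mult2_eq mult.commute)
    show "x mod (p * q) div q = x div q mod p" unfolding m by (cases "q = 0") auto
    show "x mod (p * q) mod q = x mod q" unfolding m by simp
  qed
  show "kron (kron A B) C $$ (i, j) = kron A (kron B C) $$ (i, j)"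
    using i j i' j' divmod_less[OF i] divmod_less[OF j] divmod_less[OF i'] divmod_less[OF j']
    by (simp add: d mult.assoc)
qed (auto simp: mult.assoc)

lemma kron_index_pair:
  assumes "S \<in> carrier_mat a b" "T \<in> carrier_mat c d" "i < a" "k < c" "j < b" "l < d"
  shows "kron S T $$ (i * c + k, j * d + l) = S $$ (i, j) * T $$ (k, l)"
  using assms pair_index_less[of i a k c] pair_index_less[of j b l d] by auto

lemma kron_eqI:
  assumes "A \<in> carrier_mat (a * c) (b * d)" "B \<in> carrier_mat (a * c) (b * d)"
    and "\<And>i k j l. i < a \<Longrightarrow> k < c \<Longrightarrow> j < b \<Longrightarrow> l < d \<Longrightarrow>
      A $$ (i * c + k, j * d + l) = B $$ (i * c + k, j * d + l)"
  shows "A = B"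
proof (rule eq_matI)
  fix i j assume "i < dim_row B" "j < dim_col B"
  then have ij: "i < a * c" "j < b * d" using assms by auto
  show "A $$ (i, j) = B $$ (i, j)"
    using assms(3)[OF divmod_less[OF ij(1)] divmod_less[OF ij(2)]] by simp
qed (use assms in auto)

lemma kron_add_left:
  assumes "dim_row A = dim_row B" "dim_col A = dim_col B"
  shows "kron (A + B) C = kron A C + kron B C"
proof (rule kron_eqI[of _ "dim_row A" "dim_row C" "dim_col A" "dim_col C"])
  fix i k j l assume *: "i < dim_row A" "k < dim_row C" "j < dim_col A" "l < dim_col C"
  have "i * dim_row C + k < dim_row A * dim_row C" "j * dim_col C + l < dim_col A * dim_col C"
    using * by (auto intro: pair_index_less)
  then show "kron (A + B) C $$ (i * dim_row C + k, j * dim_col C + l)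
      = (kron A C + kron B C) $$ (i * dim_row C + k, j * dim_col C + l)"
    using * assms by (simp add: distrib_right)
qed (use assms in auto)

lemma kron_add_right:
  assumes "dim_row A = dim_row B" "dim_col A = dim_col B"
  shows "kron C (A + B) = kron C A + kron C B"
proof (rule kron_eqI[of _ "dim_row C" "dim_row A" "dim_col C" "dim_col A"])
  fix i k j l assume *: "i < dim_row C" "k < dim_row A" "j < dim_col C" "l < dim_col A"
  have "i * dim_row A + k < dim_row C * dim_row A" "j * dim_col A + l < dim_col C * dim_col A"
    using * by (auto intro: pair_index_less)
  then show "kron C (A + B) $$ (i * dim_row A + k, j * dim_col A + l)
      = (kron C A + kron C B) $$ (i * dim_row A + k, j * dim_col A + l)"
    using * assms by (simp add: distrib_left)
qed (use assms in auto)

lemma kron_smult_left: "kron (k \<cdot>\<^sub>m A) B = k \<cdot>\<^sub>m kron A B"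
  by (intro eq_matI) (simp_all add: less_mult_imp_div_less)

lemma kron_smult_right: "kron A (k \<cdot>\<^sub>m B) = k \<cdot>\<^sub>m kron A B"
proof (rule eq_matI)
  fix i j assume ij: "i < dim_row (k \<cdot>\<^sub>m kron A B)" "j < dim_col (k \<cdot>\<^sub>m kron A B)"
  then show "kron A (k \<cdot>\<^sub>m B) $$ (i, j) = (k \<cdot>\<^sub>m kron A B) $$ (i, j)"
    using divmod_less[of i "dim_row A" "dim_row B"] divmod_less[of j "dim_col A" "dim_col B"] by simp
qed simp_all

lemma kron_zero_left: "kron (0\<^sub>m a b) B = 0\<^sub>m (a * dim_row B) (b * dim_col B)"
  by (intro eq_matI) (simp_all add: less_mult_imp_div_less)

lemma kron_zero_right: "kron B (0\<^sub>m a b) = 0\<^sub>m (dim_row B * a) (dim_col B * b)"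
proof (rule eq_matI)
  fix i j assume ij: "i < dim_row (0\<^sub>m (dim_row B * a) (dim_col B * b) :: complex mat)"
    "j < dim_col (0\<^sub>m (dim_row B * a) (dim_col B * b) :: complex mat)"
  then show "kron B (0\<^sub>m a b) $$ (i, j) = 0\<^sub>m (dim_row B * a) (dim_col B * b) $$ (i, j)"
    using divmod_less[of i "dim_row B" a] divmod_less[of j "dim_col B" b] by simp
qed simp_all

lemma kron_lin:
  assumes "\<And>x. x \<in> B \<Longrightarrow> X x \<in> carrier_mat a b" "\<And>y. y \<in> C \<Longrightarrow> Y y \<in> carrier_mat c d"
  shows "kron (lin a b B f X) (lin c d C h Y) =
    lin (a * c) (b * d) (B \<times> C) (\<lambda>(x, y). f x * h y) (\<lambda>(x, y). kron (X x) (Y y))"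
proof (rule eq_matI)
  fix i j assume "i < dim_row (lin (a * c) (b * d) (B \<times> C) (\<lambda>(x, y). f x * h y) (\<lambda>(x, y). kron (X x) (Y y)))"
    "j < dim_col (lin (a * c) (b * d) (B \<times> C) (\<lambda>(x, y). f x * h y) (\<lambda>(x, y). kron (X x) (Y y)))"
  then have ij: "i < a * c" "j < b * d" by auto
  have e: "kron (X x) (Y y) $$ (i, j) = X x $$ (i div c, j div d) * Y y $$ (i mod c, j mod d)"
    if "x \<in> B" "y \<in> C" for x y
    using assms(1)[OF that(1)] assms(2)[OF that(2)] ij by auto
  have "lin (a * c) (b * d) (B \<times> C) (\<lambda>(x, y). f x * h y) (\<lambda>(x, y). kron (X x) (Y y)) $$ (i, j)
      = (\<Sum>x\<in>B. \<Sum>y\<in>C. f x * h y * kron (X x) (Y y) $$ (i, j))"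
    using ij by (simp add: case_prod_unfold sum.cartesian_product)
  also have "\<dots> = (\<Sum>x\<in>B. \<Sum>y\<in>C. f x * h y * (X x $$ (i div c, j div d) * Y y $$ (i mod c, j mod d)))"
    by (intro sum.cong refl) (simp add: e)
  also have "\<dots> = kron (lin a b B f X) (lin c d C h Y) $$ (i, j)"
    using ij divmod_less[OF ij(1)] divmod_less[OF ij(2)] by (simp add: sum_product mult_ac)
  finally show "kron (lin a b B f X) (lin c d C h Y) $$ (i, j) =
      lin (a * c) (b * d) (B \<times> C) (\<lambda>(x, y). f x * h y) (\<lambda>(x, y). kron (X x) (Y y)) $$ (i, j)" ..
qed auto

text \<open>The left factor of \<open>kron\<close> carries the coarse index, so its blocks remain
  contiguous. Blocks of the right factor are interleaved instead and have to be brought to the left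
  by \<open>flip_mat\<close>.\<close>

lemma kron_four_block:
  assumes "A \<in> carrier_mat a a'" "D \<in> carrier_mat b b'"
    "B \<in> carrier_mat a b'" "C \<in> carrier_mat b a'" "T \<in> carrier_mat c c'"
  shows "kron (four_block_mat A B C D) T =
    four_block_mat (kron A T) (kron B T) (kron C T) (kron D T)"
proof (rule eq_matI)
  fix i j assume "i < dim_row (four_block_mat (kron A T) (kron B T) (kron C T) (kron D T))"
    "j < dim_col (four_block_mat (kron A T) (kron B T) (kron C T) (kron D T))"
  then have ij: "i < (a + b) * c" "j < (a' + b') * c'" using assms by (auto simp: distrib_right)
  have c: "c > 0" "c' > 0" using ij by (auto intro: gr0I)
  have d1: "(x div k < p) = (x < p * k)" if "k > 0" for x k p :: nat
    using that by (simp add: div_less_iff_less_mult)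
  have d2: "(x - p * k) div k = x div k - p \<and> (x - p * k) mod k = x mod k"
    if k: "k > 0" and x: "\<not> x < p * k" for x k p :: nat
  proof -
    obtain y where y: "x = p * k + y" using x by (metis le_Suc_ex not_less)
    show ?thesis unfolding y using k by (simp add: div_mult_self3)
  qed
  have bd: "i div c < a + b" "j div c' < a' + b'"
    using divmod_less[OF ij(1)] divmod_less[OF ij(2)] by auto
  have l: "kron (four_block_mat A B C D) T $$ (i, j)
      = four_block_mat A B C D $$ (i div c, j div c') * T $$ (i mod c, j mod c')"
    using ij assms by simp
  show "kron (four_block_mat A B C D) T $$ (i, j) =
      four_block_mat (kron A T) (kron B T) (kron C T) (kron D T) $$ (i, j)"
  proof (cases "i < a * c"; cases "j < a' * c'")
    assume *: "i < a * c" "j < a' * c'"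
    moreover have "i div c < a" "j div c' < a'" using * c by (simp_all only: d1)
    ultimately show ?thesis unfolding l using ij bd assms by (simp add: distrib_right)
  next
    assume *: "i < a * c" "\<not> j < a' * c'"
    moreover have "i div c < a" "\<not> j div c' < a'" using * c by (simp_all only: d1 not_False_eq_True)
    ultimately show ?thesis unfolding l using ij bd assms d2[OF c(2) *(2)] by (simp add: distrib_right)
  next
    assume *: "\<not> i < a * c" "j < a' * c'"
    moreover have "\<not> i div c < a" "j div c' < a'" using * c by (simp_all only: d1 not_False_eq_True)
    ultimately show ?thesis unfolding l using ij bd assms d2[OF c(1) *(1)] by (simp add: distrib_right)
  next
    assume *: "\<not> i < a * c" "\<not> j < a' * c'"
    moreover have "\<not> i div c < a" "\<not> j div c' < a'" using * c by (simp_all only: d1 not_False_eq_True)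
    ultimately show ?thesis unfolding l using ij bd assms d2[OF c(1) *(1)] d2[OF c(2) *(2)]
      by (simp add: distrib_right)
  qed
qed (use assms in \<open>auto simp: distrib_right\<close>)

lemma kron_pow:
  assumes "A \<in> carrier_mat a a" "B \<in> carrier_mat b b"
  shows "kron A B ^\<^sub>m k = kron (A ^\<^sub>m k) (B ^\<^sub>m k)"
proof (induction k)
  case 0
  then show ?case using assms by (simp add: kron_one)
next
  case (Suc k)
  then show ?case using assms kron_mult[of "A ^\<^sub>m k" a a A a "B ^\<^sub>m k" b b B b] by simp
qed

text \<open>The swap of u \<otimes> v to v \<otimes> u: column i * n + j has its only 1 in row j * m
  + i.\<close>

definition flip_mat :: "nat \<Rightarrow> nat \<Rightarrow> complex mat" where
  "flip_mat m n = mat (n * m) (m * n) (\<lambda>(r, c). of_bool (r = c mod n * m + c div n))"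

lemma flip_carrier [simp]: "flip_mat m n \<in> carrier_mat (n * m) (m * n)"
  by (simp add: flip_mat_def)

lemma flip_dim [simp]: "dim_row (flip_mat m n) = n * m" "dim_col (flip_mat m n) = m * n"
  by (simp_all add: flip_mat_def)

lemma flip_index_iff:
  fixes r c m n :: nat
  assumes "r < n * m" "c < m * n"
  shows "r = c mod n * m + c div n \<longleftrightarrow> c = r mod m * n + r div m"
proof -
  have *: "b = (a mod n * m + a div n) mod m * n + (a mod n * m + a div n) div m"
    if "a < m * n" "b = a" for a b m n :: nat
    using that divmod_less[OF that(1)] by (simp add: div_mult_self3 mult.commute)
  show ?thesis using *[OF assms(2) refl] *[OF assms(1) refl] by auto
qed

lemma flip_flip: "flip_mat n m * flip_mat m n = 1\<^sub>m (m * n)"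
proof (rule eq_matI)
  fix i j assume "i < dim_row (1\<^sub>m (m * n) :: complex mat)" "j < dim_col (1\<^sub>m (m * n) :: complex mat)"
  then have ij: "i < m * n" "j < m * n" by auto
  define k where "k = j mod n * m + j div n"
  have k: "k < n * m" using divmod_less[OF ij(2)] by (simp add: k_def pair_index_less)
  have "(flip_mat n m * flip_mat m n) $$ (i, j) = (\<Sum>l<n * m. if l = k then flip_mat n m $$ (i, l) else 0)"
    using ij by (subst mult_mat_index) (auto simp: flip_mat_def k_def intro!: sum.cong)
  also have "\<dots> = of_bool (i = k mod m * n + k div m)" using k ij by (simp add: flip_mat_def)
  also have "k mod m * n + k div m = j"
    using flip_index_iff[OF k ij(2)] k_def by simp
  finally show "(flip_mat n m * flip_mat m n) $$ (i, j) = 1\<^sub>m (m * n) $$ (i, j)" using ij by simp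
qed auto

lemma flip_kron:
  assumes A: "A \<in> carrier_mat a a'" and B: "B \<in> carrier_mat b b'"
  shows "flip_mat a b * kron A B = kron B A * flip_mat a' b'"
proof (rule eq_matI)
  fix i j assume "i < dim_row (kron B A * flip_mat a' b')" "j < dim_col (kron B A * flip_mat a' b')"
  then have ij: "i < b * a" "j < a' * b'" using assms by auto
  note l = divmod_less[OF ij(1)] divmod_less[OF ij(2)]
  define k where "k = i mod a * b + i div a"
  define k' where "k' = j mod b' * a' + j div b'"
  have k: "k < a * b" "k' < b' * a'" using l by (simp_all add: k_def k'_def pair_index_less)
  have kd: "k div b = i mod a" "k mod b = i div a" "k' div a' = j mod b'" "k' mod a' = j div b'"
    using l by (simp_all add: k_def k'_def)
  have "(flip_mat a b * kron A B) $$ (i, j) = (\<Sum>l<a * b. if l = k then kron A B $$ (l, j) else 0)"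
    using ij assms flip_index_iff[of i b a] by (subst mult_mat_index) (auto simp: flip_mat_def k_def intro!: sum.cong)
  also have "\<dots> = A $$ (i mod a, j div b') * B $$ (i div a, j mod b')" using k ij assms by (auto simp: kd)
  also have "\<dots> = (\<Sum>l<b' * a'. if l = k' then kron B A $$ (i, l) else 0)"
    using k ij assms by (auto simp: kd)
  also have "\<dots> = (kron B A * flip_mat a' b') $$ (i, j)"
    using ij assms by (subst mult_mat_index) (auto simp: flip_mat_def k'_def intro!: sum.cong)
  finally show "(flip_mat a b * kron A B) $$ (i, j) = (kron B A * flip_mat a' b') $$ (i, j)" .
qed (use assms in auto)

section \<open>Traces\<close>

definition mtrace :: "'a::comm_monoid_add mat \<Rightarrow> 'a" where
  "mtrace A = (\<Sum>i<dim_row A. A $$ (i, i))"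

lemma mtrace_mult_commute:
  fixes A :: "'a::comm_semiring_0 mat"
  assumes "A \<in> carrier_mat a b" "B \<in> carrier_mat b a"
  shows "mtrace (A * B) = mtrace (B * A)"
proof -
  have "mtrace (A * B) = (\<Sum>i<a. \<Sum>l<b. A $$ (i, l) * B $$ (l, i))"
    using assms unfolding mtrace_def by (intro sum.cong) (auto simp: mult_mat_index simp del: index_mult_mat(1))
  also have "\<dots> = (\<Sum>l<b. \<Sum>i<a. B $$ (l, i) * A $$ (i, l))"
    by (subst sum.swap) (simp add: mult.commute)
  also have "\<dots> = mtrace (B * A)"
    using assms unfolding mtrace_def by (intro sum.cong) (auto simp: mult_mat_index simp del: index_mult_mat(1))
  finally show ?thesis .
qed

lemma mtrace_four_block:
  assumes "A \<in> carrier_mat a a" "D \<in> carrier_mat b b"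
  shows "mtrace (four_block_mat A B C D) = mtrace A + mtrace D"
proof -
  have s: "{..<a + b} = {..<a} \<union> {a..<a + b}" by auto
  have "mtrace (four_block_mat A B C D) = (\<Sum>i<a. A $$ (i, i)) + (\<Sum>i\<in>{a..<a + b}. D $$ (i - a, i - a))"
    using assms unfolding mtrace_def by (simp add: s, subst sum.union_disjoint) auto
  also have "(\<Sum>i\<in>{a..<a + b}. D $$ (i - a, i - a)) = (\<Sum>i<b. D $$ (i, i))"
    by (rule sum.reindex_bij_witness[of _ "\<lambda>i. i + a" "\<lambda>i. i - a"]) auto
  finally show ?thesis using assms by (simp add: mtrace_def)
qed

lemma mtrace_one: "mtrace (1\<^sub>m d :: 'a::semiring_1 mat) = of_nat d"
  by (simp add: mtrace_def)

lemma mtrace_zero: "mtrace (0\<^sub>m d d) = 0"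
  by (simp add: mtrace_def)

lemma mtrace_smult: "mtrace (k \<cdot>\<^sub>m A) = (k::'a::semiring_0) * mtrace A" if "A \<in> carrier_mat d d"
  using that by (simp add: mtrace_def sum_distrib_left)

lemma mtrace_lin:
  assumes "\<And>b. b \<in> B \<Longrightarrow> X b \<in> carrier_mat d d"
  shows "mtrace (lin d d B a X) = (\<Sum>b\<in>B. a b * mtrace (X b))"
proof -
  have "mtrace (lin d d B a X) = (\<Sum>b\<in>B. a b * (\<Sum>i<d. X b $$ (i, i)))"
    by (simp add: mtrace_def sum_distrib_left) (rule sum.swap)
  then show ?thesis using assms by (auto simp: mtrace_def intro!: sum.cong)
qed

section \<open>The quantum binomial theorem at a root of unity\<close>

text \<open>Gaussian binomial coefficients. The Pascal recursion is free of division and so makes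
  sense at roots of unity, where the quotient formula breaks down.\<close>

fun qbin :: "complex \<Rightarrow> nat \<Rightarrow> nat \<Rightarrow> complex" where
  "qbin q m 0 = 1"
| "qbin q 0 (Suc k) = 0"
| "qbin q (Suc m) (Suc k) = qbin q m k + q ^ Suc k * qbin q m (Suc k)"

lemma qbin_gt: "m < k \<Longrightarrow> qbin q m k = 0"
proof (induction m arbitrary: k)
  case 0
  then show ?case by (cases k) auto
next
  case (Suc m)
  then show ?case by (cases k) auto
qed

lemma qbin_self: "qbin q m m = 1"
  by (induction m) (auto simp: qbin_gt)

text \<open>The factorial formula with its denominators cleared. For the lower index k + 1 it
  follows from the recursion by splitting 1 - q^(m+1) as (1 - q^(k+1)) + q^(k+1)(1 -
  q^(m-k)).\<close>

lemma qbin_prod: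
  "k \<le> m \<Longrightarrow> qbin q m k * (\<Prod>i=1..k. 1 - q ^ i) * (\<Prod>i=1..m - k. 1 - q ^ i) = (\<Prod>i=1..m. 1 - q ^ i)"
proof (induction m arbitrary: k)
  case 0
  then show ?case by simp
next
  case (Suc m)
  show ?case
  proof (cases k)
    case 0
    then show ?thesis by simp
  next
    case (Suc k')
    let ?P = "\<lambda>m. \<Prod>i=1..m. 1 - q ^ i"
    show ?thesis
    proof (cases "k' = m")
      case True
      then show ?thesis using Suc by (simp add: qbin_self[of q "Suc m", simplified] qbin_self qbin_gt)
    next
      case False
      then obtain l where l: "m - k' = Suc l" "m - Suc k' = l" "m = k' + Suc l"
        using Suc Suc.prems by (metis Suc_diff_Suc Suc_le_mono add_diff_inverse_nat le_neq_implies_less not_less)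
      have "qbin q m k' * ?P k' * ?P (Suc l) = ?P m" "qbin q m (Suc k') * ?P (Suc k') * ?P l = ?P m"
        using Suc.IH[of k'] Suc.IH[of "Suc k'"] l by auto
      note * = this
      have "qbin q (Suc m) (Suc k') * ?P (Suc k') * ?P (Suc l)
          = (1 - q ^ Suc k') * (qbin q m k' * ?P k' * ?P (Suc l))
            + q ^ Suc k' * (1 - q ^ Suc l) * (qbin q m (Suc k') * ?P (Suc k') * ?P l)"
        by (simp add: algebra_simps)
      also have "\<dots> = ((1 - q ^ Suc k') + q ^ Suc k' * (1 - q ^ Suc l)) * ?P m"
        unfolding * by (simp only: distrib_right)
      also have "(1 - q ^ Suc k') + q ^ Suc k' * (1 - q ^ Suc l) = 1 - q ^ Suc m"
        using l by (simp add: algebra_simps power_add)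
      finally show ?thesis using Suc l by (simp add: mult.commute)
    qed
  qed
qed

text \<open>The factor 1 - q^n kills the right side of \<open>qbin_prod\<close>, whereas no factor
  of either denominator vanishes because q has order exactly n.\<close>

lemma qbin_root_of_unity:
  assumes "q ^ n = 1" "\<And>m. 0 < m \<Longrightarrow> m < n \<Longrightarrow> q ^ m \<noteq> 1" "0 < k" "k < n"
  shows "qbin q n k = 0"
proof -
  have "(\<Prod>i=1..n. 1 - q ^ i) = 0" using assms by (auto intro!: bexI[of _ n])
  moreover have "(\<Prod>i=1..k. 1 - q ^ i) \<noteq> 0" "(\<Prod>i=1..n - k. 1 - q ^ i) \<noteq> 0"
    using assms(2-4) by (force simp: prod_zero_iff)+
  ultimately show ?thesis using qbin_prod[of k n q] assms(4) by (metis less_imp_le mult_eq_0_iff)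
qed

lemma q_commute_pow:
  fixes A B :: "complex mat"
  assumes c: "A \<in> carrier_mat d d" "B \<in> carrier_mat d d" and q: "B * A = q \<cdot>\<^sub>m (A * B)"
  shows "B * A ^\<^sub>m k = q ^ k \<cdot>\<^sub>m (A ^\<^sub>m k * B)"
proof (induction k)
  case (Suc k)
  have "B * A ^\<^sub>m Suc k = (B * A ^\<^sub>m k) * A" using c by (simp add: mat_assoc)
  also have "\<dots> = q ^ k \<cdot>\<^sub>m (A ^\<^sub>m k * (B * A))" using c by (simp add: Suc mat_assoc mat_smult_left)
  also have "\<dots> = q ^ Suc k \<cdot>\<^sub>m (A ^\<^sub>m Suc k * B)"
    using c by (simp add: q mat_assoc mat_smult_right) (intro eq_matI, auto simp: mult_ac)
  finally show ?case .
qed (use c in \<open>auto intro!: eq_matI\<close>)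

text \<open>Normal ordering: powers of A are kept to the left, and moving one more B past A^k costs
  q^k. This is the recursion that defines \<open>qbin\<close>.\<close>

lemma q_binomial:
  fixes A B :: "complex mat"
  assumes c: "A \<in> carrier_mat d d" "B \<in> carrier_mat d d" and q: "B * A = q \<cdot>\<^sub>m (A * B)"
  shows "(A + B) ^\<^sub>m m = lin d d {..m} (qbin q m) (\<lambda>k. A ^\<^sub>m k * B ^\<^sub>m (m - k))"
proof (induction m)
  case 0
  show ?case using c by (intro eq_matI) auto
next
  case (Suc m)
  let ?X = "\<lambda>k l. A ^\<^sub>m k * B ^\<^sub>m l"
  have X: "?X k l \<in> carrier_mat d d" for k l using c by (intro mult_carrier_mat[of _ d d]) auto
  have step: "(A + B) * ?X k l = ?X (Suc k) l + q ^ k \<cdot>\<^sub>m ?X k (Suc l)" for k l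
  proof -
    have "(A + B) * ?X k l = A * ?X k l + B * ?X k l" using c by (simp add: mat_mult_add_left)
    also have "A * ?X k l = ?X (Suc k) l"
      using c pow_mat_Suc_left[OF c(1), of k] by (simp add: mat_assoc del: pow_mat.simps flip: mat_assoc)
    also have "B * ?X k l = q ^ k \<cdot>\<^sub>m ?X k (Suc l)"
    proof -
      have "B * ?X k l = (B * A ^\<^sub>m k) * B ^\<^sub>m l" using c by (simp add: mat_assoc)
      also have "\<dots> = q ^ k \<cdot>\<^sub>m (A ^\<^sub>m k * (B * B ^\<^sub>m l))"
        using c by (simp add: q_commute_pow[OF c q] mat_assoc mat_smult_left)
      finally show ?thesis using pow_mat_Suc_left[OF c(2), of l] by simp
    qed
    finally show ?thesis .
  qed
  have "(A + B) ^\<^sub>m Suc m = (A + B) * (A + B) ^\<^sub>m m"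
    using c by (intro pow_mat_Suc_left[of _ d]) auto
  also have "\<dots> = lin d d {..m} (qbin q m) (\<lambda>k. (A + B) * ?X k (m - k))"
    unfolding Suc using c X by (intro mult_lin[of _ d]) auto
  also have "\<dots> = lin d d {..Suc m} (qbin q (Suc m)) (\<lambda>k. ?X k (Suc m - k))"
  proof (rule eq_matI)
    fix i j assume "i < dim_row (lin d d {..Suc m} (qbin q (Suc m)) (\<lambda>k. ?X k (Suc m - k)))"
      "j < dim_col (lin d d {..Suc m} (qbin q (Suc m)) (\<lambda>k. ?X k (Suc m - k)))"
    then have ij: "i < d" "j < d" by auto
    define e where "e k l = ?X k l $$ (i, j)" for k l
    have "lin d d {..m} (qbin q m) (\<lambda>k. (A + B) * ?X k (m - k)) $$ (i, j)
        = (\<Sum>k\<le>m. qbin q m k * (e (Suc k) (m - k) + q ^ k * e k (Suc (m - k))))"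
      using ij X[of "Suc _"] X[of _ "Suc _"] c
      by (simp add: step e_def del: index_mult_mat(1) pow_mat.simps)
    also have "\<dots> = (\<Sum>k\<le>m. qbin q m k * e (Suc k) (m - k)) + (\<Sum>k\<le>m. q ^ k * qbin q m k * e k (Suc m - k))"
      by (simp add: distrib_left sum.distrib mult_ac Suc_diff_le)
    also have "(\<Sum>k\<le>m. q ^ k * qbin q m k * e k (Suc m - k))
        = (\<Sum>k\<le>Suc m. q ^ k * qbin q m k * e k (Suc m - k))"
      by (simp add: qbin_gt)
    also have "\<dots> = e 0 (Suc m) + (\<Sum>k\<le>m. q ^ Suc k * qbin q m (Suc k) * e (Suc k) (m - k))"
      by (subst sum.atMost_Suc_shift) simp
    finally have "lin d d {..m} (qbin q m) (\<lambda>k. (A + B) * ?X k (m - k)) $$ (i, j)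
        = e 0 (Suc m) + (\<Sum>k\<le>m. qbin q (Suc m) (Suc k) * e (Suc k) (m - k))"
      by (simp add: sum.distrib distrib_right)
    also have "\<dots> = (\<Sum>k\<le>Suc m. qbin q (Suc m) k * e k (Suc m - k))"
      by (subst sum.atMost_Suc_shift) simp
    finally show "lin d d {..m} (qbin q m) (\<lambda>k. (A + B) * ?X k (m - k)) $$ (i, j)
        = lin d d {..Suc m} (qbin q (Suc m)) (\<lambda>k. ?X k (Suc m - k)) $$ (i, j)"
      using ij by (simp add: e_def del: index_mult_mat(1) pow_mat.simps sum.atMost_Suc)
  qed auto
  finally show ?case .
qed

lemma q_binomial_root_of_unity:
  fixes A B :: "complex mat"
  assumes c: "A \<in> carrier_mat d d" "B \<in> carrier_mat d d" and q: "B * A = q \<cdot>\<^sub>m (A * B)"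
    and r: "q ^ n = 1" "\<And>m. 0 < m \<Longrightarrow> m < n \<Longrightarrow> q ^ m \<noteq> 1" and n: "0 < n"
  shows "(A + B) ^\<^sub>m n = A ^\<^sub>m n + B ^\<^sub>m n"
proof (rule eq_matI)
  fix i j assume "i < dim_row (A ^\<^sub>m n + B ^\<^sub>m n)" "j < dim_col (A ^\<^sub>m n + B ^\<^sub>m n)"
  then have ij: "i < d" "j < d" using c by (auto split: if_splits)
  let ?e = "\<lambda>k. (A ^\<^sub>m k * B ^\<^sub>m (n - k)) $$ (i, j)"
  have "((A + B) ^\<^sub>m n) $$ (i, j) = (\<Sum>k\<le>n. qbin q n k * ?e k)"
    using ij by (simp add: q_binomial[OF c q] del: index_mult_mat(1))
  also have "\<dots> = (\<Sum>k\<in>{0, n}. qbin q n k * ?e k)"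
    using qbin_root_of_unity[OF r] by (intro sum.mono_neutral_right) auto
  also have "\<dots> = (A ^\<^sub>m n + B ^\<^sub>m n) $$ (i, j)"
    using n c ij by (simp add: qbin_self del: index_mult_mat(1))
  finally show "((A + B) ^\<^sub>m n) $$ (i, j) = (A ^\<^sub>m n + B ^\<^sub>m n) $$ (i, j)" .
qed (use c in auto)

text \<open>\<open>tw Y Z m\<close> is \<open>\<Sum>\<^sub>s\<^sub><\<^sub>m Y\<^sup>m\<^sup>-\<^sup>1\<^sup>-\<^sup>s Z Y\<^sup>s\<close>, the derivative of \<open>Y\<^sup>m\<close> in direction \<open>Z\<close>.\<close>

fun tw :: "complex mat \<Rightarrow> complex mat \<Rightarrow> nat \<Rightarrow> complex mat" where
  "tw Y Z 0 = 0\<^sub>m (dim_row Y) (dim_col Y)"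
| "tw Y Z (Suc m) = Y ^\<^sub>m m * Z + tw Y Z m * Y"

lemma tw_carrier:
  assumes "Y \<in> carrier_mat d d" "Z \<in> carrier_mat d d"
  shows "tw Y Z m \<in> carrier_mat d d"
proof (induction m)
  case (Suc m)
  then show ?case using assms by auto
qed (use assms in auto)

text \<open>With a dual number e, where e^2 = 0, this reads (C + eZ)^m = C^m + e
  \<open>tw C Z m\<close>.\<close>

lemma pow_upper_block:
  assumes c: "C \<in> carrier_mat d d" "Z \<in> carrier_mat d d"
  shows "four_block_mat C Z (0\<^sub>m d d) C ^\<^sub>m m
    = four_block_mat (C ^\<^sub>m m) (tw C Z m) (0\<^sub>m d d) (C ^\<^sub>m m)"
proof (induction m)
  case 0
  then show ?case using c by simp
next
  case (Suc m)
  have t: "tw C Z m \<in> carrier_mat d d" using c by (rule tw_carrier)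
  have "four_block_mat (C ^\<^sub>m m) (tw C Z m) (0\<^sub>m d d) (C ^\<^sub>m m) * four_block_mat C Z (0\<^sub>m d d) C
      = four_block_mat (C ^\<^sub>m m * C + tw C Z m * 0\<^sub>m d d) (C ^\<^sub>m m * Z + tw C Z m * C)
          (0\<^sub>m d d * C + C ^\<^sub>m m * 0\<^sub>m d d) (0\<^sub>m d d * Z + C ^\<^sub>m m * C)"
    using c t by (intro mult_four_block_mat[of _ d d _ d _ d]) auto
  also have "\<dots> = four_block_mat (C ^\<^sub>m Suc m) (tw C Z (Suc m)) (0\<^sub>m d d) (C ^\<^sub>m Suc m)"
  proof (rule cong_four_block_mat)
    show "C ^\<^sub>m m * C + tw C Z m * 0\<^sub>m d d = C ^\<^sub>m Suc m" using c t by (intro eq_matI) auto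
    show "0\<^sub>m d d * Z + C ^\<^sub>m m * C = C ^\<^sub>m Suc m" using c t by (intro eq_matI) auto
    show "0\<^sub>m d d * C + C ^\<^sub>m m * 0\<^sub>m d d = 0\<^sub>m d d" using c t by (intro eq_matI) auto
  qed simp
  finally show ?case using Suc by simp
qed

lemma four_block_upper_eqD:
  assumes "four_block_mat A B C D = four_block_mat A' B' C' D'"
    "A \<in> carrier_mat d d" "A' \<in> carrier_mat d d" "D \<in> carrier_mat d d" "D' \<in> carrier_mat d d"
    "B \<in> carrier_mat d d" "B' \<in> carrier_mat d d"
  shows "B = B'"
proof (rule eq_matI)
  fix i j assume "i < dim_row B'" "j < dim_col B'"
  then have ij: "i < d" "j < d" using assms by auto
  have "four_block_mat A B C D $$ (i, j + d) = four_block_mat A' B' C' D' $$ (i, j + d)"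
    using assms(1) by simp
  then show "B $$ (i, j) = B' $$ (i, j)" using assms(2-) ij by simp
qed (use assms in auto)

text \<open>Differentiate the quantum binomial theorem: apply it to dual numbers, realised as upper
  triangular block matrices.\<close>

lemma tw_q_add:
  fixes A B Z W :: "complex mat"
  assumes c: "A \<in> carrier_mat d d" "B \<in> carrier_mat d d" "Z \<in> carrier_mat d d" "W \<in> carrier_mat d d"
    and q: "B * A = q \<cdot>\<^sub>m (A * B)" "B * Z + W * A = q \<cdot>\<^sub>m (A * W + Z * B)"
    and r: "q ^ n = 1" "\<And>m. 0 < m \<Longrightarrow> m < n \<Longrightarrow> q ^ m \<noteq> 1" and n: "0 < n"
  shows "tw (A + B) (Z + W) n = tw A Z n + tw B W n"
proof -
  let ?U = "\<lambda>X Y. four_block_mat X Y (0\<^sub>m d d) X"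
  have mult: "?U X Y * ?U X' Y' = ?U (X * X') (X * Y' + Y * X')"
    if "X \<in> carrier_mat d d" "Y \<in> carrier_mat d d" "X' \<in> carrier_mat d d" "Y' \<in> carrier_mat d d"
    for X Y X' Y' :: "complex mat"
  proof -
    have "?U X Y * ?U X' Y' = four_block_mat (X * X' + Y * 0\<^sub>m d d) (X * Y' + Y * X')
        (0\<^sub>m d d * X' + X * 0\<^sub>m d d) (0\<^sub>m d d * Y' + X * X')"
      using that by (intro mult_four_block_mat[of _ d d _ d _ d]) auto
    also have "\<dots> = ?U (X * X') (X * Y' + Y * X')"
    proof (rule cong_four_block_mat)
      show "X * X' + Y * 0\<^sub>m d d = X * X'" using that by (intro eq_matI) auto
      show "0\<^sub>m d d * Y' + X * X' = X * X'" using that by (intro eq_matI) auto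
      show "0\<^sub>m d d * X' + X * 0\<^sub>m d d = 0\<^sub>m d d" using that by (intro eq_matI) auto
    qed simp
    finally show ?thesis .
  qed
  have add: "?U X Y + ?U X' Y' = ?U (X + X') (Y + Y')"
    if "X \<in> carrier_mat d d" "Y \<in> carrier_mat d d" "X' \<in> carrier_mat d d" "Y' \<in> carrier_mat d d"
    for X Y X' Y' :: "complex mat"
    using that by (subst add_four_block_mat[of _ d d _ d _ d]) auto
  have U: "?U A Z \<in> carrier_mat (d + d) (d + d)" "?U B W \<in> carrier_mat (d + d) (d + d)"
    using c by auto
  \<comment> \<open>The two equations in q say that A + eZ and B + eW q-commute over the dual
    numbers: the first is the diagonal block, the second the off-diagonal one.\<close>
  have "?U B W * ?U A Z = q \<cdot>\<^sub>m (?U A Z * ?U B W)"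
    using c q by (simp add: mult) (subst smult_four_block_mat[of _ d d _ d _ d], auto)
  then have "(?U A Z + ?U B W) ^\<^sub>m n = ?U A Z ^\<^sub>m n + ?U B W ^\<^sub>m n"
    using U r n by (intro q_binomial_root_of_unity[of _ "d + d"]) auto
  then have "?U ((A + B) ^\<^sub>m n) (tw (A + B) (Z + W) n) = ?U (A ^\<^sub>m n + B ^\<^sub>m n) (tw A Z n + tw B W n)"
    using c by (simp add: add pow_upper_block tw_carrier)
  then show ?thesis
    by (rule four_block_upper_eqD[where d = d]) (use c tw_carrier in \<open>auto intro!: add_carrier_mat\<close>)
qed

lemma tw_zero: "Y \<in> carrier_mat d d \<Longrightarrow> tw Y (0\<^sub>m d d) m = 0\<^sub>m d d"
  by (induction m) auto

section \<open>Modules over \<open>H\<close> as representations of its generators\<close>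

context non_nilpotent_group_datum
begin

text \<open>Images of the generators that satisfy the defining relations of \<open>H\<close>. The
  relation y^n = g^n - 1 is stated without subtraction.\<close>

definition hrep :: "nat \<Rightarrow> complex mat \<Rightarrow> ('a \<Rightarrow> complex mat) \<Rightarrow> bool" where
  "hrep d Y \<rho> \<longleftrightarrow> Y \<in> carrier_mat d d \<and> (\<forall>h\<in>carrier G. \<rho> h \<in> carrier_mat d d) \<and> \<rho> \<one> = 1\<^sub>m d \<and>
     (\<forall>h\<in>carrier G. \<forall>k\<in>carrier G. \<rho> (h \<otimes> k) = \<rho> h * \<rho> k) \<and>
     (\<forall>h\<in>carrier G. Y * \<rho> h = \<chi> h \<cdot>\<^sub>m (\<rho> h * Y)) \<and> Y ^\<^sub>m n + 1\<^sub>m d = \<rho> (g [^] n)"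

definition rep_mod :: "nat \<Rightarrow> complex mat \<Rightarrow> ('a \<Rightarrow> complex mat) \<Rightarrow> (nat \<times> 'a \<Rightarrow> complex) fdmod" where
  "rep_mod d Y \<rho> = FDMod d (\<lambda>a. lin d d H_basis a (\<lambda>(s, h). Y ^\<^sub>m s * \<rho> h))"

definition hY :: "(nat \<times> 'a \<Rightarrow> complex) fdmod \<Rightarrow> complex mat" where
  "hY M = act M H_y"

definition hG :: "(nat \<times> 'a \<Rightarrow> complex) fdmod \<Rightarrow> 'a \<Rightarrow> complex mat" where
  "hG M h = act M (H_grp h)"

lemma hrepD:
  assumes "hrep d Y \<rho>"
  shows "Y \<in> carrier_mat d d" "h \<in> carrier G \<Longrightarrow> \<rho> h \<in> carrier_mat d d" "\<rho> \<one> = 1\<^sub>m d"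
    "h \<in> carrier G \<Longrightarrow> k \<in> carrier G \<Longrightarrow> \<rho> (h \<otimes> k) = \<rho> h * \<rho> k"
    "h \<in> carrier G \<Longrightarrow> Y * \<rho> h = \<chi> h \<cdot>\<^sub>m (\<rho> h * Y)" "Y ^\<^sub>m n + 1\<^sub>m d = \<rho> (g [^] n)"
  using assms by (auto simp: hrep_def)

lemma hrep_dim:
  assumes "hrep d Y \<rho>"
  shows "dim_row Y = d" "dim_col Y = d" "h \<in> carrier G \<Longrightarrow> dim_row (\<rho> h) = d"
    "h \<in> carrier G \<Longrightarrow> dim_col (\<rho> h) = d"
  using hrepD(1,2)[OF assms] by (auto dest: carrier_matD)

lemma hrep_grp_Y:
  assumes r: "hrep d Y \<rho>" and h: "h \<in> carrier G"
  shows "\<rho> h * Y = inverse (\<chi> h) \<cdot>\<^sub>m (Y * \<rho> h)"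
  using hrepD(1,2,5)[OF r] h chi_nonzero[OF h] by (intro eq_matI) auto

lemma hrep_grp_Y_pow:
  assumes r: "hrep d Y \<rho>" and h: "h \<in> carrier G"
  shows "\<rho> h * Y ^\<^sub>m j = inverse (\<chi> h) ^ j \<cdot>\<^sub>m (Y ^\<^sub>m j * \<rho> h)"
  using hrepD(1,2)[OF r] h hrep_grp_Y[OF r h] by (intro q_commute_pow[of _ d]) auto

lemma hrep_Y_pow_grp:
  assumes r: "hrep d Y \<rho>" and h: "h \<in> carrier G"
  shows "Y ^\<^sub>m j * \<rho> h = \<chi> h ^ j \<cdot>\<^sub>m (\<rho> h * Y ^\<^sub>m j)"
  using hrepD(1,2)[OF r] h hrep_grp_Y_pow[OF r h] chi_nonzero[OF h] by (intro eq_matI) (auto simp: power_inverse)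

text \<open>The relations alone reproduce the structure constants: h moves past y^j at the cost of
  \<chi>(h)^(-j), and an exponent i + j \<ge> n is lowered by n through y^n = g^n - 1.\<close>

lemma hrep_basis_mult:
  assumes r: "hrep d Y \<rho>" and b: "(i, h) \<in> H_basis" "(j, k) \<in> H_basis"
  shows "(Y ^\<^sub>m i * \<rho> h) * (Y ^\<^sub>m j * \<rho> k) = lin d d H_basis (H_bprod (i, h) (j, k)) (\<lambda>(s, h). Y ^\<^sub>m s * \<rho> h)"
proof -
  let ?X = "\<lambda>(s, h). Y ^\<^sub>m s * \<rho> h"
  have c: "h \<in> carrier G" "k \<in> carrier G" "h \<otimes> k \<in> carrier G" "i < n" "j < n"
    using b by (auto simp: H_basis_def)
  note d = hrepD(1)[OF r] hrepD(2)[OF r c(1)] hrepD(2)[OF r c(2)] hrepD(2)[OF r c(3)] hrepD(2)[OF r gn_closed]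
  have X: "?X x \<in> carrier_mat d d" if "x \<in> H_basis" for x
    using that hrepD(1,2)[OF r] by (auto simp: H_basis_def intro!: mult_carrier_mat[of _ d d])
  have "(Y ^\<^sub>m i * \<rho> h) * (Y ^\<^sub>m j * \<rho> k) = Y ^\<^sub>m i * (\<rho> h * Y ^\<^sub>m j) * \<rho> k"
    using d by (simp add: mat_assoc)
  also have "\<dots> = inverse (\<chi> h) ^ j \<cdot>\<^sub>m (Y ^\<^sub>m (i + j) * \<rho> (h \<otimes> k))"
    using d c by (simp add: hrep_grp_Y_pow[OF r] hrepD(4)[OF r] mat_assoc mat_smult_left mat_smult_right pow_mat_add)
  also have "Y ^\<^sub>m (i + j) * \<rho> (h \<otimes> k) = lin d d H_basis
      (\<lambda>z. if i + j < n then unit_coord (i + j, h \<otimes> k) z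
        else unit_coord (i + j - n, g [^] n \<otimes> (h \<otimes> k)) z - unit_coord (i + j - n, h \<otimes> k) z) ?X"
  proof (cases "i + j < n")
    case True
    then have "(i + j, h \<otimes> k) \<in> H_basis" using c by (simp add: H_basis_def)
    then show ?thesis using lin_unit_coord[OF finite_H_basis _ X] True by simp
  next
    case False
    define m where "m = i + j - n"
    have m: "i + j = m + n" "m < n" using False c by (auto simp: m_def)
    have bb: "(m, g [^] n \<otimes> (h \<otimes> k)) \<in> H_basis" "(m, h \<otimes> k) \<in> H_basis"
      using m c gn_closed by (simp_all add: H_basis_def)
    \<comment> \<open>The difference y^m g^n w - y^m w that \<open>H_bprod\<close> prescribes, with
      w = hk, is handled as a sum that comes from Y^m (Y^n + 1) w; the extra summand is cancelled
      entrywise below.\<close>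
    have "?X (m, g [^] n \<otimes> (h \<otimes> k)) = Y ^\<^sub>m m * (Y ^\<^sub>m n + 1\<^sub>m d) * \<rho> (h \<otimes> k)"
      using d c gn_closed by (simp add: hrepD(4,6)[OF r] mat_assoc)
    also have "\<dots> = Y ^\<^sub>m (i + j) * \<rho> (h \<otimes> k) + ?X (m, h \<otimes> k)"
      using d by (simp add: m pow_mat_add mat_mult_add_right mat_mult_add_left)
    finally have e: "?X (m, g [^] n \<otimes> (h \<otimes> k)) = Y ^\<^sub>m (i + j) * \<rho> (h \<otimes> k) + ?X (m, h \<otimes> k)" .
    have l: "lin d d H_basis (unit_coord (m, g [^] n \<otimes> (h \<otimes> k))) ?X =
        lin d d H_basis (\<lambda>z. unit_coord (m, g [^] n \<otimes> (h \<otimes> k)) z - unit_coord (m, h \<otimes> k) z) ?X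
        + lin d d H_basis (unit_coord (m, h \<otimes> k)) ?X"
      by (simp flip: lin_add)
    let ?L = "lin d d H_basis (\<lambda>z. unit_coord (m, g [^] n \<otimes> (h \<otimes> k)) z - unit_coord (m, h \<otimes> k) z) ?X"
    have "?L + ?X (m, h \<otimes> k) = Y ^\<^sub>m (i + j) * \<rho> (h \<otimes> k) + ?X (m, h \<otimes> k)"
      using l e lin_unit_coord[OF finite_H_basis bb(1), of ?X d d, OF X[OF bb(1)]]
        lin_unit_coord[OF finite_H_basis bb(2), of ?X d d, OF X[OF bb(2)]] by simp
    then have "?L = Y ^\<^sub>m (i + j) * \<rho> (h \<otimes> k)"
    proof -
      assume *: "?L + ?X (m, h \<otimes> k) = Y ^\<^sub>m (i + j) * \<rho> (h \<otimes> k) + ?X (m, h \<otimes> k)"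
      note X2 = X[OF bb(2)]
      show ?thesis
      proof (rule eq_matI)
        fix a b assume ab: "a < dim_row (Y ^\<^sub>m (i + j) * \<rho> (h \<otimes> k))" "b < dim_col (Y ^\<^sub>m (i + j) * \<rho> (h \<otimes> k))"
        then have ab: "a < d" "b < d" using d by (auto split: if_splits)
        have "(?L + ?X (m, h \<otimes> k)) $$ (a, b) = (Y ^\<^sub>m (i + j) * \<rho> (h \<otimes> k) + ?X (m, h \<otimes> k)) $$ (a, b)"
          by (simp only: *)
        then show "?L $$ (a, b) = (Y ^\<^sub>m (i + j) * \<rho> (h \<otimes> k)) $$ (a, b)"
          using ab d by (simp del: lin_index index_mult_mat(1))
      qed (use d in auto)
    qed
    then show ?thesis using False by (simp add: m_def)
  qed
  finally show ?thesis by (simp add: H_bprod_def lin_smult)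
qed

lemma rep_mod_fdmod:
  assumes r: "hrep d Y \<rho>"
  shows "is_fdmod H (rep_mod d Y \<rho>)"
  unfolding rep_mod_def H_def
proof (rule based_algebra_fdmodI[OF finite_H_basis])
  let ?X = "\<lambda>(s, h). Y ^\<^sub>m s * \<rho> h"
  show X: "?X x \<in> carrier_mat d d" if "x \<in> H_basis" for x
    using that hrepD(1,2)[OF r] by (auto simp: H_basis_def intro!: mult_carrier_mat[of _ d d])
  show "?X x * ?X y = lin d d H_basis (H_bprod x y) ?X" if "x \<in> H_basis" "y \<in> H_basis" for x y
    using hrep_basis_mult[OF r] that by (cases x; cases y) auto
  have b: "(0, \<one>) \<in> H_basis" using n_ge_2 by (simp add: H_basis_def)
  show "lin d d H_basis (unit_coord (0, \<one>)) ?X = 1\<^sub>m d"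
    using lin_unit_coord[where X = ?X, OF finite_H_basis b X[OF b]] hrepD(1,3)[OF r] by simp
qed

lemma rep_mod_simps [simp]:
  "mdim (rep_mod d Y \<rho>) = d"
  by (simp add: rep_mod_def)

lemma rep_mod_hG:
  assumes r: "hrep d Y \<rho>" and h: "h \<in> carrier G"
  shows "hG (rep_mod d Y \<rho>) h = \<rho> h"
proof -
  have "(0, h) \<in> H_basis" using n_ge_2 h by (simp add: H_basis_def)
  then show ?thesis using lin_unit_coord[OF finite_H_basis, of "(0, h)" "\<lambda>(s, h). Y ^\<^sub>m s * \<rho> h" d d]
    hrepD(1)[OF r] hrepD(2)[OF r h] by (simp add: hG_def rep_mod_def)
qed

lemma rep_mod_hY:
  assumes r: "hrep d Y \<rho>"
  shows "hY (rep_mod d Y \<rho>) = Y"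
proof -
  have "(1, \<one>) \<in> H_basis" using n_ge_2 by (simp add: H_basis_def)
  then show ?thesis using lin_unit_coord[OF finite_H_basis, of "(1, \<one>)" "\<lambda>(s, h). Y ^\<^sub>m s * \<rho> h" d d]
    hrepD(1,3)[OF r] by (simp add: hY_def rep_mod_def)
qed

lemma rep_mod_cong:
  assumes "hrep d Y \<rho>" "\<And>h. h \<in> carrier G \<Longrightarrow> \<rho> h = \<rho>' h"
  shows "rep_mod d Y \<rho> = rep_mod d Y \<rho>'"
  using assms unfolding rep_mod_def by (auto simp: H_basis_def fun_eq_iff intro!: lin_cong)

lemma unit_coord_closed: "x \<in> H_basis \<Longrightarrow> unit_coord x \<in> carrier H"
  by (auto simp: H_def based_algebra_def unit_coord_def)

lemma H_y_closed: "H_y \<in> carrier H" "unit_coord (Suc 0, \<one>) \<in> carrier H"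
  and H_grp_closed: "h \<in> carrier G \<Longrightarrow> H_grp h \<in> carrier H"
  using n_ge_2 by (auto intro!: unit_coord_closed simp: H_basis_def)

lemma fdmod_mult:
  "is_fdmod H M \<Longrightarrow> a \<in> carrier H \<Longrightarrow> b \<in> carrier H \<Longrightarrow> act M (a \<otimes>\<^bsub>H\<^esub> b) = act M a * act M b"
  by (auto simp: is_fdmod_def)

lemma fdmod_carrier:
  "is_fdmod H M \<Longrightarrow> a \<in> carrier H \<Longrightarrow> act M a \<in> carrier_mat (mdim M) (mdim M)"
  by (auto simp: is_fdmod_def)

lemma fdmod_pow:
  assumes M: "is_fdmod H M" and a: "a \<in> carrier H"
  shows "act M (a [^]\<^bsub>H\<^esub> (k::nat)) = act M a ^\<^sub>m k"
proof (induction k)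
  interpret R: ring H by (rule H_ring)
  case 0
  then show ?case using M fdmod_carrier[OF M a] by (auto simp: is_fdmod_def)
next
  interpret R: ring H by (rule H_ring)
  case (Suc k)
  then show ?case using M a by (simp add: fdmod_mult)
qed

text \<open>Together with \<open>rep_mod_fdmod\<close> this turns every question about
  \<open>H\<close>-modules into one about a matrix Y and a representation of G.\<close>

lemma fdmod_hrep:
  assumes M: "is_fdmod H M"
  shows "hrep (mdim M) (hY M) (hG M)"
proof -
  interpret R: ring H by (rule H_ring)
  let ?d = "mdim M"
  have o: "act M \<one>\<^bsub>H\<^esub> = 1\<^sub>m ?d" using M by (auto simp: is_fdmod_def)
  have "hG M \<one> = 1\<^sub>m ?d" using o by (simp add: hG_def H_def based_algebra_def)
  moreover have "hG M (h \<otimes> k) = hG M h * hG M k" if "h \<in> carrier G" "k \<in> carrier G" for h k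
    using that by (simp add: hG_def H_grp_closed M fdmod_mult flip: H_grp_mult)
  moreover have "hY M * hG M h = \<chi> h \<cdot>\<^sub>m (hG M h * hY M)" if h: "h \<in> carrier G" for h
  proof -
    have "act M (H_y \<otimes>\<^bsub>H\<^esub> H_grp h) = act M (\<chi> h \<odot>\<^bsub>H\<^esub> (H_grp h \<otimes>\<^bsub>H\<^esub> H_y))"
      by (simp only: H_y_commute[OF h])
    also have "\<dots> = \<chi> h \<cdot>\<^sub>m act M (H_grp h \<otimes>\<^bsub>H\<^esub> H_y)"
      using M R.m_closed[OF H_grp_closed[OF h] H_y_closed(1)] unfolding is_fdmod_def by blast
    finally show ?thesis using h by (simp add: hG_def hY_def H_grp_closed H_y_closed M fdmod_mult)
  qed
  moreover have "hY M ^\<^sub>m n + 1\<^sub>m ?d = hG M (g [^] n)"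
  proof -
    have c: "H_y [^]\<^bsub>H\<^esub> n \<in> carrier H" "H_grp (g [^] n) \<in> carrier H"
      using H_y_closed H_grp_closed gn_closed by auto
    have "H_y [^]\<^bsub>H\<^esub> n \<oplus>\<^bsub>H\<^esub> \<one>\<^bsub>H\<^esub> = H_grp (g [^] n)"
      unfolding H_y_pow_n using c by (simp add: R.minus_eq R.add.m_assoc R.l_neg)
    then have "act M (H_y [^]\<^bsub>H\<^esub> n) + act M \<one>\<^bsub>H\<^esub> = act M (H_grp (g [^] n))"
      using M c R.one_closed unfolding is_fdmod_def by metis
    then show ?thesis using o by (simp add: hY_def hG_def fdmod_pow[OF M H_y_closed(2)])
  qed
  ultimately show ?thesis
    using M by (auto simp: hrep_def hY_def hG_def fdmod_carrier H_y_closed H_grp_closed)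
qed

lemma fdmod_act_basis:
  assumes M: "is_fdmod H M" and b: "(s, h) \<in> H_basis"
  shows "act M (unit_coord (s, h)) = hY M ^\<^sub>m s * hG M h"
proof -
  interpret R: ring H by (rule H_ring)
  have "unit_coord (s, h) = H_y [^]\<^bsub>H\<^esub> s \<otimes>\<^bsub>H\<^esub> H_grp h"
    using b by (subst H_basis_elem) (auto simp: H_basis_def)
  then show ?thesis using b M H_y_closed H_grp_closed
    by (simp add: H_basis_def fdmod_mult fdmod_pow hY_def hG_def)
qed

text \<open>The monomials y^s h span \<open>H\<close>, so commuting with the generators is
  enough.\<close>

lemma mod_hom_iff:
  assumes M: "is_fdmod H M" and N: "is_fdmod H N"
  shows "T \<in> mod_hom H M N \<longleftrightarrow> T \<in> carrier_mat (mdim N) (mdim M) \<and> T * hY M = hY N * T \<and>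
    (\<forall>h\<in>carrier G. T * hG M h = hG N h * T)"
proof (intro iffI)
  assume "T \<in> mod_hom H M N"
  then show "T \<in> carrier_mat (mdim N) (mdim M) \<and> T * hY M = hY N * T \<and>
    (\<forall>h\<in>carrier G. T * hG M h = hG N h * T)"
    by (auto simp: mod_hom_def hY_def hG_def H_y_closed H_grp_closed)
next
  assume *: "T \<in> carrier_mat (mdim N) (mdim M) \<and> T * hY M = hY N * T \<and>
    (\<forall>h\<in>carrier G. T * hG M h = hG N h * T)"
  then have T: "T \<in> carrier_mat (mdim N) (mdim M)" and TY: "T * hY M = hY N * T"
    and TG: "\<And>h. h \<in> carrier G \<Longrightarrow> T * hG M h = hG N h * T" by auto
  note rM = fdmod_hrep[OF M] and rN = fdmod_hrep[OF N]
  note dim = hrep_dim[OF rM] hrep_dim[OF rN]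
  have p: "T * hY M ^\<^sub>m s = hY N ^\<^sub>m s * T" for s
  proof (induction s)
    case (Suc s)
    have "T * hY M ^\<^sub>m Suc s = (T * hY M ^\<^sub>m s) * hY M" using T dim by (simp add: mat_assoc)
    also have "\<dots> = hY N ^\<^sub>m s * (T * hY M)" unfolding Suc using T dim by (simp add: mat_assoc)
    also have "\<dots> = hY N ^\<^sub>m Suc s * T" using T dim by (simp add: TY mat_assoc)
    finally show ?case .
  qed (use T dim in simp)
  have "T * act M (unit_coord b) = act N (unit_coord b) * T" if "b \<in> H_basis" for b
  proof -
    obtain s h where b: "b = (s, h)" by (cases b)
    then have h: "h \<in> carrier G" using that by (simp add: H_basis_def)
    have "T * act M (unit_coord b) = (T * hY M ^\<^sub>m s) * hG M h"
      using that b M T dim h by (simp add: fdmod_act_basis mat_assoc)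
    also have "\<dots> = hY N ^\<^sub>m s * (T * hG M h)" unfolding p using T dim h by (simp add: mat_assoc)
    also have "\<dots> = act N (unit_coord b) * T"
      using that b N T dim h by (simp add: fdmod_act_basis TG mat_assoc)
    finally show ?thesis .
  qed
  then show "T \<in> mod_hom H M N"
    using T based_algebra_mod_hom_iff[OF _ _ finite_H_basis] M N unfolding H_def by blast
qed

text \<open>An inverse of an intertwiner intertwines, since S a = S a T S = S T a S = a S. So
  equivariance is asked of T only.\<close>

lemma mod_isoI:
  assumes "is_fdmod H M" "is_fdmod H N" "T \<in> carrier_mat (mdim N) (mdim M)"
    "S \<in> carrier_mat (mdim M) (mdim N)" "S * T = 1\<^sub>m (mdim M)" "T * S = 1\<^sub>m (mdim N)"
    "T * hY M = hY N * T" "\<And>h. h \<in> carrier G \<Longrightarrow> T * hG M h = hG N h * T"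
  shows "mod_iso H M N"
proof -
  have T: "T \<in> mod_hom H M N" using assms by (simp add: mod_hom_iff)
  have "S * act N a = act M a * S" if a: "a \<in> carrier H" for a
  proof -
    have c: "act M a \<in> carrier_mat (mdim M) (mdim M)" "act N a \<in> carrier_mat (mdim N) (mdim N)"
      using assms(1,2) a by (auto simp: fdmod_carrier)
    have "S * act N a = S * (act N a * T) * S" using c assms by (simp add: mat_assoc)
    also have "\<dots> = S * (T * act M a) * S" using T a by (simp add: mod_hom_def)
    also have "\<dots> = (S * T) * act M a * S" using c assms(3,4) by (simp add: mat_assoc)
    also have "\<dots> = act M a * S" using c assms by simp
    finally show ?thesis .
  qed
  then have "S \<in> mod_hom H N M" using assms by (auto simp: mod_hom_def)
  then show ?thesis using T assms unfolding mod_iso_def by blast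
qed

lemma mod_isoE:
  assumes "mod_iso H M N" "is_fdmod H M" "is_fdmod H N"
  obtains T S where "T \<in> carrier_mat (mdim N) (mdim M)"
    "S \<in> carrier_mat (mdim M) (mdim N)" "S * T = 1\<^sub>m (mdim M)" "T * S = 1\<^sub>m (mdim N)"
    "T * hY M = hY N * T" "\<And>h. h \<in> carrier G \<Longrightarrow> T * hG M h = hG N h * T"
    "S * hY N = hY M * S" "\<And>h. h \<in> carrier G \<Longrightarrow> S * hG N h = hG M h * S"
  using assms unfolding mod_iso_def by (auto simp: mod_hom_iff)

lemma mod_iso_refl: "is_fdmod H M \<Longrightarrow> mod_iso H M M"
  using hrep_dim[OF fdmod_hrep] by (intro mod_isoI[of _ _ "1\<^sub>m (mdim M)" "1\<^sub>m (mdim M)"]) auto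

lemma mod_iso_sym: "mod_iso H M N \<Longrightarrow> mod_iso H N M"
  unfolding mod_iso_def by blast

lemma mod_iso_trans:
  assumes MN: "mod_iso H M N" and NK: "mod_iso H N K"
    and f: "is_fdmod H M" "is_fdmod H N" "is_fdmod H K"
  shows "mod_iso H M K"
proof -
  obtain T S where 1: "T \<in> carrier_mat (mdim N) (mdim M)"
    "S \<in> carrier_mat (mdim M) (mdim N)" "S * T = 1\<^sub>m (mdim M)" "T * S = 1\<^sub>m (mdim N)"
    "T * hY M = hY N * T" "\<And>h. h \<in> carrier G \<Longrightarrow> T * hG M h = hG N h * T"
    using mod_isoE[OF MN f(1,2)] by metis
  obtain T' S' where 2: "T' \<in> carrier_mat (mdim K) (mdim N)"
    "S' \<in> carrier_mat (mdim N) (mdim K)" "S' * T' = 1\<^sub>m (mdim N)" "T' * S' = 1\<^sub>m (mdim K)"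
    "T' * hY N = hY K * T'" "\<And>h. h \<in> carrier G \<Longrightarrow> T' * hG N h = hG K h * T'"
    using mod_isoE[OF NK f(2,3)] by metis
  note dim = hrep_dim[OF fdmod_hrep[OF f(1)]] hrep_dim[OF fdmod_hrep[OF f(2)]] hrep_dim[OF fdmod_hrep[OF f(3)]]
  have "S * S' * (T' * T) = S * (S' * T') * T" "T' * T * (S * S') = T' * (T * S) * S'"
    using 1(1,2) 2(1,2) by (simp_all add: mat_assoc)
  then have i: "S * S' * (T' * T) = 1\<^sub>m (mdim M)" "T' * T * (S * S') = 1\<^sub>m (mdim K)"
    using 1 2 by simp_all
  have c: "T' * T * X = X'' * (T' * T)"
    if "T * X = X' * T" "T' * X' = X'' * T'" "X \<in> carrier_mat (mdim M) (mdim M)"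
      "X' \<in> carrier_mat (mdim N) (mdim N)" "X'' \<in> carrier_mat (mdim K) (mdim K)" for X X' X''
  proof -
    have "T' * T * X = T' * (T * X)" using 1(1) 2(1) that(3-) by (simp add: mat_assoc)
    also have "\<dots> = (T' * X') * T" using 1(1) 2(1) that(3-) by (simp add: that(1) mat_assoc)
    also have "\<dots> = (X'' * T') * T" by (simp only: that(2))
    also have "\<dots> = X'' * (T' * T)" using 1(1) 2(1) that(3-) by (simp add: mat_assoc)
    finally show ?thesis .
  qed
  show ?thesis
    using f 1 2 i by (intro mod_isoI[of _ _ "T' * T" "S * S'"] c)
      (auto intro: hrepD(1,2)[OF fdmod_hrep])
qed

end

lemma kron_one_left: "kron (1\<^sub>m 1) A = A" "kron (1\<^sub>m (Suc 0)) A = A"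
  by (auto intro!: eq_matI)

lemma kron_one_right: "kron A (1\<^sub>m 1) = A" "kron A (1\<^sub>m (Suc 0)) = A"
  by (auto intro!: eq_matI)

lemma one_pow_mat: "1\<^sub>m d ^\<^sub>m k = (1\<^sub>m d :: 'a::semiring_1 mat)"
  by (induction k) auto

abbreviation diag_block :: "complex mat \<Rightarrow> complex mat \<Rightarrow> complex mat" where
  "diag_block A D \<equiv> four_block_mat A (0\<^sub>m (dim_row A) (dim_col D)) (0\<^sub>m (dim_row D) (dim_col A)) D"

lemma diag_block_mult:
  assumes "A \<in> carrier_mat a b" "D \<in> carrier_mat c d" "A' \<in> carrier_mat b a'" "D' \<in> carrier_mat d d'"
  shows "diag_block A D * diag_block A' D' = diag_block (A * A') (D * D')"
proof -
  have "diag_block A D * diag_block A' D' = four_block_mat (A * A' + 0\<^sub>m a d * 0\<^sub>m d a')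
      (A * 0\<^sub>m b d' + 0\<^sub>m a d * D') (0\<^sub>m c b * A' + D * 0\<^sub>m d a') (0\<^sub>m c b * 0\<^sub>m b d' + D * D')"
    using assms by (subst mult_four_block_mat[of _ a b _ d _ c _ _ a' _ d']) auto
  also have "\<dots> = diag_block (A * A') (D * D')"
    using assms by (intro cong_four_block_mat eq_matI) (auto simp: mult_carrier_mat[of _ a b])
  finally show ?thesis .
qed

lemma diag_block_add:
  assumes "A \<in> carrier_mat a b" "D \<in> carrier_mat c d" "A' \<in> carrier_mat a b" "D' \<in> carrier_mat c d"
  shows "diag_block A D + diag_block A' D' = diag_block (A + A') (D + D')"
  using assms by (subst add_four_block_mat[of _ a b _ d _ c]) auto

lemma diag_block_carrier:
  "A \<in> carrier_mat a b \<Longrightarrow> D \<in> carrier_mat c d \<Longrightarrow> diag_block A D \<in> carrier_mat (a + c) (b + d)"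
  by simp

lemma kron_diag_block:
  assumes "A \<in> carrier_mat a a'" "D \<in> carrier_mat b b'" "T \<in> carrier_mat c c'"
  shows "kron (diag_block A D) T = diag_block (kron A T) (kron D T)"
  using assms by (subst kron_four_block[of _ a a' _ b b' _ _ _ c c']) (auto simp: kron_zero_left)

lemma dsum_fdmod:
  assumes M: "is_fdmod A M" and N: "is_fdmod A N"
  shows "is_fdmod A (dsum M N)"
proof -
  have cM: "\<And>a. a \<in> carrier A \<Longrightarrow> act M a \<in> carrier_mat (mdim M) (mdim M)"
    and cN: "\<And>a. a \<in> carrier A \<Longrightarrow> act N a \<in> carrier_mat (mdim N) (mdim N)"
    using M N by (auto simp: is_fdmod_def)
  let ?B = "\<lambda>X Y. four_block_mat X (0\<^sub>m (mdim M) (mdim N)) (0\<^sub>m (mdim N) (mdim M)) Y"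
  have B: "act (dsum M N) a = ?B (act M a) (act N a)" for a by (simp add: dsum_def)
  have bm: "?B X Y * ?B X' Y' = ?B (X * X') (Y * Y')" and ba: "?B X Y + ?B X' Y' = ?B (X + X') (Y + Y')"
    if "X \<in> carrier_mat (mdim M) (mdim M)" "X' \<in> carrier_mat (mdim M) (mdim M)"
      "Y \<in> carrier_mat (mdim N) (mdim N)" "Y' \<in> carrier_mat (mdim N) (mdim N)" for X X' Y Y' :: "complex mat"
    using diag_block_mult[of X "mdim M" "mdim M" Y "mdim N" "mdim N" X' "mdim M" Y' "mdim N"]
      diag_block_add[of X "mdim M" "mdim M" Y "mdim N" "mdim N" X' Y'] that by auto
  have bs: "?B (c \<cdot>\<^sub>m X) (c \<cdot>\<^sub>m Y) = c \<cdot>\<^sub>m ?B X Y"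
    if "X \<in> carrier_mat (mdim M) (mdim M)" "Y \<in> carrier_mat (mdim N) (mdim N)" for c and X Y :: "complex mat"
    using that by (subst smult_four_block_mat[of _ "mdim M" "mdim M" _ "mdim N" _ "mdim N"]) (auto intro!: eq_matI)
  show ?thesis
    unfolding is_fdmod_def B
  proof (intro conjI ballI allI)
    fix a assume a: "a \<in> carrier A"
    show "?B (act M a) (act N a) \<in> carrier_mat (mdim (dsum M N)) (mdim (dsum M N))"
      using cM[OF a] cN[OF a] by (simp add: dsum_def)
    fix b assume b: "b \<in> carrier A"
    have "act K (a \<oplus>\<^bsub>A\<^esub> b) = act K a + act K b" "act K (a \<otimes>\<^bsub>A\<^esub> b) = act K a * act K b"
      if "is_fdmod A K" for K using that a b by (auto simp: is_fdmod_def)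
    then show "?B (act M (a \<oplus>\<^bsub>A\<^esub> b)) (act N (a \<oplus>\<^bsub>A\<^esub> b)) = ?B (act M a) (act N a) + ?B (act M b) (act N b)"
      "?B (act M (a \<otimes>\<^bsub>A\<^esub> b)) (act N (a \<otimes>\<^bsub>A\<^esub> b)) = ?B (act M a) (act N a) * ?B (act M b) (act N b)"
      using M N cM[OF a] cN[OF a] cM[OF b] cN[OF b] by (simp_all add: bm ba)
  next
    fix c a assume a: "a \<in> carrier A"
    then show "?B (act M (c \<odot>\<^bsub>A\<^esub> a)) (act N (c \<odot>\<^bsub>A\<^esub> a)) = c \<cdot>\<^sub>m ?B (act M a) (act N a)"
      using M N by (simp add: is_fdmod_def bs)
  qed (use M N in \<open>auto simp: is_fdmod_def dsum_def\<close>)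
qed

context non_nilpotent_group_datum
begin

section \<open>Tensor products of modules over \<open>H\<close>\<close>

lemma hrep_pow:
  assumes r: "hrep d Y \<rho>" and h: "h \<in> carrier G"
  shows "\<rho> (h [^] (k::nat)) = \<rho> h ^\<^sub>m k"
proof (induction k)
  case 0
  then show ?case using hrepD(2,3)[OF r] h by auto
next
  case (Suc k)
  then show ?case using hrepD(4)[OF r] h by simp
qed

lemma hrep_central:
  assumes r: "hrep d Y \<rho>" and h: "h \<in> carrier G"
  shows "\<rho> g * \<rho> h = \<rho> h * \<rho> g"
  using hrepD(4)[OF r] h g_closed g_central[OF h] by metis

text \<open>The image of \<Delta>(y) = y \<otimes> g + 1 \<otimes> y, with P for the action of g on
  the second factor.\<close>

definition tensor_Y :: "nat \<Rightarrow> complex mat \<Rightarrow> complex mat \<Rightarrow> complex mat \<Rightarrow> complex mat" where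
  "tensor_Y d Y P Y' = kron Y P + kron (1\<^sub>m d) Y'"

lemma tensor_Y_carrier:
  "Y \<in> carrier_mat d d \<Longrightarrow> P \<in> carrier_mat e e \<Longrightarrow> Y' \<in> carrier_mat e e \<Longrightarrow>
    tensor_Y d Y P Y' \<in> carrier_mat (d * e) (d * e)"
  by (auto simp: tensor_Y_def intro!: add_carrier_mat kron_carrier)

text \<open>The relation yg = qgy in the second factor makes the two summands of \<Delta>(y)
  q-commute, so that the quantum binomial theorem applies to them.\<close>

lemma hrep_tensor_q:
  assumes r: "hrep d Y \<rho>" and r': "hrep e Y' \<rho>'"
  shows "kron (1\<^sub>m d) Y' * kron Y (\<rho>' g) = \<chi> g \<cdot>\<^sub>m (kron Y (\<rho>' g) * kron (1\<^sub>m d) Y')"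
proof -
  note c = hrepD(1)[OF r] hrepD(1)[OF r'] hrepD(2)[OF r' g_closed]
  have "kron (1\<^sub>m d) Y' * kron Y (\<rho>' g) = kron Y (Y' * \<rho>' g)"
    using c kron_mult[of "1\<^sub>m d" d d Y d Y' e e "\<rho>' g" e] by simp
  also have "\<dots> = \<chi> g \<cdot>\<^sub>m kron Y (\<rho>' g * Y')"
    using g_closed by (simp add: hrepD(5)[OF r'] kron_smult_right)
  also have "kron Y (\<rho>' g * Y') = kron Y (\<rho>' g) * kron (1\<^sub>m d) Y'"
    using c kron_mult[of Y d d "1\<^sub>m d" d "\<rho>' g" e e Y' e] by simp
  finally show ?thesis .
qed

text \<open>The critical relation is y^n = g^n - 1. As q has order n, \<Delta>(y)^n = y^n \<otimes>
  g^n + 1 \<otimes> y^n, which is (g^n - 1) \<otimes> g^n + 1 \<otimes> (g^n - 1) = g^n \<otimes>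
  g^n - 1.\<close>

lemma hrep_tensor:
  assumes r: "hrep d Y \<rho>" and r': "hrep e Y' \<rho>'"
  shows "hrep (d * e) (tensor_Y d Y (\<rho>' g) Y') (\<lambda>h. kron (\<rho> h) (\<rho>' h))"
  unfolding hrep_def
proof (intro conjI ballI)
  note c = hrepD(1)[OF r] hrepD(1)[OF r'] hrepD(2)[OF r' g_closed]
  have kc: "kron Y (\<rho>' g) \<in> carrier_mat (d * e) (d * e)" "kron (1\<^sub>m d) Y' \<in> carrier_mat (d * e) (d * e)"
    using c by (auto intro: kron_carrier)
  show "tensor_Y d Y (\<rho>' g) Y' \<in> carrier_mat (d * e) (d * e)" using c by (intro tensor_Y_carrier)
  show "kron (\<rho> h) (\<rho>' h) \<in> carrier_mat (d * e) (d * e)" if "h \<in> carrier G" for h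
    using that hrepD(2)[OF r] hrepD(2)[OF r'] by (auto intro: kron_carrier)
  show "kron (\<rho> \<one>) (\<rho>' \<one>) = 1\<^sub>m (d * e)" by (simp add: hrepD(3)[OF r] hrepD(3)[OF r'] kron_one)
  show "kron (\<rho> (h \<otimes> k)) (\<rho>' (h \<otimes> k)) = kron (\<rho> h) (\<rho>' h) * kron (\<rho> k) (\<rho>' k)"
    if "h \<in> carrier G" "k \<in> carrier G" for h k
    using that hrepD(2)[OF r] hrepD(2)[OF r']
    by (simp add: hrepD(4)[OF r] hrepD(4)[OF r'] kron_mult[of _ d d _ d _ e e _ e])
  show "tensor_Y d Y (\<rho>' g) Y' * kron (\<rho> h) (\<rho>' h) = \<chi> h \<cdot>\<^sub>m (kron (\<rho> h) (\<rho>' h) * tensor_Y d Y (\<rho>' g) Y')"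
    if h: "h \<in> carrier G" for h
  proof -
    note ch = hrepD(2)[OF r h] hrepD(2)[OF r' h]
    have 1: "kron Y (\<rho>' g) * kron (\<rho> h) (\<rho>' h) = \<chi> h \<cdot>\<^sub>m (kron (\<rho> h) (\<rho>' h) * kron Y (\<rho>' g))"
      using c ch by (simp add: hrepD(5)[OF r h] hrep_central[OF r' h] kron_smult_left
          flip: kron_mult[of _ d d _ d _ e e _ e])
    have 2: "kron (1\<^sub>m d) Y' * kron (\<rho> h) (\<rho>' h) = \<chi> h \<cdot>\<^sub>m (kron (\<rho> h) (\<rho>' h) * kron (1\<^sub>m d) Y')"
      using c ch by (simp add: hrepD(5)[OF r' h] kron_smult_right flip: kron_mult[of _ d d _ d _ e e _ e])
    have cc: "kron (\<rho> h) (\<rho>' h) \<in> carrier_mat (d * e) (d * e)" using ch by (auto intro: kron_carrier)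
    show ?thesis
      unfolding tensor_Y_def add_mult_distrib_mat[OF kc cc] mult_add_distrib_mat[OF cc kc] 1 2
      by (rule add_smult_distrib_left_mat[OF mult_carrier_mat[OF cc kc(1)] mult_carrier_mat[OF cc kc(2)], symmetric])
  qed
  show "tensor_Y d Y (\<rho>' g) Y' ^\<^sub>m n + 1\<^sub>m (d * e) = kron (\<rho> (g [^] n)) (\<rho>' (g [^] n))"
  proof -
    note cg = hrepD(2)[OF r gn_closed] hrepD(2)[OF r' gn_closed]
    have "tensor_Y d Y (\<rho>' g) Y' ^\<^sub>m n = kron Y (\<rho>' g) ^\<^sub>m n + kron (1\<^sub>m d) Y' ^\<^sub>m n"
      unfolding tensor_Y_def using n_ge_2
      by (intro q_binomial_root_of_unity[OF kc hrep_tensor_q[OF r r'] q_pow_n q_pow_less]) auto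
    also have "\<dots> = kron (Y ^\<^sub>m n) (\<rho>' (g [^] n)) + kron (1\<^sub>m d) (Y' ^\<^sub>m n)"
      using c by (simp add: kron_pow[of _ d _ e] hrep_pow[OF r' g_closed] one_pow_mat)
    finally have "tensor_Y d Y (\<rho>' g) Y' ^\<^sub>m n + 1\<^sub>m (d * e)
        = kron (Y ^\<^sub>m n) (\<rho>' (g [^] n)) + (kron (1\<^sub>m d) (Y' ^\<^sub>m n) + kron (1\<^sub>m d) (1\<^sub>m e))"
      using c cg by (simp add: kron_one) (auto intro!: eq_matI)
    also have "kron (1\<^sub>m d) (Y' ^\<^sub>m n) + kron (1\<^sub>m d) (1\<^sub>m e) = kron (1\<^sub>m d) (\<rho>' (g [^] n))"
      using c by (simp add: hrepD(6)[OF r', symmetric] kron_add_right)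
    also have "kron (Y ^\<^sub>m n) (\<rho>' (g [^] n)) + kron (1\<^sub>m d) (\<rho>' (g [^] n)) = kron (\<rho> (g [^] n)) (\<rho>' (g [^] n))"
      using c by (simp add: hrepD(6)[OF r, symmetric] kron_add_left)
    finally show ?thesis .
  qed
qed

lemma H_bprod_closed: "u \<in> H_basis \<Longrightarrow> v \<in> H_basis \<Longrightarrow> H_bprod u v \<in> carrier H"
proof -
  interpret R: ring H by (rule H_ring)
  assume "u \<in> H_basis" "v \<in> H_basis"
  then show ?thesis using R.m_closed[OF unit_coord_closed unit_coord_closed, of u v]
    by (simp add: H_mult_unit_coord)
qed

text \<open>\<open>?\<Phi>\<close> is the action of H \<otimes> H on the tensor product. It is
  multiplicative, so the image of \<Delta>(y^s h) is determined by those of \<open>comult_y\<close>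
  and h \<otimes> h, which replaces the sum in \<open>tensor_mod\<close> by a closed form.\<close>

lemma tensor_mod_eq:
  assumes M: "is_fdmod H M" and N: "is_fdmod H N"
  shows "tensor_mod M N = rep_mod (mdim M * mdim N) (tensor_Y (mdim M) (hY M) (hG N g) (hY N))
    (\<lambda>h. kron (hG M h) (hG N h))"
proof -
  note rM = fdmod_hrep[OF M] and rN = fdmod_hrep[OF N]
  let ?d = "mdim M" and ?e = "mdim N" and ?B = "H_basis \<times> H_basis"
  let ?K = "\<lambda>(u, v). kron (act M (unit_coord u)) (act N (unit_coord v))"
  let ?\<Phi> = "\<lambda>x. lin (?d * ?e) (?d * ?e) ?B x ?K"
  have fB: "finite ?B" using finite_H_basis by simp
  have cX: "act L (unit_coord u) \<in> carrier_mat (mdim L) (mdim L)" if "is_fdmod H L" "u \<in> H_basis" for L u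
    using that by (simp add: fdmod_carrier unit_coord_closed)
  have K: "?K x \<in> carrier_mat (?d * ?e) (?d * ?e)" if "x \<in> ?B" for x
    using that M N by (auto intro!: kron_carrier cX)
  have str: "act L (unit_coord u) * act L (unit_coord v)
      = lin (mdim L) (mdim L) H_basis (H_bprod u v) (\<lambda>b. act L (unit_coord b))"
    if L: "is_fdmod H L" and uv: "u \<in> H_basis" "v \<in> H_basis" for L u v
  proof -
    have "act L (unit_coord u) * act L (unit_coord v) = act L (H_bprod u v)"
      using uv by (simp add: fdmod_mult[OF L] unit_coord_closed flip: H_mult_unit_coord)
    also have "\<dots> = lin (mdim L) (mdim L) H_basis (H_bprod u v) (\<lambda>b. act L (unit_coord b))"
      using based_algebra_act[OF _ finite_H_basis] L H_bprod_closed[OF uv] unfolding H_def by blast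
    finally show ?thesis .
  qed
  have mult: "?\<Phi> (x \<otimes>\<^bsub>HH\<^esub> y) = ?\<Phi> x * ?\<Phi> y" for x y
    unfolding HH_def
  proof (rule lin_based_mult[OF K])
    fix p r assume "p \<in> ?B" "r \<in> ?B"
    then obtain u v u' v' where e: "p = (u, v)" "r = (u', v')"
      and b: "u \<in> H_basis" "v \<in> H_basis" "u' \<in> H_basis" "v' \<in> H_basis" by auto
    have "?K p * ?K r = kron (act M (unit_coord u) * act M (unit_coord u'))
        (act N (unit_coord v) * act N (unit_coord v'))"
      using b cX[OF M] cX[OF N] by (simp add: e kron_mult[of _ ?d ?d _ ?d _ ?e ?e _ ?e])
    also have "\<dots> = lin (?d * ?e) (?d * ?e) ?B (\<lambda>(z, w). H_bprod u u' z * H_bprod v v' w) ?K"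
      using b cX[OF M] cX[OF N] by (simp add: str M N kron_lin)
    finally show "?K p * ?K r = lin (?d * ?e) (?d * ?e) ?B
        ((\<lambda>(u, v) (u', v') (z, w). H_bprod u u' z * H_bprod v v' w) p r) ?K" by (simp add: e)
  qed
  have u: "?\<Phi> (unit_coord ((i, h), (j, k))) = kron (hY M ^\<^sub>m i * hG M h) (hY N ^\<^sub>m j * hG N k)"
    if "(i, h) \<in> H_basis" "(j, k) \<in> H_basis" for i h j k
    using that lin_unit_coord[OF fB, of "((i, h), (j, k))" ?K] K[of "((i, h), (j, k))"] M N
    by (simp add: fdmod_act_basis)
  have b: "(0, \<one>) \<in> H_basis" "(1, \<one>) \<in> H_basis" "(0, g) \<in> H_basis" "h \<in> carrier G \<Longrightarrow> (0, h) \<in> H_basis" for h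
    using n_ge_2 g_closed by (auto simp: H_basis_def)
  note dim = hrep_dim[OF rM] hrep_dim[OF rN] hrepD(3)[OF rM] hrepD(3)[OF rN]
  have add: "?\<Phi> (x \<oplus>\<^bsub>HH\<^esub> y) = ?\<Phi> x + ?\<Phi> y" for x y
    by (simp add: HH_def based_algebra_def lin_add)
  have cy: "?\<Phi> comult_y = tensor_Y ?d (hY M) (hG N g) (hY N)"
    unfolding comult_y_def tensor_Y_def add u[OF b(2,3)] u[OF b(1,2)]
    using dim g_closed by simp
  have pow: "?\<Phi> (comult_y [^]\<^bsub>HH\<^esub> (s::nat)) = tensor_Y ?d (hY M) (hG N g) (hY N) ^\<^sub>m s" for s
  proof (induction s)
    case 0
    have "\<one>\<^bsub>HH\<^esub> = unit_coord ((0, \<one>), (0, \<one>))" by (simp add: HH_def based_algebra_def)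
    then have "?\<Phi> (comult_y [^]\<^bsub>HH\<^esub> (0::nat)) = 1\<^sub>m (?d * ?e)"
      using u[OF b(1,1)] dim by (simp add: nat_pow_def kron_one)
    then show ?case using dim by (simp add: tensor_Y_def)
  next
    case (Suc s)
    have "comult_y [^]\<^bsub>HH\<^esub> Suc s = comult_y [^]\<^bsub>HH\<^esub> s \<otimes>\<^bsub>HH\<^esub> comult_y" by (simp add: nat_pow_def)
    then show ?case by (simp add: mult Suc cy)
  qed
  have "?\<Phi> (comult a) = lin (?d * ?e) (?d * ?e) H_basis a
      (\<lambda>(s, h). tensor_Y ?d (hY M) (hG N g) (hY N) ^\<^sub>m s * kron (hG M h) (hG N h))" for a
  proof -
    let ?c = "\<lambda>(i, h). comult_y [^]\<^bsub>HH\<^esub> (i::nat) \<otimes>\<^bsub>HH\<^esub> unit_coord ((0, h), (0, h))"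
    have "comult a = (\<lambda>x. \<Sum>b\<in>H_basis. a b * ?c b x)"
      by (simp add: comult_def case_prod_unfold)
    then have "?\<Phi> (comult a) = lin (?d * ?e) (?d * ?e) H_basis a (\<lambda>b. ?\<Phi> (?c b))"
      by (simp only: lin_lin)
    also have "\<dots> = lin (?d * ?e) (?d * ?e) H_basis a
      (\<lambda>(s, h). tensor_Y ?d (hY M) (hG N g) (hY N) ^\<^sub>m s * kron (hG M h) (hG N h))"
    proof (intro lin_cong refl)
      fix x assume "x \<in> H_basis"
      then obtain s h where x: "x = (s, h)" "h \<in> carrier G" by (auto simp: H_basis_def)
      show "?\<Phi> (?c x) = (\<lambda>(s, h). tensor_Y ?d (hY M) (hG N g) (hY N) ^\<^sub>m s * kron (hG M h) (hG N h)) x"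
        using u[OF b(4) b(4), OF x(2) x(2)] dim x(2) by (simp add: x(1) mult pow)
    qed
    finally show ?thesis .
  qed
  moreover have "act (tensor_mod M N) a = ?\<Phi> (comult a)" for a
    by (simp add: tensor_mod_def lin_def case_prod_unfold)
  ultimately show ?thesis
    by (simp add: tensor_mod_def rep_mod_def fun_eq_iff)
qed

lemma tensor_hrep:
  assumes M: "is_fdmod H M" and N: "is_fdmod H N"
  shows "hrep (mdim M * mdim N) (tensor_Y (mdim M) (hY M) (hG N g) (hY N)) (\<lambda>h. kron (hG M h) (hG N h))"
  using hrep_tensor[OF fdmod_hrep[OF M] fdmod_hrep[OF N]] .

lemma tensor_mdim [simp]: "mdim (tensor_mod M N) = mdim M * mdim N"
  by (simp add: tensor_mod_def)

lemma tensor_fdmod: "is_fdmod H M \<Longrightarrow> is_fdmod H N \<Longrightarrow> is_fdmod H (tensor_mod M N)"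
  by (simp add: tensor_mod_eq rep_mod_fdmod tensor_hrep)

lemma tensor_hY:
  "is_fdmod H M \<Longrightarrow> is_fdmod H N \<Longrightarrow>
    hY (tensor_mod M N) = kron (hY M) (hG N g) + kron (1\<^sub>m (mdim M)) (hY N)"
  by (simp add: tensor_mod_eq rep_mod_hY tensor_hrep) (simp add: tensor_Y_def)

lemma tensor_hG:
  "is_fdmod H M \<Longrightarrow> is_fdmod H N \<Longrightarrow> h \<in> carrier G \<Longrightarrow>
    hG (tensor_mod M N) h = kron (hG M h) (hG N h)"
  by (simp add: tensor_mod_eq rep_mod_hG[OF tensor_hrep])

text \<open>Row-major numbering makes the associativity of \<open>kron\<close> a literal equality,
  so the two modules agree exactly and not only up to isomorphism. Both bracketings give y \<otimes>
  g \<otimes> g + 1 \<otimes> y \<otimes> g + 1 \<otimes> 1 \<otimes> y.\<close>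

lemma tensor_assoc:
  assumes f: "is_fdmod H M" "is_fdmod H N" "is_fdmod H K"
  shows "tensor_mod (tensor_mod M N) K = tensor_mod M (tensor_mod N K)"
proof -
  note dim = hrep_dim[OF fdmod_hrep[OF f(1)]] hrep_dim[OF fdmod_hrep[OF f(2)]] hrep_dim[OF fdmod_hrep[OF f(3)]]
  note t = tensor_fdmod[OF f(1,2)] tensor_fdmod[OF f(2,3)]
  have Y: "tensor_Y (mdim M * mdim N) (hY (tensor_mod M N)) (hG K g) (hY K)
      = tensor_Y (mdim M) (hY M) (hG (tensor_mod N K) g) (hY (tensor_mod N K))"
    using f dim g_closed
    by (simp add: tensor_hY tensor_hG tensor_Y_def kron_add_left kron_add_right kron_assoc flip: kron_one)
      (auto intro!: eq_matI)
  show ?thesis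
    unfolding tensor_mod_eq[OF t(1) f(3)] tensor_mod_eq[OF f(1) t(2)] tensor_mdim Y mult.assoc
    using tensor_hrep[OF f(1) t(2)] f
    by (intro rep_mod_cong[symmetric]) (simp_all add: tensor_hG kron_assoc)
qed

lemma tensor_iso:
  assumes f: "is_fdmod H M" "is_fdmod H N" "is_fdmod H M'" "is_fdmod H N'"
    and i: "mod_iso H M M'" "mod_iso H N N'"
  shows "mod_iso H (tensor_mod M N) (tensor_mod M' N')"
proof -
  obtain T S where 1: "T \<in> carrier_mat (mdim M') (mdim M)"
    "S \<in> carrier_mat (mdim M) (mdim M')" "S * T = 1\<^sub>m (mdim M)" "T * S = 1\<^sub>m (mdim M')"
    "T * hY M = hY M' * T" "\<And>h. h \<in> carrier G \<Longrightarrow> T * hG M h = hG M' h * T"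
    using mod_isoE[OF i(1) f(1,3)] by metis
  obtain T' S' where 2: "T' \<in> carrier_mat (mdim N') (mdim N)"
    "S' \<in> carrier_mat (mdim N) (mdim N')" "S' * T' = 1\<^sub>m (mdim N)" "T' * S' = 1\<^sub>m (mdim N')"
    "T' * hY N = hY N' * T'" "\<And>h. h \<in> carrier G \<Longrightarrow> T' * hG N h = hG N' h * T'"
    using mod_isoE[OF i(2) f(2,4)] by metis
  note k = kron_mult[OF 1(1) _ 2(1), symmetric] kron_mult[OF 1(2) _ 2(2), symmetric]
  note c = hrepD(1,2)[OF fdmod_hrep[OF f(1)]] hrepD(1,2)[OF fdmod_hrep[OF f(2)]]
    hrepD(1,2)[OF fdmod_hrep[OF f(3)]] hrepD(1,2)[OF fdmod_hrep[OF f(4)]]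
  have m: "kron T T' * kron A B = kron A' B' * kron T T'"
    if "T * A = A' * T" "T' * B = B' * T'" "A \<in> carrier_mat (mdim M) (mdim M)" "B \<in> carrier_mat (mdim N) (mdim N)"
      "A' \<in> carrier_mat (mdim M') (mdim M')" "B' \<in> carrier_mat (mdim N') (mdim N')" for A B A' B'
    using that kron_mult[OF 1(1) that(3) 2(1) that(4)] kron_mult[OF that(5) 1(1) that(6) 2(1)] by simp
  have KT: "kron T T' \<in> carrier_mat (mdim M' * mdim N') (mdim M * mdim N)"
    "kron S S' \<in> carrier_mat (mdim M * mdim N) (mdim M' * mdim N')"
    using 1 2 by (auto intro: kron_carrier)
  have Y: "kron T T' * (kron (hY M) (hG N g) + kron (1\<^sub>m (mdim M)) (hY N))
      = (kron (hY M') (hG N' g) + kron (1\<^sub>m (mdim M')) (hY N')) * kron T T'"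
  proof -
    have e: "kron T T' * kron (hY M) (hG N g) = kron (hY M') (hG N' g) * kron T T'"
      "kron T T' * kron (1\<^sub>m (mdim M)) (hY N) = kron (1\<^sub>m (mdim M')) (hY N') * kron T T'"
      using 1 2 c g_closed by (auto intro!: m)
    have d: "kron (hY M) (hG N g) \<in> carrier_mat (mdim M * mdim N) (mdim M * mdim N)"
      "kron (1\<^sub>m (mdim M)) (hY N) \<in> carrier_mat (mdim M * mdim N) (mdim M * mdim N)"
      "kron (hY M') (hG N' g) \<in> carrier_mat (mdim M' * mdim N') (mdim M' * mdim N')"
      "kron (1\<^sub>m (mdim M')) (hY N') \<in> carrier_mat (mdim M' * mdim N') (mdim M' * mdim N')"
      using c g_closed by (auto intro!: kron_carrier)
    show ?thesis
      unfolding mult_add_distrib_mat[OF KT(1) d(1,2)] add_mult_distrib_mat[OF d(3,4) KT(1)] e ..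
  qed
  show ?thesis
    using f c by (intro mod_isoI[OF tensor_fdmod tensor_fdmod, of M N M' N' "kron T T'" "kron S S'"])
      (use KT 1 2 Y in \<open>auto simp: tensor_hY tensor_hG kron_one m simp flip: kron_mult[OF 1(1) _ 2(1)] kron_mult[OF 1(2) _ 2(2)]\<close>)
qed

lemma triv_hrep: "hrep 1 (0\<^sub>m 1 1) (\<lambda>h. 1\<^sub>m 1)"
proof -
  obtain i where i: "n = Suc i" using n_ge_2 by (cases n) auto
  have "(0\<^sub>m 1 1 :: complex mat) ^\<^sub>m n = 0\<^sub>m 1 1"
    unfolding i by (simp add: right_mult_zero_mat[of _ 1 1])
  then show ?thesis by (auto simp: hrep_def)
qed

lemma triv_mod_eq: "triv_mod = rep_mod 1 (0\<^sub>m 1 1) (\<lambda>h. 1\<^sub>m 1)"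
proof -
  \<comment> \<open>With 0^0 = 1 the powers of the zero matrix reproduce the values of
    \<open>counit\<close> on y^s h.\<close>
  have p: "(0\<^sub>m 1 1 :: complex mat) ^\<^sub>m s = 0 ^ s \<cdot>\<^sub>m 1\<^sub>m 1" for s
    by (cases s) (auto intro!: eq_matI)
  have "counit a \<cdot>\<^sub>m 1\<^sub>m 1 = lin 1 1 H_basis a (\<lambda>(s, h). 0\<^sub>m 1 1 ^\<^sub>m s * 1\<^sub>m 1)" for a
    by (intro eq_matI) (auto simp: p[unfolded One_nat_def] counit_def case_prod_unfold)
  then show ?thesis by (simp add: triv_mod_def rep_mod_def)
qed

lemma triv_fdmod: "is_fdmod H triv_mod"
  by (simp only: triv_mod_eq rep_mod_fdmod triv_hrep)

lemma triv_tensor: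
  assumes M: "is_fdmod H M"
  shows "mod_iso H (tensor_mod triv_mod M) M" "mod_iso H (tensor_mod M triv_mod) M"
proof -
  note dim = hrep_dim[OF fdmod_hrep[OF M]]
  have m: "mdim triv_mod = 1" "hY triv_mod = 0\<^sub>m 1 1" "h \<in> carrier G \<Longrightarrow> hG triv_mod h = 1\<^sub>m 1" for h
    using rep_mod_hY[OF triv_hrep] rep_mod_hG[OF triv_hrep] by (simp_all add: triv_mod_eq)
  have Y: "hY (tensor_mod triv_mod M) = hY M" "hY (tensor_mod M triv_mod) = hY M"
    using dim g_closed by (auto simp: tensor_hY M triv_fdmod m kron_zero_left kron_zero_right kron_one_left kron_one_right
      simp del: One_nat_def intro!: eq_matI)
  have Gr: "hG (tensor_mod triv_mod M) h = hG M h" "hG (tensor_mod M triv_mod) h = hG M h"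
    if "h \<in> carrier G" for h
    using that by (auto simp: tensor_hG M triv_fdmod m kron_one_left kron_one_right simp del: One_nat_def)
  show "mod_iso H (tensor_mod triv_mod M) M" "mod_iso H (tensor_mod M triv_mod) M"
    using dim by (auto intro!: mod_isoI[of _ _ "1\<^sub>m (mdim M)" "1\<^sub>m (mdim M)"] tensor_fdmod M triv_fdmod simp: m Y Gr)
qed

section \<open>Direct sums and distributivity of the tensor product\<close>

lemma dsum_mdim [simp]: "mdim (dsum M N) = mdim M + mdim N"
  by (simp add: dsum_def)

lemma dsum_hY: "is_fdmod H M \<Longrightarrow> is_fdmod H N \<Longrightarrow> hY (dsum M N) = diag_block (hY M) (hY N)"
  using hrep_dim[OF fdmod_hrep[of M]] hrep_dim[OF fdmod_hrep[of N]] by (simp add: dsum_def hY_def)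

lemma dsum_hG:
  "is_fdmod H M \<Longrightarrow> is_fdmod H N \<Longrightarrow> h \<in> carrier G \<Longrightarrow> hG (dsum M N) h = diag_block (hG M h) (hG N h)"
  using hrep_dim[OF fdmod_hrep[of M]] hrep_dim[OF fdmod_hrep[of N]] by (simp add: dsum_def hG_def)

lemma mod_iso_eqI:
  assumes f: "is_fdmod H M" "is_fdmod H N" and e: "mdim M = mdim N" "hY M = hY N"
    "\<And>h. h \<in> carrier G \<Longrightarrow> hG M h = hG N h"
  shows "mod_iso H M N"
  using f e hrep_dim[OF fdmod_hrep[OF f(2)]]
  by (intro mod_isoI[of _ _ "1\<^sub>m (mdim M)" "1\<^sub>m (mdim M)"]) auto

text \<open>Blocks of the first factor stay blocks under \<open>kron\<close>, so the generators act
  by the same matrices on both sides.\<close>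

lemma tensor_dsum_left:
  assumes f: "is_fdmod H M" "is_fdmod H N" "is_fdmod H K"
  shows "mod_iso H (tensor_mod (dsum M N) K) (dsum (tensor_mod M K) (tensor_mod N K))"
proof (rule mod_iso_eqI)
  note c = hrepD(1,2)[OF fdmod_hrep[OF f(1)]] hrepD(1,2)[OF fdmod_hrep[OF f(2)]]
    hrepD(1,2)[OF fdmod_hrep[OF f(3)]]
  note d = dsum_fdmod[OF f(1,2)] tensor_fdmod[OF f(1,3)] tensor_fdmod[OF f(2,3)]
  have k: "kron (hY M) (hG K g) \<in> carrier_mat (mdim M * mdim K) (mdim M * mdim K)"
    "kron (hY N) (hG K g) \<in> carrier_mat (mdim N * mdim K) (mdim N * mdim K)"
    "kron (1\<^sub>m (mdim M)) (hY K) \<in> carrier_mat (mdim M * mdim K) (mdim M * mdim K)"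
    "kron (1\<^sub>m (mdim N)) (hY K) \<in> carrier_mat (mdim N * mdim K) (mdim N * mdim K)"
    using c g_closed by (auto intro!: kron_carrier)
  have "hY (tensor_mod (dsum M N) K) = kron (diag_block (hY M) (hY N)) (hG K g)
      + kron (diag_block (1\<^sub>m (mdim M)) (1\<^sub>m (mdim N))) (hY K)"
    using f d by (simp add: tensor_hY dsum_hY)
  also have "\<dots> = diag_block (kron (hY M) (hG K g)) (kron (hY N) (hG K g))
      + diag_block (kron (1\<^sub>m (mdim M)) (hY K)) (kron (1\<^sub>m (mdim N)) (hY K))"
    using c g_closed kron_diag_block[of "hY M" "mdim M" "mdim M" "hY N" "mdim N" "mdim N" "hG K g" "mdim K" "mdim K"]
      kron_diag_block[of "1\<^sub>m (mdim M)" "mdim M" "mdim M" "1\<^sub>m (mdim N)" "mdim N" "mdim N" "hY K" "mdim K" "mdim K"]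
    by simp
  also have "\<dots> = hY (dsum (tensor_mod M K) (tensor_mod N K))"
    using f d diag_block_add[OF k(1,2) k(3,4)] by (simp add: dsum_hY tensor_hY)
  finally show "hY (tensor_mod (dsum M N) K) = hY (dsum (tensor_mod M K) (tensor_mod N K))" .
  show "hG (tensor_mod (dsum M N) K) h = hG (dsum (tensor_mod M K) (tensor_mod N K)) h"
    if h: "h \<in> carrier G" for h
    using f d h c kron_diag_block[of "hG M h" "mdim M" "mdim M" "hG N h" "mdim N" "mdim N" "hG K h" "mdim K" "mdim K"]
    by (simp add: tensor_hG dsum_hG)
  show "is_fdmod H (tensor_mod (dsum M N) K)" "is_fdmod H (dsum (tensor_mod M K) (tensor_mod N K))"
    using d f by (auto intro: tensor_fdmod dsum_fdmod)
qed (simp add: distrib_right)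

text \<open>Here the blocks sit in the second factor and get interleaved. \<open>F\<close> swaps the
  factors, where the blocks separate, and \<open>F'\<close> swaps back inside each block. The swaps
  are only linear maps; the equivariance of the composite is \<open>key\<close>.\<close>

lemma tensor_dsum_right:
  assumes f: "is_fdmod H M" "is_fdmod H N" "is_fdmod H K"
  shows "mod_iso H (tensor_mod K (dsum M N)) (dsum (tensor_mod K M) (tensor_mod K N))"
proof -
  let ?e = "mdim K" and ?a = "mdim M" and ?b = "mdim N"
  note c = hrepD(1,2)[OF fdmod_hrep[OF f(1)]] hrepD(1,2)[OF fdmod_hrep[OF f(2)]]
    hrepD(1,2)[OF fdmod_hrep[OF f(3)]]
  note d = dsum_fdmod[OF f(1,2)] tensor_fdmod[OF f(3,1)] tensor_fdmod[OF f(3,2)]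
  define F where "F = flip_mat ?e (?a + ?b)"
  define F' where "F' = diag_block (flip_mat ?a ?e) (flip_mat ?b ?e)"
  define E where "E = flip_mat (?a + ?b) ?e"
  define E' where "E' = diag_block (flip_mat ?e ?a) (flip_mat ?e ?b)"
  have Fc: "F \<in> carrier_mat ((?a + ?b) * ?e) (?e * (?a + ?b))" "E \<in> carrier_mat (?e * (?a + ?b)) ((?a + ?b) * ?e)"
    by (simp_all add: F_def E_def)
  have Fc': "F' \<in> carrier_mat (?e * ?a + ?e * ?b) (?a * ?e + ?b * ?e)"
    "E' \<in> carrier_mat (?a * ?e + ?b * ?e) (?e * ?a + ?e * ?b)"
    unfolding F'_def E'_def by (rule diag_block_carrier; simp)+
  have dd: "(?a + ?b) * ?e = ?a * ?e + ?b * ?e" by (simp add: distrib_right)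
  have Fc'': "F' \<in> carrier_mat (?e * ?a + ?e * ?b) ((?a + ?b) * ?e)"
    "E' \<in> carrier_mat ((?a + ?b) * ?e) (?e * ?a + ?e * ?b)" using Fc' by (simp_all only: dd)
  have EF: "E * F = 1\<^sub>m (?e * (?a + ?b))" "F * E = 1\<^sub>m ((?a + ?b) * ?e)"
    by (simp_all add: E_def F_def flip_flip)
  have EF': "E' * F' = 1\<^sub>m ((?a + ?b) * ?e)" "F' * E' = 1\<^sub>m (?e * ?a + ?e * ?b)"
    unfolding E'_def F'_def dd diag_block_mult[OF flip_carrier flip_carrier flip_carrier flip_carrier] flip_flip
    by simp_all
  have key: "F' * F * kron A (diag_block B D) = diag_block (kron A B) (kron A D) * (F' * F)"
    if ABD: "A \<in> carrier_mat ?e ?e" "B \<in> carrier_mat ?a ?a" "D \<in> carrier_mat ?b ?b" for A B D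
  proof -
    have kc: "kron A (diag_block B D) \<in> carrier_mat (?e * (?a + ?b)) (?e * (?a + ?b))"
      "diag_block (kron B A) (kron D A) \<in> carrier_mat ((?a + ?b) * ?e) ((?a + ?b) * ?e)"
      "diag_block (kron A B) (kron A D) \<in> carrier_mat (?e * ?a + ?e * ?b) (?e * ?a + ?e * ?b)"
      using ABD unfolding dd by (auto intro!: kron_carrier four_block_carrier_mat)
    have 1: "F * kron A (diag_block B D) = diag_block (kron B A) (kron D A) * F"
      using flip_kron[of A ?e ?e "diag_block B D" "?a + ?b" "?a + ?b"]
        kron_diag_block[OF ABD(2,3,1)] ABD by (simp add: F_def)
    have k4: "kron A B \<in> carrier_mat (?e * ?a) (?e * ?a)" "kron A D \<in> carrier_mat (?e * ?b) (?e * ?b)"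
      "kron B A \<in> carrier_mat (?a * ?e) (?a * ?e)" "kron D A \<in> carrier_mat (?b * ?e) (?b * ?e)"
      using ABD by (auto intro!: kron_carrier)
    have 2: "F' * diag_block (kron B A) (kron D A) = diag_block (kron A B) (kron A D) * F'"
      unfolding F'_def diag_block_mult[OF flip_carrier flip_carrier k4(3,4)] diag_block_mult[OF k4(1,2) flip_carrier flip_carrier]
      using flip_kron[of B ?a ?a A ?e ?e] flip_kron[of D ?b ?b A ?e ?e] ABD by simp
    have "F' * F * kron A (diag_block B D) = F' * (F * kron A (diag_block B D))"
      by (rule assoc_mult_mat[OF Fc''(1) Fc(1) kc(1)])
    also have "\<dots> = (F' * diag_block (kron B A) (kron D A)) * F"
      unfolding 1 by (rule assoc_mult_mat[OF Fc''(1) kc(2) Fc(1), symmetric])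
    also have "\<dots> = diag_block (kron A B) (kron A D) * (F' * F)"
      unfolding 2 by (rule assoc_mult_mat[OF kc(3) Fc''(1) Fc(1)])
    finally show ?thesis .
  qed
  have inv: "E * E' * (F' * F) = 1\<^sub>m (?e * (?a + ?b))" "F' * F * (E * E') = 1\<^sub>m (?e * ?a + ?e * ?b)"
  proof -
    have "E * E' * (F' * F) = E * (E' * F') * F" using Fc Fc'' by (simp add: mat_assoc)
    then show "E * E' * (F' * F) = 1\<^sub>m (?e * (?a + ?b))" using EF EF' Fc by simp
    have "F' * F * (E * E') = F' * (F * E) * E'" using Fc Fc'' by (simp add: mat_assoc)
    then show "F' * F * (E * E') = 1\<^sub>m (?e * ?a + ?e * ?b)" using EF EF' Fc'' by simp
  qed
  have FF: "F' * F \<in> carrier_mat (?e * ?a + ?e * ?b) (?e * (?a + ?b))"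
    "E * E' \<in> carrier_mat (?e * (?a + ?b)) (?e * ?a + ?e * ?b)"
    using Fc Fc'' by (auto intro: mult_carrier_mat)
  have Y: "F' * F * hY (tensor_mod K (dsum M N)) = hY (dsum (tensor_mod K M) (tensor_mod K N)) * (F' * F)"
  proof -
    have k: "kron (hY K) (hG M g) \<in> carrier_mat (?e * ?a) (?e * ?a)"
      "kron (hY K) (hG N g) \<in> carrier_mat (?e * ?b) (?e * ?b)"
      "kron (1\<^sub>m ?e) (hY M) \<in> carrier_mat (?e * ?a) (?e * ?a)"
      "kron (1\<^sub>m ?e) (hY N) \<in> carrier_mat (?e * ?b) (?e * ?b)"
      using c g_closed by (auto intro!: kron_carrier)
    have k2: "kron (hY K) (diag_block (hG M g) (hG N g)) \<in> carrier_mat (?e * (?a + ?b)) (?e * (?a + ?b))"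
      "kron (1\<^sub>m ?e) (diag_block (hY M) (hY N)) \<in> carrier_mat (?e * (?a + ?b)) (?e * (?a + ?b))"
      using c g_closed by (auto intro!: kron_carrier four_block_carrier_mat)
    have "hY (tensor_mod K (dsum M N)) = kron (hY K) (diag_block (hG M g) (hG N g)) + kron (1\<^sub>m ?e) (diag_block (hY M) (hY N))"
      using f d g_closed by (simp add: tensor_hY dsum_hY dsum_hG)
    then have "F' * F * hY (tensor_mod K (dsum M N)) = F' * F * kron (hY K) (diag_block (hG M g) (hG N g))
        + F' * F * kron (1\<^sub>m ?e) (diag_block (hY M) (hY N))"
      using mult_add_distrib_mat[OF FF(1) k2] by simp
    also have "\<dots> = diag_block (kron (hY K) (hG M g)) (kron (hY K) (hG N g)) * (F' * F)
        + diag_block (kron (1\<^sub>m ?e) (hY M)) (kron (1\<^sub>m ?e) (hY N)) * (F' * F)"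
      using c g_closed by (simp only: key one_carrier_mat)
    also have "\<dots> = (diag_block (kron (hY K) (hG M g)) (kron (hY K) (hG N g))
        + diag_block (kron (1\<^sub>m ?e) (hY M)) (kron (1\<^sub>m ?e) (hY N))) * (F' * F)"
      by (rule add_mult_distrib_mat[OF diag_block_carrier[OF k(1,2)] diag_block_carrier[OF k(3,4)] FF(1), symmetric])
    also have "\<dots> = hY (dsum (tensor_mod K M) (tensor_mod K N)) * (F' * F)"
      unfolding diag_block_add[OF k(1,2) k(3,4)] using f d by (simp add: dsum_hY tensor_hY)
    finally show ?thesis .
  qed
  show ?thesis
    using FF inv Y f d c
    by (intro mod_isoI[of _ _ "F' * F" "E * E'"])
      (auto intro!: tensor_fdmod dsum_fdmod simp: tensor_hG dsum_hG key)
qed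

section \<open>Relatively projective modules\<close>

text \<open>Higman's criterion for relative projectivity over \<open>\<complex>G\<close>.\<close>

definition good_mod :: "(nat \<times> 'a \<Rightarrow> complex) fdmod \<Rightarrow> bool" where
  "good_mod M \<longleftrightarrow> is_fdmod H M \<and> (\<exists>Z\<in>carrier_mat (mdim M) (mdim M).
     (\<forall>h\<in>carrier G. Z * hG M h = \<chi> h \<cdot>\<^sub>m (hG M h * Z)) \<and> tw (hY M) Z n = 1\<^sub>m (mdim M))"

text \<open>Since P and Q commute, all summands have the same second factor: P^(m-s) Q P^s = P^m
  Q.\<close>

lemma tw_kron:
  assumes "Y \<in> carrier_mat d d" "Z \<in> carrier_mat d d" "P \<in> carrier_mat e e" "Q \<in> carrier_mat e e"
    and PQ: "P * Q = Q * P"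
  shows "tw (kron Y P) (kron Z Q) (Suc m) = kron (tw Y Z (Suc m)) (P ^\<^sub>m m * Q)"
proof (induction m)
  case 0
  have "kron Z Q \<in> carrier_mat (d * e) (d * e)" using assms(1-4) by (auto intro: kron_carrier)
  then show ?case using assms(1-4) by simp
next
  case (Suc m)
  have t: "tw Y Z (Suc m) \<in> carrier_mat d d" using assms by (intro tw_carrier)
  have "tw (kron Y P) (kron Z Q) (Suc (Suc m))
      = kron Y P ^\<^sub>m Suc m * kron Z Q + tw (kron Y P) (kron Z Q) (Suc m) * kron Y P" by (rule tw.simps)
  also have "kron Y P ^\<^sub>m Suc m * kron Z Q = kron (Y ^\<^sub>m Suc m * Z) (P ^\<^sub>m Suc m * Q)"
    using assms(1-4) by (simp only: kron_pow kron_mult[of _ d d _ d _ e e _ e] pow_carrier_mat)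
  also have "tw (kron Y P) (kron Z Q) (Suc m) * kron Y P = kron (tw Y Z (Suc m) * Y) (P ^\<^sub>m m * Q * P)"
    unfolding Suc using assms(3,4)
    by (intro kron_mult[OF t assms(1) _ assms(3), symmetric] mult_carrier_mat[of _ e e]) auto
  also have "P ^\<^sub>m m * Q * P = P ^\<^sub>m m * (P * Q)" unfolding PQ using assms(3,4) by (simp add: mat_assoc)
  also have "\<dots> = P ^\<^sub>m Suc m * Q" using assms(3,4) by (simp add: mat_assoc)
  also have "kron (Y ^\<^sub>m Suc m * Z) (P ^\<^sub>m Suc m * Q) + kron (tw Y Z (Suc m) * Y) (P ^\<^sub>m Suc m * Q)
      = kron (tw Y Z (Suc (Suc m))) (P ^\<^sub>m Suc m * Q)"
    unfolding tw.simps(2)[of Y Z "Suc m"] using assms(1-4) t by (intro kron_add_left[symmetric]) (auto simp del: tw.simps)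
  finally show ?case .
qed

text \<open>The witness is 1 \<otimes> Z. In the derivative of \<Delta>(y)^n only the summand 1
  \<otimes> y is moved, which leaves the Kronecker product of 1 with \<open>tw (hY N) Z n\<close>,
  that is 1.\<close>

lemma good_tensor_right:
  assumes M: "is_fdmod H M" and N: "good_mod N"
  shows "good_mod (tensor_mod M N)"
proof -
  let ?d = "mdim M" and ?e = "mdim N"
  from N obtain Z where fN: "is_fdmod H N" and Z: "Z \<in> carrier_mat ?e ?e"
    "\<And>h. h \<in> carrier G \<Longrightarrow> Z * hG N h = \<chi> h \<cdot>\<^sub>m (hG N h * Z)" "tw (hY N) Z n = 1\<^sub>m ?e"
    by (auto simp: good_mod_def)
  note rM = fdmod_hrep[OF M] and rN = fdmod_hrep[OF fN]
  note c = hrepD(1)[OF rM] hrepD(1)[OF rN] hrepD(2)[OF rN g_closed]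
  let ?A = "kron (hY M) (hG N g)" and ?B = "kron (1\<^sub>m ?d) (hY N)" and ?W = "kron (1\<^sub>m ?d) Z"
  have kc: "?A \<in> carrier_mat (?d * ?e) (?d * ?e)" "?B \<in> carrier_mat (?d * ?e) (?d * ?e)"
    "?W \<in> carrier_mat (?d * ?e) (?d * ?e)" using c Z by (auto intro: kron_carrier)
  obtain m where m: "n = Suc m" using n_ge_2 by (cases n) auto
  \<comment> \<open>Z commutes with g in the same way as y does, so 1 \<otimes> Z is an admissible
    direction for the summand 1 \<otimes> y in \<open>tw_q_add\<close>.\<close>
  have WA: "?W * ?A = \<chi> g \<cdot>\<^sub>m (?A * ?W)"
    using c Z g_closed by (simp add: Z(2)[OF g_closed] kron_smult_right flip: kron_mult[of _ ?d ?d _ ?d _ ?e ?e _ ?e])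
  have "tw (?A + ?B) (0\<^sub>m (?d * ?e) (?d * ?e) + ?W) n = tw ?A (0\<^sub>m (?d * ?e) (?d * ?e)) n + tw ?B ?W n"
  proof (rule tw_q_add[OF kc(1,2) zero_carrier_mat kc(3) hrep_tensor_q[OF rM rN] _ q_pow_n q_pow_less])
    show "?B * 0\<^sub>m (?d * ?e) (?d * ?e) + ?W * ?A = \<chi> g \<cdot>\<^sub>m (?A * ?W + 0\<^sub>m (?d * ?e) (?d * ?e) * ?B)"
      unfolding WA using kc mult_carrier_mat[OF kc(1,3)]
      by (simp only: right_mult_zero_mat[OF kc(2)] left_mult_zero_mat[OF kc(2)]) simp
  qed (use n_ge_2 in auto)
  also have "tw ?A (0\<^sub>m (?d * ?e) (?d * ?e)) n = 0\<^sub>m (?d * ?e) (?d * ?e)" by (rule tw_zero[OF kc(1)])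
  also have "0\<^sub>m (?d * ?e) (?d * ?e) + ?W = ?W" by (rule left_add_zero_mat[OF kc(3)])
  also have "0\<^sub>m (?d * ?e) (?d * ?e) + tw ?B ?W n = tw ?B ?W n"
    by (rule left_add_zero_mat[OF tw_carrier[OF kc(2,3)]])
  also have "tw ?B ?W k = kron (1\<^sub>m ?d) (tw (hY N) Z k)" for k
  proof (induction k)
    case 0
    then show ?case using c by (simp add: kron_zero_right)
  next
    case (Suc k)
    have t: "tw (hY N) Z k \<in> carrier_mat ?e ?e" using c Z by (intro tw_carrier)
    have "tw ?B ?W (Suc k) = kron (1\<^sub>m ?d) (hY N ^\<^sub>m k * Z) + kron (1\<^sub>m ?d) (tw (hY N) Z k * hY N)"
      using c Z t Suc by (simp add: kron_pow[of _ ?d _ ?e] one_pow_mat flip: kron_mult[of _ ?d ?d _ ?d _ ?e ?e _ ?e])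
    also have "\<dots> = kron (1\<^sub>m ?d) (tw (hY N) Z (Suc k))"
      using c Z t by (simp add: kron_add_right)
    finally show ?case .
  qed
  finally have "tw (hY (tensor_mod M N)) ?W n = 1\<^sub>m (?d * ?e)"
    using M fN Z by (simp add: tensor_hY kron_one)
  moreover have "?W * hG (tensor_mod M N) h = \<chi> h \<cdot>\<^sub>m (hG (tensor_mod M N) h * ?W)" if h: "h \<in> carrier G" for h
    using hrepD(2)[OF rM h] hrepD(2)[OF rN h] Z h M fN
    by (simp add: tensor_hG kron_smult_right flip: kron_mult[of _ ?d ?d _ ?d _ ?e ?e _ ?e])
  ultimately show ?thesis using kc M fN by (auto simp: good_mod_def tensor_fdmod)
qed

text \<open>Now Z acts on the first factor, and differentiating y \<otimes> g leaves n - 1 copies of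
  g behind in the second. The witness Z \<otimes> k contains a group element k that absorbs
  them.\<close>

lemma good_tensor_left:
  assumes M: "good_mod M" and fN: "is_fdmod H N"
  shows "good_mod (tensor_mod M N)"
proof -
  let ?d = "mdim M" and ?e = "mdim N"
  from M obtain Z where fM: "is_fdmod H M" and Z: "Z \<in> carrier_mat ?d ?d"
    "\<And>h. h \<in> carrier G \<Longrightarrow> Z * hG M h = \<chi> h \<cdot>\<^sub>m (hG M h * Z)" "tw (hY M) Z n = 1\<^sub>m ?d"
    by (auto simp: good_mod_def)
  note rM = fdmod_hrep[OF fM] and rN = fdmod_hrep[OF fN]
  obtain m where m: "n = Suc m" using n_ge_2 by (cases n) auto
  \<comment> \<open>The choice k = g^(1-n) gives g^(n-1) k = 1. It also has \<chi>(k) = q^(1-n) = q,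
    which is what the q-commutation of 1 \<otimes> y with Z \<otimes> k demands.\<close>
  define k where "k = inv (g [^] m)"
  have k: "k \<in> carrier G" using g_closed by (simp add: k_def)
  have kcomm: "k \<otimes> h = h \<otimes> k" if "h \<in> carrier G" for h
  proof -
    have a: "g [^] m \<in> carrier G" using g_closed by simp
    have "k \<otimes> h = k \<otimes> h \<otimes> (g [^] m \<otimes> k)" using that a k by (simp add: k_def)
    also have "\<dots> = k \<otimes> (h \<otimes> g [^] m) \<otimes> k" using that a k by (simp add: m_assoc)
    also have "\<dots> = k \<otimes> (g [^] m \<otimes> h) \<otimes> k" by (simp only: gn_central[OF that])
    also have "\<dots> = (k \<otimes> g [^] m) \<otimes> (h \<otimes> k)" using that a k by (simp add: m_assoc)
    also have "\<dots> = h \<otimes> k" using that a k by (simp add: k_def)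
    finally show ?thesis .
  qed
  have "\<chi> (g [^] m) * \<chi> k = 1" using k g_closed by (simp add: k_def chi_one flip: chi_mult)
  then have "\<chi> g * (\<chi> g ^ m * \<chi> k) = \<chi> g" by (simp add: chi_pow g_closed)
  then have "\<chi> g ^ m * \<chi> k = 1" using chi_nonzero[OF g_closed] by simp
  moreover have "\<chi> g * \<chi> g ^ m = 1" using q_pow_n by (simp add: m)
  ultimately have chik: "\<chi> k = \<chi> g" by (metis mult.assoc mult.commute mult.right_neutral)
  let ?Q = "hG N k" and ?P = "hG N g"
  note c = hrepD(1)[OF rM] hrepD(1)[OF rN] hrepD(2)[OF rN g_closed] hrepD(2)[OF rN k]
  have PQ: "?P * ?Q = ?Q * ?P" using hrep_central[OF rN k] .
  have PQ1: "?P ^\<^sub>m m * ?Q = 1\<^sub>m ?e"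
    using k g_closed hrepD(4)[OF rN, of "g [^] m" k] hrepD(3)[OF rN] hrep_pow[OF rN g_closed, of m] by (simp add: k_def)
  let ?A = "kron (hY M) ?P" and ?B = "kron (1\<^sub>m ?d) (hY N)" and ?W = "kron Z ?Q"
  have kc: "?A \<in> carrier_mat (?d * ?e) (?d * ?e)" "?B \<in> carrier_mat (?d * ?e) (?d * ?e)"
    "?W \<in> carrier_mat (?d * ?e) (?d * ?e)" using c Z by (auto intro: kron_carrier)
  have BW: "?B * ?W = \<chi> g \<cdot>\<^sub>m (?W * ?B)"
    using c Z by (simp add: hrepD(5)[OF rN k] chik kron_smult_right flip: kron_mult[of _ ?d ?d _ ?d _ ?e ?e _ ?e])
  have "tw (?A + ?B) (?W + 0\<^sub>m (?d * ?e) (?d * ?e)) n = tw ?A ?W n + tw ?B (0\<^sub>m (?d * ?e) (?d * ?e)) n"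
  proof (rule tw_q_add[OF kc(1,2,3) zero_carrier_mat hrep_tensor_q[OF rM rN] _ q_pow_n q_pow_less])
    show "?B * ?W + 0\<^sub>m (?d * ?e) (?d * ?e) * ?A = \<chi> g \<cdot>\<^sub>m (?A * 0\<^sub>m (?d * ?e) (?d * ?e) + ?W * ?B)"
      unfolding BW using mult_carrier_mat[OF kc(3,2)]
      by (simp only: right_mult_zero_mat[OF kc(1)] left_mult_zero_mat[OF kc(1)]) simp
  qed (use n_ge_2 in auto)
  also have "tw ?B (0\<^sub>m (?d * ?e) (?d * ?e)) n = 0\<^sub>m (?d * ?e) (?d * ?e)" by (rule tw_zero[OF kc(2)])
  also have "?W + 0\<^sub>m (?d * ?e) (?d * ?e) = ?W" by (rule right_add_zero_mat[OF kc(3)])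
  also have "tw ?A ?W n + 0\<^sub>m (?d * ?e) (?d * ?e) = tw ?A ?W n"
    by (rule right_add_zero_mat[OF tw_carrier[OF kc(1,3)]])
  also have "tw ?A ?W n = kron (tw (hY M) Z n) (?P ^\<^sub>m m * ?Q)"
    unfolding m by (rule tw_kron[OF c(1) Z(1) c(3,4) PQ])
  finally have "tw (hY (tensor_mod M N)) ?W n = 1\<^sub>m (?d * ?e)"
    using fM fN Z by (simp add: tensor_hY kron_one PQ1)
  moreover have "?W * hG (tensor_mod M N) h = \<chi> h \<cdot>\<^sub>m (hG (tensor_mod M N) h * ?W)" if h: "h \<in> carrier G" for h
  proof -
    have "?Q * hG N h = hG N h * ?Q"
      using kcomm[OF h] hrepD(4)[OF rN k h] hrepD(4)[OF rN h k] by simp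
    then show ?thesis
      using hrepD(2)[OF rM h] hrepD(2)[OF rN h] Z c h fM fN
      by (simp add: tensor_hG kron_smult_left flip: kron_mult[of _ ?d ?d _ ?d _ ?e ?e _ ?e])
  qed
  ultimately show ?thesis using kc fM fN by (auto simp: good_mod_def tensor_fdmod)
qed

text \<open>The compression P Z S is a witness for M: as P and S commute with y, the sum formed with
  it is P \<open>tw (hY N) Z n\<close> S = P S = 1.\<close>

lemma good_summand:
  assumes M: "is_fdmod H M" and N: "good_mod N"
    and S: "S \<in> mod_hom H M N" and P: "P \<in> mod_hom H N M" and PS: "P * S = 1\<^sub>m (mdim M)"
  shows "good_mod M"
proof -
  from N obtain Z where fN: "is_fdmod H N" and Z: "Z \<in> carrier_mat (mdim N) (mdim N)"
    "\<And>h. h \<in> carrier G \<Longrightarrow> Z * hG N h = \<chi> h \<cdot>\<^sub>m (hG N h * Z)" "tw (hY N) Z n = 1\<^sub>m (mdim N)"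
    by (auto simp: good_mod_def)
  note rM = fdmod_hrep[OF M] and rN = fdmod_hrep[OF fN]
  have Sc: "S \<in> carrier_mat (mdim N) (mdim M)" "S * hY M = hY N * S"
    "\<And>h. h \<in> carrier G \<Longrightarrow> S * hG M h = hG N h * S" using S by (auto simp: mod_hom_iff M fN)
  have Pc: "P \<in> carrier_mat (mdim M) (mdim N)" "P * hY N = hY M * P"
    "\<And>h. h \<in> carrier G \<Longrightarrow> P * hG N h = hG M h * P" using P by (auto simp: mod_hom_iff M fN)
  note c = hrepD(1)[OF rM] hrepD(1)[OF rN]
  have pw: "hY M ^\<^sub>m k * P = P * hY N ^\<^sub>m k" for k
  proof (induction k)
    case (Suc k)
    have "hY M ^\<^sub>m Suc k * P = hY M ^\<^sub>m k * (hY M * P)" using c Pc(1) by (simp add: mat_assoc)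
    also have "\<dots> = (hY M ^\<^sub>m k * P) * hY N" using c Pc(1) by (simp add: Pc(2)[symmetric] mat_assoc)
    also have "\<dots> = P * hY N ^\<^sub>m Suc k" unfolding Suc using c Pc(1) by (simp add: mat_assoc)
    finally show ?case .
  qed (use c Pc in simp)
  have t: "tw (hY N) Z k \<in> carrier_mat (mdim N) (mdim N)" for k using c Z by (intro tw_carrier)
  have "tw (hY M) (P * Z * S) k = P * tw (hY N) Z k * S" for k
  proof (induction k)
    case 0
    then show ?case using c Pc(1) Sc(1) by simp
  next
    case (Suc k)
    have "tw (hY M) (P * Z * S) (Suc k) = hY M ^\<^sub>m k * (P * Z * S) + P * tw (hY N) Z k * S * hY M"
      by (simp add: Suc)
    also have "hY M ^\<^sub>m k * (P * Z * S) = (hY M ^\<^sub>m k * P) * (Z * S)"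
      using c Pc(1) Sc(1) Z(1) by (simp add: mat_assoc)
    also have "\<dots> = P * (hY N ^\<^sub>m k * Z) * S" unfolding pw using c Pc(1) Sc(1) Z(1) by (simp add: mat_assoc)
    also have "P * tw (hY N) Z k * S * hY M = P * tw (hY N) Z k * (S * hY M)"
      using c Pc(1) Sc(1) t[of k] by (simp add: mat_assoc)
    also have "\<dots> = P * (tw (hY N) Z k * hY N) * S"
      unfolding Sc(2) using c Pc(1) Sc(1) t[of k] by (simp add: mat_assoc)
    also have "P * (hY N ^\<^sub>m k * Z) * S + P * (tw (hY N) Z k * hY N) * S = P * tw (hY N) Z (Suc k) * S"
      using c Pc(1) Sc(1) t[of k] Z(1) by (simp add: mat_mult_add_left mat_mult_add_right)
    finally show ?case .
  qed
  then have "tw (hY M) (P * Z * S) n = 1\<^sub>m (mdim M)" using Z Pc(1) Sc(1) PS by simp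
  moreover have "P * Z * S * hG M h = \<chi> h \<cdot>\<^sub>m (hG M h * (P * Z * S))" if h: "h \<in> carrier G" for h
  proof -
    note ch = hrepD(2)[OF rM h] hrepD(2)[OF rN h]
    have "P * Z * S * hG M h = P * Z * (S * hG M h)" using ch Pc(1) Sc(1) Z(1) by (simp add: mat_assoc)
    also have "\<dots> = P * (Z * hG N h) * S" unfolding Sc(3)[OF h] using ch Pc(1) Sc(1) Z(1) by (simp add: mat_assoc)
    also have "\<dots> = \<chi> h \<cdot>\<^sub>m ((P * hG N h) * Z * S)"
      unfolding Z(2)[OF h] using ch Pc(1) Sc(1) Z(1) by (simp add: mat_assoc mat_smult_left mat_smult_right)
    also have "\<dots> = \<chi> h \<cdot>\<^sub>m (hG M h * (P * Z * S))"
      unfolding Pc(3)[OF h] using ch Pc(1) Sc(1) Z(1) by (simp add: mat_assoc)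
    finally show ?thesis .
  qed
  moreover have "P * Z * S \<in> carrier_mat (mdim M) (mdim M)" using Pc(1) Sc(1) Z(1) by auto
  ultimately show ?thesis using M by (auto simp: good_mod_def)
qed

end

lemma det_pow_mat:
  fixes A :: "'a::comm_ring_1 mat"
  assumes A: "A \<in> carrier_mat d d"
  shows "det (A ^\<^sub>m k) = det A ^ k"
proof (induction k)
  case (Suc k)
  then show ?case using det_mult[of "A ^\<^sub>m k" d A] A by simp
qed (use A in simp)

text \<open>det(Y)^m is the determinant of the zero matrix, which is 0 because d > 0.\<close>

lemma nilpotent_kernel:
  fixes Y :: "complex mat"
  assumes Y: "Y \<in> carrier_mat d d" and d: "0 < d" and nil: "Y ^\<^sub>m m = 0\<^sub>m d d"
  obtains u where "u \<in> carrier_vec d" "u \<noteq> 0\<^sub>v d" "Y *\<^sub>v u = 0\<^sub>v d"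
proof -
  have "det (0\<^sub>m d d :: complex mat) = 0"
    using d det_0_iff_vec_prod_zero[of "0\<^sub>m d d :: complex mat" d]
    by (auto intro!: exI[of _ "unit_vec d 0"] eq_vecI)
  then have "det Y ^ m = 0" using nil det_pow_mat[OF Y, of m] by simp
  then show ?thesis using that det_0_iff_vec_prod_zero[OF Y] by auto
qed

context non_nilpotent_group_datum
begin

section \<open>The modules \<open>M(k)\<close> built on the trivial representation\<close>

definition kY :: "nat \<Rightarrow> complex mat" where
  "kY k = mat k k (\<lambda>(r, c). of_bool (r = c + 1))"

definition kG_rep :: "nat \<Rightarrow> 'a \<Rightarrow> complex mat" where
  "kG_rep k h = mat k k (\<lambda>(r, c). if r = c then inverse (\<chi> h) ^ c else 0)"

definition kmod :: "nat \<Rightarrow> (nat \<times> 'a \<Rightarrow> complex) fdmod" where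
  "kmod k = rep_mod k (kY k) (kG_rep k)"

lemma kY_carrier [simp]: "kY k \<in> carrier_mat k k" "dim_row (kY k) = k" "dim_col (kY k) = k"
  by (simp_all add: kY_def)

lemma kG_carrier [simp]: "kG_rep k h \<in> carrier_mat k k" "dim_row (kG_rep k h) = k" "dim_col (kG_rep k h) = k"
  by (simp_all add: kG_rep_def)

lemma kY_index: "r < k \<Longrightarrow> c < k \<Longrightarrow> kY k $$ (r, c) = of_bool (r = c + 1)"
  by (simp add: kY_def)

lemma kG_index: "r < k \<Longrightarrow> c < k \<Longrightarrow> kG_rep k h $$ (r, c) = (if r = c then inverse (\<chi> h) ^ c else 0)"
  by (simp add: kG_rep_def)

lemma mult_kY_index:
  assumes "A \<in> carrier_mat m k" "r < m" "c < k"
  shows "(A * kY k) $$ (r, c) = (if c + 1 < k then A $$ (r, c + 1) else 0)"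
proof -
  have "(A * kY k) $$ (r, c) = (\<Sum>l<k. if l = c + 1 then A $$ (r, l) else 0)"
    using assms by (subst mult_mat_index) (auto simp: kY_index intro!: sum.cong)
  then show ?thesis by simp
qed

lemma kY_mult_index:
  assumes "A \<in> carrier_mat k m" "r < k" "c < m"
  shows "(kY k * A) $$ (r, c) = (if r = 0 then 0 else A $$ (r - 1, c))"
proof -
  have "(kY k * A) $$ (r, c) = (\<Sum>l<k. kY k $$ (r, l) * A $$ (l, c))"
    using assms by (subst mult_mat_index) simp_all
  also have "\<dots> = (\<Sum>l<k. if l = r - 1 then (if r = 0 then 0 else A $$ (l, c)) else 0)"
    using assms by (intro sum.cong refl) (auto simp: kY_index)
  finally show ?thesis using assms by (simp only: sum.delta finite_lessThan) auto
qed

lemma kY_mult_vec_index: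
  assumes "v \<in> carrier_vec k" "r < k"
  shows "(kY k *\<^sub>v v) $ r = (if r = 0 then 0 else v $ (r - 1))"
proof -
  have "(kY k *\<^sub>v v) $ r = (\<Sum>l<k. kY k $$ (r, l) * v $ l)"
    using assms by (simp add: scalar_prod_def atLeast0LessThan)
  also have "\<dots> = (\<Sum>l<k. if l = r - 1 then (if r = 0 then 0 else v $ l) else 0)"
    using assms by (intro sum.cong refl) (auto simp: kY_index)
  finally show ?thesis using assms by (simp only: sum.delta finite_lessThan) auto
qed

lemma mult_kG_index:
  assumes "A \<in> carrier_mat m k" "r < m" "c < k"
  shows "(A * kG_rep k h) $$ (r, c) = A $$ (r, c) * inverse (\<chi> h) ^ c"
proof -
  have "(A * kG_rep k h) $$ (r, c) = (\<Sum>l<k. A $$ (r, l) * kG_rep k h $$ (l, c))"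
    using assms by (subst mult_mat_index) simp_all
  also have "\<dots> = (\<Sum>l<k. if l = c then A $$ (r, l) * inverse (\<chi> h) ^ l else 0)"
    using assms by (intro sum.cong refl) (auto simp: kG_index)
  finally show ?thesis using assms by (simp only: sum.delta finite_lessThan) auto
qed

lemma kG_mult_index:
  assumes "A \<in> carrier_mat k m" "r < k" "c < m"
  shows "(kG_rep k h * A) $$ (r, c) = inverse (\<chi> h) ^ r * A $$ (r, c)"
proof -
  have "(kG_rep k h * A) $$ (r, c) = (\<Sum>l<k. kG_rep k h $$ (r, l) * A $$ (l, c))"
    using assms by (subst mult_mat_index) simp_all
  also have "\<dots> = (\<Sum>l<k. if l = r then inverse (\<chi> h) ^ l * A $$ (l, c) else 0)"
    using assms by (intro sum.cong refl) (auto simp: kG_index)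
  finally show ?thesis using assms by (simp only: sum.delta finite_lessThan) auto
qed

lemma kY_pow_index:
  "r < k \<Longrightarrow> c < k \<Longrightarrow> (kY k ^\<^sub>m s) $$ (r, c) = of_bool (r = c + s)"
proof (induction s arbitrary: r c)
  case (Suc s)
  have "(kY k ^\<^sub>m Suc s) $$ (r, c) = (if c + 1 < k then (kY k ^\<^sub>m s) $$ (r, c + 1) else 0)"
    using Suc.prems by (simp add: mult_kY_index[of _ k] del: index_mult_mat(1))
  then show ?case using Suc by auto
qed auto

text \<open>The bound k \<le> n gives Y^n = 0, in agreement with g^n acting on the c-th basis vector
  by \<chi>(g^n)^(-c) = 1.\<close>

lemma khrep:
  assumes "k \<le> n"
  shows "hrep k (kY k) (kG_rep k)"
  unfolding hrep_def
proof (intro conjI ballI)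
  show "kG_rep k (h \<otimes> l) = kG_rep k h * kG_rep k l" if "h \<in> carrier G" "l \<in> carrier G" for h l
    using that by (intro eq_matI) (auto simp: mult_kG_index[of _ k] kG_index chi_mult power_mult_distrib
        simp del: index_mult_mat(1))
  show "kY k * kG_rep k h = \<chi> h \<cdot>\<^sub>m (kG_rep k h * kY k)" if h: "h \<in> carrier G" for h
    using chi_nonzero[OF h]
    by (intro eq_matI) (auto simp: mult_kG_index[of _ k] kG_mult_index[of _ k k] kY_index simp del: index_mult_mat(1))
  show "kY k ^\<^sub>m n + 1\<^sub>m k = kG_rep k (g [^] n)"
    using assms by (intro eq_matI) (auto simp: kY_pow_index kG_index chi_gn)
  show "kG_rep k \<one> = 1\<^sub>m k" by (intro eq_matI) (auto simp: kG_index chi_one)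
qed auto

lemma kmod_fdmod: "k \<le> n \<Longrightarrow> is_fdmod H (kmod k)"
  by (simp add: kmod_def rep_mod_fdmod khrep)

lemma kmod_mdim [simp]: "mdim (kmod k) = k"
  by (simp add: kmod_def)

lemma kmod_hY: "k \<le> n \<Longrightarrow> hY (kmod k) = kY k"
  by (simp add: kmod_def rep_mod_hY khrep)

lemma kmod_hG: "k \<le> n \<Longrightarrow> h \<in> carrier G \<Longrightarrow> hG (kmod k) h = kG_rep k h"
  by (simp add: kmod_def rep_mod_hG khrep)

lemma kmod_good: "good_mod (kmod n)"
proof -
  \<comment> \<open>Z returns the end e_(n-1) of the chain to its start e_0. Then y^(n-1-s) Z y^s is
    the diagonal matrix unit at position n - 1 - s, and these sum to 1.\<close>
  define Z :: "complex mat" where "Z = mat n n (\<lambda>(r, c). of_bool (r = 0 \<and> c = n - 1))"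
  have Zc: "Z \<in> carrier_mat n n" by (simp add: Z_def)
  have Zi: "Z $$ (r, c) = of_bool (r = 0 \<and> c = n - 1)" if "r < n" "c < n" for r c
    using that by (simp add: Z_def)
  \<comment> \<open>Comparing the only entry of Z on both sides asks for \<chi>(h)^(1-n) =
    \<chi>(h), which is \<chi>^n = 1.\<close>
  have "Z * kG_rep n h = \<chi> h \<cdot>\<^sub>m (kG_rep n h * Z)" if h: "h \<in> carrier G" for h
  proof -
    obtain m where m: "n = Suc m" using n_ge_2 by (cases n) auto
    have "\<chi> h * \<chi> h ^ m = 1" using chi_pow_n[OF h] by (simp add: m)
    then have "inverse (\<chi> h) ^ (n - Suc 0) = \<chi> h" using chi_nonzero[OF h]
      by (simp add: m power_inverse field_simps)
    then show ?thesis using Zc by (intro eq_matI)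
        (auto simp: mult_kG_index[of _ n] kG_mult_index[of _ n n] Zi simp del: index_mult_mat(1))
  qed
  \<comment> \<open>For m \<le> n the first m summands have ones exactly where column minus row is n
    - m and the row is below m. At m = n this is the diagonal.\<close>
  moreover have "tw (kY n) Z m $$ (r, c) = of_bool (r < m \<and> c + m = n + r)" if "r < n" "c < n" for r c m
    using that
  proof (induction m arbitrary: r c)
    case (Suc m)
    have t: "tw (kY n) Z m \<in> carrier_mat n n" by (intro tw_carrier kY_carrier Zc)
    have "(kY n ^\<^sub>m m * Z) $$ (r, c) = of_bool (r = m \<and> c = n - 1)"
    proof -
      have "(kY n ^\<^sub>m m * Z) $$ (r, c) = (\<Sum>l<n. if l = 0 then of_bool (r = m \<and> c = n - 1) else 0)"
        using Suc.prems Zc by (subst mult_mat_index) (auto simp: kY_pow_index Zi intro!: sum.cong)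
      then show ?thesis using n_ge_2 by simp
    qed
    moreover have "(tw (kY n) Z m * kY n) $$ (r, c) = of_bool (c + 1 < n \<and> r < m \<and> c + 1 + m = n + r)"
      using Suc t by (auto simp: mult_kY_index[of _ n] simp del: index_mult_mat(1))
    moreover have "tw (kY n) Z (Suc m) $$ (r, c) = (kY n ^\<^sub>m m * Z) $$ (r, c) + (tw (kY n) Z m * kY n) $$ (r, c)"
      using Suc.prems t Zc by (simp del: index_mult_mat(1))
    ultimately show ?case using Suc.prems by auto
  qed auto
  then have "tw (kY n) Z n = 1\<^sub>m n"
    using tw_carrier[OF kY_carrier(1) Zc, of n] by (intro eq_matI) auto
  ultimately show ?thesis
    unfolding good_mod_def using Zc by (auto simp: kmod_fdmod kmod_hY kmod_hG)
qed

text \<open>The map from M(n) onto its top M(1) makes P a quotient of P \<otimes> M(n), which is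
  good. Projectivity splits this quotient map, and goodness passes to summands.\<close>

lemma projective_good:
  assumes P: "projective_mod H P"
  shows "good_mod P"
proof -
  have f: "is_fdmod H P" using P by (simp add: projective_mod_def)
  let ?d = "mdim P" and ?N = "tensor_mod P (kmod n)"
  have fN: "is_fdmod H ?N" using f by (simp add: tensor_fdmod kmod_fdmod)
  define E where "E = (mat 1 n (\<lambda>(r, c). of_bool (c = 0)) :: complex mat)"
  define E' where "E' = (mat n 1 (\<lambda>(r, c). of_bool (r = 0)) :: complex mat)"
  have Ec: "E \<in> carrier_mat 1 n" "E' \<in> carrier_mat n 1" by (simp_all add: E_def E'_def)
  note r = fdmod_hrep[OF f]
  have EG: "E * kG_rep n h = E" for h
    by (intro eq_matI) (use Ec in \<open>auto simp: mult_kG_index[of _ 1] E_def simp del: index_mult_mat(1) intro!: gr0I\<close>)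
  have EY: "E * kY n = 0\<^sub>m 1 n"
    by (intro eq_matI) (use Ec in \<open>auto simp: mult_kY_index[of _ 1] E_def simp del: index_mult_mat(1)\<close>)
  have EE: "E * E' = 1\<^sub>m 1"
    using n_ge_2 by (intro eq_matI) (auto simp: E_def E'_def scalar_prod_def intro!: sum.neutral)
  let ?T = "kron (1\<^sub>m ?d) E" and ?S = "kron (1\<^sub>m ?d) E'"
  have Tc: "?T \<in> carrier_mat ?d (?d * n)" "?S \<in> carrier_mat (?d * n) ?d"
    using kron_carrier[OF one_carrier_mat Ec(1)] kron_carrier[OF one_carrier_mat Ec(2)] by simp_all
  have TX: "?T * kron X Y = kron X (E * Y)" if "X \<in> carrier_mat ?d ?d" "Y \<in> carrier_mat n n" for X Y
    using that Ec kron_mult[of "1\<^sub>m ?d" ?d ?d X ?d E 1 n Y n] by simp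
  have XT: "X * ?T = kron X E" if "X \<in> carrier_mat ?d ?d" for X
    using that Ec kron_mult[of X ?d ?d "1\<^sub>m ?d" ?d "1\<^sub>m 1" 1 1 E n]
    by (simp add: kron_one_right(2))
  have "?T \<in> mod_hom H ?N P"
    unfolding mod_hom_iff[OF fN f]
  proof (intro conjI ballI)
    have k: "kron (hY P) (kG_rep n g) \<in> carrier_mat (?d * n) (?d * n)" "kron (1\<^sub>m ?d) (kY n) \<in> carrier_mat (?d * n) (?d * n)"
      using hrepD(1)[OF r] by (auto intro!: kron_carrier)
    have "?T * hY ?N = ?T * kron (hY P) (kG_rep n g) + ?T * kron (1\<^sub>m ?d) (kY n)"
      using f g_closed mult_add_distrib_mat[OF Tc(1) k] by (simp add: tensor_hY kmod_fdmod kmod_hY kmod_hG)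
    also have "\<dots> = kron (hY P) E + 0\<^sub>m ?d (?d * n)"
      using hrepD(1)[OF r] by (simp add: TX EG EY kron_zero_right)
    also have "\<dots> = hY P * ?T"
      using hrepD(1)[OF r] Ec kron_carrier[OF hrepD(1)[OF r] Ec(1)] by (simp add: XT)
    finally show "?T * hY ?N = hY P * ?T" .
    show "?T * hG ?N h = hG P h * ?T" if h: "h \<in> carrier G" for h
      using f h hrepD(2)[OF r h] by (simp add: tensor_hG kmod_fdmod kmod_hG TX EG XT)
  qed (use Tc in simp)
  moreover have "surj_hom ?N P ?T"
  proof -
    have TS: "?T * ?S = 1\<^sub>m ?d"
      using kron_mult[of "1\<^sub>m ?d" ?d ?d "1\<^sub>m ?d" ?d E 1 n E' 1] Ec by (simp add: EE kron_one)
    have "v \<in> (\<lambda>v. ?T *\<^sub>v v) ` carrier_vec (?d * n)" if v: "v \<in> carrier_vec ?d" for v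
    proof (rule image_eqI)
      show "v = ?T *\<^sub>v (?S *\<^sub>v v)" using v Tc TS by (simp flip: assoc_mult_mat_vec)
      show "?S *\<^sub>v v \<in> carrier_vec (?d * n)" using v Tc by simp
    qed
    then show ?thesis using Tc by (auto simp: surj_hom_def intro!: mult_mat_vec_carrier)
  qed
  moreover have "1\<^sub>m ?d \<in> mod_hom H P P" using hrep_dim[OF r] by (simp add: mod_hom_iff f)
  ultimately obtain k where "k \<in> mod_hom H P ?N" "?T * k = 1\<^sub>m ?d"
    using P fN f unfolding projective_mod_def by blast
  then show ?thesis
    using good_summand[OF f good_tensor_right[OF f kmod_good]] \<open>?T \<in> mod_hom H ?N P\<close> by blast
qed

end

lemma mat_vec_assoc:
  fixes A :: "'a::semiring_0 mat"
  assumes "dim_col A = dim_row B" "dim_vec v = dim_col B"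
  shows "(A * B) *\<^sub>v v = A *\<^sub>v (B *\<^sub>v v)"
  using assms by (intro assoc_mult_mat_vec[of _ "dim_row A" "dim_row B" _ "dim_col B"]) (auto intro: carrier_vecI)

lemma mult_zero_vec:
  fixes A :: "'a::semiring_0 mat"
  shows "dim_col A = d \<Longrightarrow> A *\<^sub>v 0\<^sub>v d = 0\<^sub>v (dim_row A)"
  by (intro eq_vecI) (auto simp: scalar_prod_def)

lemma mult_unit_vec_index:
  fixes A :: "'a::semiring_1 mat"
  shows "A \<in> carrier_mat m k \<Longrightarrow> r < m \<Longrightarrow> c < k \<Longrightarrow> (A *\<^sub>v unit_vec k c) $ r = A $$ (r, c)"
  by (simp add: scalar_prod_right_unit[of c k])

context non_nilpotent_group_datum
begin

lemma kY_pow_unit: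
  assumes "c < k"
  shows "kY k ^\<^sub>m c *\<^sub>v unit_vec k 0 = unit_vec k c"
proof (rule eq_vecI)
  fix r assume "r < dim_vec (unit_vec k c :: complex vec)"
  then have r: "r < k" by simp
  have "(kY k ^\<^sub>m c *\<^sub>v unit_vec k 0) $ r = (kY k ^\<^sub>m c) $$ (r, 0)"
    using r assms by (intro mult_unit_vec_index[of _ k]) auto
  then show "(kY k ^\<^sub>m c *\<^sub>v unit_vec k 0) $ r = (unit_vec k c :: complex vec) $ r"
    using r assms by (simp add: kY_pow_index)
qed simp

lemma kY_kernel:
  assumes v: "v \<in> carrier_vec (Suc m)" and z: "kY (Suc m) *\<^sub>v v = 0\<^sub>v (Suc m)"
  shows "v = v $ m \<cdot>\<^sub>v unit_vec (Suc m) m"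
proof (rule eq_vecI)
  fix i assume "i < dim_vec (v $ m \<cdot>\<^sub>v unit_vec (Suc m) m)"
  then have i: "i < Suc m" by simp
  show "v $ i = (v $ m \<cdot>\<^sub>v unit_vec (Suc m) m) $ i"
  proof (cases "i = m")
    case False
    then have "(kY (Suc m) *\<^sub>v v) $ Suc i = v $ i" using i v kY_mult_vec_index[OF v, of "Suc i"] by simp
    then show ?thesis using False i z by simp
  qed simp
qed (use v in simp)

text \<open>The kernel of y on M(n) is a line. In a decomposition into two nonzero summands y would
  be nilpotent on each and would have a kernel vector in each.\<close>

lemma kmod_indecomposable: "indecomposable_mod H (kmod n)"
  unfolding indecomposable_mod_def
proof (intro conjI allI impI)
  obtain m where m: "n = Suc m" using n_ge_2 by (cases n) auto
  show fn: "is_fdmod H (kmod n)" by (simp add: kmod_fdmod)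
  show "0 < mdim (kmod n)" using n_ge_2 by simp
  fix K L assume f: "is_fdmod H K" "is_fdmod H L" and i: "mod_iso H (kmod n) (dsum K L)"
  have fd: "is_fdmod H (dsum K L)" using f by (rule dsum_fdmod)
  obtain T S where TS: "T \<in> carrier_mat (mdim K + mdim L) n" "S \<in> carrier_mat n (mdim K + mdim L)"
    "S * T = 1\<^sub>m n" "T * S = 1\<^sub>m (mdim K + mdim L)" "T * kY n = hY (dsum K L) * T" "S * hY (dsum K L) = kY n * S"
    using mod_isoE[OF i fn fd] by (metis dsum_mdim kmod_mdim kmod_hY order_refl)
  have cK: "hY K \<in> carrier_mat (mdim K) (mdim K)" "hY L \<in> carrier_mat (mdim L) (mdim L)"
    using hrepD(1)[OF fdmod_hrep] f by auto
  have Y: "hY (dsum K L) = diag_block (hY K) (hY L)" using f by (simp add: dsum_hY)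
  have Yc: "hY (dsum K L) \<in> carrier_mat (mdim K + mdim L) (mdim K + mdim L)"
    using hrepD(1)[OF fdmod_hrep[OF fd]] by simp
  have pw: "hY (dsum K L) ^\<^sub>m k * T = T * kY n ^\<^sub>m k" for k
  proof (induction k)
    case (Suc k)
    have "hY (dsum K L) ^\<^sub>m Suc k * T = hY (dsum K L) ^\<^sub>m k * (hY (dsum K L) * T)"
      using TS(1) Yc by (simp add: mat_assoc)
    also have "\<dots> = (hY (dsum K L) ^\<^sub>m k * T) * kY n"
      unfolding TS(5)[symmetric] using TS(1) Yc by (simp add: mat_assoc)
    also have "\<dots> = T * kY n ^\<^sub>m Suc k" unfolding Suc using TS(1) by (simp add: mat_assoc)
    finally show ?case .
  qed (use TS Yc in simp)
  have nilp: "kY n ^\<^sub>m n = 0\<^sub>m n n" by (intro eq_matI) (auto simp: kY_pow_index)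
  have "hY (dsum K L) ^\<^sub>m n = hY (dsum K L) ^\<^sub>m n * (T * S)" using Yc TS(4) by simp
  also have "\<dots> = (hY (dsum K L) ^\<^sub>m n * T) * S" using Yc TS(1,2) by (simp add: mat_assoc)
  also have "\<dots> = 0\<^sub>m (mdim K + mdim L) (mdim K + mdim L)"
    unfolding pw nilp using TS(1,2) by (simp add: right_mult_zero_mat left_mult_zero_mat)
  finally have dn: "diag_block (hY K) (hY L) ^\<^sub>m n = 0\<^sub>m (mdim K + mdim L) (mdim K + mdim L)" unfolding Y .
  have dn': "diag_block (hY K ^\<^sub>m n) (hY L ^\<^sub>m n) = 0\<^sub>m (mdim K + mdim L) (mdim K + mdim L)"
    using pow_four_block_mat[OF cK, of n] dn cK n_ge_2 by simp
  have nK: "hY K ^\<^sub>m n = 0\<^sub>m (mdim K) (mdim K)" "hY L ^\<^sub>m n = 0\<^sub>m (mdim L) (mdim L)"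
  proof -
    show "hY K ^\<^sub>m n = 0\<^sub>m (mdim K) (mdim K)"
    proof (rule eq_matI)
      fix i j assume "i < dim_row (0\<^sub>m (mdim K) (mdim K) :: complex mat)" "j < dim_col (0\<^sub>m (mdim K) (mdim K) :: complex mat)"
      then show "(hY K ^\<^sub>m n) $$ (i, j) = 0\<^sub>m (mdim K) (mdim K) $$ (i, j)"
        using arg_cong[OF dn', of "\<lambda>A. A $$ (i, j)"] cK n_ge_2 by simp
    qed (use cK in auto)
    show "hY L ^\<^sub>m n = 0\<^sub>m (mdim L) (mdim L)"
    proof (rule eq_matI)
      fix i j assume "i < dim_row (0\<^sub>m (mdim L) (mdim L) :: complex mat)" "j < dim_col (0\<^sub>m (mdim L) (mdim L) :: complex mat)"
      then show "(hY L ^\<^sub>m n) $$ (i, j) = 0\<^sub>m (mdim L) (mdim L) $$ (i, j)"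
        using arg_cong[OF dn', of "\<lambda>A. A $$ (i + mdim K, j + mdim K)"] cK n_ge_2 by simp
    qed (use cK in auto)
  qed
  show "mdim K = 0 \<or> mdim L = 0"
  proof (rule ccontr)
    assume "\<not> (mdim K = 0 \<or> mdim L = 0)"
    then obtain u w where u: "u \<in> carrier_vec (mdim K)" "u \<noteq> 0\<^sub>v (mdim K)" "hY K *\<^sub>v u = 0\<^sub>v (mdim K)"
      and w: "w \<in> carrier_vec (mdim L)" "w \<noteq> 0\<^sub>v (mdim L)" "hY L *\<^sub>v w = 0\<^sub>v (mdim L)"
      using nilpotent_kernel[OF cK(1) _ nK(1)] nilpotent_kernel[OF cK(2) _ nK(2)] by (metis gr0I)
    define u' where "u' = u @\<^sub>v 0\<^sub>v (mdim L)"
    define w' where "w' = 0\<^sub>v (mdim K) @\<^sub>v w"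
    have c: "u' \<in> carrier_vec (mdim K + mdim L)" "w' \<in> carrier_vec (mdim K + mdim L)"
      using u w by (auto simp: u'_def w'_def)
    have z: "hY (dsum K L) *\<^sub>v u' = 0\<^sub>v (mdim K + mdim L)" "hY (dsum K L) *\<^sub>v w' = 0\<^sub>v (mdim K + mdim L)"
      unfolding Y u'_def w'_def using u w cK
      by (auto simp: four_block_mat_mult_vec[of _ "mdim K" "mdim K" _ "mdim L" _ "mdim L"] mult_zero_vec
          intro!: eq_vecI)
    have ker: "S *\<^sub>v v = (S *\<^sub>v v) $ m \<cdot>\<^sub>v unit_vec n m"
      if "v \<in> carrier_vec (mdim K + mdim L)" "hY (dsum K L) *\<^sub>v v = 0\<^sub>v (mdim K + mdim L)" for v
    proof -
      have "kY n *\<^sub>v (S *\<^sub>v v) = (kY n * S) *\<^sub>v v"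
        using that TS(2) by (simp add: mat_vec_assoc)
      also have "\<dots> = S *\<^sub>v (hY (dsum K L) *\<^sub>v v)"
        unfolding TS(6)[symmetric] using that TS(2) Yc by (intro assoc_mult_mat_vec) auto
      also have "\<dots> = 0\<^sub>v n" using that TS(2) by (auto intro!: eq_vecI)
      finally show ?thesis using kY_kernel[of "S *\<^sub>v v" m] that TS(2) m by simp
    qed
    define \<alpha> where "\<alpha> = (S *\<^sub>v u') $ m"
    define \<beta> where "\<beta> = (S *\<^sub>v w') $ m"
    have e: "S *\<^sub>v u' = \<alpha> \<cdot>\<^sub>v unit_vec n m" "S *\<^sub>v w' = \<beta> \<cdot>\<^sub>v unit_vec n m"
      unfolding \<alpha>_def \<beta>_def using ker c z by auto
    have bk: "v = T *\<^sub>v (S *\<^sub>v v)" if v: "v \<in> carrier_vec (mdim K + mdim L)" for v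
    proof -
      have "T *\<^sub>v (S *\<^sub>v v) = (T * S) *\<^sub>v v" using TS(1,2) v by (simp add: mat_vec_assoc)
      then show ?thesis using v TS(4) by simp
    qed
    \<comment> \<open>The images under S of the two kernel vectors are multiples of the last basis
      vector. Cross-multiplying gives a linear relation between \<open>u'\<close> and
      \<open>w'\<close>, although these live in complementary blocks.\<close>
    have "S *\<^sub>v (\<beta> \<cdot>\<^sub>v u') = S *\<^sub>v (\<alpha> \<cdot>\<^sub>v w')"
      using c TS(2) e by (simp add: mult_mat_vec smult_smult_assoc mult.commute)
    then have eq: "\<beta> \<cdot>\<^sub>v u' = \<alpha> \<cdot>\<^sub>v w'"
      using bk[of "\<beta> \<cdot>\<^sub>v u'"] bk[of "\<alpha> \<cdot>\<^sub>v w'"] c by simp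
    have "\<beta> * u $ i = 0" if "i < mdim K" for i
      using arg_cong[OF eq, of "\<lambda>v. v $ i"] that u w by (simp add: u'_def w'_def)
    moreover obtain i where "i < mdim K" "u $ i \<noteq> 0" using u by (metis carrier_vecD eq_vecI index_zero_vec)
    ultimately have "\<beta> = 0" by auto
    then have "S *\<^sub>v w' = 0\<^sub>v n" using e by (auto intro!: eq_vecI)
    then have wz: "w' = 0\<^sub>v (mdim K + mdim L)" using bk[OF c(2)] TS(1) by (auto intro!: eq_vecI)
    have "w $ i = 0" if "i < mdim L" for i
    proof -
      have "w $ i = w' $ (i + mdim K)" using that w by (simp add: w'_def)
      then show ?thesis using that by (simp add: wz)
    qed
    then show False using w by (metis carrier_vecD eq_vecI index_zero_vec)
  qed
qed

definition grp_avg :: "nat \<Rightarrow> ('a \<Rightarrow> complex mat) \<Rightarrow> complex mat" where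
  "grp_avg d \<rho> = lin d d (carrier G) (\<lambda>_. 1 / of_nat (card (carrier G))) \<rho>"

lemma card_G_pos: "card (carrier G) > 0"
  using finite_G one_closed by (auto simp: card_gt_0_iff)

lemma bij_mult_left: "h \<in> carrier G \<Longrightarrow> bij_betw (\<lambda>k. h \<otimes> k) (carrier G) (carrier G)"
  by (rule bij_betwI[of _ _ _ "\<lambda>k. inv h \<otimes> k"]) (auto simp: m_assoc[symmetric])

lemma lin_grp_shift:
  assumes "h \<in> carrier G"
  shows "lin a b (carrier G) (\<lambda>_. c) (\<lambda>k. X (h \<otimes> k)) = lin a b (carrier G) (\<lambda>_. c) X"
  by (intro eq_matI) (auto simp: sum.reindex_bij_betw[OF bij_mult_left[OF assms], of "\<lambda>k. c * X k $$ (_, _)"])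

text \<open>M(n) is induced from the trivial representation of G: a map out of it is the same as a
  G-fixed vector, the image of e_0. Fixed vectors lift along surjections by averaging over
  G.\<close>

lemma kmod_projective: "projective_mod H (kmod n)"
  unfolding projective_mod_def
proof (intro conjI allI impI ballI)
  show fn: "is_fdmod H (kmod n)" by (simp add: kmod_fdmod)
  fix A B f h assume fA: "is_fdmod H A" and fB: "is_fdmod H B" and f: "f \<in> mod_hom H A B"
    and s: "surj_hom A B f" and h: "h \<in> mod_hom H (kmod n) B"
  note rA = fdmod_hrep[OF fA] and rB = fdmod_hrep[OF fB]
  note cA = hrepD(1,2)[OF rA] and cB = hrepD(1,2)[OF rB]
  have fc: "f \<in> carrier_mat (mdim B) (mdim A)" "f * hY A = hY B * f" "\<And>k. k \<in> carrier G \<Longrightarrow> f * hG A k = hG B k * f"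
    using f by (auto simp: mod_hom_iff fA fB)
  have hc: "h \<in> carrier_mat (mdim B) n" "h * kY n = hY B * h" "\<And>k. k \<in> carrier G \<Longrightarrow> h * kG_rep n k = hG B k * h"
    using h by (auto simp: mod_hom_iff fn fB kmod_hY kmod_hG)
  define e :: "complex vec" where "e = unit_vec n 0"
  define b where "b = h *\<^sub>v e"
  have ec: "e \<in> carrier_vec n" "b \<in> carrier_vec (mdim B)" using hc by (auto simp: e_def b_def)
  obtain a0 where a0: "a0 \<in> carrier_vec (mdim A)" "f *\<^sub>v a0 = b"
  proof -
    have "b \<in> (\<lambda>v. f *\<^sub>v v) ` carrier_vec (mdim A)" using s ec by (simp add: surj_hom_def)
    then show ?thesis using that by blast
  qed
  have be: "hG B k *\<^sub>v b = b" if k: "k \<in> carrier G" for k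
  proof -
    have "kG_rep n k *\<^sub>v e = e"
      using n_ge_2 by (intro eq_vecI) (auto simp: e_def mult_unit_vec_index[of _ n n] kG_index simp del: index_mult_mat_vec)
    then have "(h * kG_rep n k) *\<^sub>v e = b" using hc ec by (simp add: mat_vec_assoc b_def)
    then show ?thesis unfolding hc(3)[OF k] using cB(2)[OF k] hc(1) ec by (simp add: mat_vec_assoc b_def)
  qed
  let ?w = "1 / of_nat (card (carrier G)) :: complex"
  define a where "a = grp_avg (mdim A) (hG A) *\<^sub>v a0"
  have ac: "a \<in> carrier_vec (mdim A)" unfolding a_def grp_avg_def by (rule mult_mat_vec_carrier[OF lin_carrier a0(1)])
  have fa: "f *\<^sub>v a = b"
  proof -
    have "f * grp_avg (mdim A) (hG A) = lin (mdim B) (mdim A) (carrier G) (\<lambda>_. ?w) (\<lambda>k. f * hG A k)"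
      unfolding grp_avg_def using fc cA by (intro mult_lin) auto
    also have "\<dots> = lin (mdim B) (mdim A) (carrier G) (\<lambda>_. ?w) (\<lambda>k. hG B k * f)"
      by (intro lin_cong) (auto simp: fc)
    also have "\<dots> = grp_avg (mdim B) (hG B) * f"
      unfolding grp_avg_def using fc cB by (intro lin_mult[symmetric]) auto
    finally have favg: "f * grp_avg (mdim A) (hG A) = grp_avg (mdim B) (hG B) * f" .
    have "f *\<^sub>v a = (f * grp_avg (mdim A) (hG A)) *\<^sub>v a0"
      using a0(1) fc(1) by (simp add: a_def grp_avg_def mat_vec_assoc)
    also have "\<dots> = grp_avg (mdim B) (hG B) *\<^sub>v b"
      unfolding favg using a0 fc(1) by (simp add: grp_avg_def mat_vec_assoc)
    also have "\<dots> = b"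
    proof (rule eq_vecI)
      fix i assume "i < dim_vec b"
      then have i: "i < mdim B" using ec by auto
      have "(grp_avg (mdim B) (hG B) *\<^sub>v b) $ i = (\<Sum>l<mdim B. (\<Sum>k\<in>carrier G. ?w * hG B k $$ (i, l)) * b $ l)"
        using i ec by (simp add: grp_avg_def scalar_prod_def atLeast0LessThan)
      also have "\<dots> = (\<Sum>k\<in>carrier G. ?w * (\<Sum>l<mdim B. hG B k $$ (i, l) * b $ l))"
        by (simp only: sum_distrib_right sum_distrib_left, subst sum.swap) (simp add: mult_ac)
      also have "\<dots> = (\<Sum>k\<in>carrier G. ?w * (hG B k *\<^sub>v b) $ i)"
      proof (intro sum.cong refl)
        fix k assume k: "k \<in> carrier G"
        show "?w * (\<Sum>l<mdim B. hG B k $$ (i, l) * b $ l) = ?w * (hG B k *\<^sub>v b) $ i"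
          using cB(2)[OF k] i ec by (simp add: scalar_prod_def atLeast0LessThan)
      qed
      also have "\<dots> = b $ i" using card_G_pos by (simp add: be)
      finally show "(grp_avg (mdim B) (hG B) *\<^sub>v b) $ i = b $ i" .
    qed (use ec in \<open>simp add: grp_avg_def\<close>)
    finally show ?thesis .
  qed
  have ae: "hG A k *\<^sub>v a = a" if k: "k \<in> carrier G" for k
  proof -
    have "hG A k * grp_avg (mdim A) (hG A) = lin (mdim A) (mdim A) (carrier G) (\<lambda>_. ?w) (\<lambda>l. hG A k * hG A l)"
      unfolding grp_avg_def using cA k by (intro mult_lin) auto
    also have "\<dots> = lin (mdim A) (mdim A) (carrier G) (\<lambda>_. ?w) (\<lambda>l. hG A (k \<otimes> l))"
      using k by (intro lin_cong) (auto simp: hrepD(4)[OF rA])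
    also have "\<dots> = grp_avg (mdim A) (hG A)" unfolding grp_avg_def by (rule lin_grp_shift[OF k])
    finally have avg: "hG A k * grp_avg (mdim A) (hG A) = grp_avg (mdim A) (hG A)" .
    have "hG A k *\<^sub>v a = (hG A k * grp_avg (mdim A) (hG A)) *\<^sub>v a0"
      using a0(1) cA(2)[OF k] by (simp add: a_def grp_avg_def mat_vec_assoc)
    then show ?thesis unfolding avg a_def .
  qed
  \<comment> \<open>The map sending e_c to y^c a, the only candidate that sends e_0 to a.\<close>
  define K where "K = mat (mdim A) n (\<lambda>(r, c). (hY A ^\<^sub>m c *\<^sub>v a) $ r)"
  have Kc: "K \<in> carrier_mat (mdim A) n" by (simp add: K_def)
  have Ya: "hY A ^\<^sub>m c *\<^sub>v a \<in> carrier_vec (mdim A)" for c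
    by (rule mult_mat_vec_carrier[OF pow_carrier_mat[OF cA(1)] ac])
  have Kcol: "col K c = hY A ^\<^sub>m c *\<^sub>v a" if "c < n" for c
    using that Ya[of c] cA(1) by (intro eq_vecI) (auto simp: K_def)
  \<comment> \<open>The chain stops after n steps because y^n + 1 = g^n fixes a.\<close>
  have Yn: "hY A ^\<^sub>m n *\<^sub>v a = 0\<^sub>v (mdim A)"
  proof (rule eq_vecI)
    fix i assume "i < dim_vec (0\<^sub>v (mdim A) :: complex vec)"
    then have i: "i < mdim A" by simp
    have "hY A ^\<^sub>m n *\<^sub>v a + a = (hY A ^\<^sub>m n + 1\<^sub>m (mdim A)) *\<^sub>v a"
      using cA(1) ac by (subst add_mult_distrib_mat_vec[of _ "mdim A" "mdim A"]) auto
    also have "\<dots> = a" unfolding hrepD(6)[OF rA] by (rule ae[OF gn_closed])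
    finally have "(hY A ^\<^sub>m n *\<^sub>v a + a) $ i = a $ i" by simp
    then show "(hY A ^\<^sub>m n *\<^sub>v a) $ i = 0\<^sub>v (mdim A) $ i" using i ac Ya[of n] by simp
  qed (use cA(1) in simp)
  have "K \<in> mod_hom H (kmod n) A"
    unfolding mod_hom_iff[OF fn fA]
  proof (intro conjI ballI)
    show "K * hY (kmod n) = hY A * K"
    proof (rule eq_matI)
      fix r c assume "r < dim_row (hY A * K)" "c < dim_col (hY A * K)"
      then have rc: "r < mdim A" "c < n" using cA(1) Kc by auto
      have "(hY A * K) $$ (r, c) = (hY A *\<^sub>v col K c) $ r"
        using rc cA(1) Kc by simp
      also have "\<dots> = (hY A ^\<^sub>m Suc c *\<^sub>v a) $ r"
        unfolding Kcol[OF rc(2)] pow_mat_Suc_left[OF cA(1)] using cA(1) ac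
        by (subst mat_vec_assoc) auto
      also have "\<dots> = (if c + 1 < n then K $$ (r, c + 1) else 0)"
      proof (cases "c + 1 < n")
        case False
        then have "Suc c = n" using rc by simp
        then show ?thesis using Yn rc by simp
      qed (use rc in \<open>simp add: K_def\<close>)
      also have "\<dots> = (K * hY (kmod n)) $$ (r, c)"
        using rc Kc by (simp add: kmod_hY mult_kY_index[of _ "mdim A"] del: index_mult_mat(1))
      finally show "(K * hY (kmod n)) $$ (r, c) = (hY A * K) $$ (r, c)" ..
    qed (use cA(1) Kc in \<open>auto simp: kmod_hY\<close>)
    fix k assume k: "k \<in> carrier G"
    show "K * hG (kmod n) k = hG A k * K"
    proof (rule eq_matI)
      fix r c assume "r < dim_row (hG A k * K)" "c < dim_col (hG A k * K)"
      then have rc: "r < mdim A" "c < n" using cA(2)[OF k] Kc by auto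
      have "(hG A k * K) $$ (r, c) = (hG A k *\<^sub>v col K c) $ r"
        using rc cA(2)[OF k] Kc by simp
      also have "hG A k *\<^sub>v col K c = (hG A k * hY A ^\<^sub>m c) *\<^sub>v a"
        unfolding Kcol[OF rc(2)] using cA(1) cA(2)[OF k] ac
        by (subst mat_vec_assoc) auto
      also have "\<dots> = inverse (\<chi> k) ^ c \<cdot>\<^sub>v ((hY A ^\<^sub>m c * hG A k) *\<^sub>v a)"
        unfolding hrep_grp_Y_pow[OF rA k] using cA(1) cA(2)[OF k] ac
        by (intro eq_vecI) (auto simp: smult_scalar_prod_distrib[of _ "mdim A"])
      also have "(hY A ^\<^sub>m c * hG A k) *\<^sub>v a = hY A ^\<^sub>m c *\<^sub>v a"
        using cA(1) cA(2)[OF k] ac by (subst mat_vec_assoc) (auto simp: ae k)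
      also have "(inverse (\<chi> k) ^ c \<cdot>\<^sub>v (hY A ^\<^sub>m c *\<^sub>v a)) $ r = K $$ (r, c) * inverse (\<chi> k) ^ c"
        using rc Ya[of c] cA(1) by (simp add: K_def)
      also have "\<dots> = (K * hG (kmod n) k) $$ (r, c)"
        using rc Kc k by (simp add: kmod_hG mult_kG_index[of _ "mdim A"] del: index_mult_mat(1))
      finally show "(K * hG (kmod n) k) $$ (r, c) = (hG A k * K) $$ (r, c)" ..
    qed (use cA(2)[OF k] Kc k in \<open>auto simp: kmod_hG\<close>)
  qed (use Kc in simp)
  moreover have "f * K = h"
  proof (rule eq_matI)
    fix r c assume "r < dim_row h" "c < dim_col h"
    then have rc: "r < mdim B" "c < n" using hc by auto
    have pf: "f * hY A ^\<^sub>m k = hY B ^\<^sub>m k * f" "h * kY n ^\<^sub>m k = hY B ^\<^sub>m k * h" for k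
      using cA(1) cB(1) fc(1) hc(1)
      by (induction k) (simp_all add: mat_assoc[symmetric], simp_all add: mat_assoc fc(2) hc(2))
    have "(f * K) $$ (r, c) = (f *\<^sub>v col K c) $ r" using rc fc(1) Kc by simp
    also have "f *\<^sub>v col K c = (f * hY A ^\<^sub>m c) *\<^sub>v a"
      unfolding Kcol[OF rc(2)] using cA(1) fc(1) ac by (subst mat_vec_assoc) auto
    also have "\<dots> = hY B ^\<^sub>m c *\<^sub>v b"
      unfolding pf using cB(1) fc(1) ac fa by (subst mat_vec_assoc) auto
    also have "\<dots> = (h * kY n ^\<^sub>m c) *\<^sub>v e"
      unfolding pf b_def using cB(1) hc(1) ec by (subst mat_vec_assoc) auto
    also have "\<dots> = h *\<^sub>v unit_vec n c"
      using hc(1) ec kY_pow_unit[OF rc(2)] unfolding e_def by (subst mat_vec_assoc) auto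
    also have "\<dots> $ r = h $$ (r, c)" using rc hc(1) by (intro mult_unit_vec_index)
    finally show "(f * K) $$ (r, c) = h $$ (r, c)" .
  qed (use fc hc Kc in auto)
  ultimately show "\<exists>k\<in>mod_hom H (kmod n) A. f * k = h" by blast
qed

end

section \<open>Projections and traces\<close>

lemma mat_eq_vecI:
  fixes A :: "'a::semiring_1 mat"
  assumes "A \<in> carrier_mat m d" "B \<in> carrier_mat m d"
    and "\<And>v. v \<in> carrier_vec d \<Longrightarrow> A *\<^sub>v v = B *\<^sub>v v"
  shows "A = B"
proof (rule eq_matI)
  fix i j assume "i < dim_row B" "j < dim_col B"
  then have ij: "i < m" "j < d" using assms by auto
  have "(A *\<^sub>v unit_vec d j) $ i = (B *\<^sub>v unit_vec d j) $ i" using assms(3)[of "unit_vec d j"] by simp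
  then show "A $$ (i, j) = B $$ (i, j)" using assms(1,2) ij by (simp only: mult_unit_vec_index)
qed (use assms in auto)

definition vec_subspace :: "nat \<Rightarrow> complex vec set \<Rightarrow> bool" where
  "vec_subspace d W \<longleftrightarrow> W \<subseteq> carrier_vec d \<and> 0\<^sub>v d \<in> W \<and> (\<forall>v\<in>W. \<forall>w\<in>W. v + w \<in> W) \<and>
     (\<forall>c. \<forall>v\<in>W. c \<cdot>\<^sub>v v \<in> W)"

definition is_proj :: "nat \<Rightarrow> complex mat \<Rightarrow> complex vec set \<Rightarrow> bool" where
  "is_proj d P W \<longleftrightarrow> P \<in> carrier_mat d d \<and> (\<forall>v\<in>carrier_vec d. P *\<^sub>v v \<in> W) \<and> (\<forall>w\<in>W. P *\<^sub>v w = w)"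

text \<open>If d < k, pad A with zero rows to a square matrix. It is singular, and a kernel vector
  of it is killed by A, contrary to B A = 1.\<close>

lemma left_inverse_dim:
  fixes A B :: "complex mat"
  assumes A: "A \<in> carrier_mat d k" and B: "B \<in> carrier_mat k d" and BA: "B * A = 1\<^sub>m k"
  shows "k \<le> d"
proof (rule ccontr)
  assume "\<not> k \<le> d"
  then have k: "d < k" by simp
  define C where "C = mat k k (\<lambda>(r, c). if r < d then A $$ (r, c) else 0)"
  have C: "C \<in> carrier_mat k k" by (simp add: C_def)
  have "transpose_mat C *\<^sub>v unit_vec k d = 0\<^sub>v k"
    using k C by (intro eq_vecI) (simp_all add: mult_unit_vec_index[of _ k] C_def del: index_mult_mat_vec)
  then have "det (transpose_mat C) = 0"
    using det_0_iff_vec_prod_zero[of "transpose_mat C" k] C k by (auto intro!: exI[of _ "unit_vec k d"])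
  then have "det C = 0" using det_transpose[OF C] by simp
  then obtain v where v: "v \<in> carrier_vec k" "v \<noteq> 0\<^sub>v k" "C *\<^sub>v v = 0\<^sub>v k"
    using det_0_iff_vec_prod_zero[OF C] by auto
  have "A *\<^sub>v v = 0\<^sub>v d"
  proof (rule eq_vecI)
    fix i assume i: "i < dim_vec (0\<^sub>v d :: complex vec)"
    have "row A i = row C i" using i k A C by (intro eq_vecI) (auto simp: C_def)
    then show "(A *\<^sub>v v) $ i = 0\<^sub>v d $ i" using i k A C arg_cong[OF v(3), of "\<lambda>v. v $ i"] by simp
  qed (use A in simp)
  then have "(B * A) *\<^sub>v v = 0\<^sub>v k" using A B v by (simp add: mat_vec_assoc mult_zero_vec)
  then show False using v BA by simp
qed

text \<open>Turns a subspace given as a set into a projection that factors through a k-dimensional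
  space. Here k is maximal among the retracts inside W, and a vector of W that A B does not fix
  would enlarge the retract.\<close>

lemma subspace_factor:
  assumes W: "vec_subspace d W"
  obtains k A B where "A \<in> carrier_mat d k" "B \<in> carrier_mat k d" "B * A = 1\<^sub>m k" "is_proj d (A * B) W"
proof -
  define Q where "Q k \<longleftrightarrow> (\<exists>A B. A \<in> carrier_mat d k \<and> B \<in> carrier_mat k d \<and> B * A = 1\<^sub>m k \<and>
      (\<forall>v\<in>carrier_vec d. (A * B) *\<^sub>v v \<in> W))" for k
  have Wd: "W \<subseteq> carrier_vec d" "0\<^sub>v d \<in> W" "\<And>v w. v \<in> W \<Longrightarrow> w \<in> W \<Longrightarrow> v + w \<in> W" "\<And>c v. v \<in> W \<Longrightarrow> c \<cdot>\<^sub>v v \<in> W"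
    using W by (auto simp: vec_subspace_def)
  have "Q 0"
    unfolding Q_def
  proof (intro exI conjI ballI)
    fix v :: "complex vec" assume v: "v \<in> carrier_vec d"
    have "(0\<^sub>m d 0 * 0\<^sub>m 0 d) *\<^sub>v v = 0\<^sub>v d" using v by (intro eq_vecI) (auto simp: scalar_prod_def)
    then show "(0\<^sub>m d 0 * 0\<^sub>m 0 d) *\<^sub>v v \<in> W" using Wd by simp
  qed (auto intro!: eq_matI)
  moreover have bd: "\<forall>k. Q k \<longrightarrow> k \<le> d" by (auto simp: Q_def intro: left_inverse_dim)
  ultimately obtain k where k: "Q k" "\<And>k'. Q k' \<Longrightarrow> k' \<le> k"
    using GreatestI_nat[of Q 0 d] Greatest_le_nat[of Q _ d] by blast
  then obtain A B where AB: "A \<in> carrier_mat d k" "B \<in> carrier_mat k d" "B * A = 1\<^sub>m k"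
    "\<And>v. v \<in> carrier_vec d \<Longrightarrow> (A * B) *\<^sub>v v \<in> W" unfolding Q_def by blast
  have "(A * B) *\<^sub>v w = w" if w: "w \<in> W" for w
  proof (rule ccontr)
    assume ne: "(A * B) *\<^sub>v w \<noteq> w"
    have wc: "w \<in> carrier_vec d" using w Wd by auto
    define u where "u = w + (-1) \<cdot>\<^sub>v ((A * B) *\<^sub>v w)"
    have u: "u \<in> W" "u \<in> carrier_vec d" using Wd AB(4)[OF wc] w by (auto simp: u_def)
    obtain i where i: "i < d" "((A * B) *\<^sub>v w) $ i \<noteq> w $ i"
      using ne wc AB(1,2) by (metis carrier_matD(1) carrier_vecD dim_mult_mat_vec eq_vecI index_mult_mat(2))
    have ui: "u $ i \<noteq> 0" using i wc AB(1,2) by (auto simp: u_def simp del: index_mult_mat_vec)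
    have ABu: "B *\<^sub>v u = 0\<^sub>v k"
    proof -
      have "B *\<^sub>v ((A * B) *\<^sub>v w) = (B * A) *\<^sub>v (B *\<^sub>v w)" using AB(1,2) wc by (simp add: mat_vec_assoc)
      also have "\<dots> = B *\<^sub>v w" using AB wc by simp
      finally have e: "B *\<^sub>v ((A * B) *\<^sub>v w) = B *\<^sub>v w" .
      have c: "(A * B) *\<^sub>v w \<in> carrier_vec d" using AB(4)[OF wc] Wd by auto
      have "B *\<^sub>v u = B *\<^sub>v w + (-1) \<cdot>\<^sub>v (B *\<^sub>v ((A * B) *\<^sub>v w))"
        unfolding u_def using AB(2) wc c by (simp add: mult_add_distrib_mat_vec[of _ k d] mult_mat_vec[of _ k d])
      then show ?thesis unfolding e using AB(2) wc by (auto intro!: eq_vecI)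
    qed
    define U where "U = mat d 1 (\<lambda>(r, c). u $ r)"
    \<comment> \<open>The new row is the i-th row of 1 - A B divided by u_i. It annihilates the
      columns of A, as A B A = A, and takes the value 1 on u, as A B u = 0.\<close>
    define b where "b = mat 1 d (\<lambda>(r, c). (1\<^sub>m d $$ (i, c) - (A * B) $$ (i, c)) / u $ i)"
    have Ub: "U \<in> carrier_mat d 1" "b \<in> carrier_mat 1 d" by (simp_all add: U_def b_def)
    have BU: "B * U = 0\<^sub>m k 1"
    proof (rule eq_matI)
      fix r c assume "r < dim_row (0\<^sub>m k 1 :: complex mat)" "c < dim_col (0\<^sub>m k 1 :: complex mat)"
      then have rc: "r < k" "c = 0" by auto
      have "col U 0 = u" using u by (intro eq_vecI) (auto simp: U_def)
      then show "(B * U) $$ (r, c) = 0\<^sub>m k 1 $$ (r, c)"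
        using rc AB(2) Ub arg_cong[OF ABu, of "\<lambda>v. v $ r"] by simp
    qed (use AB Ub in auto)
    have bX: "(b * X) $$ (0, c) = (X $$ (i, c) - (A * B * X) $$ (i, c)) / u $ i"
      if X: "X \<in> carrier_mat d m" "c < m" for X m c
    proof -
      have "(b * X) $$ (0, c) = (\<Sum>l<d. (1\<^sub>m d $$ (i, l) - (A * B) $$ (i, l)) / u $ i * X $$ (l, c))"
        using X Ub by (subst mult_mat_index) (auto simp: b_def)
      also have "\<dots> = ((\<Sum>l<d. 1\<^sub>m d $$ (i, l) * X $$ (l, c)) - (\<Sum>l<d. (A * B) $$ (i, l) * X $$ (l, c))) / u $ i"
        by (simp add: left_diff_distrib sum_subtractf diff_divide_distrib sum_divide_distrib)
      also have "(\<Sum>l<d. 1\<^sub>m d $$ (i, l) * X $$ (l, c)) = (1\<^sub>m d * X) $$ (i, c)"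
        using X i by (subst mult_mat_index) auto
      also have "(\<Sum>l<d. (A * B) $$ (i, l) * X $$ (l, c)) = (A * B * X) $$ (i, c)"
        using X i AB(1,2) by (subst (2) mult_mat_index) auto
      finally show ?thesis using X by simp
    qed
    have bA: "b * A = 0\<^sub>m 1 k"
    proof (rule eq_matI)
      fix r c assume rc: "r < dim_row (0\<^sub>m 1 k :: complex mat)" "c < dim_col (0\<^sub>m 1 k :: complex mat)"
      have "A * B * A = A" using AB(1-3) by (simp add: mat_assoc)
      then show "(b * A) $$ (r, c) = 0\<^sub>m 1 k $$ (r, c)" using rc bX[OF AB(1), of c] by simp
    qed (use AB Ub in auto)
    have bU: "b * U = 1\<^sub>m 1"
    proof (rule eq_matI)
      fix r c assume rc: "r < dim_row (1\<^sub>m 1 :: complex mat)" "c < dim_col (1\<^sub>m 1 :: complex mat)"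
      have "A * B * U = 0\<^sub>m d 1" using AB(1,2) Ub BU by (simp add: mat_assoc)
      then show "(b * U) $$ (r, c) = 1\<^sub>m 1 $$ (r, c)" using rc bX[OF Ub(1), of 0] ui i by (simp add: U_def)
    qed (use Ub in auto)
    let ?A = "four_block_mat A U (0\<^sub>m 0 k) (0\<^sub>m 0 1)"
    let ?B = "four_block_mat B (0\<^sub>m k 0) b (0\<^sub>m 1 0)"
    have c': "?A \<in> carrier_mat (d + 0) (k + 1)" "?B \<in> carrier_mat (k + 1) (d + 0)"
      by (rule four_block_carrier_mat, use AB Ub in auto)+
    have "?B * ?A = four_block_mat (B * A + 0\<^sub>m k 0 * 0\<^sub>m 0 k) (B * U + 0\<^sub>m k 0 * 0\<^sub>m 0 1)
        (b * A + 0\<^sub>m 1 0 * 0\<^sub>m 0 k) (b * U + 0\<^sub>m 1 0 * 0\<^sub>m 0 1)"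
      using AB(1,2) Ub by (intro mult_four_block_mat) auto
    also have "\<dots> = four_block_mat (1\<^sub>m k) (0\<^sub>m k 1) (0\<^sub>m 1 k) (1\<^sub>m 1)"
      unfolding AB(3) BU bA bU by (intro cong_four_block_mat) (auto intro!: eq_matI simp: scalar_prod_def)
    also have "\<dots> = 1\<^sub>m (k + 1)" by (rule four_block_one_mat)
    finally have 1: "?B * ?A = 1\<^sub>m (k + 1)" .
    have "?A * ?B = four_block_mat (A * B + U * b) (A * 0\<^sub>m k 0 + U * 0\<^sub>m 1 0)
        (0\<^sub>m 0 k * B + 0\<^sub>m 0 1 * b) (0\<^sub>m 0 k * 0\<^sub>m k 0 + 0\<^sub>m 0 1 * 0\<^sub>m 1 0)"
      using AB(1,2) Ub by (intro mult_four_block_mat) auto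
    also have "\<dots> = A * B + U * b" using AB(1,2) Ub by (intro eq_matI) auto
    finally have 2: "?A * ?B = A * B + U * b" .
    have "(A * B + U * b) *\<^sub>v v \<in> W" if v: "v \<in> carrier_vec d" for v
    proof -
      have "(A * B + U * b) *\<^sub>v v = (A * B) *\<^sub>v v + U *\<^sub>v (b *\<^sub>v v)"
        using AB(1,2) Ub v by (subst add_mult_distrib_mat_vec[of _ d d]) (auto simp: mat_vec_assoc)
      also have "U *\<^sub>v (b *\<^sub>v v) = (b *\<^sub>v v) $ 0 \<cdot>\<^sub>v u"
        using u Ub by (intro eq_vecI) (auto simp: U_def scalar_prod_def simp del: index_mult_mat_vec, simp add: scalar_prod_def)
      finally show ?thesis using AB(4)[OF v] Wd u by simp
    qed
    then have "Q (k + 1)" unfolding Q_def using c' 1 2 by (intro exI[of _ ?A] exI[of _ ?B]) auto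
    then show False using k(2) by fastforce
  qed
  then have "is_proj d (A * B) W" using AB by (auto simp: is_proj_def)
  then show ?thesis using that AB by blast
qed

text \<open>Both numbers are the trace of R on W. From P' R P = R P and P P' = P' the cyclic
  property gives tr(R P) = tr(P' R P) = tr(R P P') = tr(R P').\<close>

lemma is_proj_trace_unique:
  assumes P: "is_proj d P W" "is_proj d P' W" and R: "R \<in> carrier_mat d d" "\<And>w. w \<in> W \<Longrightarrow> R *\<^sub>v w \<in> W"
  shows "mtrace (R * P) = mtrace (R * P')"
proof -
  have c: "P \<in> carrier_mat d d" "P' \<in> carrier_mat d d" using P by (auto simp: is_proj_def)
  have 1: "P' * (R * P) = R * P"
    using P R c by (intro mat_eq_vecI[of _ d d]) (auto simp: is_proj_def mat_vec_assoc)
  have 2: "P * P' = P'"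
    using P c by (intro mat_eq_vecI[of _ d d]) (auto simp: is_proj_def mat_vec_assoc)
  have "mtrace (R * P) = mtrace (P' * (R * P))" by (simp only: 1)
  also have "\<dots> = mtrace (R * P * P')" using c R by (intro mtrace_mult_commute[of _ d d]) auto
  also have "R * P * P' = R * P'" using c R by (simp add: mat_assoc 2)
  finally show ?thesis .
qed

lemma mtrace_kron:
  assumes "A \<in> carrier_mat a a" "B \<in> carrier_mat b b"
  shows "mtrace (kron A B) = mtrace A * mtrace B"
proof -
  have "mtrace (kron A B) = (\<Sum>l<a * b. (\<lambda>i j. A $$ (i, i) * B $$ (j, j)) (l div b) (l mod b))"
    using assms by (auto simp: mtrace_def intro!: sum.cong)
  also have "\<dots> = (\<Sum>i<a. \<Sum>j<b. A $$ (i, i) * B $$ (j, j))" by (rule sum_div_mod)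
  finally show ?thesis using assms by (simp add: mtrace_def sum_product)
qed

context non_nilpotent_group_datum
begin

section \<open>Additive invariants vanishing on projective modules\<close>

text \<open>The span of the ends of those Jordan chains of y, for the eigenvalue 0, that are longer
  than k.\<close>

definition soc :: "(nat \<times> 'a \<Rightarrow> complex) fdmod \<Rightarrow> nat \<Rightarrow> complex vec set" where
  "soc M k = {v \<in> carrier_vec (mdim M). hY M *\<^sub>v v = 0\<^sub>v (mdim M) \<and>
     (\<exists>w\<in>carrier_vec (mdim M). hY M ^\<^sub>m n *\<^sub>v w = 0\<^sub>v (mdim M) \<and> v = hY M ^\<^sub>m k *\<^sub>v w)}"

text \<open>Any projection onto \<open>soc M k\<close> gives the same traces. The choice depends
  only on the dimension and the subspace, so equal subspaces have equal projections.\<close>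

definition soc_proj :: "(nat \<times> 'a \<Rightarrow> complex) fdmod \<Rightarrow> nat \<Rightarrow> complex mat" where
  "soc_proj M k = (SOME P. is_proj (mdim M) P (soc M k))"

text \<open>The trace of h on \<open>soc M k\<close> modulo \<open>soc M (Suc k)\<close>, which sees
  exactly the Jordan chains of length k + 1.\<close>

definition phi :: "nat \<Rightarrow> 'a \<Rightarrow> (nat \<times> 'a \<Rightarrow> complex) fdmod \<Rightarrow> complex" where
  "phi k h M = mtrace (hG M h * soc_proj M k) - mtrace (hG M h * soc_proj M (Suc k))"

lemma hY_carriers:
  assumes "is_fdmod H M"
  shows "hY M \<in> carrier_mat (mdim M) (mdim M)" "hY M ^\<^sub>m k \<in> carrier_mat (mdim M) (mdim M)"
    "h \<in> carrier G \<Longrightarrow> hG M h \<in> carrier_mat (mdim M) (mdim M)"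
  using hrepD(1,2)[OF fdmod_hrep[OF assms]] by auto

lemma soc_subspace:
  assumes M: "is_fdmod H M"
  shows "vec_subspace (mdim M) (soc M k)"
  unfolding vec_subspace_def
proof (intro conjI ballI allI)
  let ?d = "mdim M"
  note c = hY_carriers[OF M]
  show "soc M k \<subseteq> carrier_vec ?d" by (auto simp: soc_def)
  show "0\<^sub>v ?d \<in> soc M k"
    using c(1) c(2)[of k] c(2)[of n] by (auto simp: soc_def mult_zero_vec intro!: bexI[of _ "0\<^sub>v ?d"])
  fix v assume v: "v \<in> soc M k"
  then obtain w where w: "v \<in> carrier_vec ?d" "hY M *\<^sub>v v = 0\<^sub>v ?d" "w \<in> carrier_vec ?d"
    "hY M ^\<^sub>m n *\<^sub>v w = 0\<^sub>v ?d" "v = hY M ^\<^sub>m k *\<^sub>v w" by (auto simp: soc_def)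
  fix a :: complex
  show "a \<cdot>\<^sub>v v \<in> soc M k"
    unfolding soc_def using w c(1) mult_mat_vec[OF c(2) w(3)]
    by (auto simp: mult_mat_vec[of _ ?d ?d] intro!: bexI[of _ "a \<cdot>\<^sub>v w"])
next
  let ?d = "mdim M"
  note c = hY_carriers[OF M]
  fix v v' assume v: "v \<in> soc M k" "v' \<in> soc M k"
  then obtain w w' where w: "v \<in> carrier_vec ?d" "hY M *\<^sub>v v = 0\<^sub>v ?d" "w \<in> carrier_vec ?d"
    "hY M ^\<^sub>m n *\<^sub>v w = 0\<^sub>v ?d" "v = hY M ^\<^sub>m k *\<^sub>v w"
    "v' \<in> carrier_vec ?d" "hY M *\<^sub>v v' = 0\<^sub>v ?d" "w' \<in> carrier_vec ?d"
    "hY M ^\<^sub>m n *\<^sub>v w' = 0\<^sub>v ?d" "v' = hY M ^\<^sub>m k *\<^sub>v w'" by (auto simp: soc_def)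
  show "v + v' \<in> soc M k"
    unfolding soc_def using w(1,6) w(2,7) w(4,9) mult_add_distrib_mat_vec[OF c(1) w(1,6)] 
      mult_add_distrib_mat_vec[OF c(2) w(3,8)] w(3,5,8,10)
    by (auto intro!: bexI[of _ "w + w'"])
qed

lemma soc_stable:
  assumes M: "is_fdmod H M" and h: "h \<in> carrier G" and v: "v \<in> soc M k"
  shows "hG M h *\<^sub>v v \<in> soc M k"
proof -
  let ?d = "mdim M"
  note r = fdmod_hrep[OF M] and c = hY_carriers[OF M] and ch = hY_carriers(3)[OF M h]
  obtain w where w: "v \<in> carrier_vec ?d" "hY M *\<^sub>v v = 0\<^sub>v ?d" "w \<in> carrier_vec ?d"
    "hY M ^\<^sub>m n *\<^sub>v w = 0\<^sub>v ?d" "v = hY M ^\<^sub>m k *\<^sub>v w" using v by (auto simp: soc_def)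
  have sm: "(a \<cdot>\<^sub>m A) *\<^sub>v u = a \<cdot>\<^sub>v (A *\<^sub>v u)" if "A \<in> carrier_mat ?d ?d" "u \<in> carrier_vec ?d" for a A and u :: "complex vec"
    using that by (intro eq_vecI) (auto simp: smult_scalar_prod_distrib[of _ ?d])
  have Yh: "hY M ^\<^sub>m j *\<^sub>v (hG M h *\<^sub>v u) = \<chi> h ^ j \<cdot>\<^sub>v (hG M h *\<^sub>v (hY M ^\<^sub>m j *\<^sub>v u))"
    if u: "u \<in> carrier_vec ?d" for j u
  proof -
    have "hY M ^\<^sub>m j *\<^sub>v (hG M h *\<^sub>v u) = (hY M ^\<^sub>m j * hG M h) *\<^sub>v u"
      using c(2)[of j] ch u by (simp add: mat_vec_assoc)
    also have "\<dots> = \<chi> h ^ j \<cdot>\<^sub>v ((hG M h * hY M ^\<^sub>m j) *\<^sub>v u)"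
      unfolding hrep_Y_pow_grp[OF r h] using c(2)[of j] ch u by (intro sm) auto
    finally show ?thesis using c(2)[of j] ch u by (simp add: mat_vec_assoc)
  qed
  have "hG M h *\<^sub>v v = hY M ^\<^sub>m k *\<^sub>v (inverse (\<chi> h) ^ k \<cdot>\<^sub>v (hG M h *\<^sub>v w))"
    using w(3) ch c(2)[of k] chi_nonzero[OF h]
    by (simp add: mult_mat_vec[of _ ?d ?d] Yh w(5) smult_smult_assoc power_inverse)
  moreover have "hY M ^\<^sub>m n *\<^sub>v (inverse (\<chi> h) ^ k \<cdot>\<^sub>v (hG M h *\<^sub>v w)) = 0\<^sub>v ?d"
    using w(3,4) ch c(2)[of n] by (simp add: mult_mat_vec[of _ ?d ?d] Yh mult_zero_vec) (auto intro!: eq_vecI)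
  moreover have "hY M *\<^sub>v (hG M h *\<^sub>v v) = 0\<^sub>v ?d"
    using Yh[OF w(1), of 1] w(2) c(1) ch by (simp add: mult_zero_vec) (auto intro!: eq_vecI)
  moreover have "hG M h *\<^sub>v v \<in> carrier_vec ?d" "inverse (\<chi> h) ^ k \<cdot>\<^sub>v (hG M h *\<^sub>v w) \<in> carrier_vec ?d"
    using ch w by auto
  ultimately show ?thesis unfolding soc_def by blast
qed

lemma soc_proj_is_proj:
  assumes M: "is_fdmod H M"
  shows "is_proj (mdim M) (soc_proj M k) (soc M k)"
  unfolding soc_proj_def by (rule someI_ex) (metis subspace_factor[OF soc_subspace[OF M]])

lemma soc_trace:
  assumes M: "is_fdmod H M" and h: "h \<in> carrier G" and P: "is_proj (mdim M) P (soc M k)"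
  shows "mtrace (hG M h * soc_proj M k) = mtrace (hG M h * P)"
  using is_proj_trace_unique[OF soc_proj_is_proj[OF M] P hY_carriers(3)[OF M h]] soc_stable[OF M h] by blast

text \<open>T P S is a projection onto the corresponding subspace of N, and the cyclic property of
  the trace removes the conjugation.\<close>

lemma soc_trace_iso:
  assumes i: "mod_iso H M N" and f: "is_fdmod H M" "is_fdmod H N" and h: "h \<in> carrier G"
  shows "mtrace (hG M h * soc_proj M k) = mtrace (hG N h * soc_proj N k)"
proof -
  obtain T S where TS: "T \<in> carrier_mat (mdim N) (mdim M)"
    "S \<in> carrier_mat (mdim M) (mdim N)" "S * T = 1\<^sub>m (mdim M)" "T * S = 1\<^sub>m (mdim N)"
    "T * hY M = hY N * T" "\<And>h. h \<in> carrier G \<Longrightarrow> T * hG M h = hG N h * T"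
    "S * hY N = hY M * S"
    using mod_isoE[OF i f] by metis
  define P where "P = soc_proj M k"
  have P: "is_proj (mdim M) P (soc M k)" unfolding P_def by (rule soc_proj_is_proj[OF f(1)])
  then have Pc: "P \<in> carrier_mat (mdim M) (mdim M)" by (simp add: is_proj_def)
  have transport: "X *\<^sub>v v \<in> soc L k"
    if v: "v \<in> soc K k" and X: "X \<in> carrier_mat (mdim L) (mdim K)" "X * hY K = hY L * X"
      and fK: "is_fdmod H K" and fL: "is_fdmod H L" for X v K L
  proof -
    note cK = hY_carriers[OF fK] and cL = hY_carriers[OF fL]
    obtain w where w: "v \<in> carrier_vec (mdim K)" "hY K *\<^sub>v v = 0\<^sub>v (mdim K)" "w \<in> carrier_vec (mdim K)"
      "hY K ^\<^sub>m n *\<^sub>v w = 0\<^sub>v (mdim K)" "v = hY K ^\<^sub>m k *\<^sub>v w" using v by (auto simp: soc_def)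
    have pw: "hY L ^\<^sub>m j * X = X * hY K ^\<^sub>m j" for j
    proof (induction j)
      case (Suc j)
      have "hY L ^\<^sub>m Suc j * X = hY L ^\<^sub>m j * (hY L * X)"
        using cL(1) X(1) by (simp add: mat_assoc)
      also have "\<dots> = (hY L ^\<^sub>m j * X) * hY K"
        unfolding X(2)[symmetric] using cL(1) cK(1) X(1) by (simp add: mat_assoc)
      also have "\<dots> = X * hY K ^\<^sub>m Suc j" unfolding Suc using cK(1) X(1) by (simp add: mat_assoc)
      finally show ?case .
    qed (use cL cK X in simp)
    have pv: "hY L ^\<^sub>m j *\<^sub>v (X *\<^sub>v u) = X *\<^sub>v (hY K ^\<^sub>m j *\<^sub>v u)" if u: "u \<in> carrier_vec (mdim K)" for j u
    proof -
      have "hY L ^\<^sub>m j *\<^sub>v (X *\<^sub>v u) = (hY L ^\<^sub>m j * X) *\<^sub>v u" using u X(1) cL(2)[of j] by (simp add: mat_vec_assoc)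
      also have "\<dots> = X *\<^sub>v (hY K ^\<^sub>m j *\<^sub>v u)" unfolding pw using u X(1) cK(2)[of j] by (simp add: mat_vec_assoc)
      finally show ?thesis .
    qed
    have "hY L *\<^sub>v (X *\<^sub>v v) = 0\<^sub>v (mdim L)"
      using pv[OF w(1), of 1] cL(1) cK(1) w(2) X(1) by (simp add: mult_zero_vec)
    moreover have "hY L ^\<^sub>m n *\<^sub>v (X *\<^sub>v w) = 0\<^sub>v (mdim L)"
      using pv[OF w(3), of n] w(4) X(1) by (simp add: mult_zero_vec)
    moreover have "X *\<^sub>v v = hY L ^\<^sub>m k *\<^sub>v (X *\<^sub>v w)" using pv[OF w(3), of k] w(5) by simp
    moreover have "X *\<^sub>v v \<in> carrier_vec (mdim L)" "X *\<^sub>v w \<in> carrier_vec (mdim L)"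
      using w(1,3) X(1) by (auto intro: mult_mat_vec_carrier)
    ultimately show ?thesis unfolding soc_def by blast
  qed
  have "is_proj (mdim N) (T * P * S) (soc N k)"
    unfolding is_proj_def
  proof (intro conjI ballI)
    show "T * P * S \<in> carrier_mat (mdim N) (mdim N)" using TS Pc by auto
    fix v :: "complex vec" assume v: "v \<in> carrier_vec (mdim N)"
    have "(T * P * S) *\<^sub>v v = T *\<^sub>v (P *\<^sub>v (S *\<^sub>v v))" using v TS(1,2) Pc by (simp add: mat_vec_assoc)
    moreover have "P *\<^sub>v (S *\<^sub>v v) \<in> soc M k" using P v TS(2) by (simp add: is_proj_def)
    ultimately show "(T * P * S) *\<^sub>v v \<in> soc N k" using transport TS(1,5) f by simp
  next
    fix v assume v: "v \<in> soc N k"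
    then have vc: "v \<in> carrier_vec (mdim N)" by (simp add: soc_def)
    have "S *\<^sub>v v \<in> soc M k" using transport[OF v] TS(2,7) f by simp
    then have "P *\<^sub>v (S *\<^sub>v v) = S *\<^sub>v v" using P by (simp add: is_proj_def)
    then have "(T * P * S) *\<^sub>v v = (T * S) *\<^sub>v v" using vc TS(1,2) Pc by (simp add: mat_vec_assoc)
    then show "(T * P * S) *\<^sub>v v = v" using vc TS(4) by simp
  qed
  then have "mtrace (hG N h * soc_proj N k) = mtrace (hG N h * (T * P * S))"
    by (rule soc_trace[OF f(2) h])
  also have "hG N h * (T * P * S) = (hG N h * T) * (P * S)"
    using hY_carriers(3)[OF f(2) h] TS(1,2) Pc by (simp add: mat_assoc)
  also have "\<dots> = (T * (hG M h * P)) * S"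
    unfolding TS(6)[OF h, symmetric] using hY_carriers(3)[OF f(1) h] TS(1,2) Pc by (simp add: mat_assoc)
  also have "mtrace \<dots> = mtrace (S * (T * (hG M h * P)))"
    using hY_carriers(3)[OF f(1) h] TS(1,2) Pc by (intro mtrace_mult_commute[of _ "mdim N" "mdim M"]) auto
  also have "S * (T * (hG M h * P)) = (S * T) * (hG M h * P)"
    using hY_carriers(3)[OF f(1) h] TS(1,2) Pc by (simp add: mat_assoc)
  also have "\<dots> = hG M h * P" unfolding TS(3) using hY_carriers(3)[OF f(1) h] Pc by simp
  finally show ?thesis by (simp add: P_def)
qed

lemma phi_iso:
  assumes "mod_iso H M N" "is_fdmod H M" "is_fdmod H N" "h \<in> carrier G"
  shows "phi k h M = phi k h N"
  unfolding phi_def soc_trace_iso[OF assms] ..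

lemma diag_block_mult_vec:
  assumes "A \<in> carrier_mat a b" "D \<in> carrier_mat c d" "u \<in> carrier_vec b" "w \<in> carrier_vec d"
  shows "diag_block A D *\<^sub>v (u @\<^sub>v w) = (A *\<^sub>v u) @\<^sub>v (D *\<^sub>v w)"
proof -
  have "diag_block A D *\<^sub>v (u @\<^sub>v w) = (A *\<^sub>v u + 0\<^sub>m a d *\<^sub>v w) @\<^sub>v (0\<^sub>m c b *\<^sub>v u + D *\<^sub>v w)"
    using assms by (subst four_block_mat_mult_vec[of _ a b _ d _ c]) auto
  also have "A *\<^sub>v u + 0\<^sub>m a d *\<^sub>v w = A *\<^sub>v u" using assms by (intro eq_vecI) (auto simp: scalar_prod_def)
  also have "0\<^sub>m c b *\<^sub>v u + D *\<^sub>v w = D *\<^sub>v w" using assms by (intro eq_vecI) (auto simp: scalar_prod_def)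
  finally show ?thesis .
qed

lemma vec_split:
  assumes "v \<in> carrier_vec (a + b)"
  obtains u w where "u \<in> carrier_vec a" "w \<in> carrier_vec b" "v = u @\<^sub>v w"
proof (rule that)
  show "v = vec a (\<lambda>i. v $ i) @\<^sub>v vec b (\<lambda>i. v $ (i + a))"
    using assms by (intro eq_vecI) auto
qed auto

lemma append_vec_zero: "0\<^sub>v (a + b) = 0\<^sub>v a @\<^sub>v 0\<^sub>v b"
  by (intro eq_vecI) auto

lemma soc_dsum:
  assumes f: "is_fdmod H M" "is_fdmod H N" and u: "u \<in> carrier_vec (mdim M)" and w: "w \<in> carrier_vec (mdim N)"
  shows "u @\<^sub>v w \<in> soc (dsum M N) k \<longleftrightarrow> u \<in> soc M k \<and> w \<in> soc N k"
proof -
  note cM = hY_carriers[OF f(1)] and cN = hY_carriers[OF f(2)]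
  have Y: "hY (dsum M N) ^\<^sub>m j = diag_block (hY M ^\<^sub>m j) (hY N ^\<^sub>m j)" for j
    unfolding dsum_hY[OF f] using pow_four_block_mat[OF cM(1) cN(1), of j] cM(1) cM(2)[of j] cN(1) cN(2)[of j] by simp
  have ap: "hY (dsum M N) ^\<^sub>m j *\<^sub>v (a @\<^sub>v b) = (hY M ^\<^sub>m j *\<^sub>v a) @\<^sub>v (hY N ^\<^sub>m j *\<^sub>v b)"
    if "a \<in> carrier_vec (mdim M)" "b \<in> carrier_vec (mdim N)" for a b j
    unfolding Y by (rule diag_block_mult_vec[OF cM(2) cN(2) that])
  have ap1: "hY (dsum M N) *\<^sub>v (u @\<^sub>v w) = (hY M *\<^sub>v u) @\<^sub>v (hY N *\<^sub>v w)"
    unfolding dsum_hY[OF f] by (rule diag_block_mult_vec[OF cM(1) cN(1) u w])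
  have eq: "a @\<^sub>v b = 0\<^sub>v (mdim M + mdim N) \<longleftrightarrow> a = 0\<^sub>v (mdim M) \<and> b = 0\<^sub>v (mdim N)"
    if "a \<in> carrier_vec (mdim M)" for a b :: "complex vec"
    unfolding append_vec_zero using append_vec_eq[OF that] by auto
  have cv: "hY M *\<^sub>v u \<in> carrier_vec (mdim M)" "hY M ^\<^sub>m j *\<^sub>v a \<in> carrier_vec (mdim M)"
    if "a \<in> carrier_vec (mdim M)" for a j
    using u cM(1) mult_mat_vec_carrier[OF cM(2) that] by auto
  have ex: "(\<exists>x\<in>carrier_vec (mdim M + mdim N). R x) \<longleftrightarrow>
      (\<exists>a\<in>carrier_vec (mdim M). \<exists>b\<in>carrier_vec (mdim N). R (a @\<^sub>v b))" for R
    by (metis append_carrier_vec vec_split)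
  show ?thesis
    unfolding soc_def using u w
    by (auto simp: ex ap ap1 eq cv append_vec_eq[of _ "mdim M"] intro: cv)
qed

lemma soc_trace_dsum:
  assumes f: "is_fdmod H M" "is_fdmod H N" and h: "h \<in> carrier G"
  shows "mtrace (hG (dsum M N) h * soc_proj (dsum M N) k)
    = mtrace (hG M h * soc_proj M k) + mtrace (hG N h * soc_proj N k)"
proof -
  let ?P = "soc_proj M k" and ?Q = "soc_proj N k"
  have P: "is_proj (mdim M) ?P (soc M k)" "is_proj (mdim N) ?Q (soc N k)"
    using f by (auto intro: soc_proj_is_proj)
  have c: "?P \<in> carrier_mat (mdim M) (mdim M)" "?Q \<in> carrier_mat (mdim N) (mdim N)"
    using P by (auto simp: is_proj_def)
  have "is_proj (mdim (dsum M N)) (diag_block ?P ?Q) (soc (dsum M N) k)"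
    unfolding is_proj_def
  proof (intro conjI ballI)
    show "diag_block ?P ?Q \<in> carrier_mat (mdim (dsum M N)) (mdim (dsum M N))" using c by simp
    fix v :: "complex vec" assume "v \<in> carrier_vec (mdim (dsum M N))"
    then have "v \<in> carrier_vec (mdim M + mdim N)" by simp
    then obtain u w where v: "u \<in> carrier_vec (mdim M)" "w \<in> carrier_vec (mdim N)" "v = u @\<^sub>v w" by (rule vec_split)
    have "?P *\<^sub>v u \<in> soc M k" "?Q *\<^sub>v w \<in> soc N k" using P v by (auto simp: is_proj_def)
    then show "diag_block ?P ?Q *\<^sub>v v \<in> soc (dsum M N) k"
      unfolding v(3) diag_block_mult_vec[OF c v(1,2)] using soc_dsum[OF f] by (auto simp: soc_def)
  next
    fix v assume v': "v \<in> soc (dsum M N) k"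
    then have "v \<in> carrier_vec (mdim M + mdim N)" by (simp add: soc_def)
    then obtain u w where v: "u \<in> carrier_vec (mdim M)" "w \<in> carrier_vec (mdim N)" "v = u @\<^sub>v w" by (rule vec_split)
    then have "u \<in> soc M k" "w \<in> soc N k" using v' soc_dsum[OF f v(1,2)] by auto
    then show "diag_block ?P ?Q *\<^sub>v v = v"
      unfolding v(3) diag_block_mult_vec[OF c v(1,2)] using P by (simp add: is_proj_def)
  qed
  then have "mtrace (hG (dsum M N) h * soc_proj (dsum M N) k) = mtrace (hG (dsum M N) h * diag_block ?P ?Q)"
    by (rule soc_trace[OF dsum_fdmod[OF f] h])
  also have "hG (dsum M N) h * diag_block ?P ?Q = diag_block (hG M h * ?P) (hG N h * ?Q)"
    unfolding dsum_hG[OF f h] by (rule diag_block_mult[OF hY_carriers(3)[OF f(1) h] hY_carriers(3)[OF f(2) h] c])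
  also have "mtrace \<dots> = mtrace (hG M h * ?P) + mtrace (hG N h * ?Q)"
    using mult_carrier_mat[OF hY_carriers(3)[OF f(1) h] c(1)] mult_carrier_mat[OF hY_carriers(3)[OF f(2) h] c(2)]
    by (rule mtrace_four_block)
  finally show ?thesis .
qed

lemma phi_dsum:
  assumes "is_fdmod H M" "is_fdmod H N" "h \<in> carrier G"
  shows "phi k h (dsum M N) = phi k h M + phi k h N"
  unfolding phi_def soc_trace_dsum[OF assms] by simp

text \<open>Apply \<open>tw (hY M) Z n\<close> = 1 to a vector v of ker y. Every summand that ends
  in y vanishes, which leaves v = y^(n-1) Z v, so v lies in the image of y^k for each k < n.\<close>

lemma soc_good:
  assumes good: "good_mod M" and k: "k < n"
  shows "soc M k = {v \<in> carrier_vec (mdim M). hY M *\<^sub>v v = 0\<^sub>v (mdim M)}"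
proof (intro equalityI subsetI)
  fix v assume "v \<in> {v \<in> carrier_vec (mdim M). hY M *\<^sub>v v = 0\<^sub>v (mdim M)}"
  then have v: "v \<in> carrier_vec (mdim M)" "hY M *\<^sub>v v = 0\<^sub>v (mdim M)" by auto
  let ?d = "mdim M" and ?Y = "hY M"
  from good obtain Z where f: "is_fdmod H M" and Z: "Z \<in> carrier_mat ?d ?d"
    "\<And>h. h \<in> carrier G \<Longrightarrow> Z * hG M h = \<chi> h \<cdot>\<^sub>m (hG M h * Z)" "tw ?Y Z n = 1\<^sub>m ?d"
    by (auto simp: good_mod_def)
  note c = hY_carriers[OF f]
  obtain m where m: "n = Suc m" using n_ge_2 by (cases n) auto
  have Zv: "Z *\<^sub>v v \<in> carrier_vec ?d" using Z(1) v by simp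
  have t: "tw ?Y Z m \<in> carrier_mat ?d ?d" using c(1) Z(1) by (rule tw_carrier)
  have "v = tw ?Y Z n *\<^sub>v v" using Z(3) v by simp
  also have "\<dots> = (?Y ^\<^sub>m m * Z) *\<^sub>v v + (tw ?Y Z m * ?Y) *\<^sub>v v"
    unfolding m tw.simps using c(1) c(2)[of m] Z(1) t v by (intro add_mult_distrib_mat_vec[of _ ?d ?d]) auto
  also have "(tw ?Y Z m * ?Y) *\<^sub>v v = 0\<^sub>v ?d" using t c(1) v by (simp add: mat_vec_assoc mult_zero_vec)
  also have "(?Y ^\<^sub>m m * Z) *\<^sub>v v + 0\<^sub>v ?d = ?Y ^\<^sub>m m *\<^sub>v (Z *\<^sub>v v)"
    using c(1) Z(1) v by (simp add: mat_vec_assoc) (rule right_zero_vec[OF mult_mat_vec_carrier[OF c(2) Zv]])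
  finally have vm: "v = ?Y ^\<^sub>m m *\<^sub>v (Z *\<^sub>v v)" .
  define w where "w = ?Y ^\<^sub>m (m - k) *\<^sub>v (Z *\<^sub>v v)"
  have wc: "w \<in> carrier_vec ?d" unfolding w_def by (rule mult_mat_vec_carrier[OF c(2) Zv])
  have "v = ?Y ^\<^sub>m k *\<^sub>v w"
  proof -
    have "?Y ^\<^sub>m k *\<^sub>v w = (?Y ^\<^sub>m k * ?Y ^\<^sub>m (m - k)) *\<^sub>v (Z *\<^sub>v v)"
      unfolding w_def using c(1) Z(1) by (simp add: mat_vec_assoc)
    also have "?Y ^\<^sub>m k * ?Y ^\<^sub>m (m - k) = ?Y ^\<^sub>m m" using k m by (simp flip: pow_mat_add[OF c(1)])
    finally show ?thesis using vm by simp
  qed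
  moreover have "?Y ^\<^sub>m n *\<^sub>v w = 0\<^sub>v ?d"
  proof -
    \<comment> \<open>As y^n = g^n - 1 and \<chi>(g^n) = 1, Z commutes with y^n even if it does not
      commute with y. Thus the preimage w of v stays inside ker y^n, as the definition of
      \<open>soc\<close> requires.\<close>
    have ZY: "Z * ?Y ^\<^sub>m n = ?Y ^\<^sub>m n * Z"
    proof -
      have "Z * (?Y ^\<^sub>m n + 1\<^sub>m ?d) = (?Y ^\<^sub>m n + 1\<^sub>m ?d) * Z"
        unfolding hrepD(6)[OF fdmod_hrep[OF f]] using Z(2)[OF gn_closed] chi_gn by (auto intro!: eq_matI)
      then have *: "Z * ?Y ^\<^sub>m n + Z = ?Y ^\<^sub>m n * Z + Z"
        using Z(1) c(1) by (simp add: mat_mult_add_left mat_mult_add_right)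
      show ?thesis
      proof (rule eq_matI)
        fix i j assume "i < dim_row (?Y ^\<^sub>m n * Z)" "j < dim_col (?Y ^\<^sub>m n * Z)"
        then have "i < ?d" "j < ?d" using Z(1) c(2)[of n] by auto
        then show "(Z * ?Y ^\<^sub>m n) $$ (i, j) = (?Y ^\<^sub>m n * Z) $$ (i, j)"
          using arg_cong[OF *, of "\<lambda>A. A $$ (i, j)"] Z(1) c(2)[of n] by (simp del: index_mult_mat(1))
      qed (use Z(1) c(2)[of n] in auto)
    qed
    have "?Y ^\<^sub>m n *\<^sub>v w = (?Y ^\<^sub>m n * ?Y ^\<^sub>m (m - k)) *\<^sub>v (Z *\<^sub>v v)"
      unfolding w_def using c(1) Z(1) by (simp add: mat_vec_assoc)
    also have "?Y ^\<^sub>m n * ?Y ^\<^sub>m (m - k) = ?Y ^\<^sub>m (m - k) * ?Y ^\<^sub>m n"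
      by (simp flip: pow_mat_add[OF c(1)] add: add.commute)
    also have "(?Y ^\<^sub>m (m - k) * ?Y ^\<^sub>m n) *\<^sub>v (Z *\<^sub>v v) = ?Y ^\<^sub>m (m - k) *\<^sub>v ((?Y ^\<^sub>m n * Z) *\<^sub>v v)"
      using c(1) Z(1) v by (simp add: mat_vec_assoc)
    also have "(?Y ^\<^sub>m n * Z) *\<^sub>v v = (Z * ?Y ^\<^sub>m m) *\<^sub>v (?Y *\<^sub>v v)"
      unfolding ZY[symmetric] using c(1) Z(1) v by (simp add: m mat_vec_assoc)
    finally show ?thesis using v c(1) c(2)[of "m - k"] Z(1) by (simp add: mult_zero_vec)
  qed
  ultimately show "v \<in> soc M k" unfolding soc_def using v wc by blast
qed (auto simp: soc_def)

text \<open>For k and k + 1 both below n the two spaces are the whole of ker y, so even the chosen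
  projections coincide.\<close>

lemma phi_good:
  assumes "good_mod M" "Suc k < n"
  shows "phi k h M = 0"
  using soc_good[OF assms(1), of k] soc_good[OF assms] assms(2) by (simp add: phi_def soc_proj_def)

end

section \<open>The stable Green ring\<close>

lemma frag_extend_pointwise_add:
  "frag_extend (\<lambda>c. f c + g c) x = frag_extend f x + frag_extend g x"
  by (simp add: frag_extend_def frag_cmul_distrib2 sum.distrib)

definition frag_mult :: "('c \<Rightarrow> 'c \<Rightarrow> 'c) \<Rightarrow> ('c \<Rightarrow>\<^sub>0 int) \<Rightarrow> ('c \<Rightarrow>\<^sub>0 int) \<Rightarrow> 'c \<Rightarrow>\<^sub>0 int" where
  "frag_mult t x y = frag_extend (\<lambda>c. frag_extend (\<lambda>d. frag_of (t c d)) y) x"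

lemma frag_mult_of [simp]: "frag_mult t (frag_of c) (frag_of d) = frag_of (t c d)"
  by (simp add: frag_mult_def)

lemma frag_mult_zero [simp]: "frag_mult t 0 y = 0" "frag_mult t x 0 = 0"
  by (simp_all add: frag_mult_def frag_extend_eq_0)

lemma frag_mult_add_left: "frag_mult t (x + x') y = frag_mult t x y + frag_mult t x' y"
  by (simp add: frag_mult_def frag_extend_add)

lemma frag_mult_add_right: "frag_mult t x (y + y') = frag_mult t x y + frag_mult t x y'"
  by (simp add: frag_mult_def frag_extend_add frag_extend_pointwise_add)

lemma frag_mult_diff_left: "frag_mult t (x - x') y = frag_mult t x y - frag_mult t x' y"
  by (simp add: frag_mult_def frag_extend_diff)

lemma frag_mult_diff_right: "frag_mult t x (y - y') = frag_mult t x y - frag_mult t x y'"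
  using frag_mult_add_right[of t x "y - y'" y'] by (simp add: algebra_simps)

lemma frag_mult_keys:
  assumes "\<And>c d. c \<in> S \<Longrightarrow> d \<in> S \<Longrightarrow> t c d \<in> S"
    and x: "Poly_Mapping.keys x \<subseteq> S" and y: "Poly_Mapping.keys y \<subseteq> S"
  shows "Poly_Mapping.keys (frag_mult t x y) \<subseteq> S"
proof -
  have "Poly_Mapping.keys (frag_extend (\<lambda>d. frag_of (t c d)) y) \<subseteq> S" if "c \<in> S" for c
    using keys_frag_extend[of "\<lambda>d. frag_of (t c d)" y] that y assms(1) by fastforce
  then show ?thesis
    unfolding frag_mult_def using keys_frag_extend[of "\<lambda>c. frag_extend (\<lambda>d. frag_of (t c d)) y" x] x by fastforce
qed

text \<open>For a monoid with carrier \<open>S\<close>, product \<open>t\<close> and unit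
  \<open>e\<close> this is its integral monoid ring.\<close>

definition frag_ring :: "'c set \<Rightarrow> ('c \<Rightarrow> 'c \<Rightarrow> 'c) \<Rightarrow> 'c \<Rightarrow> ('c \<Rightarrow>\<^sub>0 int) ring" where
  "frag_ring S t e = \<lparr>carrier = {x. Poly_Mapping.keys x \<subseteq> S}, monoid.mult = frag_mult t,
     monoid.one = frag_of e, ring.zero = 0, ring.add = (+)\<rparr>"

text \<open>Each law is additive in every variable, so \<open>frag_induction\<close> reduces it to
  generators.\<close>

lemma frag_ring_ring:
  assumes t: "\<And>c d. c \<in> S \<Longrightarrow> d \<in> S \<Longrightarrow> t c d \<in> S"
    and assoc: "\<And>b c d. b \<in> S \<Longrightarrow> c \<in> S \<Longrightarrow> d \<in> S \<Longrightarrow> t (t b c) d = t b (t c d)"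
    and e: "e \<in> S" "\<And>c. c \<in> S \<Longrightarrow> t e c = c" "\<And>c. c \<in> S \<Longrightarrow> t c e = c"
  shows "ring (frag_ring S t e)"
proof (rule ringI)
  show "abelian_group (frag_ring S t e)"
  proof (rule abelian_groupI, goal_cases)
    case (1 x y)
    then show ?case using keys_add[of x y] by (auto simp: frag_ring_def)
  next
    case (6 x)
    then show ?case by (auto simp: frag_ring_def intro!: exI[of _ "- x"])
  qed (auto simp: frag_ring_def algebra_simps)
  show "monoid (frag_ring S t e)"
  proof (rule monoidI, goal_cases)
    case (1 x y)
    then show ?case using frag_mult_keys[OF t] by (auto simp: frag_ring_def)
  next
    case 2
    then show ?case using e by (simp add: frag_ring_def)
  next
    case (3 x y z)
    then have k: "Poly_Mapping.keys x \<subseteq> S" "Poly_Mapping.keys y \<subseteq> S" "Poly_Mapping.keys z \<subseteq> S"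
      by (auto simp: frag_ring_def)
    have "frag_mult t (frag_mult t x y) z = frag_mult t x (frag_mult t y z)"
      using k(1)
    proof (induction x rule: frag_induction)
      case (one b)
      show ?case using k(2)
      proof (induction y rule: frag_induction)
        case (one c)
        show ?case using k(3)
        proof (induction z rule: frag_induction)
          case (one d)
          then show ?case using assoc \<open>b \<in> S\<close> \<open>c \<in> S\<close> by simp
        qed (simp_all add: frag_mult_diff_right)
      qed (simp_all add: frag_mult_diff_right frag_mult_diff_left)
    qed (simp_all add: frag_mult_diff_left)
    then show ?case by (simp add: frag_ring_def)
  next
    case (4 x)
    then have "Poly_Mapping.keys x \<subseteq> S" by (simp add: frag_ring_def)
    then have "frag_mult t (frag_of e) x = x"
      by (induction x rule: frag_induction) (simp_all add: e frag_mult_diff_right)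
    then show ?case by (simp add: frag_ring_def)
  next
    case (5 x)
    then have "Poly_Mapping.keys x \<subseteq> S" by (simp add: frag_ring_def)
    then have "frag_mult t x (frag_of e) = x"
      by (induction x rule: frag_induction) (simp_all add: e frag_mult_diff_left)
    then show ?case by (simp add: frag_ring_def)
  qed
qed (auto simp: frag_ring_def frag_mult_add_left frag_mult_add_right)

definition frag_eval :: "('c \<Rightarrow> complex) \<Rightarrow> ('c \<Rightarrow>\<^sub>0 int) \<Rightarrow> complex" where
  "frag_eval f x = (\<Sum>c\<in>Poly_Mapping.keys x. of_int (Poly_Mapping.lookup x c) * f c)"

lemma frag_eval_superset:
  assumes "finite K" "Poly_Mapping.keys x \<subseteq> K"
  shows "frag_eval f x = (\<Sum>c\<in>K. of_int (Poly_Mapping.lookup x c) * f c)"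
  unfolding frag_eval_def using assms by (intro sum.mono_neutral_left) (auto simp: in_keys_iff)

lemma frag_eval_add: "frag_eval f (x + y) = frag_eval f x + frag_eval f y"
proof -
  let ?K = "Poly_Mapping.keys x \<union> Poly_Mapping.keys y"
  have K: "finite ?K" "Poly_Mapping.keys x \<subseteq> ?K" "Poly_Mapping.keys y \<subseteq> ?K" "Poly_Mapping.keys (x + y) \<subseteq> ?K"
    using keys_add[of x y] by auto
  show ?thesis
    unfolding frag_eval_superset[OF K(1,2)] frag_eval_superset[OF K(1,3)] frag_eval_superset[OF K(1,4)]
    by (simp add: lookup_add distrib_right sum.distrib)
qed

lemma frag_eval_zero [simp]: "frag_eval f 0 = 0"
  by (simp add: frag_eval_def)

lemma frag_eval_of [simp]: "frag_eval f (frag_of c) = f c"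
  by (simp add: frag_eval_def)

lemma frag_eval_diff: "frag_eval f (x - y) = frag_eval f x - frag_eval f y"
  using frag_eval_add[of f "x - y" y] by simp

lemma frag_eval_uminus: "frag_eval f (- x) = - frag_eval f x"
  using frag_eval_diff[of f 0 x] by simp

lemma frag_eval_cmul: "frag_eval f (frag_cmul a x) = of_int a * frag_eval f x"
proof -
  have K: "Poly_Mapping.keys (frag_cmul a x) \<subseteq> Poly_Mapping.keys x" by (rule keys_cmul)
  show ?thesis
    unfolding frag_eval_superset[OF finite_keys K] by (simp add: frag_eval_def sum_distrib_left mult_ac)
qed

context non_nilpotent_group_datum
begin

section \<open>The free Green ring and its quotients\<close>

lemma iso_class_self: "is_fdmod H M \<Longrightarrow> M \<in> iso_class M"
  by (simp add: iso_class_def mod_iso_refl)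

lemma iso_class_eq:
  assumes "mod_iso H M N" "is_fdmod H M" "is_fdmod H N"
  shows "iso_class M = iso_class N"
  unfolding iso_class_def using assms mod_iso_trans mod_iso_sym by blast

lemma iso_classes_iff: "C \<in> iso_classes \<longleftrightarrow> (\<exists>M. is_fdmod H M \<and> C = iso_class M)"
  by (auto simp: iso_classes_def)

text \<open>\<open>tensor_class\<close> unites the classes over all representatives; by
  \<open>tensor_iso\<close> they are one and the same class, so the union collapses.\<close>

lemma tensor_class_iso_class:
  assumes f: "is_fdmod H M" "is_fdmod H N"
  shows "tensor_class (iso_class M) (iso_class N) = iso_class (tensor_mod M N)"
proof -
  have "iso_class (tensor_mod M' N') = iso_class (tensor_mod M N)"
    if "M' \<in> iso_class M" "N' \<in> iso_class N" for M' N'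
    using that f by (intro iso_class_eq tensor_iso tensor_fdmod) (auto simp: iso_class_def)
  then show ?thesis using iso_class_self f unfolding tensor_class_def by blast
qed

lemma free_green_eq: "free_green = frag_ring iso_classes tensor_class (iso_class triv_mod)"
  by (simp add: free_green_def frag_ring_def frag_mult_def fun_eq_iff)

lemma free_green_ring: "ring free_green"
  unfolding free_green_eq
proof (rule frag_ring_ring)
  show "iso_class triv_mod \<in> iso_classes" using triv_fdmod by (auto simp: iso_classes_iff)
  fix c assume c: "c \<in> iso_classes"
  then obtain M where M: "is_fdmod H M" "c = iso_class M" by (auto simp: iso_classes_iff)
  show "tensor_class (iso_class triv_mod) c = c" "tensor_class c (iso_class triv_mod) = c"
    using M triv_fdmod iso_class_eq[OF triv_tensor(1)[OF M(1)]] iso_class_eq[OF triv_tensor(2)[OF M(1)]]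
    by (simp_all add: tensor_class_iso_class tensor_fdmod)
  fix d assume "d \<in> iso_classes"
  then obtain N where N: "is_fdmod H N" "d = iso_class N" by (auto simp: iso_classes_iff)
  show "tensor_class c d \<in> iso_classes"
    using M N by (auto simp: iso_classes_iff tensor_class_iso_class intro!: tensor_fdmod)
  fix e assume "e \<in> iso_classes"
  then obtain K where K: "is_fdmod H K" "e = iso_class K" by (auto simp: iso_classes_iff)
  show "tensor_class (tensor_class c d) e = tensor_class c (tensor_class d e)"
    using M N K by (simp add: tensor_class_iso_class tensor_fdmod tensor_assoc)
qed

abbreviation fcl :: "(nat \<times> 'a \<Rightarrow> complex) fdmod \<Rightarrow> (nat \<times> 'a \<Rightarrow> complex) fdmod set \<Rightarrow>\<^sub>0 int" where
  "fcl M \<equiv> frag_of (iso_class M)"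

lemma free_green_simps:
  "carrier free_green = {x. Poly_Mapping.keys x \<subseteq> iso_classes}"
  "x \<otimes>\<^bsub>free_green\<^esub> y = frag_mult tensor_class x y" "\<one>\<^bsub>free_green\<^esub> = fcl triv_mod"
  "\<zero>\<^bsub>free_green\<^esub> = 0" "x \<oplus>\<^bsub>free_green\<^esub> y = x + y"
  by (simp_all add: free_green_eq frag_ring_def)

lemma fcl_closed: "is_fdmod H M \<Longrightarrow> fcl M \<in> carrier free_green"
  by (auto simp: free_green_simps iso_classes_iff)

lemma free_green_uminus: "x \<in> carrier free_green \<Longrightarrow> \<ominus>\<^bsub>free_green\<^esub> x = - x"
proof -
  interpret ring free_green by (rule free_green_ring)
  assume x: "x \<in> carrier free_green"
  then have "- x \<in> carrier free_green" by (simp add: free_green_simps)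
  then show ?thesis using x minus_equality[of "- x" x] by (simp add: free_green_simps)
qed

lemma free_green_minus:
  "x \<in> carrier free_green \<Longrightarrow> y \<in> carrier free_green \<Longrightarrow> x \<ominus>\<^bsub>free_green\<^esub> y = x - y"
  by (simp add: a_minus_def free_green_uminus free_green_simps(5))

lemma free_green_diff_closed:
  "x \<in> carrier free_green \<Longrightarrow> y \<in> carrier free_green \<Longrightarrow> x - y \<in> carrier free_green"
  using ring.ring_simprules(4)[OF free_green_ring, of x y] by (simp add: free_green_minus)

lemma dsum_gens_closed:
  "{fcl (dsum M N) - fcl M - fcl N | M N. is_fdmod H M \<and> is_fdmod H N} \<subseteq> carrier free_green"
  by (auto intro!: free_green_diff_closed fcl_closed dsum_fdmod)

lemma dsum_ideal_ideal: "ideal dsum_ideal free_green"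
  unfolding dsum_ideal_def by (rule ring.genideal_ideal[OF free_green_ring dsum_gens_closed])

lemma green_ring_ring: "ring green_ring"
  unfolding green_ring_def by (rule ideal.quotient_is_ring[OF dsum_ideal_ideal])

lemma green_hom: "(\<lambda>x. dsum_ideal +>\<^bsub>free_green\<^esub> x) \<in> Ring.ring_hom free_green green_ring"
  unfolding green_ring_def by (rule ideal.rcos_ring_hom[OF dsum_ideal_ideal])

lemma green_class_closed: "is_fdmod H M \<Longrightarrow> green_class M \<in> carrier green_ring"
  unfolding green_class_def using ring_hom_closed[OF green_hom] fcl_closed by blast

lemma proj_gens_closed: "{green_class P | P. indecomposable_mod H P \<and> projective_mod H P} \<subseteq> carrier green_ring"
  by (auto intro!: green_class_closed simp: projective_mod_def)

lemma proj_ideal_ideal: "ideal proj_ideal green_ring"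
  unfolding proj_ideal_def by (rule ring.genideal_ideal[OF green_ring_ring proj_gens_closed])

lemma stable_green_ring_ring: "ring stable_green_ring"
  unfolding stable_green_ring_def by (rule ideal.quotient_is_ring[OF proj_ideal_ideal])

definition stab :: "((nat \<times> 'a \<Rightarrow> complex) fdmod set \<Rightarrow>\<^sub>0 int) \<Rightarrow> ((nat \<times> 'a \<Rightarrow> complex) fdmod set \<Rightarrow>\<^sub>0 int) set set" where
  "stab x = proj_ideal +>\<^bsub>green_ring\<^esub> (dsum_ideal +>\<^bsub>free_green\<^esub> x)"

lemma stable_class_eq: "stable_class M = stab (fcl M)"
  by (simp add: stable_class_def green_class_def stab_def)

lemma stab_hom: "stab \<in> Ring.ring_hom free_green stable_green_ring"
proof -
  have "(\<lambda>x. proj_ideal +>\<^bsub>green_ring\<^esub> x) \<in> Ring.ring_hom green_ring stable_green_ring"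
    unfolding stable_green_ring_def by (rule ideal.rcos_ring_hom[OF proj_ideal_ideal])
  from ring_hom_trans[OF green_hom this] show ?thesis
    by (simp add: stab_def[abs_def] comp_def)
qed

lemma stable_class_closed: "is_fdmod H M \<Longrightarrow> stable_class M \<in> carrier stable_green_ring"
  unfolding stable_class_eq using ring_hom_closed[OF stab_hom] fcl_closed by blast

lemma stable_class_tensor:
  assumes "is_fdmod H M" "is_fdmod H N"
  shows "stable_class (tensor_mod M N) = stable_class M \<otimes>\<^bsub>stable_green_ring\<^esub> stable_class N"
  using ring_hom_mult[OF stab_hom fcl_closed fcl_closed, OF assms] assms
  by (simp add: stable_class_eq free_green_simps tensor_class_iso_class)

lemma stable_class_triv: "stable_class triv_mod = \<one>\<^bsub>stable_green_ring\<^esub>"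
  using ring_hom_one[OF stab_hom] by (simp add: stable_class_eq free_green_simps)

lemma stable_class_iso:
  "mod_iso H M N \<Longrightarrow> is_fdmod H M \<Longrightarrow> is_fdmod H N \<Longrightarrow> stable_class M = stable_class N"
  by (simp add: stable_class_eq iso_class_eq)

lemma stable_class_dsum:
  assumes f: "is_fdmod H M" "is_fdmod H N"
  shows "stable_class (dsum M N) = stable_class M \<oplus>\<^bsub>stable_green_ring\<^esub> stable_class N"
proof -
  interpret F: ring free_green by (rule free_green_ring)
  have c: "fcl (dsum M N) \<in> carrier free_green" "fcl M \<oplus>\<^bsub>free_green\<^esub> fcl N \<in> carrier free_green"
    using f by (auto intro!: fcl_closed dsum_fdmod)
  have "fcl (dsum M N) \<ominus>\<^bsub>free_green\<^esub> (fcl M \<oplus>\<^bsub>free_green\<^esub> fcl N) = fcl (dsum M N) - fcl M - fcl N"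
    using c by (simp add: free_green_minus) (simp add: free_green_simps)
  also have "\<dots> \<in> dsum_ideal"
    using F.genideal_self[OF dsum_gens_closed] f unfolding dsum_ideal_def by blast
  finally have "dsum_ideal +>\<^bsub>free_green\<^esub> fcl (dsum M N) = dsum_ideal +>\<^bsub>free_green\<^esub> (fcl M \<oplus>\<^bsub>free_green\<^esub> fcl N)"
    using F.quotient_eq_iff_same_a_r_cos[OF dsum_ideal_ideal c] by simp
  then have "stab (fcl (dsum M N)) = stab (fcl M \<oplus>\<^bsub>free_green\<^esub> fcl N)" by (simp add: stab_def)
  then show ?thesis
    using ring_hom_add[OF stab_hom fcl_closed fcl_closed, OF f] by (simp add: stable_class_eq)
qed

lemma stab_eq_zero_iff:
  assumes x: "x \<in> carrier free_green"
  shows "stab x = \<zero>\<^bsub>stable_green_ring\<^esub> \<longleftrightarrow> dsum_ideal +>\<^bsub>free_green\<^esub> x \<in> proj_ideal"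
proof -
  interpret R: ring green_ring by (rule green_ring_ring)
  have z: "\<zero>\<^bsub>stable_green_ring\<^esub> = proj_ideal" by (simp add: stable_green_ring_def FactRing_def)
  have c: "dsum_ideal +>\<^bsub>free_green\<^esub> x \<in> carrier green_ring" using ring_hom_closed[OF green_hom x] .
  have s: "subgroup proj_ideal (add_monoid green_ring)"
    by (rule proj_ideal_ideal[THEN ideal.axioms(1), THEN additive_subgroup.a_subgroup])
  show ?thesis
    unfolding stab_def z using R.a_coset_join1[OF _ c s] R.a_coset_join2[OF c s] by auto
qed

lemma stable_class_projective:
  assumes "indecomposable_mod H P" "projective_mod H P"
  shows "stable_class P = \<zero>\<^bsub>stable_green_ring\<^esub>"
proof -
  interpret R: ring green_ring by (rule green_ring_ring)
  have "green_class P \<in> proj_ideal"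
    using R.genideal_self[OF proj_gens_closed] assms unfolding proj_ideal_def by blast
  moreover have "fcl P \<in> carrier free_green" using assms by (intro fcl_closed) (simp add: projective_mod_def)
  ultimately show ?thesis by (simp add: stable_class_eq stab_eq_zero_iff green_class_def)
qed

section \<open>Descent of the functionals to the stable Green ring\<close>

definition phi_class :: "nat \<Rightarrow> 'a \<Rightarrow> (nat \<times> 'a \<Rightarrow> complex) fdmod set \<Rightarrow> complex" where
  "phi_class k h C = phi k h (SOME M. M \<in> C)"

lemma phi_class_eq:
  assumes "is_fdmod H M" "h \<in> carrier G"
  shows "phi_class k h (iso_class M) = phi k h M"
proof -
  have "(SOME N. N \<in> iso_class M) \<in> iso_class M" using iso_class_self[OF assms(1)] by (rule someI)
  then show ?thesis unfolding phi_class_def using assms by (auto simp: iso_class_def intro!: phi_iso)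
qed

text \<open>The largest two-sided ideal on which all the functionals vanish. The common kernel of
  additive functionals need not be an ideal; the factors y and z on the two sides repair
  this.\<close>

definition phi_kernel :: "((nat \<times> 'a \<Rightarrow> complex) fdmod set \<Rightarrow>\<^sub>0 int) set" where
  "phi_kernel = {x \<in> carrier free_green. \<forall>y\<in>carrier free_green. \<forall>z\<in>carrier free_green.
     \<forall>k. Suc k < n \<longrightarrow> (\<forall>h\<in>carrier G. frag_eval (phi_class k h) (y \<otimes>\<^bsub>free_green\<^esub> x \<otimes>\<^bsub>free_green\<^esub> z) = 0)}"

lemma phi_kernel_ideal: "ideal phi_kernel free_green"
proof (rule idealI)
  interpret F: ring free_green by (rule free_green_ring)
  show "ring free_green" by (rule free_green_ring)
  show "subgroup phi_kernel (add_monoid free_green)"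
  proof (rule group.subgroupI[OF F.a_group])
    show "phi_kernel \<subseteq> carrier (add_monoid free_green)" by (auto simp: phi_kernel_def)
    have "0 \<in> phi_kernel" by (simp add: phi_kernel_def free_green_simps)
    then show "phi_kernel \<noteq> {}" by auto
    fix a assume a: "a \<in> phi_kernel"
    then have ac: "a \<in> carrier free_green" by (simp add: phi_kernel_def)
    have "- a \<in> phi_kernel"
      using a ac F.a_inv_closed[OF ac] F.l_minus F.r_minus
      by (auto simp: phi_kernel_def free_green_uminus[symmetric] frag_eval_uminus)
        (metis F.m_closed free_green_uminus frag_eval_uminus neg_equal_0_iff_equal)
    then show "inv\<^bsub>add_monoid free_green\<^esub> a \<in> phi_kernel"
      using free_green_uminus[OF ac] by (simp add: a_inv_def)
    fix b assume b: "b \<in> phi_kernel"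
    then have bc: "b \<in> carrier free_green" by (simp add: phi_kernel_def)
    have "a \<oplus>\<^bsub>free_green\<^esub> b \<in> phi_kernel"
      using a b ac bc by (auto simp: phi_kernel_def F.l_distr F.r_distr)
        (simp add: free_green_simps(5) frag_eval_add)
    then show "a \<otimes>\<^bsub>add_monoid free_green\<^esub> b \<in> phi_kernel" by simp
  qed
  fix a x assume a: "a \<in> phi_kernel" and x: "x \<in> carrier free_green"
  then have ac: "a \<in> carrier free_green" by (simp add: phi_kernel_def)
  have "y \<otimes>\<^bsub>free_green\<^esub> (x \<otimes>\<^bsub>free_green\<^esub> a) \<otimes>\<^bsub>free_green\<^esub> z = (y \<otimes>\<^bsub>free_green\<^esub> x) \<otimes>\<^bsub>free_green\<^esub> a \<otimes>\<^bsub>free_green\<^esub> z"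
    "y \<otimes>\<^bsub>free_green\<^esub> (a \<otimes>\<^bsub>free_green\<^esub> x) \<otimes>\<^bsub>free_green\<^esub> z = y \<otimes>\<^bsub>free_green\<^esub> a \<otimes>\<^bsub>free_green\<^esub> (x \<otimes>\<^bsub>free_green\<^esub> z)"
    if "y \<in> carrier free_green" "z \<in> carrier free_green" for y z
    using that x ac by (simp_all add: F.m_assoc)
  then show "x \<otimes>\<^bsub>free_green\<^esub> a \<in> phi_kernel" "a \<otimes>\<^bsub>free_green\<^esub> x \<in> phi_kernel"
    using a x ac by (auto simp: phi_kernel_def)
qed

text \<open>The condition is additive in y and in z, so for these it suffices to test classes of
  modules.\<close>

lemma phi_kernelI:
  assumes x: "x \<in> carrier free_green"
    and v: "\<And>A B k h. is_fdmod H A \<Longrightarrow> is_fdmod H B \<Longrightarrow> Suc k < n \<Longrightarrow> h \<in> carrier G \<Longrightarrow>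
      frag_eval (phi_class k h) (frag_mult tensor_class (frag_mult tensor_class (fcl A) x) (fcl B)) = 0"
  shows "x \<in> phi_kernel"
  unfolding phi_kernel_def
proof (intro CollectI conjI ballI allI impI x)
  fix y z k h assume yz: "y \<in> carrier free_green" "z \<in> carrier free_green" and k: "Suc k < n" "h \<in> carrier G"
  have ky: "Poly_Mapping.keys y \<subseteq> iso_classes" and kz: "Poly_Mapping.keys z \<subseteq> iso_classes"
    using yz by (auto simp: free_green_simps)
  show "frag_eval (phi_class k h) (y \<otimes>\<^bsub>free_green\<^esub> x \<otimes>\<^bsub>free_green\<^esub> z) = 0"
    unfolding free_green_simps using ky
  proof (induction y rule: frag_induction)
    case (one a)
    show ?case using kz
    proof (induction z rule: frag_induction)
      case (one b)
      then show ?case using v k \<open>a \<in> iso_classes\<close> by (auto simp: iso_classes_iff)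
    qed (simp_all add: frag_mult_diff_right frag_eval_diff)
  qed (simp_all add: frag_mult_diff_left frag_eval_diff)
qed

lemma phi_tensor_dsum:
  assumes f: "is_fdmod H A" "is_fdmod H M" "is_fdmod H N" "is_fdmod H B" and h: "h \<in> carrier G"
  shows "phi k h (tensor_mod (tensor_mod A (dsum M N)) B)
    = phi k h (tensor_mod (tensor_mod A M) B) + phi k h (tensor_mod (tensor_mod A N) B)"
proof -
  have "mod_iso H (tensor_mod (tensor_mod A (dsum M N)) B) (tensor_mod (dsum (tensor_mod A M) (tensor_mod A N)) B)"
    using f by (intro tensor_iso tensor_fdmod dsum_fdmod mod_iso_refl tensor_dsum_right)
  then have "phi k h (tensor_mod (tensor_mod A (dsum M N)) B)
      = phi k h (tensor_mod (dsum (tensor_mod A M) (tensor_mod A N)) B)"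
    using f h by (intro phi_iso tensor_fdmod dsum_fdmod)
  also have "\<dots> = phi k h (dsum (tensor_mod (tensor_mod A M) B) (tensor_mod (tensor_mod A N) B))"
    using f h by (intro phi_iso tensor_dsum_left tensor_fdmod dsum_fdmod)
  also have "\<dots> = phi k h (tensor_mod (tensor_mod A M) B) + phi k h (tensor_mod (tensor_mod A N) B)"
    using f h by (intro phi_dsum tensor_fdmod)
  finally show ?thesis .
qed

lemma dsum_ideal_subset: "dsum_ideal \<subseteq> phi_kernel"
  unfolding dsum_ideal_def
proof (rule ring.genideal_minimal[OF free_green_ring phi_kernel_ideal], safe)
  fix M N assume f: "is_fdmod H M" "is_fdmod H N"
  show "fcl (dsum M N) - fcl M - fcl N \<in> phi_kernel"
  proof (rule phi_kernelI)
    show "fcl (dsum M N) - fcl M - fcl N \<in> carrier free_green" using f dsum_gens_closed by blast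
    fix A B k h assume *: "is_fdmod H A" "is_fdmod H B" "Suc k < n" "h \<in> carrier G"
    have t: "frag_mult tensor_class (frag_mult tensor_class (fcl A) (fcl K)) (fcl B)
        = fcl (tensor_mod (tensor_mod A K) B)" if "is_fdmod H K" for K
      using that * by (simp add: tensor_class_iso_class tensor_fdmod)
    show "frag_eval (phi_class k h) (frag_mult tensor_class (frag_mult tensor_class (fcl A)
        (fcl (dsum M N) - fcl M - fcl N)) (fcl B)) = 0"
      using f * dsum_fdmod[OF f]
      by (simp add: frag_mult_diff_left frag_mult_diff_right t frag_eval_diff phi_class_eq tensor_fdmod
          phi_tensor_dsum del: frag_mult_of)
  qed
qed

text \<open>The two-sided stability of \<open>good_mod\<close> is used here: A \<otimes> P \<otimes>
  B is good for every projective P, so the functionals vanish on its class.\<close>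

lemma proj_ideal_subset: "proj_ideal \<subseteq> (\<lambda>x. dsum_ideal +>\<^bsub>free_green\<^esub> x) ` phi_kernel"
  unfolding proj_ideal_def
proof (rule ring.genideal_minimal[OF green_ring_ring])
  show "ideal ((\<lambda>x. dsum_ideal +>\<^bsub>free_green\<^esub> x) ` phi_kernel) green_ring"
    unfolding green_ring_def
    by (rule ring.ring_ideal_imp_quot_ideal[OF free_green_ring dsum_ideal_ideal phi_kernel_ideal])
  have "fcl P \<in> phi_kernel" if P: "projective_mod H P" for P
  proof (rule phi_kernelI)
    have f: "is_fdmod H P" and g: "good_mod P" using P projective_good by (auto simp: projective_mod_def)
    show "fcl P \<in> carrier free_green" using f by (rule fcl_closed)
    fix A B k h assume *: "is_fdmod H A" "is_fdmod H B" "Suc k < n" "h \<in> carrier G"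
    have "good_mod (tensor_mod (tensor_mod A P) B)"
      using * g by (intro good_tensor_left good_tensor_right)
    then show "frag_eval (phi_class k h) (frag_mult tensor_class (frag_mult tensor_class (fcl A) (fcl P)) (fcl B)) = 0"
      using * f by (simp add: tensor_class_iso_class tensor_fdmod phi_class_eq phi_good)
  qed
  then show "{green_class P | P. indecomposable_mod H P \<and> projective_mod H P}
      \<subseteq> (\<lambda>x. dsum_ideal +>\<^bsub>free_green\<^esub> x) ` phi_kernel"
    by (auto simp: green_class_def)
qed

lemma stab_zero_phi:
  assumes x: "x \<in> carrier free_green" "stab x = \<zero>\<^bsub>stable_green_ring\<^esub>" and k: "Suc k < n" "h \<in> carrier G"
  shows "frag_eval (phi_class k h) x = 0"
proof -
  interpret F: ring free_green by (rule free_green_ring)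
  have "dsum_ideal +>\<^bsub>free_green\<^esub> x \<in> proj_ideal" using stab_eq_zero_iff[OF x(1)] x(2) by blast
  then obtain y where y: "y \<in> phi_kernel" "dsum_ideal +>\<^bsub>free_green\<^esub> x = dsum_ideal +>\<^bsub>free_green\<^esub> y"
    using proj_ideal_subset by blast
  then have yc: "y \<in> carrier free_green" by (simp add: phi_kernel_def)
  have "x \<ominus>\<^bsub>free_green\<^esub> y \<in> phi_kernel"
    using F.quotient_eq_iff_same_a_r_cos[OF dsum_ideal_ideal x(1) yc] y dsum_ideal_subset by auto
  then have "(x \<ominus>\<^bsub>free_green\<^esub> y) \<oplus>\<^bsub>free_green\<^esub> y \<in> phi_kernel" 
    using y(1) by (rule additive_subgroup.a_closed[OF ideal.axioms(1)[OF phi_kernel_ideal]])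
  moreover have "(x \<ominus>\<^bsub>free_green\<^esub> y) \<oplus>\<^bsub>free_green\<^esub> y = x"
    using x(1) yc by (simp add: free_green_minus) (simp add: free_green_simps)
  ultimately have "x \<in> phi_kernel" by simp
  \<comment> \<open>Taking the unit on both sides turns membership in \<open>phi_kernel\<close> into
    the vanishing of the functional at x itself.\<close>
  then have "frag_eval (phi_class k h) (\<one>\<^bsub>free_green\<^esub> \<otimes>\<^bsub>free_green\<^esub> x \<otimes>\<^bsub>free_green\<^esub> \<one>\<^bsub>free_green\<^esub>) = 0"
    using k F.one_closed unfolding phi_kernel_def by blast
  then show ?thesis using x(1) by simp
qed

end

section \<open>Representations of the group\<close>

lemma lin_insert:
  assumes "finite S" "s \<notin> S" "X s \<in> carrier_mat nr nc"
  shows "lin nr nc (insert s S) a X = a s \<cdot>\<^sub>m X s + lin nr nc S a X"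
  using assms by (intro eq_matI) auto

lemma lin_mult_vec_closed:
  assumes W: "vec_subspace nr W" and S: "finite S" and X: "\<And>s. s \<in> S \<Longrightarrow> X s \<in> carrier_mat nr nc"
    and v: "v \<in> carrier_vec nc" "\<And>s. s \<in> S \<Longrightarrow> X s *\<^sub>v v \<in> W"
  shows "lin nr nc S a X *\<^sub>v v \<in> W"
  using S X v(2)
proof (induction S)
  case empty
  have "lin nr nc {} a X *\<^sub>v v = 0\<^sub>v nr" using v by (intro eq_vecI) (auto simp: scalar_prod_def)
  then show ?case using W by (simp add: vec_subspace_def)
next
  case (insert s S)
  have "lin nr nc (insert s S) a X *\<^sub>v v = (a s \<cdot>\<^sub>m X s) *\<^sub>v v + lin nr nc S a X *\<^sub>v v"
    unfolding lin_insert[where X = X, OF insert(1,2) insert(4)[OF insertI1]]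
    using insert v by (intro add_mult_distrib_mat_vec[of _ nr nc]) auto
  also have "(a s \<cdot>\<^sub>m X s) *\<^sub>v v = a s \<cdot>\<^sub>v (X s *\<^sub>v v)"
    using insert(4)[OF insertI1] v by (intro eq_vecI) (auto simp: smult_scalar_prod_distrib[of _ nc])
  finally show ?case using insert W by (simp add: vec_subspace_def)
qed

lemma injective_surjective_inverse:
  fixes T :: "complex mat"
  assumes T: "T \<in> carrier_mat m d"
    and inj: "\<And>v. v \<in> carrier_vec d \<Longrightarrow> T *\<^sub>v v = 0\<^sub>v m \<Longrightarrow> v = 0\<^sub>v d"
    and surj: "\<And>w. w \<in> carrier_vec m \<Longrightarrow> \<exists>v\<in>carrier_vec d. T *\<^sub>v v = w"
  obtains S where "S \<in> carrier_mat d m" "T * S = 1\<^sub>m m" "S * T = 1\<^sub>m d"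
proof -
  obtain f where f: "\<And>j. f j \<in> carrier_vec d" "\<And>j. T *\<^sub>v f j = unit_vec m j"
    using surj[OF unit_vec_carrier] by metis
  define S where "S = mat d m (\<lambda>(r, c). f c $ r)"
  have S: "S \<in> carrier_mat d m" by (simp add: S_def)
  have "col S j = f j" if "j < m" for j
    using that f(1)[of j] by (intro eq_vecI) (auto simp: S_def)
  then have TS: "T * S = 1\<^sub>m m"
    using T S by (intro eq_matI) (auto simp flip: index_mult_mat_vec simp: f unit_vec_def)
  have "S * T = 1\<^sub>m d"
  proof (rule mat_eq_vecI[of _ d d])
    fix v :: "complex vec" assume v: "v \<in> carrier_vec d"
    define u where "u = S *\<^sub>v (T *\<^sub>v v) + (-1) \<cdot>\<^sub>v v"
    have u: "u \<in> carrier_vec d" using S T v by (auto simp: u_def)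
    have "T *\<^sub>v (S *\<^sub>v (T *\<^sub>v v)) = (T * S) *\<^sub>v (T *\<^sub>v v)" using S T v by (simp add: mat_vec_assoc)
    then have "T *\<^sub>v u = T *\<^sub>v v + (-1) \<cdot>\<^sub>v (T *\<^sub>v v)"
      using S T v by (simp add: u_def mult_add_distrib_mat_vec[of _ m d] mult_mat_vec[of _ m d] TS)
    then have "T *\<^sub>v u = 0\<^sub>v m" using T v by (auto intro!: eq_vecI)
    then have u0: "u = 0\<^sub>v d" by (rule inj[OF u])
    have "S *\<^sub>v (T *\<^sub>v v) = v"
    proof (rule eq_vecI)
      fix i assume "i < dim_vec v"
      then show "(S *\<^sub>v (T *\<^sub>v v)) $ i = v $ i"
        using arg_cong[OF u0, of "\<lambda>w. w $ i"] S T v by (simp add: u_def del: index_mult_mat_vec)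
    qed (use S v in simp)
    then show "(S * T) *\<^sub>v v = 1\<^sub>m d *\<^sub>v v" using S T v by (simp add: mat_vec_assoc)
  qed (use S T in auto)
  then show ?thesis using that S TS by blast
qed

context non_nilpotent_group_datum
begin

definition grp_rep :: "nat \<Rightarrow> ('a \<Rightarrow> complex mat) \<Rightarrow> bool" where
  "grp_rep d \<rho> \<longleftrightarrow> (\<forall>h\<in>carrier G. \<rho> h \<in> carrier_mat d d) \<and> \<rho> \<one> = 1\<^sub>m d \<and>
     (\<forall>h\<in>carrier G. \<forall>k\<in>carrier G. \<rho> (h \<otimes> k) = \<rho> h * \<rho> k)"

definition gact :: "('a \<Rightarrow> complex) fdmod \<Rightarrow> 'a \<Rightarrow> complex mat" where
  "gact U h = act U (unit_coord h)"

definition kg_mod :: "nat \<Rightarrow> ('a \<Rightarrow> complex mat) \<Rightarrow> ('a \<Rightarrow> complex) fdmod" where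
  "kg_mod d \<rho> = FDMod d (\<lambda>a. lin d d (carrier G) a \<rho>)"

lemma grp_repD:
  assumes "grp_rep d \<rho>"
  shows "h \<in> carrier G \<Longrightarrow> \<rho> h \<in> carrier_mat d d" "\<rho> \<one> = 1\<^sub>m d"
    "h \<in> carrier G \<Longrightarrow> k \<in> carrier G \<Longrightarrow> \<rho> (h \<otimes> k) = \<rho> h * \<rho> k"
  using assms by (auto simp: grp_rep_def)

lemma kg_mod_mdim [simp]: "mdim (kg_mod d \<rho>) = d"
  by (simp add: kg_mod_def)

lemma kg_mod_gact: "grp_rep d \<rho> \<Longrightarrow> h \<in> carrier G \<Longrightarrow> gact (kg_mod d \<rho>) h = \<rho> h"
  by (simp add: gact_def kg_mod_def lin_unit_coord finite_G grp_repD)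

lemma kg_mod_fdmod:
  assumes r: "grp_rep d \<rho>"
  shows "is_fdmod kG (kg_mod d \<rho>)"
  unfolding kG_def kg_mod_def
proof (rule based_algebra_fdmodI[OF finite_G])
  show "\<rho> x * \<rho> y = lin d d (carrier G) (unit_coord (x \<otimes> y)) \<rho>" if "x \<in> carrier G" "y \<in> carrier G" for x y
    using that lin_unit_coord[where X = \<rho>, OF finite_G m_closed[OF that] grp_repD(1)[OF r m_closed[OF that]]] grp_repD(3)[OF r] by simp
  show "lin d d (carrier G) (unit_coord \<one>) \<rho> = 1\<^sub>m d"
    using lin_unit_coord[where X = \<rho>, OF finite_G one_closed grp_repD(1)[OF r one_closed]] grp_repD(2)[OF r] by simp
qed (use grp_repD(1)[OF r] in auto)

lemma kG_unit_closed: "h \<in> carrier G \<Longrightarrow> unit_coord h \<in> carrier kG"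
  by (auto simp: kG_def based_algebra_def unit_coord_def)

lemma fdmod_grp_rep:
  assumes U: "is_fdmod kG U"
  shows "grp_rep (mdim U) (gact U)"
  unfolding grp_rep_def
proof (intro conjI ballI)
  fix h assume h: "h \<in> carrier G"
  show "gact U h \<in> carrier_mat (mdim U) (mdim U)"
    using U kG_unit_closed[OF h] by (auto simp: gact_def is_fdmod_def)
  fix k assume k: "k \<in> carrier G"
  have "unit_coord h \<otimes>\<^bsub>kG\<^esub> unit_coord k = unit_coord (h \<otimes> k)"
    unfolding kG_def using h k by (intro based_algebra_mult_unit_coord finite_G)
  moreover have "act U (unit_coord h \<otimes>\<^bsub>kG\<^esub> unit_coord k) = act U (unit_coord h) * act U (unit_coord k)"
    using U kG_unit_closed[OF h] kG_unit_closed[OF k] unfolding is_fdmod_def by blast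
  ultimately show "gact U (h \<otimes> k) = gact U h * gact U k" by (simp add: gact_def)
next
  show "gact U \<one> = 1\<^sub>m (mdim U)"
    using U by (auto simp: gact_def is_fdmod_def kG_def based_algebra_def)
qed

lemma fdmod_act_lin:
  "is_fdmod kG U \<Longrightarrow> a \<in> carrier kG \<Longrightarrow> act U a = lin (mdim U) (mdim U) (carrier G) a (gact U)"
  using based_algebra_act[OF _ finite_G] unfolding kG_def gact_def by blast

lemma kG_mod_hom_iff:
  assumes "is_fdmod kG M" "is_fdmod kG N"
  shows "T \<in> mod_hom kG M N \<longleftrightarrow> T \<in> carrier_mat (mdim N) (mdim M) \<and>
    (\<forall>h\<in>carrier G. T * gact M h = gact N h * T)"
  using based_algebra_mod_hom_iff[OF _ _ finite_G] assms unfolding kG_def gact_def by blast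

lemma submod_kG_iff:
  assumes U: "is_fdmod kG U"
  shows "submod kG W U \<longleftrightarrow> vec_subspace (mdim U) W \<and> (\<forall>h\<in>carrier G. \<forall>v\<in>W. gact U h *\<^sub>v v \<in> W)"
proof
  assume "submod kG W U"
  then show "vec_subspace (mdim U) W \<and> (\<forall>h\<in>carrier G. \<forall>v\<in>W. gact U h *\<^sub>v v \<in> W)"
    by (auto simp: submod_def vec_subspace_def gact_def kG_unit_closed)
next
  assume *: "vec_subspace (mdim U) W \<and> (\<forall>h\<in>carrier G. \<forall>v\<in>W. gact U h *\<^sub>v v \<in> W)"
  have "act U a *\<^sub>v v \<in> W" if "a \<in> carrier kG" "v \<in> W" for a v
    unfolding fdmod_act_lin[OF U that(1)]
    using * that grp_repD(1)[OF fdmod_grp_rep[OF U]]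
    by (intro lin_mult_vec_closed finite_G) (auto simp: vec_subspace_def)
  then show "submod kG W U" using * by (auto simp: submod_def vec_subspace_def)
qed

section \<open>Schur's lemma\<close>

lemma kG_hom_kernel_submod:
  assumes f: "is_fdmod kG M" "is_fdmod kG N" and T: "T \<in> mod_hom kG M N"
  shows "submod kG {v \<in> carrier_vec (mdim M). T *\<^sub>v v = 0\<^sub>v (mdim N)} M"
proof -
  have Tc: "T \<in> carrier_mat (mdim N) (mdim M)" "\<And>h. h \<in> carrier G \<Longrightarrow> T * gact M h = gact N h * T"
    using T by (auto simp: kG_mod_hom_iff f)
  note cM = grp_repD(1)[OF fdmod_grp_rep[OF f(1)]] and cN = grp_repD(1)[OF fdmod_grp_rep[OF f(2)]]
  have "T *\<^sub>v (gact M h *\<^sub>v v) = 0\<^sub>v (mdim N)"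
    if h: "h \<in> carrier G" and v: "v \<in> carrier_vec (mdim M)" "T *\<^sub>v v = 0\<^sub>v (mdim N)" for h v
  proof -
    have "T *\<^sub>v (gact M h *\<^sub>v v) = (T * gact M h) *\<^sub>v v" using Tc(1) cM[OF h] v(1) by (simp add: mat_vec_assoc)
    also have "\<dots> = gact N h *\<^sub>v (T *\<^sub>v v)" unfolding Tc(2)[OF h] using Tc(1) cN[OF h] v(1) by (simp add: mat_vec_assoc)
    finally show ?thesis using v(2) cN[OF h] by (simp add: mult_zero_vec)
  qed
  then show ?thesis
    unfolding submod_kG_iff[OF f(1)] vec_subspace_def using Tc(1) cM
    by (auto simp: mult_zero_vec mult_add_distrib_mat_vec[of _ "mdim N" "mdim M"] mult_mat_vec[of _ "mdim N" "mdim M"]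
        intro: mult_mat_vec_carrier[of _ "mdim M" "mdim M"])
qed

lemma kG_hom_image_submod:
  assumes f: "is_fdmod kG M" "is_fdmod kG N" and T: "T \<in> mod_hom kG M N"
  shows "submod kG ((\<lambda>v. T *\<^sub>v v) ` carrier_vec (mdim M)) N"
  unfolding submod_kG_iff[OF f(2)] vec_subspace_def
proof (intro conjI ballI allI)
  have Tc: "T \<in> carrier_mat (mdim N) (mdim M)" "\<And>h. h \<in> carrier G \<Longrightarrow> T * gact M h = gact N h * T"
    using T by (auto simp: kG_mod_hom_iff f)
  note cM = grp_repD(1)[OF fdmod_grp_rep[OF f(1)]] and cN = grp_repD(1)[OF fdmod_grp_rep[OF f(2)]]
  let ?W = "(\<lambda>v. T *\<^sub>v v) ` carrier_vec (mdim M)"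
  show "?W \<subseteq> carrier_vec (mdim N)" using Tc by (auto intro: mult_mat_vec_carrier)
  show "0\<^sub>v (mdim N) \<in> ?W" using Tc(1) by (intro image_eqI[of _ _ "0\<^sub>v (mdim M)"]) (auto simp: mult_zero_vec)
  fix v assume "v \<in> ?W"
  then obtain u where u: "u \<in> carrier_vec (mdim M)" "v = T *\<^sub>v u" by auto
  show "c \<cdot>\<^sub>v v \<in> ?W" for c
    using u Tc(1) by (intro image_eqI[of _ _ "c \<cdot>\<^sub>v u"]) (auto simp: mult_mat_vec[of _ "mdim N" "mdim M"])
  show "gact N h *\<^sub>v v \<in> ?W" if h: "h \<in> carrier G" for h
  proof (rule image_eqI)
    have "gact N h *\<^sub>v v = (gact N h * T) *\<^sub>v u" unfolding u(2) using Tc(1) cN[OF h] u(1) by (simp add: mat_vec_assoc)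
    then show "gact N h *\<^sub>v v = T *\<^sub>v (gact M h *\<^sub>v u)"
      unfolding Tc(2)[OF h, symmetric] using Tc(1) cM[OF h] u(1) by (simp add: mat_vec_assoc)
    show "gact M h *\<^sub>v u \<in> carrier_vec (mdim M)" using cM[OF h] u by simp
  qed
  fix v' assume "v' \<in> ?W"
  then obtain u' where u': "u' \<in> carrier_vec (mdim M)" "v' = T *\<^sub>v u'" by auto
  show "v + v' \<in> ?W"
    using u u' Tc(1) by (intro image_eqI[of _ _ "u + u'"]) (auto simp: mult_add_distrib_mat_vec[of _ "mdim N" "mdim M"])
qed

lemma schur:
  assumes s: "simple_mod kG M" "simple_mod kG N" and T: "T \<in> mod_hom kG M N" and nz: "T \<noteq> 0\<^sub>m (mdim N) (mdim M)"
  obtains S where "S \<in> mod_hom kG N M" "T * S = 1\<^sub>m (mdim N)" "S * T = 1\<^sub>m (mdim M)"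
proof -
  have f: "is_fdmod kG M" "is_fdmod kG N" using s by (auto simp: simple_mod_def)
  have Tc: "T \<in> carrier_mat (mdim N) (mdim M)" "\<And>h. h \<in> carrier G \<Longrightarrow> T * gact M h = gact N h * T"
    using T by (auto simp: kG_mod_hom_iff f)
  note cM = grp_repD(1)[OF fdmod_grp_rep[OF f(1)]] and cN = grp_repD(1)[OF fdmod_grp_rep[OF f(2)]]
  let ?K = "{v \<in> carrier_vec (mdim M). T *\<^sub>v v = 0\<^sub>v (mdim N)}" and ?I = "(\<lambda>v. T *\<^sub>v v) ` carrier_vec (mdim M)"
  have ne: "\<not> (\<forall>v\<in>carrier_vec (mdim M). T *\<^sub>v v = 0\<^sub>v (mdim N))"
  proof
    assume *: "\<forall>v\<in>carrier_vec (mdim M). T *\<^sub>v v = 0\<^sub>v (mdim N)"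
    have "T = 0\<^sub>m (mdim N) (mdim M)"
      using Tc(1) * by (intro mat_eq_vecI[of _ "mdim N" "mdim M"]) (auto intro!: eq_vecI simp: scalar_prod_def)
    then show False using nz by simp
  qed
  have K: "?K = {0\<^sub>v (mdim M)}"
    using s(1) kG_hom_kernel_submod[OF f T] ne unfolding simple_mod_def by blast
  have "?I \<noteq> {0\<^sub>v (mdim N)}" using ne by auto
  then have I: "?I = carrier_vec (mdim N)"
    using s(2) kG_hom_image_submod[OF f T] unfolding simple_mod_def by blast
  obtain S where S: "S \<in> carrier_mat (mdim M) (mdim N)" "T * S = 1\<^sub>m (mdim N)" "S * T = 1\<^sub>m (mdim M)"
  proof (rule injective_surjective_inverse[OF Tc(1)])
    show "v = 0\<^sub>v (mdim M)" if "v \<in> carrier_vec (mdim M)" "T *\<^sub>v v = 0\<^sub>v (mdim N)" for v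
      using K that by blast
    show "\<exists>v\<in>carrier_vec (mdim M). T *\<^sub>v v = w" if "w \<in> carrier_vec (mdim N)" for w
    proof -
      have "w \<in> ?I" using I that by simp
      then show ?thesis by auto
    qed
  qed
  have "S * gact N h = gact M h * S" if h: "h \<in> carrier G" for h
  proof -
    have "S * gact N h = S * (gact N h * T) * S" using S Tc(1) cN[OF h] by (simp add: mat_assoc)
    also have "\<dots> = (S * T) * gact M h * S" unfolding Tc(2)[OF h, symmetric]
      using S(1) Tc(1) cM[OF h] by (simp add: mat_assoc)
    finally show ?thesis using S cM[OF h] by simp
  qed
  then have "S \<in> mod_hom kG N M" using S by (simp add: kG_mod_hom_iff f)
  then show ?thesis using that S by blast
qed

lemma schur_scalar:
  assumes s: "simple_mod kG M" and T: "T \<in> mod_hom kG M M"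
  obtains c where "T = c \<cdot>\<^sub>m 1\<^sub>m (mdim M)"
proof -
  have f: "is_fdmod kG M" and d: "mdim M > 0" using s by (auto simp: simple_mod_def)
  have Tc: "T \<in> carrier_mat (mdim M) (mdim M)" "\<And>h. h \<in> carrier G \<Longrightarrow> T * gact M h = gact M h * T"
    using T by (auto simp: kG_mod_hom_iff f)
  note cM = grp_repD(1)[OF fdmod_grp_rep[OF f]]
  have "degree (char_poly T) = mdim M" using degree_monic_char_poly[OF Tc(1)] by simp
  then have "\<not> constant (poly (char_poly T))" using d by (simp add: constant_degree)
  then obtain c where "poly (char_poly T) c = 0" using fundamental_theorem_of_algebra by blast
  then have "eigenvalue T c" using eigenvalue_root_char_poly[OF Tc(1)] by simp
  then obtain v where v: "v \<in> carrier_vec (mdim M)" "v \<noteq> 0\<^sub>v (mdim M)" "T *\<^sub>v v = c \<cdot>\<^sub>v v"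
    using Tc(1) by (auto simp: eigenvalue_def eigenvector_def)
  define R where "R = T + (-c) \<cdot>\<^sub>m 1\<^sub>m (mdim M)"
  have Rc: "R \<in> carrier_mat (mdim M) (mdim M)" using Tc by (simp add: R_def)
  have R: "R \<in> mod_hom kG M M"
    unfolding kG_mod_hom_iff[OF f f]
  proof (intro conjI ballI Rc)
    fix h assume h: "h \<in> carrier G"
    show "R * gact M h = gact M h * R"
      using Tc(1) cM[OF h]
      by (simp add: R_def Tc(2)[OF h] mat_mult_add_left mat_mult_add_right mat_smult_left mat_smult_right)
  qed
  have "R *\<^sub>v v = T *\<^sub>v v + ((-c) \<cdot>\<^sub>m 1\<^sub>m (mdim M)) *\<^sub>v v"
    unfolding R_def using Tc v by (intro add_mult_distrib_mat_vec[of _ "mdim M" "mdim M"]) auto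
  also have "\<dots> = 0\<^sub>v (mdim M)"
    unfolding v(3) using v(1) by (intro eq_vecI) (auto simp: smult_scalar_prod_distrib[of _ "mdim M"])
  finally have Rv: "R *\<^sub>v v = 0\<^sub>v (mdim M)" .
  have "R = 0\<^sub>m (mdim M) (mdim M)"
  proof (rule ccontr)
    assume "R \<noteq> 0\<^sub>m (mdim M) (mdim M)"
    then obtain S where S: "S \<in> mod_hom kG M M" "S * R = 1\<^sub>m (mdim M)" using schur[OF s s R] by metis
    have Sc: "S \<in> carrier_mat (mdim M) (mdim M)" using S by (simp add: mod_hom_def)
    have "v = (S * R) *\<^sub>v v" using S(2) v by simp
    also have "\<dots> = 0\<^sub>v (mdim M)" using Sc Rc v(1) Rv by (simp add: mat_vec_assoc mult_zero_vec)
    finally show False using v by simp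
  qed
  have "T = c \<cdot>\<^sub>m 1\<^sub>m (mdim M)"
  proof (rule eq_matI)
    fix i j assume ij: "i < dim_row (c \<cdot>\<^sub>m 1\<^sub>m (mdim M))" "j < dim_col (c \<cdot>\<^sub>m 1\<^sub>m (mdim M))"
    then show "T $$ (i, j) = (c \<cdot>\<^sub>m 1\<^sub>m (mdim M)) $$ (i, j)"
      using arg_cong[OF \<open>R = 0\<^sub>m (mdim M) (mdim M)\<close>, of "\<lambda>A. A $$ (i, j)"] Tc(1) by (auto simp: R_def split: if_splits)
  qed (use Tc in auto)
  then show ?thesis using that by blast
qed

text \<open>Makes an equivariant map out of any linear map T. It is applied to matrix units for the
  orthogonality of characters and to a projection for Maschke's theorem.\<close>

definition grp_conj_sum :: "nat \<Rightarrow> nat \<Rightarrow> ('a \<Rightarrow> complex mat) \<Rightarrow> ('a \<Rightarrow> complex mat) \<Rightarrow> complex mat \<Rightarrow> complex mat" where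
  "grp_conj_sum m d \<sigma> \<rho> T = lin m d (carrier G) (\<lambda>_. 1) (\<lambda>h. \<sigma> h * T * \<rho> (inv h))"

lemma grp_conj_sum_hom:
  assumes r: "grp_rep m \<sigma>" "grp_rep d \<rho>" and T: "T \<in> carrier_mat m d" and k: "k \<in> carrier G"
  shows "grp_conj_sum m d \<sigma> \<rho> T * \<rho> k = \<sigma> k * grp_conj_sum m d \<sigma> \<rho> T"
proof -
  note c = grp_repD(1)[OF r(1)] grp_repD(1)[OF r(2)]
  let ?X = "\<lambda>h. \<sigma> h * T * \<rho> (inv h \<otimes> k)"
  have cc: "\<sigma> h * T * \<rho> (inv h) \<in> carrier_mat m d" if "h \<in> carrier G" for h
    using mult_carrier_mat[OF mult_carrier_mat[OF c(1)[OF that] T] c(2)[OF inv_closed[OF that]]] .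
  have "grp_conj_sum m d \<sigma> \<rho> T * \<rho> k = lin m d (carrier G) (\<lambda>_. 1) (\<lambda>h. \<sigma> h * T * \<rho> (inv h) * \<rho> k)"
    unfolding grp_conj_sum_def by (rule lin_mult[OF c(2)[OF k] cc])
  also have "\<dots> = lin m d (carrier G) (\<lambda>_. 1) ?X"
  proof (intro lin_cong refl)
    fix h assume h: "h \<in> carrier G"
    show "\<sigma> h * T * \<rho> (inv h) * \<rho> k = ?X h"
      using c(1)[OF h] c(2)[OF k] c(2)[OF inv_closed[OF h]] T h k by (simp add: grp_repD(3)[OF r(2)] mat_assoc)
  qed
  also have "\<dots> = lin m d (carrier G) (\<lambda>_. 1) (\<lambda>h. ?X (k \<otimes> h))" by (rule lin_grp_shift[OF k, symmetric])
  also have "\<dots> = lin m d (carrier G) (\<lambda>_. 1) (\<lambda>h. \<sigma> k * (\<sigma> h * T * \<rho> (inv h)))"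
  proof (intro lin_cong refl)
    fix h assume h: "h \<in> carrier G"
    have "inv (k \<otimes> h) \<otimes> k = inv h" using h k by (simp add: inv_mult_group m_assoc)
    then show "?X (k \<otimes> h) = \<sigma> k * (\<sigma> h * T * \<rho> (inv h))"
      using c(1)[OF h] c(1)[OF k] c(2)[OF inv_closed[OF h]] T h k by (simp add: grp_repD(3)[OF r(1)] mat_assoc)
  qed
  also have "\<dots> = \<sigma> k * grp_conj_sum m d \<sigma> \<rho> T"
    unfolding grp_conj_sum_def by (rule mult_lin[OF c(1)[OF k] cc, symmetric])
  finally show ?thesis .
qed

section \<open>Orthogonality of characters\<close>

definition grp_char :: "('a \<Rightarrow> complex) fdmod \<Rightarrow> 'a \<Rightarrow> complex" where
  "grp_char U h = mtrace (gact U h)"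

text \<open>The (a, b) entry of A E_ab B is the product of the diagonal entries A_aa and B_bb, and
  summing over a and b gives tr(A) tr(B).\<close>

lemma char_sum:
  assumes f: "is_fdmod kG M" "is_fdmod kG N"
  defines "E \<equiv> \<lambda>a b. mat (mdim N) (mdim M) (\<lambda>(r, c). of_bool (r = a \<and> c = b))"
  shows "(\<Sum>h\<in>carrier G. grp_char N h * grp_char M (inv h))
    = (\<Sum>a<mdim N. \<Sum>b<mdim M. grp_conj_sum (mdim N) (mdim M) (gact N) (gact M) (E a b) $$ (a, b))"
proof -
  note cM = grp_repD(1)[OF fdmod_grp_rep[OF f(1)]] and cN = grp_repD(1)[OF fdmod_grp_rep[OF f(2)]]
  have e: "(A * E a b * B) $$ (a, b) = A $$ (a, a) * B $$ (b, b)"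
    if A: "A \<in> carrier_mat (mdim N) (mdim N)" and B: "B \<in> carrier_mat (mdim M) (mdim M)"
      and ab: "a < mdim N" "b < mdim M" for A B a b
  proof -
    have AE: "(A * E a b) $$ (a, l) = (if l = b then A $$ (a, a) else 0)" if l: "l < mdim M" for l
    proof -
      have "(A * E a b) $$ (a, l) = (\<Sum>i<mdim N. A $$ (a, i) * E a b $$ (i, l))"
        using A ab l by (subst mult_mat_index) (auto simp: E_def)
      also have "\<dots> = (\<Sum>i<mdim N. if i = a then (if l = b then A $$ (a, a) else 0) else 0)"
        using l by (intro sum.cong) (auto simp: E_def)
      finally show ?thesis using ab by simp
    qed
    have "(A * E a b * B) $$ (a, b) = (\<Sum>l<mdim M. (A * E a b) $$ (a, l) * B $$ (l, b))"
      using A B ab by (subst mult_mat_index) (auto simp: E_def)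
    also have "\<dots> = (\<Sum>l<mdim M. if l = b then A $$ (a, a) * B $$ (b, b) else 0)"
      by (intro sum.cong) (auto simp: AE)
    finally show ?thesis using ab by simp
  qed
  have "(\<Sum>a<mdim N. \<Sum>b<mdim M. grp_conj_sum (mdim N) (mdim M) (gact N) (gact M) (E a b) $$ (a, b))
      = (\<Sum>a<mdim N. \<Sum>b<mdim M. \<Sum>h\<in>carrier G. gact N h $$ (a, a) * gact M (inv h) $$ (b, b))"
    by (intro sum.cong refl) (auto simp: grp_conj_sum_def e[OF cN cM[OF inv_closed]] simp del: index_mult_mat(1))
  also have "\<dots> = (\<Sum>a<mdim N. \<Sum>h\<in>carrier G. \<Sum>b<mdim M. gact N h $$ (a, a) * gact M (inv h) $$ (b, b))"
    by (intro sum.cong refl, rule sum.swap)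
  also have "\<dots> = (\<Sum>h\<in>carrier G. \<Sum>a<mdim N. \<Sum>b<mdim M. gact N h $$ (a, a) * gact M (inv h) $$ (b, b))"
    by (rule sum.swap)
  also have "\<dots> = (\<Sum>h\<in>carrier G. grp_char N h * grp_char M (inv h))"
  proof (intro sum.cong refl)
    fix h assume h: "h \<in> carrier G"
    show "(\<Sum>a<mdim N. \<Sum>b<mdim M. gact N h $$ (a, a) * gact M (inv h) $$ (b, b)) = grp_char N h * grp_char M (inv h)"
      using cN[OF h] cM[OF inv_closed[OF h]] by (simp add: grp_char_def mtrace_def sum_product)
  qed
  finally show ?thesis ..
qed

text \<open>By Schur's lemma the averaged matrix units vanish for non-isomorphic modules and are
  scalars c for M = N; comparing traces gives c dim M = |G| tr(E_ab). Pairing h with its inverse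
  instead of taking complex conjugates avoids unitary structures.\<close>

lemma char_orthogonal:
  assumes s: "simple_mod kG M" "simple_mod kG N"
  shows "\<not> mod_iso kG M N \<Longrightarrow> (\<Sum>h\<in>carrier G. grp_char N h * grp_char M (inv h)) = 0"
    and "(\<Sum>h\<in>carrier G. grp_char M h * grp_char M (inv h)) = of_nat (card (carrier G))"
proof -
  have f: "is_fdmod kG M" "is_fdmod kG N" using s by (auto simp: simple_mod_def)
  note rM = fdmod_grp_rep[OF f(1)] and rN = fdmod_grp_rep[OF f(2)]
  {
    assume ni: "\<not> mod_iso kG M N"
    let ?C = "\<lambda>a b. grp_conj_sum (mdim N) (mdim M) (gact N) (gact M) (mat (mdim N) (mdim M) (\<lambda>(r, c). of_bool (r = a \<and> c = b)))"
    have "?C a b = 0\<^sub>m (mdim N) (mdim M)" for a b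
    proof (rule ccontr)
      assume nz: "?C a b \<noteq> 0\<^sub>m (mdim N) (mdim M)"
      have "?C a b \<in> mod_hom kG M N"
        unfolding kG_mod_hom_iff[OF f] using grp_conj_sum_hom[OF rN rM] by (simp add: grp_conj_sum_def)
      then show False using schur[OF s _ nz] ni unfolding mod_iso_def by metis
    qed
    then show "(\<Sum>h\<in>carrier G. grp_char N h * grp_char M (inv h)) = 0"
      unfolding char_sum[OF f] by simp
  }
  let ?E = "\<lambda>a b. mat (mdim M) (mdim M) (\<lambda>(r, c). of_bool (r = a \<and> c = b)) :: complex mat"
  let ?C = "\<lambda>a b. grp_conj_sum (mdim M) (mdim M) (gact M) (gact M) (?E a b)"
  have d: "mdim M > 0" using s by (simp add: simple_mod_def)
  have C: "?C a b $$ (a, b) = (if a = b then of_nat (card (carrier G)) / of_nat (mdim M) else 0)"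
    if ab: "a < mdim M" "b < mdim M" for a b
  proof -
    have "?C a b \<in> mod_hom kG M M"
      unfolding kG_mod_hom_iff[OF f(1) f(1)] using grp_conj_sum_hom[OF rM rM] by (simp add: grp_conj_sum_def)
    then obtain c where c: "?C a b = c \<cdot>\<^sub>m 1\<^sub>m (mdim M)" by (rule schur_scalar[OF s(1)])
    have "mtrace (?C a b) = (\<Sum>h\<in>carrier G. 1 * mtrace (gact M h * ?E a b * gact M (inv h)))"
      unfolding grp_conj_sum_def using grp_repD(1)[OF rM] by (intro mtrace_lin) (auto intro!: mult_carrier_mat[of _ "mdim M" "mdim M"])
    also have "\<dots> = (\<Sum>h\<in>carrier G. mtrace (?E a b))"
    proof (intro sum.cong refl)
      fix h assume h: "h \<in> carrier G"
      note ch = grp_repD(1)[OF rM h] grp_repD(1)[OF rM inv_closed[OF h]]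
      have "mtrace (gact M h * ?E a b * gact M (inv h)) = mtrace (gact M (inv h) * (gact M h * ?E a b))"
        using ch by (intro mtrace_mult_commute[of _ "mdim M" "mdim M"]) (auto intro!: mult_carrier_mat[of _ "mdim M" "mdim M"])
      also have "gact M (inv h) * (gact M h * ?E a b) = (gact M (inv h) * gact M h) * ?E a b"
        using ch by (simp add: mat_assoc)
      also have "gact M (inv h) * gact M h = 1\<^sub>m (mdim M)"
        using h grp_repD(2)[OF rM] by (simp flip: grp_repD(3)[OF rM])
      finally show "1 * mtrace (gact M h * ?E a b * gact M (inv h)) = mtrace (?E a b)" by simp
    qed
    also have "mtrace (?E a b) = (\<Sum>i<mdim M. if i = a then of_bool (a = b) else 0)"
      unfolding mtrace_def by (intro sum.cong) auto
    also have "\<dots> = of_bool (a = b)" using ab by simp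
    finally have "c * of_nat (mdim M) = of_nat (card (carrier G)) * of_bool (a = b)"
      unfolding c by (simp add: mtrace_smult[of _ "mdim M"] mtrace_one)
    then have "c = (if a = b then of_nat (card (carrier G)) / of_nat (mdim M) else 0)"
      using d by (auto simp: field_simps)
    then show ?thesis unfolding c using ab by simp
  qed
  have "(\<Sum>h\<in>carrier G. grp_char M h * grp_char M (inv h)) = (\<Sum>a<mdim M. \<Sum>b<mdim M. ?C a b $$ (a, b))"
    by (rule char_sum[OF f(1) f(1)])
  also have "\<dots> = (\<Sum>a<mdim M. of_nat (card (carrier G)) / of_nat (mdim M))"
    by (intro sum.cong refl) (simp add: C)
  also have "\<dots> = of_nat (card (carrier G))" using d by simp
  finally show "(\<Sum>h\<in>carrier G. grp_char M h * grp_char M (inv h)) = of_nat (card (carrier G))" .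
qed

end

lemma mult_mat_vec_sum:
  fixes A :: "'a::semiring_0 mat"
  shows "A \<in> carrier_mat m d \<Longrightarrow> i < m \<Longrightarrow> v \<in> carrier_vec d \<Longrightarrow> (A *\<^sub>v v) $ i = (\<Sum>l<d. A $$ (i, l) * v $ l)"
  by (simp add: scalar_prod_def atLeast0LessThan)

context non_nilpotent_group_datum
begin

text \<open>The orthogonality relations exhibit a left inverse of the matrix of character values,
  whose rows are indexed by G and columns by F. This rough bound is enough for the finiteness of
  \<Omega>.\<close>

lemma simples_card_bound:
  assumes V: "complete_simples kG \<Omega> V" and F: "F \<subseteq> \<Omega>" "finite F"
  shows "card F \<le> card (carrier G)"
proof -
  obtain e where e: "bij_betw e {0..<card (carrier G)} (carrier G)" using ex_bij_betw_nat_finite[OF finite_G] by blast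
  obtain f where f: "bij_betw f {0..<card F} F" using ex_bij_betw_nat_finite[OF F(2)] by blast
  let ?N = "card (carrier G)"
  define A where "A = mat ?N (card F) (\<lambda>(r, c). grp_char (V (f c)) (e r))"
  define B where "B = mat (card F) ?N (\<lambda>(r, c). grp_char (V (f r)) (inv (e c)) / of_nat ?N)"
  have "B * A = 1\<^sub>m (card F)"
  proof (rule eq_matI)
    fix i j assume "i < dim_row (1\<^sub>m (card F) :: complex mat)" "j < dim_col (1\<^sub>m (card F) :: complex mat)"
    then have ij: "i < card F" "j < card F" by auto
    then have fF: "f i \<in> \<Omega>" "f j \<in> \<Omega>" using f F(1) by (auto simp: bij_betw_def)
    have s: "simple_mod kG (V (f i))" "simple_mod kG (V (f j))" using V fF by (auto simp: complete_simples_def)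
    have "(B * A) $$ (i, j) = (\<Sum>l<?N. grp_char (V (f i)) (inv (e l)) / of_nat ?N * grp_char (V (f j)) (e l))"
      using ij by (subst mult_mat_index) (auto simp: A_def B_def)
    also have "\<dots> = (\<Sum>h\<in>carrier G. grp_char (V (f i)) (inv h) / of_nat ?N * grp_char (V (f j)) h)"
      using sum.reindex_bij_betw[OF e, of "\<lambda>h. grp_char (V (f i)) (inv h) / of_nat ?N * grp_char (V (f j)) h"]
      by (simp add: atLeast0LessThan)
    also have "\<dots> = (\<Sum>h\<in>carrier G. grp_char (V (f j)) h * grp_char (V (f i)) (inv h)) / of_nat ?N"
      by (simp add: sum_divide_distrib mult.commute)
    also have "\<dots> = (if i = j then 1 else 0)"
    proof (cases "i = j")
      case True
      then show ?thesis using char_orthogonal(2)[OF s(2) s(2)] card_G_pos by simp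
    next
      case False
      then have "f i \<noteq> f j" using f ij by (auto simp: bij_betw_def inj_on_def)
      then have "\<not> mod_iso kG (V (f i)) (V (f j))" using V fF by (auto simp: complete_simples_def)
      then show ?thesis using char_orthogonal(1)[OF s] False by simp
    qed
    finally show "(B * A) $$ (i, j) = 1\<^sub>m (card F) $$ (i, j)" using ij by simp
  qed (auto simp: A_def B_def)
  then show ?thesis
    by (intro left_inverse_dim[of A _ _ B]) (auto simp: A_def B_def)
qed

lemma simples_finite:
  assumes V: "complete_simples kG \<Omega> V"
  shows "finite \<Omega>"
proof (rule ccontr)
  assume "infinite \<Omega>"
  then obtain F where "finite F" "card F = Suc (card (carrier G))" "F \<subseteq> \<Omega>"
    using infinite_arbitrarily_large by blast
  then show False using simples_card_bound[OF V, of F] by simp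
qed

section \<open>Maschke's theorem\<close>

lemma vec_subspaceD:
  assumes "vec_subspace d W"
  shows "W \<subseteq> carrier_vec d" "0\<^sub>v d \<in> W" "v \<in> W \<Longrightarrow> w \<in> W \<Longrightarrow> v + w \<in> W" "v \<in> W \<Longrightarrow> c \<cdot>\<^sub>v v \<in> W"
  using assms by (auto simp: vec_subspace_def)

text \<open>Averaging a projection onto W over G gives an equivariant projection P onto W, whose
  kernel is a stable complement. The columns of T are bases of the two parts, and in these
  coordinates the representation is block diagonal.\<close>

lemma grp_rep_split:
  assumes r: "grp_rep d \<rho>" and W: "vec_subspace d W" and st: "\<And>h v. h \<in> carrier G \<Longrightarrow> v \<in> W \<Longrightarrow> \<rho> h *\<^sub>v v \<in> W"
    and ne: "W \<noteq> {0\<^sub>v d}" "W \<noteq> carrier_vec d"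
  obtains k l \<rho>1 \<rho>2 S T where "0 < k" "0 < l" "k + l = d" "grp_rep k \<rho>1" "grp_rep l \<rho>2"
    "S \<in> carrier_mat d d" "T \<in> carrier_mat d d" "S * T = 1\<^sub>m d" "T * S = 1\<^sub>m d"
    "\<And>h. h \<in> carrier G \<Longrightarrow> S * \<rho> h = diag_block (\<rho>1 h) (\<rho>2 h) * S"
proof -
  note c = grp_repD(1)[OF r]
  obtain k A B where AB: "A \<in> carrier_mat d k" "B \<in> carrier_mat k d" "B * A = 1\<^sub>m k" "is_proj d (A * B) W"
    using subspace_factor[OF W] by blast
  let ?w = "1 / of_nat (card (carrier G)) :: complex"
  have ABc: "A * B \<in> carrier_mat d d" using AB by simp
  define P where "P = ?w \<cdot>\<^sub>m grp_conj_sum d d \<rho> \<rho> (A * B)"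
  have Pc: "P \<in> carrier_mat d d" by (simp add: P_def grp_conj_sum_def)
  have PV: "P *\<^sub>v v = ?w \<cdot>\<^sub>v (grp_conj_sum d d \<rho> \<rho> (A * B) *\<^sub>v v)" if "v \<in> carrier_vec d" for v
    using that unfolding P_def by (intro eq_vecI) (auto simp: grp_conj_sum_def smult_scalar_prod_distrib[of _ d])
  have xc: "\<rho> h * (A * B) * \<rho> (inv h) \<in> carrier_mat d d" if "h \<in> carrier G" for h
    using mult_carrier_mat[OF mult_carrier_mat[OF c[OF that] ABc] c[OF inv_closed[OF that]]] .
  have xv: "(\<rho> h * (A * B) * \<rho> (inv h)) *\<^sub>v v = \<rho> h *\<^sub>v ((A * B) *\<^sub>v (\<rho> (inv h) *\<^sub>v v))"
    if "h \<in> carrier G" "v \<in> carrier_vec d" for h v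
    using c[OF that(1)] c[OF inv_closed[OF that(1)]] ABc that(2) AB(1,2) by (simp add: mat_vec_assoc)
  have PW: "P *\<^sub>v v \<in> W" if v: "v \<in> carrier_vec d" for v
  proof -
    have "(\<rho> h * (A * B) * \<rho> (inv h)) *\<^sub>v v \<in> W" if h: "h \<in> carrier G" for h
    proof -
      have "\<rho> (inv h) *\<^sub>v v \<in> carrier_vec d" using mult_mat_vec_carrier[OF c[OF inv_closed[OF h]] v] .
      then have "(A * B) *\<^sub>v (\<rho> (inv h) *\<^sub>v v) \<in> W" using AB(4) by (simp add: is_proj_def)
      then show ?thesis unfolding xv[OF h v] by (rule st[OF h])
    qed
    then have "grp_conj_sum d d \<rho> \<rho> (A * B) *\<^sub>v v \<in> W"
      unfolding grp_conj_sum_def using xc v by (intro lin_mult_vec_closed[OF W finite_G]) auto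
    then show ?thesis unfolding PV[OF v] by (rule vec_subspaceD(4)[OF W])
  qed
  have Pw: "P *\<^sub>v w = w" if w: "w \<in> W" for w
  proof -
    have wc: "w \<in> carrier_vec d" using w vec_subspaceD(1)[OF W] by auto
    have x1: "(\<rho> h * (A * B) * \<rho> (inv h)) *\<^sub>v w = w" if h: "h \<in> carrier G" for h
    proof -
      have "(A * B) *\<^sub>v (\<rho> (inv h) *\<^sub>v w) = \<rho> (inv h) *\<^sub>v w"
        using AB(4) st[OF inv_closed[OF h] w] by (simp add: is_proj_def)
      then have "(\<rho> h * (A * B) * \<rho> (inv h)) *\<^sub>v w = (\<rho> h * \<rho> (inv h)) *\<^sub>v w"
        unfolding xv[OF h wc] using c[OF h] c[OF inv_closed[OF h]] wc by (simp add: mat_vec_assoc)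
      also have "\<rho> h * \<rho> (inv h) = 1\<^sub>m d" using h grp_repD(2)[OF r] by (simp flip: grp_repD(3)[OF r])
      finally show ?thesis using wc by simp
    qed
    show ?thesis
    proof (rule eq_vecI)
      fix i assume "i < dim_vec w"
      then have i: "i < d" using wc by simp
      have "(P *\<^sub>v w) $ i = ?w * (\<Sum>l<d. (\<Sum>h\<in>carrier G. (\<rho> h * (A * B) * \<rho> (inv h)) $$ (i, l)) * w $ l)"
        unfolding PV[OF wc] using i wc
        by (simp add: grp_conj_sum_def scalar_prod_def atLeast0LessThan del: index_mult_mat(1))
      also have "\<dots> = ?w * (\<Sum>h\<in>carrier G. \<Sum>l<d. (\<rho> h * (A * B) * \<rho> (inv h)) $$ (i, l) * w $ l)"
        by (simp only: sum_distrib_right, subst sum.swap) simp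
      also have "(\<Sum>h\<in>carrier G. \<Sum>l<d. (\<rho> h * (A * B) * \<rho> (inv h)) $$ (i, l) * w $ l) = (\<Sum>h\<in>carrier G. w $ i)"
      proof (intro sum.cong refl)
        fix h assume h: "h \<in> carrier G"
        have "((\<rho> h * (A * B) * \<rho> (inv h)) *\<^sub>v w) $ i = (\<Sum>l<d. (\<rho> h * (A * B) * \<rho> (inv h)) $$ (i, l) * w $ l)"
          by (rule mult_mat_vec_sum[OF xc[OF h] i wc])
        then show "(\<Sum>l<d. (\<rho> h * (A * B) * \<rho> (inv h)) $$ (i, l) * w $ l) = w $ i" unfolding x1[OF h] ..
      qed
      finally show "(P *\<^sub>v w) $ i = w $ i" using card_G_pos by simp
    qed (use Pc wc in simp)
  qed
  have Ph: "P * \<rho> h = \<rho> h * P" if h: "h \<in> carrier G" for h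
    using grp_conj_sum_hom[OF r r ABc h] c[OF h]
    by (simp add: P_def mat_smult_left mat_smult_right grp_conj_sum_def)
  define Q where "Q = 1\<^sub>m d + (-1) \<cdot>\<^sub>m P"
  have Qc: "Q \<in> carrier_mat d d" using Pc by (simp add: Q_def)
  have Qh: "Q * \<rho> h = \<rho> h * Q" if h: "h \<in> carrier G" for h
    using c[OF h] Pc Ph[OF h] by (simp add: Q_def mat_mult_add_left mat_mult_add_right mat_smult_left mat_smult_right)
  have PQ: "P + Q = 1\<^sub>m d" using Pc by (auto simp: Q_def intro!: eq_matI)
  have PP: "P * P = P"
    using Pc Pw PW by (intro mat_eq_vecI[of _ d d]) (auto simp: mat_vec_assoc)
  have PQ0: "P * Q = 0\<^sub>m d d" "Q * P = 0\<^sub>m d d"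
    using Pc by (auto simp: Q_def mat_mult_add_left mat_mult_add_right mat_smult_left mat_smult_right PP intro!: eq_matI)
  have QQ: "Q * Q = Q"
  proof -
    have "Q * Q = (P + Q) * Q" using Pc Qc PQ0 by (simp add: mat_mult_add_left)
    then show ?thesis using PQ Qc by simp
  qed
  define W' where "W' = {v \<in> carrier_vec d. P *\<^sub>v v = 0\<^sub>v d}"
  have W': "vec_subspace d W'"
    using Pc by (auto simp: vec_subspace_def W'_def mult_zero_vec mult_add_distrib_mat_vec[of _ d d] mult_mat_vec[of _ d d])
  obtain l A2 B2 where AB2: "A2 \<in> carrier_mat d l" "B2 \<in> carrier_mat l d" "B2 * A2 = 1\<^sub>m l" "is_proj d (A2 * B2) W'"
    using subspace_factor[OF W'] by blast
  have Qv: "Q *\<^sub>v v = v + (-1) \<cdot>\<^sub>v (P *\<^sub>v v)" if "v \<in> carrier_vec d" for v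
    unfolding Q_def using that Pc
    by (subst add_mult_distrib_mat_vec[of _ d d]) (auto intro!: eq_vecI simp: smult_scalar_prod_distrib[of _ d])
  have PA: "P * A = A"
  proof (rule mat_eq_vecI[of _ d k])
    fix v :: "complex vec" assume v: "v \<in> carrier_vec k"
    have Av: "A *\<^sub>v v \<in> carrier_vec d" using AB(1) v by simp
    have "A *\<^sub>v v = A *\<^sub>v ((B * A) *\<^sub>v v)" using v AB(3) by simp
    also have "\<dots> = (A * B) *\<^sub>v (A *\<^sub>v v)" using v AB(1,2) by (simp add: mat_vec_assoc)
    also have "\<dots> \<in> W" using AB(4) Av by (simp add: is_proj_def)
    finally show "(P * A) *\<^sub>v v = A *\<^sub>v v" using Pw Pc AB(1) v by (simp add: mat_vec_assoc)
  qed (use Pc AB in auto)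
  have ABP: "A * (B * P) = P"
  proof (rule mat_eq_vecI[of _ d d])
    fix v :: "complex vec" assume v: "v \<in> carrier_vec d"
    have "(A * B) *\<^sub>v (P *\<^sub>v v) = P *\<^sub>v v" using AB(4) PW[OF v] by (simp add: is_proj_def)
    then show "(A * (B * P)) *\<^sub>v v = P *\<^sub>v v" using AB(1,2) Pc v by (simp add: mat_vec_assoc)
  qed (use AB Pc in auto)
  have PA2: "P * A2 = 0\<^sub>m d l"
  proof (rule mat_eq_vecI[of _ d l])
    fix v :: "complex vec" assume v: "v \<in> carrier_vec l"
    have Av: "A2 *\<^sub>v v \<in> carrier_vec d" using AB2(1) v by simp
    have "A2 *\<^sub>v v = A2 *\<^sub>v ((B2 * A2) *\<^sub>v v)" using v AB2(3) by simp
    also have "\<dots> = (A2 * B2) *\<^sub>v (A2 *\<^sub>v v)" using v AB2(1,2) by (simp add: mat_vec_assoc)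
    also have "\<dots> \<in> W'" using AB2(4) Av by (simp add: is_proj_def)
    finally have "P *\<^sub>v (A2 *\<^sub>v v) = 0\<^sub>v d" by (simp add: W'_def)
    then show "(P * A2) *\<^sub>v v = 0\<^sub>m d l *\<^sub>v v" using Pc AB2(1) v by (auto simp: mat_vec_assoc scalar_prod_def intro!: eq_vecI)
  qed (use Pc AB2 in auto)
  have QA2: "Q * A2 = A2"
  proof -
    have "(P + Q) * A2 = Q * A2" using Pc Qc AB2(1) PA2 by (simp add: mat_mult_add_left)
    then show ?thesis using PQ AB2(1) by simp
  qed
  have QA: "Q * A = 0\<^sub>m d k"
  proof -
    have "Q * A = Q * (P * A)" by (simp only: PA)
    also have "\<dots> = (Q * P) * A" using Pc Qc AB(1) by (simp add: mat_assoc)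
    finally show ?thesis using PQ0 AB(1) by simp
  qed
  have ABQ: "A2 * (B2 * Q) = Q"
  proof (rule mat_eq_vecI[of _ d d])
    fix v :: "complex vec" assume v: "v \<in> carrier_vec d"
    have Qvc: "Q *\<^sub>v v \<in> carrier_vec d" using Qc v by simp
    have "P *\<^sub>v (Q *\<^sub>v v) = (P * Q) *\<^sub>v v" using Pc Qc v by (simp add: mat_vec_assoc)
    also have "\<dots> = 0\<^sub>v d" unfolding PQ0 using v by (auto intro!: eq_vecI simp: scalar_prod_def)
    finally have "Q *\<^sub>v v \<in> W'" using Qvc by (simp add: W'_def)
    then have "(A2 * B2) *\<^sub>v (Q *\<^sub>v v) = Q *\<^sub>v v" using AB2(4) by (simp add: is_proj_def)
    then show "(A2 * (B2 * Q)) *\<^sub>v v = Q *\<^sub>v v" using AB2(1,2) Qc v by (simp add: mat_vec_assoc)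
  qed (use AB2 Qc in auto)
  \<comment> \<open>A B and P project onto W along possibly different complements. Composing B with
    P makes the factorisation exact, A B1 = P, and makes B1 vanish on ker P.\<close>
  define B1 where "B1 = B * P"
  define B3 where "B3 = B2 * Q"
  have Bc: "B1 \<in> carrier_mat k d" "B3 \<in> carrier_mat l d" using AB AB2 Pc Qc by (auto simp: B1_def B3_def)
  have id: "B1 * A = 1\<^sub>m k" "B3 * A2 = 1\<^sub>m l" "B1 * A2 = 0\<^sub>m k l" "B3 * A = 0\<^sub>m l k" "A * B1 = P" "A2 * B3 = Q"
    "B1 * P = B1" "B3 * Q = B3"
    using AB AB2 Pc Qc PA QA2 PA2 QA PP QQ ABP ABQ by (simp_all add: B1_def B3_def mat_assoc)
  \<comment> \<open>B1 stacked above B3, and A set beside A2, formed as block matrices whose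
    remaining blocks have size zero.\<close>
  let ?S = "four_block_mat B1 (0\<^sub>m k 0) B3 (0\<^sub>m l 0)" and ?T = "four_block_mat A A2 (0\<^sub>m 0 k) (0\<^sub>m 0 l)"
  have STc: "?S \<in> carrier_mat (k + l) (d + 0)" "?T \<in> carrier_mat (d + 0) (k + l)"
    by (rule four_block_carrier_mat, use AB AB2 Bc in auto)+
  have "?S * ?T = four_block_mat (B1 * A + 0\<^sub>m k 0 * 0\<^sub>m 0 k) (B1 * A2 + 0\<^sub>m k 0 * 0\<^sub>m 0 l)
      (B3 * A + 0\<^sub>m l 0 * 0\<^sub>m 0 k) (B3 * A2 + 0\<^sub>m l 0 * 0\<^sub>m 0 l)"
    using AB(1) AB2(1) Bc by (intro mult_four_block_mat) auto
  also have "\<dots> = four_block_mat (1\<^sub>m k) (0\<^sub>m k l) (0\<^sub>m l k) (1\<^sub>m l)"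
    unfolding id by (intro cong_four_block_mat) (auto intro!: eq_matI simp: scalar_prod_def)
  also have "\<dots> = 1\<^sub>m (k + l)" by (rule four_block_one_mat)
  finally have ST: "?S * ?T = 1\<^sub>m (k + l)" .
  have "?T * ?S = four_block_mat (A * B1 + A2 * B3) (A * 0\<^sub>m k 0 + A2 * 0\<^sub>m l 0)
      (0\<^sub>m 0 k * B1 + 0\<^sub>m 0 l * B3) (0\<^sub>m 0 k * 0\<^sub>m k 0 + 0\<^sub>m 0 l * 0\<^sub>m l 0)"
    using AB(1) AB2(1) Bc by (intro mult_four_block_mat) auto
  also have "\<dots> = 1\<^sub>m d" unfolding id PQ using AB(1) AB2(1) by (intro eq_matI) auto
  finally have TS: "?T * ?S = 1\<^sub>m d" .
  have kl: "k + l = d"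
    using left_inverse_dim[of ?T d "k + l" ?S] left_inverse_dim[of ?S "k + l" d ?T] STc ST TS by simp
  define \<rho>1 where "\<rho>1 h = B1 * \<rho> h * A" for h
  define \<rho>2 where "\<rho>2 h = B3 * \<rho> h * A2" for h
  have r1: "grp_rep k \<rho>1"
    unfolding grp_rep_def
  proof (intro conjI ballI)
    fix h assume h: "h \<in> carrier G"
    show "\<rho>1 h \<in> carrier_mat k k" using Bc(1) c[OF h] AB(1) by (auto simp: \<rho>1_def)
    fix h' assume h': "h' \<in> carrier G"
    have "\<rho>1 h * \<rho>1 h' = B1 * (\<rho> h * (A * B1)) * \<rho> h' * A"
      using Bc(1) c[OF h] c[OF h'] AB(1) by (simp add: \<rho>1_def mat_assoc)
    also have "\<rho> h * (A * B1) = P * \<rho> h" by (simp only: id Ph[OF h])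
    also have "B1 * (P * \<rho> h) * \<rho> h' * A = (B1 * P) * (\<rho> h * \<rho> h') * A"
      using Bc(1) c[OF h] c[OF h'] AB(1) Pc by (simp add: mat_assoc)
    finally show "\<rho>1 (h \<otimes> h') = \<rho>1 h * \<rho>1 h'" by (simp add: id \<rho>1_def grp_repD(3)[OF r h h'])
  qed (use Bc(1) id grp_repD(2)[OF r] in \<open>simp add: \<rho>1_def\<close>)
  have r2: "grp_rep l \<rho>2"
    unfolding grp_rep_def
  proof (intro conjI ballI)
    fix h assume h: "h \<in> carrier G"
    show "\<rho>2 h \<in> carrier_mat l l" using Bc(2) c[OF h] AB2(1) by (auto simp: \<rho>2_def)
    fix h' assume h': "h' \<in> carrier G"
    have "\<rho>2 h * \<rho>2 h' = B3 * (\<rho> h * (A2 * B3)) * \<rho> h' * A2"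
      using Bc(2) c[OF h] c[OF h'] AB2(1) by (simp add: \<rho>2_def mat_assoc)
    also have "\<rho> h * (A2 * B3) = Q * \<rho> h" by (simp only: id Qh[OF h])
    also have "B3 * (Q * \<rho> h) * \<rho> h' * A2 = (B3 * Q) * (\<rho> h * \<rho> h') * A2"
      using Bc(2) c[OF h] c[OF h'] AB2(1) Qc by (simp add: mat_assoc)
    finally show "\<rho>2 (h \<otimes> h') = \<rho>2 h * \<rho>2 h'" by (simp add: id \<rho>2_def grp_repD(3)[OF r h h'])
  qed (use Bc(2) id grp_repD(2)[OF r] in \<open>simp add: \<rho>2_def\<close>)
  have Sr: "?S * \<rho> h = diag_block (\<rho>1 h) (\<rho>2 h) * ?S" if h: "h \<in> carrier G" for h
  proof -
    note ch = c[OF h]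
    have c12: "\<rho>1 h \<in> carrier_mat k k" "\<rho>2 h \<in> carrier_mat l l" using grp_repD(1)[OF r1 h] grp_repD(1)[OF r2 h] .
    have \<rho>4: "\<rho> h = four_block_mat (\<rho> h) (0\<^sub>m d 0) (0\<^sub>m 0 d) (0\<^sub>m 0 0)" using ch by (intro eq_matI) auto
    have "?S * four_block_mat (\<rho> h) (0\<^sub>m d 0) (0\<^sub>m 0 d) (0\<^sub>m 0 0)
        = four_block_mat (B1 * \<rho> h + 0\<^sub>m k 0 * 0\<^sub>m 0 d) (B1 * 0\<^sub>m d 0 + 0\<^sub>m k 0 * 0\<^sub>m 0 0)
          (B3 * \<rho> h + 0\<^sub>m l 0 * 0\<^sub>m 0 d) (B3 * 0\<^sub>m d 0 + 0\<^sub>m l 0 * 0\<^sub>m 0 0)"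
      using ch Bc by (intro mult_four_block_mat) auto
    also have "\<dots> = four_block_mat (B1 * \<rho> h) (0\<^sub>m k 0) (B3 * \<rho> h) (0\<^sub>m l 0)"
      using ch Bc by (intro cong_four_block_mat) (auto intro!: eq_matI simp: scalar_prod_def)
    finally have L: "?S * \<rho> h = four_block_mat (B1 * \<rho> h) (0\<^sub>m k 0) (B3 * \<rho> h) (0\<^sub>m l 0)" using \<rho>4 by simp
    have "diag_block (\<rho>1 h) (\<rho>2 h) * ?S = four_block_mat (\<rho>1 h * B1 + 0\<^sub>m k l * B3) (\<rho>1 h * 0\<^sub>m k 0 + 0\<^sub>m k l * 0\<^sub>m l 0)
        (0\<^sub>m l k * B1 + \<rho>2 h * B3) (0\<^sub>m l k * 0\<^sub>m k 0 + \<rho>2 h * 0\<^sub>m l 0)"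
      using c12 Bc by (subst mult_four_block_mat[of _ k k _ l _ l _ _ d _ 0]) auto
    also have "\<dots> = four_block_mat (\<rho>1 h * B1) (0\<^sub>m k 0) (\<rho>2 h * B3) (0\<^sub>m l 0)"
      using mult_carrier_mat[OF c12(1) Bc(1)] mult_carrier_mat[OF c12(2) Bc(2)] c12 Bc
      by (intro cong_four_block_mat) (auto intro!: eq_matI simp del: index_mult_mat(1))
    also have "\<rho>1 h * B1 = B1 * \<rho> h"
    proof -
      have "\<rho>1 h * B1 = B1 * (\<rho> h * (A * B1))" using ch Bc AB(1) by (simp add: \<rho>1_def mat_assoc)
      also have "\<dots> = (B1 * P) * \<rho> h" unfolding id(5) Ph[OF h, symmetric] using ch Bc Pc by (simp add: mat_assoc)
      finally show ?thesis by (simp add: id)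
    qed
    also have "\<rho>2 h * B3 = B3 * \<rho> h"
    proof -
      have "\<rho>2 h * B3 = B3 * (\<rho> h * (A2 * B3))" using ch Bc AB2(1) by (simp add: \<rho>2_def mat_assoc)
      also have "\<dots> = (B3 * Q) * \<rho> h" unfolding id(6) Qh[OF h, symmetric] using ch Bc Qc by (simp add: mat_assoc)
      finally show ?thesis by (simp add: id)
    qed
    finally show ?thesis using L by simp
  qed
  have "k \<noteq> 0"
  proof
    assume k0: "k = 0"
    have "w = 0\<^sub>v d" if w: "w \<in> W" for w
    proof -
      have wc: "w \<in> carrier_vec d" using w vec_subspaceD(1)[OF W] by auto
      have "w = (A * B) *\<^sub>v w" using AB(4) w by (simp add: is_proj_def)
      also have "\<dots> = 0\<^sub>v d" using AB(1,2) wc by (intro eq_vecI) (auto simp: k0 scalar_prod_def)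
      finally show ?thesis .
    qed
    then have "W = {0\<^sub>v d}" using vec_subspaceD(2)[OF W] by blast
    then show False using ne(1) by simp
  qed
  moreover have "l \<noteq> 0"
  proof
    assume l0: "l = 0"
    have "A2 * B3 = 0\<^sub>m d d" using AB2(1) Bc(2) by (intro eq_matI) (auto simp: l0 scalar_prod_def)
    then have P1: "P = 1\<^sub>m d" using PQ Pc id(6) by simp
    have "v \<in> W" if "v \<in> carrier_vec d" for v using PW[OF that] that by (simp add: P1)
    then have "W = carrier_vec d" using vec_subspaceD(1)[OF W] by blast
    then show False using ne(2) by simp
  qed
  ultimately show ?thesis
    using that[of k l \<rho>1 \<rho>2 ?S ?T] kl r1 r2 STc ST TS Sr by simp
qed

end

lemma zero_pow_mat: "0 < k \<Longrightarrow> 0\<^sub>m d d ^\<^sub>m k = (0\<^sub>m d d :: complex mat)"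
  by (cases k) (auto simp: right_mult_zero_mat[of _ d d])

context non_nilpotent_group_datum
begin

section \<open>Ladder modules\<close>

text \<open>The representations of \<open>G/\<langle>g\<^sup>n\<rangle>\<close>, which are the \<open>H\<close>-modules with \<open>y = 0\<close>.\<close>

definition quot_rep :: "nat \<Rightarrow> ('a \<Rightarrow> complex mat) \<Rightarrow> bool" where
  "quot_rep d \<rho> \<longleftrightarrow> grp_rep d \<rho> \<and> \<rho> (g [^] n) = 1\<^sub>m d"

definition infl :: "nat \<Rightarrow> ('a \<Rightarrow> complex mat) \<Rightarrow> (nat \<times> 'a \<Rightarrow> complex) fdmod" where
  "infl d \<rho> = rep_mod d (0\<^sub>m d d) \<rho>"

text \<open>The Kronecker form of \<open>ladder_mod\<close>. The position in the chain is the coarse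
  index, in agreement with the numbering s * d + t of x^s e_t.\<close>

definition lad :: "nat \<Rightarrow> nat \<Rightarrow> ('a \<Rightarrow> complex mat) \<Rightarrow> (nat \<times> 'a \<Rightarrow> complex) fdmod" where
  "lad k d \<rho> = rep_mod (k * d) (kron (kY k) (1\<^sub>m d)) (\<lambda>h. kron (kG_rep k h) (\<rho> h))"

lemma quot_repD:
  assumes "quot_rep d \<rho>"
  shows "grp_rep d \<rho>" "h \<in> carrier G \<Longrightarrow> \<rho> h \<in> carrier_mat d d" "\<rho> \<one> = 1\<^sub>m d"
    "h \<in> carrier G \<Longrightarrow> k \<in> carrier G \<Longrightarrow> \<rho> (h \<otimes> k) = \<rho> h * \<rho> k" "\<rho> (g [^] n) = 1\<^sub>m d"
  using assms by (auto simp: quot_rep_def grp_rep_def)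

lemma infl_hrep:
  assumes "quot_rep d \<rho>"
  shows "hrep d (0\<^sub>m d d) \<rho>"
proof -
  have z: "(0\<^sub>m d d :: complex mat) ^\<^sub>m n = 0\<^sub>m d d" using n_ge_2 by (intro zero_pow_mat) simp
  show ?thesis
    unfolding hrep_def z
    using quot_repD[OF assms]
    by (auto simp: left_mult_zero_mat[of _ d d] right_mult_zero_mat[of _ d d])
qed

lemma infl_fdmod: "quot_rep d \<rho> \<Longrightarrow> is_fdmod H (infl d \<rho>)"
  by (simp add: infl_def rep_mod_fdmod infl_hrep)

lemma infl_mdim [simp]: "mdim (infl d \<rho>) = d"
  by (simp add: infl_def)

lemma infl_hY: "quot_rep d \<rho> \<Longrightarrow> hY (infl d \<rho>) = 0\<^sub>m d d"
  by (simp add: infl_def rep_mod_hY infl_hrep)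

lemma infl_hG: "quot_rep d \<rho> \<Longrightarrow> h \<in> carrier G \<Longrightarrow> hG (infl d \<rho>) h = \<rho> h"
  by (simp add: infl_def rep_mod_hG infl_hrep)

lemma lad_hrep:
  assumes q: "quot_rep d \<rho>" and k: "k \<le> n"
  shows "hrep (k * d) (kron (kY k) (1\<^sub>m d)) (\<lambda>h. kron (kG_rep k h) (\<rho> h))"
  unfolding hrep_def
proof (intro conjI ballI)
  note r = khrep[OF k] and qD = quot_repD[OF q]
  show "kron (kY k) (1\<^sub>m d) \<in> carrier_mat (k * d) (k * d)" by (intro kron_carrier) auto
  show "kron (kG_rep k h) (\<rho> h) \<in> carrier_mat (k * d) (k * d)" if "h \<in> carrier G" for h
    using that qD by (intro kron_carrier) auto
  show "kron (kG_rep k \<one>) (\<rho> \<one>) = 1\<^sub>m (k * d)" by (simp add: hrepD(3)[OF r] qD kron_one)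
  show "kron (kG_rep k (h \<otimes> l)) (\<rho> (h \<otimes> l)) = kron (kG_rep k h) (\<rho> h) * kron (kG_rep k l) (\<rho> l)"
    if "h \<in> carrier G" "l \<in> carrier G" for h l
    using that qD by (simp add: hrepD(4)[OF r] kron_mult[of _ k k _ k _ d d _ d])
  show "kron (kY k) (1\<^sub>m d) * kron (kG_rep k h) (\<rho> h) = \<chi> h \<cdot>\<^sub>m (kron (kG_rep k h) (\<rho> h) * kron (kY k) (1\<^sub>m d))"
    if h: "h \<in> carrier G" for h
    using qD(2)[OF h] by (simp add: hrepD(5)[OF r h] kron_smult_left flip: kron_mult[of _ k k _ k _ d d _ d])
  show "kron (kY k) (1\<^sub>m d) ^\<^sub>m n + 1\<^sub>m (k * d) = kron (kG_rep k (g [^] n)) (\<rho> (g [^] n))"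
    by (simp add: kron_pow[of _ k _ d] one_pow_mat qD(5) hrepD(6)[OF r, symmetric] kron_add_left flip: kron_one)
qed

lemma lad_fdmod: "quot_rep d \<rho> \<Longrightarrow> k \<le> n \<Longrightarrow> is_fdmod H (lad k d \<rho>)"
  by (simp add: lad_def rep_mod_fdmod lad_hrep)

lemma lad_mdim [simp]: "mdim (lad k d \<rho>) = k * d"
  by (simp add: lad_def)

lemma lad_hY: "quot_rep d \<rho> \<Longrightarrow> k \<le> n \<Longrightarrow> hY (lad k d \<rho>) = kron (kY k) (1\<^sub>m d)"
  by (simp add: lad_def rep_mod_hY lad_hrep)

lemma lad_hG: "quot_rep d \<rho> \<Longrightarrow> k \<le> n \<Longrightarrow> h \<in> carrier G \<Longrightarrow> hG (lad k d \<rho>) h = kron (kG_rep k h) (\<rho> h)"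
  by (simp add: lad_def rep_mod_hG[OF lad_hrep])

lemma ladder_mod_eq:
  assumes U: "is_fdmod kG U"
  shows "ladder_mod k U = lad k (mdim U) (gact U)"
proof -
  let ?d = "mdim U"
  have pd: "(x * m + b) div m = x" "(x * m + b) mod m = b" if "b < m" for b m x :: nat using that by simp_all
  have Y: "ladder_y k U = kron (kY k) (1\<^sub>m ?d)"
  proof (rule kron_eqI[of _ k ?d k ?d])
    fix i a j b assume ij: "i < k" "a < ?d" "j < k" "b < ?d"
    have "i * ?d + a = j * ?d + b + ?d \<longleftrightarrow> i = j + 1 \<and> a = b"
    proof
      assume *: "i * ?d + a = j * ?d + b + ?d"
      then have e: "i * ?d + a = (j + 1) * ?d + b" by simp
      have "i = j + 1" "a = b"
        using ij(2,4) arg_cong[OF e, of "\<lambda>x. x div ?d"] arg_cong[OF e, of "\<lambda>x. x mod ?d"]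
          pd[of a ?d i] pd[of b ?d "j + 1"] by (metis, metis)
      then show "i = j + 1 \<and> a = b" by blast
    qed simp
    then show "ladder_y k U $$ (i * ?d + a, j * ?d + b) = kron (kY k) (1\<^sub>m ?d) $$ (i * ?d + a, j * ?d + b)"
      using ij pair_index_less[OF ij(1,2)] pair_index_less[OF ij(3,4)]
      unfolding kron_index_pair[OF kY_carrier(1) one_carrier_mat ij]
      by (auto simp: ladder_y_def Let_def kY_index)
  qed (auto simp: ladder_y_def Let_def intro!: carrier_matI)
  have Gr: "ladder_grp k U h = kron (kG_rep k h) (gact U h)" if h: "h \<in> carrier G" for h
  proof (rule kron_eqI[of _ k ?d k ?d])
    note c = grp_repD(1)[OF fdmod_grp_rep[OF U] h]
    show "kron (kG_rep k h) (gact U h) \<in> carrier_mat (k * ?d) (k * ?d)" by (rule kron_carrier[OF kG_carrier(1) c])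
    fix i a j b assume ij: "i < k" "a < ?d" "j < k" "b < ?d"
    show "ladder_grp k U h $$ (i * ?d + a, j * ?d + b) = kron (kG_rep k h) (gact U h) $$ (i * ?d + a, j * ?d + b)"
      using ij pair_index_less[OF ij(1,2)] pair_index_less[OF ij(3,4)]
      unfolding kron_index_pair[OF kG_carrier(1) c ij(1,2,3,4)]
      by (auto simp: ladder_grp_def Let_def kG_index gact_def)
  qed (auto simp: ladder_grp_def Let_def intro!: carrier_matI)
  have "lin (k * ?d) (k * ?d) H_basis a (\<lambda>(s, h). ladder_y k U ^\<^sub>m s * ladder_grp k U h)
      = lin (k * ?d) (k * ?d) H_basis a (\<lambda>(s, h). kron (kY k) (1\<^sub>m ?d) ^\<^sub>m s * kron (kG_rep k h) (gact U h))" for a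
    by (intro lin_cong refl) (auto simp: H_basis_def Y Gr)
  then show ?thesis
    by (simp add: ladder_mod_def lad_def rep_mod_def lin_def case_prod_unfold fun_eq_iff)
qed

text \<open>Every chain of y in this module has length k and ends in the layer x^(k-1) V, where h
  acts by \<chi>(h)^(-(k-1)) times \<open>\<rho> h\<close>.\<close>

lemma phi_lad:
  assumes q: "quot_rep d \<rho>" and k: "0 < k" "k \<le> n" and h: "h \<in> carrier G"
  shows "phi s h (lad k d \<rho>) = (if k = Suc s then inverse (\<chi> h) ^ s * mtrace (\<rho> h) else 0)"
proof -
  let ?M = "lad k d \<rho>" and ?D = "k * d"
  note f = lad_fdmod[OF q k(2)] and qD = quot_repD[OF q]
  \<comment> \<open>The matrix unit sending e_(k-1) to e_i. For i = k - 1 it projects onto the end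
    of the chain, and for i = k - 1 - t it supplies a preimage of that projection under y^t.\<close>
  define E where "E i = (mat k k (\<lambda>(r, c). of_bool (r = i \<and> c = k - 1)) :: complex mat)" for i
  have Ec: "E i \<in> carrier_mat k k" for i by (simp add: E_def)
  have Yp: "hY ?M ^\<^sub>m t = kron (kY k ^\<^sub>m t) (1\<^sub>m d)" for t
    by (simp add: lad_hY[OF q k(2)] kron_pow[of _ k _ d] one_pow_mat)
  have soc_small: "is_proj ?D (kron (E (k - 1)) (1\<^sub>m d)) (soc ?M t)" if t: "t < k" for t
    unfolding is_proj_def
  proof (intro conjI ballI)
    show Pc: "kron (E (k - 1)) (1\<^sub>m d) \<in> carrier_mat ?D ?D" using Ec by (intro kron_carrier) auto
    define F where "F = kron (E (k - 1 - t)) (1\<^sub>m d)"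
    have Fc: "F \<in> carrier_mat ?D ?D" unfolding F_def using Ec by (intro kron_carrier) auto
    have YE: "kY k * E (k - 1) = 0\<^sub>m k k"
      by (intro eq_matI) (auto simp: kY_mult_index[of _ k k] E_def simp del: index_mult_mat(1))
    have YtE: "kY k ^\<^sub>m t * E (k - 1 - t) = E (k - 1)"
    proof (rule eq_matI)
      fix i j assume "i < dim_row (E (k - 1))" "j < dim_col (E (k - 1))"
      then have ij: "i < k" "j < k" by (auto simp: E_def)
      have "(kY k ^\<^sub>m t * E (k - 1 - t)) $$ (i, j) = (\<Sum>l<k. (kY k ^\<^sub>m t) $$ (i, l) * E (k - 1 - t) $$ (l, j))"
        using ij Ec by (subst mult_mat_index) (auto simp: E_def)
      also have "\<dots> = (\<Sum>l<k. if l = k - 1 - t then of_bool (i = l + t \<and> j = k - 1) else 0)"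
        using ij by (intro sum.cong) (auto simp: kY_pow_index E_def)
      also have "\<dots> = E (k - 1) $$ (i, j)" using ij t k by (auto simp: E_def)
      finally show "(kY k ^\<^sub>m t * E (k - 1 - t)) $$ (i, j) = E (k - 1) $$ (i, j)" .
    qed (auto simp: E_def)
    fix v :: "complex vec" assume v: "v \<in> carrier_vec ?D"
    have 1: "hY ?M *\<^sub>v (kron (E (k - 1)) (1\<^sub>m d) *\<^sub>v v) = 0\<^sub>v ?D"
    proof -
      have "hY ?M * kron (E (k - 1)) (1\<^sub>m d) = kron (kY k * E (k - 1)) (1\<^sub>m d * 1\<^sub>m d)"
        unfolding lad_hY[OF q k(2)] by (rule kron_mult[OF kY_carrier(1) Ec one_carrier_mat one_carrier_mat, symmetric])
      also have "\<dots> = 0\<^sub>m ?D ?D" unfolding YE by (simp add: kron_zero_left)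
      finally have z: "hY ?M * kron (E (k - 1)) (1\<^sub>m d) = 0\<^sub>m ?D ?D" .
      have "hY ?M *\<^sub>v (kron (E (k - 1)) (1\<^sub>m d) *\<^sub>v v) = (hY ?M * kron (E (k - 1)) (1\<^sub>m d)) *\<^sub>v v"
        using v Pc hY_carriers(1)[OF f] by (simp only: assoc_mult_mat_vec[of _ ?D ?D] lad_mdim)
      then show ?thesis unfolding z using v by (auto intro!: eq_vecI simp: scalar_prod_def)
    qed
    have 2: "kron (E (k - 1)) (1\<^sub>m d) *\<^sub>v v = hY ?M ^\<^sub>m t *\<^sub>v (F *\<^sub>v v)"
    proof -
      have "hY ?M ^\<^sub>m t * F = kron (kY k ^\<^sub>m t * E (k - 1 - t)) (1\<^sub>m d * 1\<^sub>m d)"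
        unfolding Yp F_def by (rule kron_mult[OF pow_carrier_mat[OF kY_carrier(1)] Ec one_carrier_mat one_carrier_mat, symmetric])
      then have e: "hY ?M ^\<^sub>m t * F = kron (E (k - 1)) (1\<^sub>m d)" unfolding YtE by simp
      show ?thesis unfolding e[symmetric]
        using v Fc hY_carriers(2)[OF f, of t] by (intro assoc_mult_mat_vec[of _ ?D ?D]) auto
    qed
    have Yn: "hY ?M ^\<^sub>m n = 0\<^sub>m ?D ?D"
    proof -
      have "kY k ^\<^sub>m n = 0\<^sub>m k k" using k by (intro eq_matI) (auto simp: kY_pow_index)
      then show ?thesis by (simp add: Yp kron_zero_left)
    qed
    have zz: "0\<^sub>m ?D ?D *\<^sub>v u = 0\<^sub>v ?D" if "u \<in> carrier_vec ?D" for u :: "complex vec"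
      using that by (auto intro!: eq_vecI simp: scalar_prod_def)
    have 3: "hY ?M ^\<^sub>m n *\<^sub>v (F *\<^sub>v v) = 0\<^sub>v ?D"
      unfolding Yn by (rule zz[OF mult_mat_vec_carrier[OF Fc v]])
    show "kron (E (k - 1)) (1\<^sub>m d) *\<^sub>v v \<in> soc ?M t"
      unfolding soc_def using 1 2 3 mult_mat_vec_carrier[OF Fc v] mult_mat_vec_carrier[OF Pc v] by auto
  next
    fix w assume "w \<in> soc ?M t"
    then have w: "w \<in> carrier_vec ?D" "hY ?M *\<^sub>v w = 0\<^sub>v ?D" by (auto simp: soc_def)
    define X where "X = kron (transpose_mat (kY k)) (1\<^sub>m d)"
    have Xc: "X \<in> carrier_mat ?D ?D" unfolding X_def by (intro kron_carrier) auto
    have Pc: "kron (E (k - 1)) (1\<^sub>m d) \<in> carrier_mat ?D ?D" using Ec by (intro kron_carrier) auto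
    \<comment> \<open>Shifting forwards and then backwards loses the last basis vector only. Hence
      on ker y the projection onto the last layer is the identity.\<close>
    have TY: "transpose_mat (kY k) * kY k + E (k - 1) = 1\<^sub>m k"
    proof (rule eq_matI)
      fix i j assume "i < dim_row (1\<^sub>m k :: complex mat)" "j < dim_col (1\<^sub>m k :: complex mat)"
      then have ij: "i < k" "j < k" by auto
      have c: "transpose_mat (kY k) \<in> carrier_mat k k" by auto
      show "(transpose_mat (kY k) * kY k + E (k - 1)) $$ (i, j) = 1\<^sub>m k $$ (i, j)"
        using ij mult_kY_index[OF c ij] by (auto simp: E_def kY_index simp del: index_mult_mat(1))
    qed (auto simp: E_def)
    have "X * hY ?M + kron (E (k - 1)) (1\<^sub>m d) = 1\<^sub>m ?D"
    proof -
      have c: "transpose_mat (kY k) \<in> carrier_mat k k" by auto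
      have "X * hY ?M = kron (transpose_mat (kY k) * kY k) (1\<^sub>m d * 1\<^sub>m d)"
        unfolding X_def lad_hY[OF q k(2)] by (rule kron_mult[OF c kY_carrier(1) one_carrier_mat one_carrier_mat, symmetric])
      then have "X * hY ?M + kron (E (k - 1)) (1\<^sub>m d) = kron (transpose_mat (kY k) * kY k + E (k - 1)) (1\<^sub>m d)"
        by (simp add: kron_add_left E_def)
      then show ?thesis unfolding TY by (simp add: kron_one)
    qed
    then have "w = (X * hY ?M + kron (E (k - 1)) (1\<^sub>m d)) *\<^sub>v w" using w by simp
    also have "\<dots> = (X * hY ?M) *\<^sub>v w + kron (E (k - 1)) (1\<^sub>m d) *\<^sub>v w"
      using Xc Pc hY_carriers(1)[OF f] w(1)
      by (intro add_mult_distrib_mat_vec[of _ ?D ?D]) (auto intro: mult_carrier_mat[of _ ?D ?D])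
    also have "(X * hY ?M) *\<^sub>v w = X *\<^sub>v (hY ?M *\<^sub>v w)"
      using Xc hY_carriers(1)[OF f] w(1) by (intro assoc_mult_mat_vec[of _ ?D ?D]) auto
    also have "\<dots> = 0\<^sub>v ?D" unfolding w(2) using Xc by (simp add: mult_zero_vec)
    also have "0\<^sub>v ?D + kron (E (k - 1)) (1\<^sub>m d) *\<^sub>v w = kron (E (k - 1)) (1\<^sub>m d) *\<^sub>v w"
      using mult_mat_vec_carrier[OF Pc w(1)] by (rule left_zero_vec)
    finally show "kron (E (k - 1)) (1\<^sub>m d) *\<^sub>v w = w" ..
  qed
  have soc_large: "is_proj ?D (0\<^sub>m ?D ?D) (soc ?M t)" if t: "k \<le> t" for t
  proof -
    have "kY k ^\<^sub>m t = 0\<^sub>m k k" using t by (intro eq_matI) (auto simp: kY_pow_index)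
    then have Yt: "hY ?M ^\<^sub>m t = 0\<^sub>m ?D ?D" by (simp add: Yp kron_zero_left)
    have z: "0\<^sub>m ?D ?D *\<^sub>v v = 0\<^sub>v ?D" if "v \<in> carrier_vec ?D" for v :: "complex vec"
      using that by (auto intro!: eq_vecI simp: scalar_prod_def)
    have "soc ?M t = {0\<^sub>v ?D}"
      using vec_subspaceD(2)[OF soc_subspace[OF f, of t]] by (auto simp: soc_def Yt z)
    then show ?thesis by (auto simp: is_proj_def z)
  qed
  have tr: "mtrace (hG ?M h * soc_proj ?M t) = (if t < k then inverse (\<chi> h) ^ (k - 1) * mtrace (\<rho> h) else 0)" for t
  proof (cases "t < k")
    case True
    have "mtrace (hG ?M h * soc_proj ?M t) = mtrace (hG ?M h * kron (E (k - 1)) (1\<^sub>m d))"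
      using soc_trace[OF f h] soc_small[OF True] by simp
    also have "hG ?M h * kron (E (k - 1)) (1\<^sub>m d) = kron (kG_rep k h * E (k - 1)) (\<rho> h * 1\<^sub>m d)"
      unfolding lad_hG[OF q k(2) h] by (rule kron_mult[OF kG_carrier(1) Ec qD(2)[OF h] one_carrier_mat, symmetric])
    also have "mtrace \<dots> = mtrace (kG_rep k h * E (k - 1)) * mtrace (\<rho> h)"
      using qD(2)[OF h] Ec[of "k - 1"] by (subst mtrace_kron[of _ k _ d]) (auto intro!: mult_carrier_mat[of _ k k])
    also have "mtrace (kG_rep k h * E (k - 1)) = (\<Sum>i<k. if i = k - 1 then inverse (\<chi> h) ^ (k - 1) else 0)"
      using Ec[of "k - 1"] unfolding mtrace_def
      by (intro sum.cong) (auto simp: kG_mult_index[of _ k k] E_def simp del: index_mult_mat(1))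
    also have "\<dots> = inverse (\<chi> h) ^ (k - 1)" using k by simp
    finally show ?thesis using True by simp
  next
    case False
    then have "mtrace (hG ?M h * soc_proj ?M t) = mtrace (hG ?M h * 0\<^sub>m ?D ?D)"
      using soc_trace[OF f h] soc_large by simp
    also have "hG ?M h * 0\<^sub>m ?D ?D = 0\<^sub>m ?D ?D" using hY_carriers(3)[OF f h] by simp
    finally show ?thesis using False by (simp add: mtrace_zero)
  qed
  show ?thesis unfolding phi_def tr by auto
qed

section \<open>Relations between the generators of the stable Green ring\<close>

abbreviation R :: "((nat \<times> 'a \<Rightarrow> complex) fdmod set \<Rightarrow>\<^sub>0 int) set set ring" where
  "R \<equiv> stable_green_ring"

definition jor :: "nat \<Rightarrow> ((nat \<times> 'a \<Rightarrow> complex) fdmod set \<Rightarrow>\<^sub>0 int) set set" where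
  "jor k = stable_class (kmod k)"

definition inf_class :: "nat \<Rightarrow> ('a \<Rightarrow> complex mat) \<Rightarrow> ((nat \<times> 'a \<Rightarrow> complex) fdmod set \<Rightarrow>\<^sub>0 int) set set" where
  "inf_class d \<rho> = stable_class (infl d \<rho>)"

definition chi_inv :: "'a \<Rightarrow> complex mat" where
  "chi_inv h = inverse (\<chi> h) \<cdot>\<^sub>m 1\<^sub>m 1"

lemma jor_closed: "k \<le> n \<Longrightarrow> jor k \<in> carrier R"
  by (simp add: jor_def stable_class_closed kmod_fdmod)

lemma inf_class_closed: "quot_rep d \<rho> \<Longrightarrow> inf_class d \<rho> \<in> carrier R"
  by (simp add: inf_class_def stable_class_closed infl_fdmod)

lemma chi_inv_quot: "quot_rep 1 chi_inv"
proof -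
  have 1: "chi_inv h \<in> carrier_mat 1 1" for h by (simp add: chi_inv_def)
  have 2: "chi_inv (h \<otimes> k) = chi_inv h * chi_inv k" if "h \<in> carrier G" "k \<in> carrier G" for h k
    using that by (intro eq_matI) (auto simp: chi_inv_def chi_mult)
  have 3: "chi_inv \<one> = 1\<^sub>m 1" "chi_inv (g [^] n) = 1\<^sub>m 1"
    unfolding chi_inv_def by (intro eq_matI; simp add: chi_one chi_gn)+
  show ?thesis using 1 2 3 by (auto simp: quot_rep_def grp_rep_def)
qed

text \<open>As y vanishes on the first factor, \<Delta>(y) acts as 1 \<otimes> y alone and the plain
  swap of factors is equivariant.\<close>

lemma infl_tensor_kmod_iso:
  assumes q: "quot_rep d \<rho>" and k: "k \<le> n"
  shows "mod_iso H (tensor_mod (infl d \<rho>) (kmod k)) (lad k d \<rho>)"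
proof (rule mod_isoI[of _ _ "flip_mat d k" "flip_mat k d"])
  note f = infl_fdmod[OF q] kmod_fdmod[OF k]
  show "is_fdmod H (tensor_mod (infl d \<rho>) (kmod k))" by (rule tensor_fdmod[OF f])
  show "is_fdmod H (lad k d \<rho>)" by (rule lad_fdmod[OF q k])
  show "flip_mat d k \<in> carrier_mat (mdim (lad k d \<rho>)) (mdim (tensor_mod (infl d \<rho>) (kmod k)))"
    "flip_mat k d \<in> carrier_mat (mdim (tensor_mod (infl d \<rho>) (kmod k))) (mdim (lad k d \<rho>))"
    by simp_all
  show "flip_mat k d * flip_mat d k = 1\<^sub>m (mdim (tensor_mod (infl d \<rho>) (kmod k)))"
    "flip_mat d k * flip_mat k d = 1\<^sub>m (mdim (lad k d \<rho>))"
    by (simp_all add: flip_flip)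
  have Y: "hY (tensor_mod (infl d \<rho>) (kmod k)) = kron (1\<^sub>m d) (kY k)"
    using kron_carrier[OF one_carrier_mat[of d] kY_carrier(1)[of k]]
    by (simp add: tensor_hY[OF f] infl_hY[OF q] kmod_hY[OF k] kmod_hG[OF k g_closed] kron_zero_left)
  show "flip_mat d k * hY (tensor_mod (infl d \<rho>) (kmod k)) = hY (lad k d \<rho>) * flip_mat d k"
    unfolding Y lad_hY[OF q k] by (rule flip_kron[OF one_carrier_mat kY_carrier(1)])
  show "flip_mat d k * hG (tensor_mod (infl d \<rho>) (kmod k)) h = hG (lad k d \<rho>) h * flip_mat d k"
    if h: "h \<in> carrier G" for h
    unfolding tensor_hG[OF f h] infl_hG[OF q h] kmod_hG[OF k h] lad_hG[OF q k h]
    by (rule flip_kron[OF quot_repD(2)[OF q h] kG_carrier(1)])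
qed

lemma stable_class_lad:
  assumes "quot_rep d \<rho>" "k \<le> n"
  shows "stable_class (lad k d \<rho>) = inf_class d \<rho> \<otimes>\<^bsub>R\<^esub> jor k"
  using assms stable_class_iso[OF infl_tensor_kmod_iso[OF assms] tensor_fdmod lad_fdmod]
  by (simp add: inf_class_def jor_def infl_fdmod kmod_fdmod stable_class_tensor)

text \<open>In this order \<Delta>(y) acts as y \<otimes> g. Applying g to the layer of e_0 only,
  which is \<open>T\<close>, removes the extra g. The case of \<open>kmod 2\<close> is enough,
  because by their recursion all \<open>jor k\<close> are polynomials in \<open>jor 2\<close> and
  the class of \<open>chi_inv\<close>.\<close>

lemma kmod2_tensor_infl_iso:
  assumes q: "quot_rep d \<rho>"
  shows "mod_iso H (tensor_mod (kmod 2) (infl d \<rho>)) (lad 2 d \<rho>)"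
proof -
  define E where "E i = (mat 2 2 (\<lambda>(r, c). of_bool (r = i \<and> c = i)) :: complex mat)" for i :: nat
  have Ec: "E i \<in> carrier_mat 2 2" for i by (simp add: E_def)
  have EE: "E 0 * E 0 = E 0" "E 0 * E 1 = 0\<^sub>m 2 2" "E 1 * E 0 = 0\<^sub>m 2 2" "E 1 * E 1 = E 1"
    unfolding E_def by (intro eq_matI; auto simp: scalar_prod_def sum.atLeast0_lessThan_Suc numeral_2_eq_2)+
  have E1: "E 0 + E 1 = 1\<^sub>m 2" unfolding E_def by (intro eq_matI) auto
  have EY: "E 0 * kY 2 = 0\<^sub>m 2 2" "E 1 * kY 2 = kY 2" "kY 2 * E 0 = kY 2" "kY 2 * E 1 = 0\<^sub>m 2 2"
    unfolding E_def kY_def by (intro eq_matI; auto simp: scalar_prod_def sum.atLeast0_lessThan_Suc numeral_2_eq_2)+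
  have EG: "E i * kG_rep 2 h = kG_rep 2 h * E i" for i h
    unfolding E_def kG_rep_def by (intro eq_matI; auto simp: scalar_prod_def sum.atLeast0_lessThan_Suc numeral_2_eq_2)+
  note f = kmod_fdmod[OF n_ge_2] infl_fdmod[OF q] and qD = quot_repD[OF q]
  let ?g' = "inv g"
  have g': "?g' \<in> carrier G" using g_closed by simp
  have P: "\<rho> g \<in> carrier_mat d d" "\<rho> ?g' \<in> carrier_mat d d" using qD(2) g_closed g' by auto
  have Pinv: "\<rho> g * \<rho> ?g' = 1\<^sub>m d" "\<rho> ?g' * \<rho> g = 1\<^sub>m d"
    using g_closed g' by (simp_all add: qD(3) flip: qD(4))
  define T where "T = kron (E 0) (\<rho> g) + kron (E 1) (1\<^sub>m d)"
  define S where "S = kron (E 0) (\<rho> ?g') + kron (E 1) (1\<^sub>m d)"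
  note km = kron_mult[of _ 2 2 _ 2 _ d d _ d, symmetric]
  have kc: "kron A B \<in> carrier_mat (2 * d) (2 * d)" if "A \<in> carrier_mat 2 2" "B \<in> carrier_mat d d" for A B
    using that by (rule kron_carrier)
  have add_l: "(kron A B + kron C D) * kron A' B' = kron (A * A') (B * B') + kron (C * A') (D * B')"
    if "A \<in> carrier_mat 2 2" "B \<in> carrier_mat d d" "C \<in> carrier_mat 2 2" "D \<in> carrier_mat d d"
      "A' \<in> carrier_mat 2 2" "B' \<in> carrier_mat d d" for A B C D A' B'
    using that by (subst add_mult_distrib_mat[OF kc kc kc]) (auto simp: km)
  have add_r: "kron A' B' * (kron A B + kron C D) = kron (A' * A) (B' * B) + kron (A' * C) (B' * D)"
    if "A \<in> carrier_mat 2 2" "B \<in> carrier_mat d d" "C \<in> carrier_mat 2 2" "D \<in> carrier_mat d d"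
      "A' \<in> carrier_mat 2 2" "B' \<in> carrier_mat d d" for A B C D A' B'
    using that by (subst mult_add_distrib_mat[OF kc kc kc]) (auto simp: km)
  have prod: "(kron (E 0) A + kron (E 1) (1\<^sub>m d)) * (kron (E 0) B + kron (E 1) (1\<^sub>m d)) = 1\<^sub>m (2 * d)"
    if AB: "A \<in> carrier_mat d d" "B \<in> carrier_mat d d" "A * B = 1\<^sub>m d" for A B
  proof -
    have c: "kron (E 0) A + kron (E 1) (1\<^sub>m d) \<in> carrier_mat (2 * d) (2 * d)"
      using AB by (intro add_carrier_mat kc Ec) auto
    have "(kron (E 0) A + kron (E 1) (1\<^sub>m d)) * (kron (E 0) B + kron (E 1) (1\<^sub>m d))
      = (kron (E 0) A + kron (E 1) (1\<^sub>m d)) * kron (E 0) B + (kron (E 0) A + kron (E 1) (1\<^sub>m d)) * kron (E 1) (1\<^sub>m d)"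
      by (rule mult_add_distrib_mat[OF c kc[OF Ec AB(2)] kc[OF Ec one_carrier_mat]])
    also have "\<dots> = (kron (E 0) (1\<^sub>m d) + kron (0\<^sub>m 2 2) B) + (kron (0\<^sub>m 2 2) A + kron (E 1) (1\<^sub>m d))"
      using AB Ec by (simp add: add_l EE[unfolded One_nat_def])
    also have "\<dots> = kron (E 0) (1\<^sub>m d) + kron (E 1) (1\<^sub>m d)"
      using AB kc[OF Ec one_carrier_mat, of 0] kc[OF Ec one_carrier_mat, of 1] by (simp add: kron_zero_left)
    also have "\<dots> = kron (E 0 + E 1) (1\<^sub>m d)" by (rule kron_add_left[symmetric]) (simp_all add: E_def)
    finally show ?thesis unfolding E1 by (simp add: kron_one)
  qed
  have YM: "hY (tensor_mod (kmod 2) (infl d \<rho>)) = kron (kY 2) (\<rho> g)"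
    using kc[OF kY_carrier(1) P(1)]
    by (simp add: tensor_hY[OF f] infl_hY[OF q] kmod_hY[OF n_ge_2] infl_hG[OF q g_closed] kron_zero_right)
  show ?thesis
  proof (rule mod_isoI[of _ _ T S])
    show "is_fdmod H (tensor_mod (kmod 2) (infl d \<rho>))" by (rule tensor_fdmod[OF f])
    show "is_fdmod H (lad 2 d \<rho>)" by (rule lad_fdmod[OF q n_ge_2])
    have "T \<in> carrier_mat (2 * d) (2 * d)" "S \<in> carrier_mat (2 * d) (2 * d)"
      using P by (auto simp: T_def S_def intro!: add_carrier_mat kc Ec)
    then show "T \<in> carrier_mat (mdim (lad 2 d \<rho>)) (mdim (tensor_mod (kmod 2) (infl d \<rho>)))"
      "S \<in> carrier_mat (mdim (tensor_mod (kmod 2) (infl d \<rho>))) (mdim (lad 2 d \<rho>))" by simp_all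
    show "S * T = 1\<^sub>m (mdim (tensor_mod (kmod 2) (infl d \<rho>)))" "T * S = 1\<^sub>m (mdim (lad 2 d \<rho>))"
      using prod P Pinv by (simp_all add: T_def S_def)
    show "T * hY (tensor_mod (kmod 2) (infl d \<rho>)) = hY (lad 2 d \<rho>) * T"
      unfolding YM lad_hY[OF q n_ge_2] T_def using P Ec kc[OF kY_carrier(1) P(1)]
      by (simp add: add_l add_r EY[unfolded One_nat_def] kron_zero_left)
    fix h assume h: "h \<in> carrier G"
    have c: "\<rho> g * \<rho> h = \<rho> h * \<rho> g" using h g_closed g_central[OF h] by (simp flip: qD(4))
    show "T * hG (tensor_mod (kmod 2) (infl d \<rho>)) h = hG (lad 2 d \<rho>) h * T"
      unfolding tensor_hG[OF f h] infl_hG[OF q h] kmod_hG[OF n_ge_2 h] lad_hG[OF q n_ge_2 h] T_def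
      using P Ec qD(2)[OF h] by (simp add: add_l add_r EG c)
  qed
qed

lemma jor2_commute:
  assumes q: "quot_rep d \<rho>"
  shows "jor 2 \<otimes>\<^bsub>R\<^esub> inf_class d \<rho> = inf_class d \<rho> \<otimes>\<^bsub>R\<^esub> jor 2"
  using stable_class_iso[OF kmod2_tensor_infl_iso[OF q] tensor_fdmod lad_fdmod] q n_ge_2
  by (simp add: stable_class_lad stable_class_tensor kmod_fdmod infl_fdmod jor_def inf_class_def)

lemma infl_tensor:
  assumes q: "quot_rep d \<rho>" and q': "quot_rep e \<sigma>"
  shows "quot_rep (d * e) (\<lambda>h. kron (\<rho> h) (\<sigma> h))"
    "tensor_mod (infl d \<rho>) (infl e \<sigma>) = infl (d * e) (\<lambda>h. kron (\<rho> h) (\<sigma> h))"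
proof -
  note D = quot_repD[OF q] and D' = quot_repD[OF q']
  show qq: "quot_rep (d * e) (\<lambda>h. kron (\<rho> h) (\<sigma> h))"
    unfolding quot_rep_def grp_rep_def
    using D(2-5) D'(2-5) by (auto simp: kron_one kron_mult[of _ d d _ d _ e e _ e] intro!: kron_carrier)
  note f = infl_fdmod[OF q] infl_fdmod[OF q']
  have Y: "tensor_Y d (0\<^sub>m d d) (\<sigma> g) (0\<^sub>m e e) = 0\<^sub>m (d * e) (d * e)"
    using D'(2)[OF g_closed] by (simp add: tensor_Y_def kron_zero_left kron_zero_right)
  have "tensor_mod (infl d \<rho>) (infl e \<sigma>) = rep_mod (d * e) (0\<^sub>m (d * e) (d * e)) (\<lambda>h. kron (hG (infl d \<rho>) h) (hG (infl e \<sigma>) h))"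
    unfolding tensor_mod_eq[OF f] infl_hY[OF q] infl_hY[OF q'] infl_hG[OF q' g_closed] infl_mdim Y ..
  also have "\<dots> = infl (d * e) (\<lambda>h. kron (\<rho> h) (\<sigma> h))"
    unfolding infl_def[of "d * e"]
    by (rule rep_mod_cong[symmetric, OF infl_hrep[OF qq]]) (simp add: infl_hG[OF q] infl_hG[OF q'])
  finally show "tensor_mod (infl d \<rho>) (infl e \<sigma>) = infl (d * e) (\<lambda>h. kron (\<rho> h) (\<sigma> h))" .
qed

lemma inf_class_mult:
  assumes "quot_rep d \<rho>" "quot_rep e \<sigma>"
  shows "inf_class d \<rho> \<otimes>\<^bsub>R\<^esub> inf_class e \<sigma> = inf_class (d * e) (\<lambda>h. kron (\<rho> h) (\<sigma> h))"
  using assms by (simp add: inf_class_def infl_fdmod flip: stable_class_tensor infl_tensor(2))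

lemma chi_class_commute:
  assumes q: "quot_rep d \<rho>"
  shows "inf_class 1 chi_inv \<otimes>\<^bsub>R\<^esub> inf_class d \<rho> = inf_class d \<rho> \<otimes>\<^bsub>R\<^esub> inf_class 1 chi_inv"
proof -
  have "kron (chi_inv h) (\<rho> h) = kron (\<rho> h) (chi_inv h)" for h
    unfolding chi_inv_def kron_smult_left kron_smult_right kron_one_left kron_one_right ..
  then show ?thesis
    unfolding inf_class_mult[OF q chi_inv_quot] inf_class_mult[OF chi_inv_quot q] by (simp add: mult.commute)
qed

lemma inf_class_iso:
  assumes q: "quot_rep d \<rho>" and q': "quot_rep e \<sigma>"
    and T: "T \<in> carrier_mat e d" "S \<in> carrier_mat d e" "S * T = 1\<^sub>m d" "T * S = 1\<^sub>m e"
    and i: "\<And>h. h \<in> carrier G \<Longrightarrow> T * \<rho> h = \<sigma> h * T"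
  shows "inf_class d \<rho> = inf_class e \<sigma>"
  unfolding inf_class_def
proof (rule stable_class_iso[OF _ infl_fdmod[OF q] infl_fdmod[OF q']])
  show "mod_iso H (infl d \<rho>) (infl e \<sigma>)"
    using T i left_mult_zero_mat[OF T(1)] right_mult_zero_mat[OF T(1)]
    by (intro mod_isoI[of _ _ T S]) (simp_all add: infl_fdmod[OF q] infl_fdmod[OF q'] infl_hY[OF q] infl_hY[OF q'] infl_hG[OF q] infl_hG[OF q'])
qed

lemma inf_class_dsum:
  assumes q: "quot_rep k \<rho>1" and q': "quot_rep l \<rho>2"
  shows "quot_rep (k + l) (\<lambda>h. diag_block (\<rho>1 h) (\<rho>2 h))"
    "inf_class (k + l) (\<lambda>h. diag_block (\<rho>1 h) (\<rho>2 h)) = inf_class k \<rho>1 \<oplus>\<^bsub>R\<^esub> inf_class l \<rho>2"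
proof -
  note D = quot_repD[OF q] and D' = quot_repD[OF q']
  have dim: "dim_row (\<rho>1 h) = k" "dim_col (\<rho>1 h) = k" "dim_row (\<rho>2 h) = l" "dim_col (\<rho>2 h) = l" if "h \<in> carrier G" for h
    using D(2)[OF that] D'(2)[OF that] by auto
  show qq: "quot_rep (k + l) (\<lambda>h. diag_block (\<rho>1 h) (\<rho>2 h))"
    unfolding quot_rep_def grp_rep_def
  proof (intro conjI ballI)
    show "diag_block (\<rho>1 h) (\<rho>2 h) \<in> carrier_mat (k + l) (k + l)" if "h \<in> carrier G" for h
      using D(2)[OF that] D'(2)[OF that] by (rule diag_block_carrier)
    show "diag_block (\<rho>1 \<one>) (\<rho>2 \<one>) = 1\<^sub>m (k + l)" "diag_block (\<rho>1 (g [^] n)) (\<rho>2 (g [^] n)) = 1\<^sub>m (k + l)"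
      by (simp_all add: D(3,5) D'(3,5))
    show "diag_block (\<rho>1 (h \<otimes> m)) (\<rho>2 (h \<otimes> m)) = diag_block (\<rho>1 h) (\<rho>2 h) * diag_block (\<rho>1 m) (\<rho>2 m)"
      if "h \<in> carrier G" "m \<in> carrier G" for h m
      unfolding D(4)[OF that] D'(4)[OF that]
      by (rule diag_block_mult[symmetric, OF D(2)[OF that(1)] D'(2)[OF that(1)] D(2)[OF that(2)] D'(2)[OF that(2)]])
  qed
  note f = infl_fdmod[OF q] infl_fdmod[OF q']
  have "mod_iso H (infl (k + l) (\<lambda>h. diag_block (\<rho>1 h) (\<rho>2 h))) (dsum (infl k \<rho>1) (infl l \<rho>2))"
  proof (rule mod_isoI[of _ _ "1\<^sub>m (k + l)" "1\<^sub>m (k + l)"])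
    show "is_fdmod H (infl (k + l) (\<lambda>h. diag_block (\<rho>1 h) (\<rho>2 h)))" by (rule infl_fdmod[OF qq])
    show "is_fdmod H (dsum (infl k \<rho>1) (infl l \<rho>2))" by (rule dsum_fdmod[OF f])
    have "hY (dsum (infl k \<rho>1) (infl l \<rho>2)) = 0\<^sub>m (k + l) (k + l)"
      by (simp add: dsum_hY[OF f] infl_hY[OF q] infl_hY[OF q'])
    then show "1\<^sub>m (k + l) * hY (infl (k + l) (\<lambda>h. diag_block (\<rho>1 h) (\<rho>2 h))) = hY (dsum (infl k \<rho>1) (infl l \<rho>2)) * 1\<^sub>m (k + l)"
      by (simp add: infl_hY[OF qq])
    fix h assume h: "h \<in> carrier G"
    show "1\<^sub>m (k + l) * hG (infl (k + l) (\<lambda>h. diag_block (\<rho>1 h) (\<rho>2 h))) h = hG (dsum (infl k \<rho>1) (infl l \<rho>2)) h * 1\<^sub>m (k + l)"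
      unfolding infl_hG[OF qq h] dsum_hG[OF f h] infl_hG[OF q h] infl_hG[OF q' h]
      using diag_block_carrier[OF D(2)[OF h] D'(2)[OF h]] by (simp only: left_mult_one_mat right_mult_one_mat)
  qed simp_all
  from stable_class_iso[OF this infl_fdmod[OF qq] dsum_fdmod[OF f]]
  show "inf_class (k + l) (\<lambda>h. diag_block (\<rho>1 h) (\<rho>2 h)) = inf_class k \<rho>1 \<oplus>\<^bsub>R\<^esub> inf_class l \<rho>2"
    by (simp add: inf_class_def stable_class_dsum f)
qed

lemma jor_0: "jor 0 = \<zero>\<^bsub>R\<^esub>"
proof -
  interpret R: ring R by (rule stable_green_ring_ring)
  have f: "is_fdmod H (kmod 0)" by (simp add: kmod_fdmod)
  have "mod_iso H (dsum (kmod 0) (kmod 0)) (kmod 0)"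
    using f dsum_fdmod[OF f f] by (intro mod_isoI[of _ _ "0\<^sub>m 0 0" "0\<^sub>m 0 0"])
      (auto intro!: eq_matI simp: dsum_hY[OF f f] dsum_hG[OF f f] kmod_hY kmod_hG)
  from stable_class_iso[OF this dsum_fdmod[OF f f] f]
  have "jor 0 \<oplus>\<^bsub>R\<^esub> jor 0 = jor 0" by (simp add: jor_def stable_class_dsum f)
  then show ?thesis using R.add.l_cancel_one[of "jor 0" "jor 0"] jor_closed[of 0] by simp
qed

lemma jor_1: "jor 1 = \<one>\<^bsub>R\<^esub>"
proof -
  have "kY 1 = 0\<^sub>m 1 1" "kG_rep 1 h = 1\<^sub>m 1" for h
    by (auto intro!: eq_matI simp: kY_def kG_rep_def)
  then have "kmod 1 = triv_mod" by (simp only: kmod_def triv_mod_eq) (simp add: rep_mod_def)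
  then show ?thesis by (simp only: jor_def stable_class_triv)
qed

lemma jor_n: "jor n = \<zero>\<^bsub>R\<^esub>"
  unfolding jor_def by (rule stable_class_projective[OF kmod_indecomposable kmod_projective])

text \<open>Multiplied by q^(-1) - 1, a vanishing geometric sum would give q^k = 1.\<close>

lemma q_sum_nonzero:
  assumes "0 < k" "k < n"
  shows "(\<Sum>t<k. inverse (\<chi> g) ^ t) \<noteq> 0"
proof
  let ?q = "inverse (\<chi> g)"
  assume z: "(\<Sum>t<k. ?q ^ t) = 0"
  have "?q ^ k = 1"
    using z power_diff_1_eq[of ?q k] by simp
  then have "\<chi> g ^ k = 1" by (simp add: power_inverse)
  then show False using q_pow_less assms by simp
qed

text \<open>In the tensor product of \<open>M(2)\<close> and \<open>M(k)\<close> let \<open>a\<^sub>t = e\<^sub>0 \<otimes> e\<^sub>t\<close>, \<open>b\<^sub>t = e\<^sub>1 \<otimes> e\<^sub>t\<close> and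
  \<open>c\<^sub>s = 1 + q\<^sup>-\<^sup>1 + \<dots> + q\<^sup>1\<^sup>-\<^sup>s\<close>. The vectors \<open>y\<^sup>s a\<^sub>0 = a\<^sub>s + c\<^sub>s b\<^sub>s\<^sub>-\<^sub>1\<close> span a copy of \<open>M(k+1)\<close>, and
  \<open>w\<^sub>t = a\<^sub>t\<^sub>+\<^sub>1 + (c\<^sub>t\<^sub>+\<^sub>1 - c\<^sub>k) b\<^sub>t\<close> span a complement. The complement exists because \<open>c\<^sub>k \<noteq> 0\<close>.\<close>

lemma clebsch_gordan_step:
  assumes k: "0 < k" "k < n"
  shows "mod_iso H (dsum (kmod (k + 1)) (tensor_mod (infl 1 chi_inv) (kmod (k - 1)))) (tensor_mod (kmod 2) (kmod k))"
proof -
  define p where "p = inverse (\<chi> g)"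
  define c where "c s = (\<Sum>t<s. p ^ t)" for s :: nat
  have c0: "c 0 = 0" and cS: "c (Suc s) = c s + p ^ s" for s by (simp_all add: c_def)
  have ck: "c k \<noteq> 0" unfolding c_def p_def by (rule q_sum_nonzero[OF k])
  let ?K = "tensor_mod (infl 1 chi_inv) (kmod (k - 1))" and ?D = "2 * k"
  have k1: "k - 1 \<le> n" "k + 1 \<le> n" "k \<le> n" using k by auto
  note f1 = infl_fdmod[OF chi_inv_quot] kmod_fdmod[OF k1(1)]
  note fK = tensor_fdmod[OF f1]
  note fM = kmod_fdmod[OF k1(2)] fK
  note fN = kmod_fdmod[OF n_ge_2] kmod_fdmod[OF k1(3)]
  let ?M = "dsum (kmod (k + 1)) ?K" and ?N = "tensor_mod (kmod 2) (kmod k)"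
  have dM: "mdim ?M = ?D" and dN: "mdim ?N = ?D" using k by simp_all
  have dm: "r div k = (if r < k then 0 else 1)" "r mod k = (if r < k then r else r - k)" if "r < ?D" for r
    using that by (auto simp: le_div_geq le_mod_geq)
  have YM: "hY ?M $$ (r, s) = of_bool (r = s + 1 \<and> s \<noteq> k)" if "r < ?D" "s < ?D" for r s
  proof -
    have "hY ?K = kY (k - 1)"
      by (simp add: tensor_hY[OF f1] infl_hY[OF chi_inv_quot] kmod_hY[OF k1(1)] kmod_hG[OF k1(1) g_closed] kron_zero_left
          kron_one_left(1) left_add_zero_mat[OF kY_carrier(1)] del: One_nat_def)
    then have e: "hY ?M = diag_block (kY (k + 1)) (kY (k - 1))" unfolding dsum_hY[OF fM] kmod_hY[OF k1(2)] by (rule arg_cong)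
    show ?thesis unfolding e using that k by (auto simp: kY_index)
  qed
  have GM: "hG ?M h $$ (r, s) = (if r = s then inverse (\<chi> h) ^ (if s \<le> k then s else s - k) else 0)"
    if h: "h \<in> carrier G" and "r < ?D" "s < ?D" for r s h
  proof -
    have "hG ?K h = inverse (\<chi> h) \<cdot>\<^sub>m kG_rep (k - 1) h"
      unfolding tensor_hG[OF f1 h] infl_hG[OF chi_inv_quot h] kmod_hG[OF k1(1) h] chi_inv_def kron_smult_left kron_one_left ..
    then have e: "hG ?M h = diag_block (kG_rep (k + 1) h) (inverse (\<chi> h) \<cdot>\<^sub>m kG_rep (k - 1) h)"
      unfolding dsum_hG[OF fM h] kmod_hG[OF k1(2) h] by (rule arg_cong)
    have pw: "inverse (\<chi> h) * inverse (\<chi> h) ^ (s - Suc k) = inverse (\<chi> h) ^ (s - k)" if "k < s"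
      using that by (metis Suc_diff_Suc power_Suc)
    show ?thesis unfolding e using that(2,3) k pw by (auto simp: kG_index)
  qed
  \<comment> \<open>Columns s < k stand for a_s and columns k + t for b_t. The entry p^s comes from
    y \<otimes> g, since g acts on e_s by q^(-s).\<close>
  have YN: "hY ?N $$ (r, s) = of_bool (r = s + 1 \<and> r \<noteq> k) + (if r = s + k then p ^ s else 0)"
    if "r < ?D" "s < ?D" for r s
    unfolding tensor_hY[OF fN] kmod_hY[OF n_ge_2] kmod_hY[OF k1(3)] kmod_hG[OF k1(3) g_closed] kmod_mdim
    using that k by (auto simp: dm kY_index kG_index p_def)
  have GN: "hG ?N h $$ (r, s) = (if r = s then inverse (\<chi> h) ^ (if s < k then s else Suc s - k) else 0)"
    if h: "h \<in> carrier G" and "r < ?D" "s < ?D" for r s h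
    unfolding tensor_hG[OF fN h] kmod_hG[OF n_ge_2 h] kmod_hG[OF k1(3) h]
    using that k by (auto simp: dm kG_index Suc_diff_le)
  have YMc: "hY ?M \<in> carrier_mat ?D ?D" and YNc: "hY ?N \<in> carrier_mat ?D ?D"
    using hY_carriers(1)[OF dsum_fdmod[OF fM]] hY_carriers(1)[OF tensor_fdmod[OF fN]] unfolding dM dN by simp_all
  have GMc: "hG ?M h \<in> carrier_mat ?D ?D" and GNc: "hG ?N h \<in> carrier_mat ?D ?D" if "h \<in> carrier G" for h
    using hY_carriers(3)[OF dsum_fdmod[OF fM] that] hY_carriers(3)[OF tensor_fdmod[OF fN] that] unfolding dM dN by simp_all
  define ya yb ga gb where abs: "ya = hY ?M" "yb = hY ?N" "ga = hG ?M" "gb = hG ?N"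
  note YM = YM[folded abs] and GM = GM[folded abs] and YN = YN[folded abs] and GN = GN[folded abs]
    and YMc = YMc[folded abs] and YNc = YNc[folded abs] and GMc = GMc[folded abs] and GNc = GNc[folded abs]
  \<comment> \<open>Column s \<le> k is y^s a_0 and column k + 1 + t is w_t. The condition s < k in
    the first term reflects a_k = 0.\<close>
  define tt where "tt r s = (if s \<le> k then of_bool (r = s \<and> s < k) + of_bool (r + 1 = k + s \<and> 0 < s) * c s
     else of_bool (r = s - k) + of_bool (r + 1 = s) * (c (s - k) - c k))" for r s
  define T where "T = mat ?D ?D (\<lambda>(r, s). tt r s)"
  \<comment> \<open>The inverse change of basis. From y^(t+1) a_0 - w_t = c_k b_t one gets b_t, and
    then a_s = (1 - c_s/c_k) y^s a_0 + (c_s/c_k) w_(s-1), with c_0 = 0 at s = 0. For t = k - 1 there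
    is no w_t and y^k a_0 = c_k b_t; the index 0 in \<open>\<beta>\<close> is then a dummy with
    coefficient 0.\<close>
  define \<alpha> where "\<alpha> s = (if s < k then s else s - k + 1)" for s
  define \<beta> where "\<beta> s = (if s < k then s + k else if s + 1 < ?D then s + 1 else 0)" for s
  define x where "x s = (if s < k then 1 - c s / c k else 1 / c k)" for s
  define y where "y s = (if s < k then c s / c k else if s + 1 < ?D then - 1 / c k else 0)" for s
  define S where "S = mat ?D ?D (\<lambda>(r, s). of_bool (r = \<alpha> s) * x s + of_bool (r = \<beta> s) * y s)"
  have Tc: "T \<in> carrier_mat ?D ?D" and Sc: "S \<in> carrier_mat ?D ?D" by (simp_all add: T_def S_def)
  have Ti: "T $$ (r, s) = tt r s" if "r < ?D" "s < ?D" for r s using that by (simp add: T_def)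
  have ab: "\<alpha> s < ?D" "\<beta> s < ?D" if "s < ?D" for s using that k by (auto simp: \<alpha>_def \<beta>_def)
  have TS: "T * S = 1\<^sub>m ?D"
  proof (rule eq_matI)
    fix r s assume "r < dim_row (1\<^sub>m ?D :: complex mat)" "s < dim_col (1\<^sub>m ?D :: complex mat)"
    then have rs: "r < ?D" "s < ?D" by auto
    have "(T * S) $$ (r, s) = (\<Sum>l<?D. tt r l * S $$ (l, s))"
      using rs Tc Sc by (subst mult_mat_index) (auto simp: Ti)
    also have "\<dots> = (\<Sum>l<?D. (if l = \<alpha> s then tt r l * x s else 0) + (if l = \<beta> s then tt r l * y s else 0))"
      using rs by (intro sum.cong) (auto simp: S_def algebra_simps)
    also have "\<dots> = tt r (\<alpha> s) * x s + tt r (\<beta> s) * y s"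
      using ab[OF rs(2)] by (simp add: sum.distrib)
    also have "\<dots> = of_bool (r = s)"
    proof (cases "s < k")
      case True
      then show ?thesis using ck k c0 by (auto simp: tt_def \<alpha>_def \<beta>_def x_def y_def field_simps)
    next
      case False
      then obtain t where t: "s = k + t" "t < k" using rs by (metis le_Suc_ex linorder_not_less mult_2 nat_add_left_cancel_less)
      show ?thesis
      proof (cases "t + 1 < k")
        case True
        then show ?thesis using t ck by (auto simp: tt_def \<alpha>_def \<beta>_def x_def y_def field_simps)
      next
        case False
        then have "k = Suc t" using t by simp
        then show ?thesis using t ck by (auto simp: tt_def \<alpha>_def \<beta>_def x_def y_def field_simps)
      qed
    qed
    finally show "(T * S) $$ (r, s) = 1\<^sub>m ?D $$ (r, s)" using rs by simp
  qed (use Tc Sc in auto)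
  have YT: "T * ya = yb * T"
  proof (rule eq_matI)
    fix r s assume "r < dim_row (yb * T)" "s < dim_col (yb * T)"
    then have rs: "r < ?D" "s < ?D" using YNc Tc by auto
    have "(T * ya) $$ (r, s) = (\<Sum>l<?D. tt r l * of_bool (l = s + 1 \<and> s \<noteq> k))"
      using rs Tc YMc by (subst mult_mat_index) (auto simp: Ti YM)
    also have "\<dots> = (\<Sum>l<?D. if l = s + 1 then (if s \<noteq> k then tt r l else 0) else 0)"
      by (intro sum.cong) auto
    also have "\<dots> = (if s + 1 < ?D \<and> s \<noteq> k then tt r (s + 1) else 0)" by simp
    finally have 1: "(T * ya) $$ (r, s) = (if s + 1 < ?D \<and> s \<noteq> k then tt r (s + 1) else 0)" .
    have "(yb * T) $$ (r, s) = (\<Sum>l<?D. (of_bool (r = l + 1 \<and> r \<noteq> k) + (if r = l + k then p ^ l else 0)) * tt l s)"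
      using rs Tc YNc by (subst mult_mat_index) (auto simp: Ti YN)
    also have "\<dots> = (\<Sum>l<?D. (if l = r - 1 then (if r \<noteq> 0 \<and> r \<noteq> k then tt l s else 0) else 0)
        + (if l = r - k then (if k \<le> r then p ^ l * tt l s else 0) else 0))"
      by (intro sum.cong) (auto simp: algebra_simps)
    also have "\<dots> = (if r \<noteq> 0 \<and> r \<noteq> k then tt (r - 1) s else 0) + (if k \<le> r then p ^ (r - k) * tt (r - k) s else 0)"
      using rs by (simp add: sum.distrib less_imp_diff_less)
    finally have 2: "(yb * T) $$ (r, s) = (if r \<noteq> 0 \<and> r \<noteq> k then tt (r - 1) s else 0) + (if k \<le> r then p ^ (r - k) * tt (r - k) s else 0)" .
    have "(if s + 1 < ?D \<and> s \<noteq> k then tt r (s + 1) else 0)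
      = (if r \<noteq> 0 \<and> r \<noteq> k then tt (r - 1) s else 0) + (if k \<le> r then p ^ (r - k) * tt (r - k) s else 0)"
    proof (cases "s \<le> k")
      case True
      then show ?thesis using rs k by (cases r) (auto simp: tt_def c0 cS)
    next
      case False
      then obtain t where t: "s = k + Suc t" "Suc t < k"
        using rs by (metis add.commute less_imp_Suc_add linorder_not_less mult_2 nat_add_left_cancel_less add_Suc_right)
      obtain m where m: "k = Suc m" using k by (cases k) auto
      show ?thesis
      proof (cases "Suc t < m")
        case True
        then show ?thesis using rs t m by (cases r) (auto simp: tt_def cS)
      next
        case False
        then have "m = Suc t" using t m by simp
        then show ?thesis using rs t m by (cases r) (auto simp: tt_def cS)
      qed
    qed
    then show "(T * ya) $$ (r, s) = (yb * T) $$ (r, s)" unfolding 1 2 .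
  qed (use YMc YNc Tc in auto)
  have GT: "T * ga h = gb h * T" if h: "h \<in> carrier G" for h
  proof (rule eq_matI)
    fix r s assume "r < dim_row (gb h * T)" "s < dim_col (gb h * T)"
    then have rs: "r < ?D" "s < ?D" using GNc[OF h] Tc by auto
    have "(T * ga h) $$ (r, s) = (\<Sum>l<?D. tt r l * (if l = s then inverse (\<chi> h) ^ (if s \<le> k then s else s - k) else 0))"
      using rs Tc GMc[OF h] by (subst mult_mat_index) (auto simp: Ti GM[OF h])
    also have "\<dots> = (\<Sum>l<?D. if l = s then tt r l * inverse (\<chi> h) ^ (if s \<le> k then s else s - k) else 0)"
      by (intro sum.cong) auto
    finally have 1: "(T * ga h) $$ (r, s) = tt r s * inverse (\<chi> h) ^ (if s \<le> k then s else s - k)" using rs by simp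
    have "(gb h * T) $$ (r, s) = (\<Sum>l<?D. (if r = l then inverse (\<chi> h) ^ (if l < k then l else Suc l - k) else 0) * tt l s)"
      using rs Tc GNc[OF h] by (subst mult_mat_index) (auto simp: Ti GN[OF h])
    also have "\<dots> = (\<Sum>l<?D. if l = r then inverse (\<chi> h) ^ (if l < k then l else Suc l - k) * tt l s else 0)"
      by (intro sum.cong) auto
    finally have 2: "(gb h * T) $$ (r, s) = inverse (\<chi> h) ^ (if r < k then r else Suc r - k) * tt r s" using rs by simp
    show "(T * ga h) $$ (r, s) = (gb h * T) $$ (r, s)"
      unfolding 1 2 using rs k by (auto simp: tt_def)
  qed (use GMc[OF h] GNc[OF h] Tc in auto)
  show ?thesis
    by (rule mod_isoI[OF dsum_fdmod[OF fM] tensor_fdmod[OF fN], unfolded dM dN,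
          OF Tc Sc mat_mult_left_right_inverse[OF Tc Sc TS] TS YT[unfolded abs] GT[unfolded abs]])
qed

lemma jor_step:
  assumes k: "0 < k" "k < n"
  shows "jor 2 \<otimes>\<^bsub>R\<^esub> jor k = jor (k + 1) \<oplus>\<^bsub>R\<^esub> inf_class 1 chi_inv \<otimes>\<^bsub>R\<^esub> jor (k - 1)"
proof -
  have k1: "k - 1 \<le> n" "k + 1 \<le> n" "k \<le> n" using k by auto
  note f = kmod_fdmod[OF k1(2)] infl_fdmod[OF chi_inv_quot] kmod_fdmod[OF k1(1)] kmod_fdmod[OF n_ge_2] kmod_fdmod[OF k1(3)]
  show ?thesis
    using stable_class_iso[OF clebsch_gordan_step[OF k] dsum_fdmod[OF f(1) tensor_fdmod[OF f(2,3)]] tensor_fdmod[OF f(4,5)]]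
    by (simp only: jor_def inf_class_def stable_class_dsum[OF f(1) tensor_fdmod[OF f(2,3)]] stable_class_tensor[OF f(2,3)] stable_class_tensor[OF f(4,5)])
qed

end

section \<open>Truncated Clebsch-Gordan rule\<close>

text \<open>Isolates the relations between the classes f_k. \<open>R\<close> is not assumed
  commutative: only the commutation of a with x is given, and the rest is derived from the
  recursion.\<close>

locale fusion_chain = ring R for R (structure) +
  fixes a x :: 'b and f :: "nat \<Rightarrow> 'b" and n :: nat
  assumes a_closed: "a \<in> carrier R" and x_closed: "x \<in> carrier R"
    and f_closed: "k \<le> n \<Longrightarrow> f k \<in> carrier R"
    and f_0: "f 0 = \<zero>" and f_1: "f 1 = \<one>" and f_n: "f n = \<zero>"
    and f_step: "0 < k \<Longrightarrow> k < n \<Longrightarrow> a \<otimes> f k = f (k + 1) \<oplus> x \<otimes> f (k - 1)"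
    and ax: "a \<otimes> x = x \<otimes> a"
begin

lemma f_Suc_0: "f (Suc 0) = \<one>"
  using f_1 by simp

text \<open>By \<open>f_step\<close> each f_k is a polynomial in a and x, so whatever commutes with
  these two commutes with f_k.\<close>

lemma f_commute:
  assumes z: "z \<in> carrier R" "z \<otimes> a = a \<otimes> z" "z \<otimes> x = x \<otimes> z"
  shows "k \<le> n \<Longrightarrow> z \<otimes> f k = f k \<otimes> z"
proof (induction k rule: less_induct)
  case (less k)
  show ?case
  proof (cases "k < 2")
    case True
    then show ?thesis using z(1) by (auto simp: less_2_cases_iff f_0 f_Suc_0)
  next
    case False
    then obtain m where m: "k = Suc (Suc m)" by (metis add_2_eq_Suc le_add_diff_inverse not_less)
    have mn: "Suc m < n" "m < n" using less.prems m by auto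
    note c = z(1) a_closed x_closed f_closed[of m] f_closed[of "Suc m"] f_closed[of k]
    have s: "a \<otimes> f (Suc m) = f k \<oplus> x \<otimes> f m" using f_step[of "Suc m"] mn m by simp
    have i: "z \<otimes> f (Suc m) = f (Suc m) \<otimes> z" "z \<otimes> f m = f m \<otimes> z" using less.IH m mn by auto
    have "z \<otimes> f k \<oplus> x \<otimes> f m \<otimes> z = z \<otimes> f k \<oplus> z \<otimes> (x \<otimes> f m)"
    proof -
      have "x \<otimes> f m \<otimes> z = x \<otimes> z \<otimes> f m" using c mn i by (simp add: m_assoc)
      then show ?thesis using c mn by (simp add: m_assoc flip: z(3))
    qed
    also have "\<dots> = z \<otimes> (a \<otimes> f (Suc m))" unfolding s using c mn less.prems by (simp add: r_distr)
    also have "\<dots> = a \<otimes> f (Suc m) \<otimes> z"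
    proof -
      have "z \<otimes> (a \<otimes> f (Suc m)) = z \<otimes> a \<otimes> f (Suc m)" using c mn by (simp add: m_assoc)
      also have "\<dots> = a \<otimes> (z \<otimes> f (Suc m))" using c mn by (simp add: z(2) m_assoc)
      finally show ?thesis using c mn by (simp add: i m_assoc)
    qed
    also have "\<dots> = f k \<otimes> z \<oplus> x \<otimes> f m \<otimes> z" unfolding s using c mn less.prems by (simp add: l_distr)
    finally show ?thesis using c mn less.prems by simp
  qed
qed

lemma a_commute: "k \<le> n \<Longrightarrow> a \<otimes> f k = f k \<otimes> a"
  by (rule f_commute[OF a_closed refl ax])

lemma x_commute: "k \<le> n \<Longrightarrow> x \<otimes> f k = f k \<otimes> x"
  by (rule f_commute[OF x_closed ax[symmetric] refl])

lemma ff_commute: "j \<le> n \<Longrightarrow> k \<le> n \<Longrightarrow> f j \<otimes> f k = f k \<otimes> f j"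
  by (rule f_commute) (simp_all add: f_closed a_commute x_commute)

lemma a_mult_ff:
  assumes "0 < j" "j < n" "z \<in> carrier R"
  shows "a \<otimes> (f j \<otimes> z) = f (j + 1) \<otimes> z \<oplus> x \<otimes> (f (j - 1) \<otimes> z)"
proof -
  have "a \<otimes> (f j \<otimes> z) = a \<otimes> f j \<otimes> z" using assms a_closed f_closed[of j] by (simp add: m_assoc)
  then show ?thesis
    using assms x_closed f_closed[of "j + 1"] f_closed[of "j - 1"] by (simp add: f_step l_distr m_assoc)
qed

text \<open>The identity f_(j+1) f_k - x f_j f_(k-1) = f_(j+k), known for Chebyshev polynomials,
  without subtraction. Iterated, it is the Clebsch-Gordan sum, and it has no negative
  coefficients.\<close>

lemma fusion_low:
  assumes "0 < k" "j + k \<le> n"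
  shows "f (j + 1) \<otimes> f k = x \<otimes> (f j \<otimes> f (k - 1)) \<oplus> f (j + k)"
  using assms
proof (induction j arbitrary: k rule: less_induct)
  case (less j)
  have kc: "f k \<in> carrier R" "f (k - 1) \<in> carrier R" using less.prems by (auto intro!: f_closed)
  show ?case
  proof (cases j)
    case 0
    then show ?thesis using kc x_closed by (simp add: f_0 f_Suc_0)
  next
    case (Suc i)
    have le: "i \<le> n" "i + 1 \<le> n" "i + 2 \<le> n" "i + k \<le> n" "i + k + 1 \<le> n" using less.prems Suc by auto
    note ic = le[THEN f_closed]
    have 1: "f (i + 1) \<otimes> f k = x \<otimes> (f i \<otimes> f (k - 1)) \<oplus> f (i + k)"
      using less.IH[of i k] less.prems Suc by simp
    \<comment> \<open>The product a f_(i+1) f_k is expanded in two ways, by the recursion for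
      f_(i+1) and by the induction hypothesis; the common term x f_i f_k is cancelled at the
      end.\<close>
    have "f (i + 2) \<otimes> f k \<oplus> x \<otimes> (f i \<otimes> f k) = a \<otimes> (f (i + 1) \<otimes> f k)"
      using a_mult_ff[of "i + 1" "f k"] less.prems Suc kc by simp
    also have "\<dots> = a \<otimes> (x \<otimes> (f i \<otimes> f (k - 1))) \<oplus> a \<otimes> f (i + k)"
      unfolding 1 using a_closed x_closed kc ic by (simp add: r_distr)
    also have "a \<otimes> f (i + k) = f (i + k + 1) \<oplus> x \<otimes> f (i + k - 1)"
      using less.prems Suc by (intro f_step) auto
    also have "a \<otimes> (x \<otimes> (f i \<otimes> f (k - 1))) = x \<otimes> (a \<otimes> (f i \<otimes> f (k - 1)))"
      using a_closed x_closed kc ic by (simp add: ax flip: m_assoc)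
    finally have e: "f (i + 2) \<otimes> f k \<oplus> x \<otimes> (f i \<otimes> f k)
      = x \<otimes> (a \<otimes> (f i \<otimes> f (k - 1))) \<oplus> (f (i + k + 1) \<oplus> x \<otimes> f (i + k - 1))" .
    show ?thesis
    proof (cases i)
      case 0
      have "f (i + 2) \<otimes> f k \<oplus> x \<otimes> (f i \<otimes> f k) = f (i + 2) \<otimes> f k"
        "x \<otimes> (a \<otimes> (f i \<otimes> f (k - 1))) \<oplus> (f (i + k + 1) \<oplus> x \<otimes> f (i + k - 1)) = x \<otimes> f (k - 1) \<oplus> f (k + 1)"
        using 0 a_closed x_closed kc ic by (simp_all add: f_0 a_comm)
      then show ?thesis using e 0 Suc kc by (simp add: f_Suc_0)
    next
      case (Suc l)
      have lc: "f l \<in> carrier R" "f (i + k - 1) \<in> carrier R" using le Suc by (auto intro!: f_closed)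
      have 2: "f i \<otimes> f k = x \<otimes> (f l \<otimes> f (k - 1)) \<oplus> f (i + k - 1)"
        using less.IH[of l k] less.prems \<open>j = Suc i\<close> Suc by simp
      have "x \<otimes> (a \<otimes> (f i \<otimes> f (k - 1))) = x \<otimes> (f (i + 1) \<otimes> f (k - 1)) \<oplus> x \<otimes> (x \<otimes> (f l \<otimes> f (k - 1)))"
        using a_mult_ff[of i "f (k - 1)"] less.prems \<open>j = Suc i\<close> Suc kc ic lc x_closed by (simp add: r_distr)
      with e have "f (i + 2) \<otimes> f k \<oplus> x \<otimes> (f i \<otimes> f k)
        = (x \<otimes> (f (i + 1) \<otimes> f (k - 1)) \<oplus> f (i + k + 1)) \<oplus> x \<otimes> (f i \<otimes> f k)"
        unfolding 2 using x_closed kc ic lc by (simp add: r_distr a_ac)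
      then show ?thesis using \<open>j = Suc i\<close> x_closed kc ic by (simp add: add.right_cancel)
    qed
  qed
qed

text \<open>The truncation f_n = 0 reflects the chain: beyond n both indices are replaced by their
  complements, whose sum is at most n, so that \<open>fusion_low\<close> governs the product
  again.\<close>

lemma fusion_high:
  assumes "k \<le> n" "j \<le> n" "n \<le> j + k"
  shows "f j \<otimes> f k = x [^] (j + k - n) \<otimes> (f (n - j) \<otimes> f (n - k))"
  using assms(2,3)
proof (induction j rule: less_induct)
  case (less j)
  have kc: "f k \<in> carrier R" "f (n - k) \<in> carrier R" "f j \<in> carrier R" "f (n - j) \<in> carrier R"
    using assms(1) less.prems by (auto intro!: f_closed)
  consider (base) "j + k = n" | (one) "j + k = n + 1" | (step) "j + k \<ge> n + 2" using less.prems by linarith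
  then show ?case
  proof cases
    case base
    then have "n - j = k" "n - k = j" by auto
    then show ?thesis using base kc ff_commute[of j k] less.prems assms(1) by simp
  next
    case one
    show ?thesis
    proof (cases "k = 0")
      case False
      have e: "n - j = k - 1" "n - k = j - 1" "j \<noteq> 0" using one False assms(1) less.prems by auto
      have c: "f (j - 1) \<in> carrier R" "f (k - 1) \<in> carrier R" using less.prems assms(1) by (auto intro!: f_closed)
      \<comment> \<open>Here the last term of \<open>fusion_low\<close> is f_n = 0, which is where
        the truncation enters.\<close>
      have "f (j - 1 + 1) \<otimes> f k = x \<otimes> (f (j - 1) \<otimes> f (k - 1)) \<oplus> f (j - 1 + k)"
        using one False e less.prems by (intro fusion_low) auto
      moreover have "j - 1 + k = n" using one e by simp
      ultimately show ?thesis
        using one e c x_closed ff_commute[of "j - 1" "k - 1"] less.prems assms(1) by (simp add: f_n)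
    qed (use one less.prems in auto)
  next
    case step
    then have "2 \<le> j" using assms(1) by linarith
    then obtain i where j: "j = Suc (Suc i)" using le_Suc_ex[of 2 j] by auto
    have le: "i \<le> n" "i + 1 \<le> n" "n - (i + 1) \<le> n" "n - i \<le> n" using less.prems j by auto
    note ic = le[THEN f_closed]
    define m where "m = i + k - n"
    have m: "i + k - n = m" "Suc i + k - n = Suc m" "j + k - n = Suc (Suc m)" using step j by (auto simp: m_def)
    have 1: "f (i + 1) \<otimes> f k = x [^] Suc m \<otimes> (f (n - (i + 1)) \<otimes> f (n - k))"
      using less.IH[of "Suc i"] j step less.prems m by simp
    have 2: "f i \<otimes> f k = x [^] m \<otimes> (f (n - i) \<otimes> f (n - k))"
      using less.IH[of i] j step less.prems m by simp
    have xa: "a \<otimes> x [^] t = x [^] t \<otimes> a" for t :: nat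
    proof (induction t)
      case (Suc t)
      have "a \<otimes> x [^] Suc t = a \<otimes> x [^] t \<otimes> x" using x_closed a_closed by (simp add: m_assoc)
      also have "\<dots> = x [^] t \<otimes> (a \<otimes> x)" using x_closed a_closed by (simp add: Suc m_assoc)
      finally show ?case using x_closed a_closed by (simp add: ax m_assoc)
    qed (use a_closed in simp)
    let ?w = "f (n - k)"
    \<comment> \<open>The factors f_j and f_(n-j) obey the same three-term recursion in opposite
      directions, so the formulas for i and i + 1 determine the one for j = i + 2.\<close>
    have "a \<otimes> (f (i + 1) \<otimes> f k) = x [^] Suc m \<otimes> (a \<otimes> (f (n - (i + 1)) \<otimes> ?w))"
      unfolding 1 using xa[of "Suc m"] a_closed x_closed ic kc by (simp del: nat_pow_Suc flip: m_assoc)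
    also have "a \<otimes> (f (n - (i + 1)) \<otimes> ?w) = f (n - i) \<otimes> ?w \<oplus> x \<otimes> (f (n - j) \<otimes> ?w)"
      using a_mult_ff[of "n - (i + 1)" ?w] less.prems j kc by (simp add: Suc_diff_Suc)
    also have "x [^] Suc m \<otimes> (f (n - i) \<otimes> ?w \<oplus> x \<otimes> (f (n - j) \<otimes> ?w))
      = x [^] Suc m \<otimes> (f (n - i) \<otimes> ?w) \<oplus> x [^] Suc (Suc m) \<otimes> (f (n - j) \<otimes> ?w)"
      using x_closed ic kc by (simp add: r_distr m_assoc)
    also have "x [^] Suc m \<otimes> (f (n - i) \<otimes> ?w) = x \<otimes> (f i \<otimes> f k)"
      unfolding 2 nat_pow_Suc2[OF x_closed] using x_closed ic kc by (simp add: m_assoc)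
    finally have "f j \<otimes> f k \<oplus> x \<otimes> (f i \<otimes> f k) = x [^] Suc (Suc m) \<otimes> (f (n - j) \<otimes> ?w) \<oplus> x \<otimes> (f i \<otimes> f k)"
      using a_mult_ff[of "i + 1" "f k"] less.prems j kc x_closed ic by (simp add: a_comm del: nat_pow_Suc)
    then show ?thesis using x_closed ic kc unfolding m by (simp add: add.right_cancel del: nat_pow_Suc)
  qed
qed

end

section \<open>The values of the Dickson polynomials\<close>

text \<open>The quantum integer [k] at the root of unity exp(i pi/n), that is the value of the
  Chebyshev polynomial U_(k-1) at cos(pi/n).\<close>

definition qnum :: "nat \<Rightarrow> nat \<Rightarrow> real" where
  "qnum n k = sin (real k * (pi / real n)) / sin (pi / real n)"

lemma dickson_qnum:
  assumes n: "2 \<le> n"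
  shows "dickson k 1 (2 * cos (pi / real n)) = qnum n k"
proof -
  let ?t = "pi / real n"
  have s: "sin ?t > 0" using n by (intro sin_gt_zero) (auto simp: field_simps)
  have "dickson k 1 (2 * cos ?t) * sin ?t = sin (real k * ?t)"
  proof (induction k "1::real" "2 * cos ?t" rule: dickson.induct)
    case (4 j)
    define A where "A = real (Suc (Suc j)) * ?t"
    have e: "real (Suc (Suc (Suc j))) * ?t = A + ?t" "real (Suc j) * ?t = A - ?t"
      by (simp_all add: A_def algebra_simps add_divide_distrib)
    have "dickson (Suc (Suc (Suc j))) 1 (2 * cos ?t) * sin ?t
      = 2 * cos ?t * (dickson (Suc (Suc j)) 1 (2 * cos ?t) * sin ?t) - dickson (Suc j) 1 (2 * cos ?t) * sin ?t"
      by (simp add: algebra_simps)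
    also have "\<dots> = sin (real (Suc (Suc (Suc j))) * ?t)"
      unfolding 4 A_def[symmetric] unfolding e by (simp add: sin_add sin_diff)
    finally show ?case .
  qed (simp_all add: sin_double[of ?t, simplified])
  then show ?thesis using s by (simp add: qnum_def field_simps)
qed

lemma qnum_0 [simp]: "qnum n 0 = 0"
  by (simp add: qnum_def)

lemma qnum_n: "qnum n n = 0"
  by (cases "n = 0") (simp_all add: qnum_def)

lemma qnum_pos: "2 \<le> n \<Longrightarrow> 0 < k \<Longrightarrow> k < n \<Longrightarrow> 0 < qnum n k"
  unfolding qnum_def by (intro divide_pos_pos sin_gt_zero) (auto simp: field_simps)

text \<open>The reflection of \<open>fusion_high\<close> on the level of weights, where x has weight
  1.\<close>

lemma qnum_reflect:
  assumes "0 < n" "k \<le> n"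
  shows "qnum n (n - k) = qnum n k"
proof -
  have "real (n - k) * (pi / real n) = pi - real k * (pi / real n)"
    using assms by (simp add: of_nat_diff field_simps)
  then show ?thesis by (simp add: qnum_def sin_diff)
qed

text \<open>The rule \<open>fusion_low\<close> on the level of weights, with x of weight 1. It comes
  from the addition theorems.\<close>

lemma qnum_fusion:
  assumes n: "2 \<le> n" and k: "0 < k"
  shows "qnum n (j + 1) * qnum n k = qnum n j * qnum n (k - 1) + qnum n (j + k)"
proof -
  let ?t = "pi / real n"
  have s: "sin ?t > 0" using n by (intro sin_gt_zero) (auto simp: field_simps)
  obtain m where m: "k = Suc m" using k by (cases k) auto
  have "sin (real (j + 1) * ?t) * sin (real k * ?t) = sin (real j * ?t) * sin (real m * ?t) + sin ?t * sin (real (j + k) * ?t)"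
  proof -
    have e: "real (j + 1) * ?t = real j * ?t + ?t" "real k * ?t = real m * ?t + ?t"
      "real (j + k) * ?t = real j * ?t + real m * ?t + ?t"
      unfolding m by (simp_all add: algebra_simps add_divide_distrib)
    have "x = sin ?t * sin ?t * x + cos ?t * cos ?t * x" for x
      using sin_cos_squared_add[of ?t] by (simp add: power2_eq_square flip: distrib_right)
    from this[of "sin (real j * ?t) * sin (real m * ?t)"] show ?thesis
      unfolding e by (simp add: sin_add cos_add algebra_simps)
  qed
  then show ?thesis using s m by (simp add: qnum_def field_simps)
qed

lemma (in abelian_group) add_pow_int_one: "x \<in> carrier G \<Longrightarrow> add_pow G (1 :: int) x = x"
  by (rule add.int_pow_1)

lemma (in abelian_group) add_pow_int_zero: "add_pow G (0 :: int) x = \<zero>"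
  by (simp add: add_pow_def)

lemma (in abelian_group) finsum_add_pow_add:
  fixes c c' :: "'p \<Rightarrow> int"
  assumes b: "b \<in> I \<rightarrow> carrier G"
  shows "(\<Oplus>p\<in>I. add_pow G (c p + c' p) (b p)) = (\<Oplus>p\<in>I. add_pow G (c p) (b p)) \<oplus> (\<Oplus>p\<in>I. add_pow G (c' p) (b p))"
proof -
  have cl: "add_pow G (k :: int) (b p) \<in> carrier G" if "p \<in> I" for k p
    using b that by (auto intro: add.int_pow_closed)
  have "(\<Oplus>p\<in>I. add_pow G (c p + c' p) (b p)) = (\<Oplus>p\<in>I. add_pow G (c p) (b p) \<oplus> add_pow G (c' p) (b p))"
    using cl funcset_mem[OF b] by (intro finsum_cong') (auto simp: add.int_pow_mult)
  also have "\<dots> = (\<Oplus>p\<in>I. add_pow G (c p) (b p)) \<oplus> (\<Oplus>p\<in>I. add_pow G (c' p) (b p))"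
    using cl by (intro finsum_addf) auto
  finally show ?thesis .
qed

context non_nilpotent_group_datum
begin

section \<open>Nonnegativity of the structure constants\<close>

lemma jor_fusion_chain: "fusion_chain R (jor 2) (inf_class 1 chi_inv) jor n"
  unfolding fusion_chain_def fusion_chain_axioms_def
  using jor_closed n_ge_2 inf_class_closed[OF chi_inv_quot] jor_0 jor_1 jor_n jor_step jor2_commute[OF chi_inv_quot]
  by (intro conjI stable_green_ring_ring) auto

lemma jor_commute_inf_class:
  assumes q: "quot_rep d \<rho>" and k: "k \<le> n"
  shows "inf_class d \<rho> \<otimes>\<^bsub>R\<^esub> jor k = jor k \<otimes>\<^bsub>R\<^esub> inf_class d \<rho>"
  by (rule fusion_chain.f_commute[OF jor_fusion_chain inf_class_closed[OF q] jor2_commute[OF q, symmetric]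
        chi_class_commute[OF q, symmetric] k])

lemma inf_class_0:
  assumes q: "quot_rep 0 \<rho>"
  shows "inf_class 0 \<rho> = \<zero>\<^bsub>R\<^esub>"
proof -
  interpret R: ring R by (rule stable_green_ring_ring)
  note D = quot_repD[OF q] and s = inf_class_dsum[OF q q]
  have c: "diag_block (\<rho> h) (\<rho> h) \<in> carrier_mat 0 0" if "h \<in> carrier G" for h
    using diag_block_carrier[OF D(2)[OF that] D(2)[OF that]] by simp
  have z: "A = B" if "A \<in> carrier_mat 0 0" "B \<in> carrier_mat 0 0" for A B :: "complex mat"
    using that by (intro eq_matI) auto
  have "inf_class (0 + 0) (\<lambda>h. diag_block (\<rho> h) (\<rho> h)) = inf_class 0 \<rho>"
    by (rule inf_class_iso[OF s(1) q, of "1\<^sub>m 0" "1\<^sub>m 0"]) (auto intro!: z mult_carrier_mat[of _ 0 0 _ 0] simp: c D(2))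
  then have "inf_class 0 \<rho> \<oplus>\<^bsub>R\<^esub> inf_class 0 \<rho> = inf_class 0 \<rho>" using s(2) by simp
  then show ?thesis using R.add.l_cancel_one[of "inf_class 0 \<rho>" "inf_class 0 \<rho>"] inf_class_closed[OF q] by simp
qed

text \<open>Maschke's theorem inside the representations that are trivial on g^n: the block diagonal
  matrix of g^n is conjugate to 1, hence equal to 1, and so is each block.\<close>

lemma quot_rep_split:
  assumes q: "quot_rep d \<rho>" and W: "vec_subspace d W" and st: "\<And>h v. h \<in> carrier G \<Longrightarrow> v \<in> W \<Longrightarrow> \<rho> h *\<^sub>v v \<in> W"
    and ne: "W \<noteq> {0\<^sub>v d}" "W \<noteq> carrier_vec d"
  obtains k l \<rho>1 \<rho>2 where "0 < k" "0 < l" "k + l = d" "quot_rep k \<rho>1" "quot_rep l \<rho>2"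
    "inf_class d \<rho> = inf_class k \<rho>1 \<oplus>\<^bsub>R\<^esub> inf_class l \<rho>2"
proof -
  note D = quot_repD[OF q]
  obtain k l \<rho>1 \<rho>2 S T where *: "0 < k" "0 < l" "k + l = d" "grp_rep k \<rho>1" "grp_rep l \<rho>2"
    "S \<in> carrier_mat d d" "T \<in> carrier_mat d d" "S * T = 1\<^sub>m d" "T * S = 1\<^sub>m d"
    "\<And>h. h \<in> carrier G \<Longrightarrow> S * \<rho> h = diag_block (\<rho>1 h) (\<rho>2 h) * S"
    using grp_rep_split[OF D(1) W st ne] by blast
  note c1 = grp_repD(1)[OF *(4) gn_closed] and c2 = grp_repD(1)[OF *(5) gn_closed]
  let ?B = "diag_block (\<rho>1 (g [^] n)) (\<rho>2 (g [^] n))"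
  have Bc: "?B \<in> carrier_mat d d" using diag_block_carrier[OF c1 c2] *(3) by simp
  have "?B = ?B * (S * T)" unfolding *(8) by (rule right_mult_one_mat[OF Bc, symmetric])
  also have "\<dots> = S * \<rho> (g [^] n) * T" unfolding *(10)[OF gn_closed] using Bc *(6,7) by (simp add: assoc_mult_mat[of _ d d])
  also have "\<dots> = 1\<^sub>m d" using D(5) *(6,7,8) by simp
  finally have B: "?B = 1\<^sub>m d" .
  have "\<rho>1 (g [^] n) = 1\<^sub>m k"
  proof (rule eq_matI)
    fix i j assume ij: "i < dim_row (1\<^sub>m k :: complex mat)" "j < dim_col (1\<^sub>m k :: complex mat)"
    then show "\<rho>1 (g [^] n) $$ (i, j) = 1\<^sub>m k $$ (i, j)"
      using arg_cong[OF B, of "\<lambda>M. M $$ (i, j)"] c1 c2 *(1,2,3) by auto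
  qed (use c1 in auto)
  moreover have "\<rho>2 (g [^] n) = 1\<^sub>m l"
  proof (rule eq_matI)
    fix i j assume ij: "i < dim_row (1\<^sub>m l :: complex mat)" "j < dim_col (1\<^sub>m l :: complex mat)"
    then show "\<rho>2 (g [^] n) $$ (i, j) = 1\<^sub>m l $$ (i, j)"
      using arg_cong[OF B, of "\<lambda>M. M $$ (k + i, k + j)"] c1 c2 *(1,2,3) by auto
  qed (use c2 in auto)
  ultimately have q12: "quot_rep k \<rho>1" "quot_rep l \<rho>2" using *(4,5) by (auto simp: quot_rep_def)
  note s = inf_class_dsum[OF q12]
  have "inf_class d \<rho> = inf_class (k + l) (\<lambda>h. diag_block (\<rho>1 h) (\<rho>2 h))"
    using *(3,6-10) by (intro inf_class_iso[OF q s(1), of S T]) auto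
  then show ?thesis using that[OF *(1-3) q12] s(2) by simp
qed

context
  fixes \<Omega> :: "'i set" and V :: "'i \<Rightarrow> ('a \<Rightarrow> complex) fdmod"
begin

definition stable_index :: "(nat \<times> 'i) set" where
  "stable_index = {1..n - 1} \<times> Omega0 \<Omega> V"

definition comb :: "(nat \<times> 'i \<Rightarrow> int) \<Rightarrow> ((nat \<times> 'a \<Rightarrow> complex) fdmod set \<Rightarrow>\<^sub>0 int) set set" where
  "comb c = (\<Oplus>\<^bsub>R\<^esub>p\<in>stable_index. add_pow R (c p) (M_stable V p))"

definition weight :: "nat \<times> 'i \<Rightarrow> real" where
  "weight p = real (mdim (V (snd p))) * qnum n (fst p)"

text \<open>\<open>z\<close> is a nonnegative combination of the basis, of total weight \<open>w\<close>. The weight turns out to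
  be multiplicative, which makes it a left eigenvector of every multiplication matrix.\<close>

definition pos_comb :: "((nat \<times> 'a \<Rightarrow> complex) fdmod set \<Rightarrow>\<^sub>0 int) set set \<Rightarrow> real \<Rightarrow> bool" where
  "pos_comb z w \<longleftrightarrow> (\<exists>c. (\<forall>p\<in>stable_index. 0 \<le> c p) \<and> z = comb c \<and> w = (\<Sum>p\<in>stable_index. real_of_int (c p) * weight p))"

text \<open>Quantifying over all representations makes this property stable under multiplication by the
  class of \<open>\<chi>\<^sup>-\<^sup>1\<close>.\<close>

definition pos_mult :: "((nat \<times> 'a \<Rightarrow> complex) fdmod set \<Rightarrow>\<^sub>0 int) set set \<Rightarrow> real \<Rightarrow> bool" where
  "pos_mult z w \<longleftrightarrow> z \<in> carrier R \<and> (\<forall>d \<rho>. quot_rep d \<rho> \<longrightarrow> pos_comb (inf_class d \<rho> \<otimes>\<^bsub>R\<^esub> z) (real d * w))"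

context
  assumes cs: "complete_simples kG \<Omega> V"
begin

lemma finite_stable_index: "finite stable_index"
  using simples_finite[OF cs] by (simp add: stable_index_def Omega0_def)

lemma simple_V: "l \<in> \<Omega> \<Longrightarrow> simple_mod kG (V l)"
  using cs by (simp add: complete_simples_def)

lemma Omega0D:
  assumes "l \<in> Omega0 \<Omega> V"
  shows "l \<in> \<Omega>" "simple_mod kG (V l)" "is_fdmod kG (V l)" "0 < mdim (V l)" "quot_rep (mdim (V l)) (gact (V l))"
proof -
  show l: "l \<in> \<Omega>" using assms by (simp add: Omega0_def)
  show s: "simple_mod kG (V l)" by (rule simple_V[OF l])
  then show f: "is_fdmod kG (V l)" "0 < mdim (V l)" by (simp_all add: simple_mod_def)
  show "quot_rep (mdim (V l)) (gact (V l))"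
    using fdmod_grp_rep[OF f(1)] assms by (simp add: quot_rep_def Omega0_def gact_def)
qed

lemma M_stable_lad:
  assumes "l \<in> Omega0 \<Omega> V"
  shows "M_stable V (k, l) = stable_class (lad k (mdim (V l)) (gact (V l)))"
  by (simp add: M_stable_def ladder_mod_eq[OF Omega0D(3)[OF assms]])

lemma M_stable_mult:
  assumes "l \<in> Omega0 \<Omega> V" "k \<le> n"
  shows "M_stable V (k, l) = inf_class (mdim (V l)) (gact (V l)) \<otimes>\<^bsub>R\<^esub> jor k"
  using M_stable_lad[OF assms(1)] stable_class_lad[OF Omega0D(5)[OF assms(1)] assms(2)] by simp

lemma M_stable_closed: "M_stable V \<in> stable_index \<rightarrow> carrier R"
  using M_stable_lad Omega0D(5) by (auto simp: stable_index_def intro!: stable_class_closed lad_fdmod)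

lemma pos_comb_zero: "pos_comb \<zero>\<^bsub>R\<^esub> 0"
proof -
  interpret R: ring R by (rule stable_green_ring_ring)
  have "comb (\<lambda>_. 0) = \<zero>\<^bsub>R\<^esub>" unfolding comb_def by (intro R.add.finprod_one_eqI) (simp add: add_pow_def)
  then show ?thesis unfolding pos_comb_def by (intro exI[of _ "\<lambda>_. 0"]) simp
qed

lemma pos_comb_add:
  assumes "pos_comb z w" "pos_comb z' w'"
  shows "pos_comb (z \<oplus>\<^bsub>R\<^esub> z') (w + w')"
proof -
  interpret R: ring R by (rule stable_green_ring_ring)
  obtain c c' where *: "\<forall>p\<in>stable_index. 0 \<le> c p" "\<forall>p\<in>stable_index. 0 \<le> c' p" "z = comb c" "z' = comb c'"
    "w = (\<Sum>p\<in>stable_index. real_of_int (c p) * weight p)" "w' = (\<Sum>p\<in>stable_index. real_of_int (c' p) * weight p)"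
    using assms by (auto simp: pos_comb_def)
  show ?thesis unfolding pos_comb_def
    using * by (intro exI[of _ "\<lambda>p. c p + c' p"])
      (auto simp: comb_def R.finsum_add_pow_add[OF M_stable_closed] sum.distrib distrib_right)
qed

lemma pos_comb_basis:
  assumes p: "p \<in> stable_index"
  shows "pos_comb (M_stable V p) (weight p)"
proof -
  interpret R: ring R by (rule stable_green_ring_ring)
  let ?c = "\<lambda>p'. if p' = p then 1 else (0 :: int)"
  have "comb ?c = (\<Oplus>\<^bsub>R\<^esub>p'\<in>stable_index. if p = p' then M_stable V p' else \<zero>\<^bsub>R\<^esub>)"
    unfolding comb_def using funcset_mem[OF M_stable_closed] by (intro R.finsum_cong') (auto simp: R.add_pow_int_one R.add_pow_int_zero)
  also have "\<dots> = M_stable V p"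
    by (rule R.finsum_singleton[OF p finite_stable_index M_stable_closed])
  finally have 1: "comb ?c = M_stable V p" .
  have "(\<Sum>p'\<in>stable_index. real_of_int (?c p') * weight p') = (\<Sum>p'\<in>stable_index. if p' = p then weight p' else 0)"
    by (intro sum.cong) auto
  also have "\<dots> = weight p" using p finite_stable_index by simp
  finally show ?thesis unfolding pos_comb_def using 1 by (intro exI[of _ ?c]) simp
qed

text \<open>Maschke's theorem splits the representation until it is simple, by induction on its
  dimension. A simple one that is trivial on g^n is some V_l with l in \<open>Omega0\<close>, so its
  product with \<open>jor k\<close> is a basis element. Dimensions add up, hence so do the
  weights.\<close>

lemma pos_comb_inf_jor:
  assumes k: "0 < k" "k < n"
  shows "quot_rep d \<rho> \<Longrightarrow> pos_comb (inf_class d \<rho> \<otimes>\<^bsub>R\<^esub> jor k) (real d * qnum n k)"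
proof (induction d arbitrary: \<rho> rule: less_induct)
  case (less d)
  interpret R: ring R by (rule stable_green_ring_ring)
  note q = less.prems and D = quot_repD[OF less.prems]
  let ?U = "kg_mod d \<rho>"
  have fU: "is_fdmod kG ?U" by (rule kg_mod_fdmod[OF D(1)])
  have aU: "h \<in> carrier G \<Longrightarrow> gact ?U h = \<rho> h" for h by (rule kg_mod_gact[OF D(1)])
  have jc: "jor k \<in> carrier R" using k by (simp add: jor_closed)
  consider (zero) "d = 0" | (simple) "simple_mod kG ?U" | (split) "d > 0" "\<not> simple_mod kG ?U" by blast
  then show ?case
  proof cases
    case zero
    then show ?thesis using inf_class_0 q jc pos_comb_zero by simp
  next
    case simple
    then obtain l where l: "l \<in> \<Omega>" "mod_iso kG ?U (V l)" using cs by (auto simp: complete_simples_def)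
    have fV: "is_fdmod kG (V l)" using simple_V[OF l(1)] by (simp add: simple_mod_def)
    let ?m = "mdim (V l)"
    obtain T S where T: "T \<in> carrier_mat ?m d" "S \<in> carrier_mat d ?m" "S * T = 1\<^sub>m d" "T * S = 1\<^sub>m ?m"
      and i: "\<And>h. h \<in> carrier G \<Longrightarrow> T * \<rho> h = gact (V l) h * T"
      using l(2) unfolding mod_iso_def by (auto simp: kG_mod_hom_iff fU fV aU)
    have gc: "gact (V l) (g [^] n) \<in> carrier_mat ?m ?m" by (rule grp_repD(1)[OF fdmod_grp_rep[OF fV] gn_closed])
    have "gact (V l) (g [^] n) = gact (V l) (g [^] n) * (T * S)" using gc T by simp
    also have "\<dots> = T * \<rho> (g [^] n) * S" unfolding i[OF gn_closed] using gc T by (simp add: assoc_mult_mat[of _ ?m ?m])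
    also have "\<dots> = 1\<^sub>m ?m" using D(5) T by simp
    finally have l0: "l \<in> Omega0 \<Omega> V" using l(1) by (simp add: Omega0_def gact_def)
    \<comment> \<open>T S = 1 and S T = 1 have the same trace, which identifies the two
      dimensions.\<close>
    have "complex_of_nat d = complex_of_nat ?m"
      using mtrace_mult_commute[OF T(1,2)] T(3,4) by (simp add: mtrace_one)
    then have dm: "d = ?m" by simp
    have "inf_class d \<rho> = inf_class ?m (gact (V l))"
      by (rule inf_class_iso[OF q Omega0D(5)[OF l0] T i])
    then have "inf_class d \<rho> \<otimes>\<^bsub>R\<^esub> jor k = M_stable V (k, l)" using k by (simp add: M_stable_mult[OF l0])
    moreover have "(k, l) \<in> stable_index" using k l0 by (auto simp: stable_index_def)
    ultimately show ?thesis using pos_comb_basis[of "(k, l)"] dm by (simp add: weight_def)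
  next
    case split
    then obtain W where "submod kG W ?U" "W \<noteq> {0\<^sub>v d}" "W \<noteq> carrier_vec d"
      using fU by (auto simp: simple_mod_def)
    then have W: "vec_subspace d W" "\<And>h v. h \<in> carrier G \<Longrightarrow> v \<in> W \<Longrightarrow> \<rho> h *\<^sub>v v \<in> W" "W \<noteq> {0\<^sub>v d}" "W \<noteq> carrier_vec d"
      by (auto simp: submod_kG_iff[OF fU] aU)
    from quot_rep_split[OF q W] obtain e1 e2 \<rho>1 \<rho>2
      where e: "0 < e1" "0 < e2" "e1 + e2 = d" "quot_rep e1 \<rho>1" "quot_rep e2 \<rho>2"
        "inf_class d \<rho> = inf_class e1 \<rho>1 \<oplus>\<^bsub>R\<^esub> inf_class e2 \<rho>2" .
    have "pos_comb (inf_class e1 \<rho>1 \<otimes>\<^bsub>R\<^esub> jor k \<oplus>\<^bsub>R\<^esub> inf_class e2 \<rho>2 \<otimes>\<^bsub>R\<^esub> jor k) (real e1 * qnum n k + real e2 * qnum n k)"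
      using e by (intro pos_comb_add less.IH) auto
    then show ?thesis
      using e jc inf_class_closed by (simp add: R.l_distr flip: e(3) distrib_right)
  qed
qed

lemma pos_mult_zero: "pos_mult \<zero>\<^bsub>R\<^esub> 0"
proof -
  interpret R: ring R by (rule stable_green_ring_ring)
  show ?thesis by (simp add: pos_mult_def inf_class_closed pos_comb_zero)
qed

lemma pos_mult_add: "pos_mult z w \<Longrightarrow> pos_mult z' w' \<Longrightarrow> pos_mult (z \<oplus>\<^bsub>R\<^esub> z') (w + w')"
proof -
  interpret R: ring R by (rule stable_green_ring_ring)
  assume "pos_mult z w" "pos_mult z' w'"
  then show ?thesis
    using pos_comb_add by (auto simp: pos_mult_def R.r_distr inf_class_closed distrib_left)
qed

text \<open>Tensoring with a one-dimensional representation changes \<open>\<rho>\<close> but not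
  its dimension, so the same w serves.\<close>

lemma pos_mult_chi: "pos_mult z w \<Longrightarrow> pos_mult (inf_class 1 chi_inv \<otimes>\<^bsub>R\<^esub> z) w"
proof -
  interpret R: ring R by (rule stable_green_ring_ring)
  assume z: "pos_mult z w"
  then have zc: "z \<in> carrier R" by (simp add: pos_mult_def)
  have xc: "inf_class 1 chi_inv \<in> carrier R" by (rule inf_class_closed[OF chi_inv_quot])
  have "pos_comb (inf_class d \<rho> \<otimes>\<^bsub>R\<^esub> (inf_class 1 chi_inv \<otimes>\<^bsub>R\<^esub> z)) (real d * w)" if q: "quot_rep d \<rho>" for d \<rho>
  proof -
    have "inf_class d \<rho> \<otimes>\<^bsub>R\<^esub> (inf_class 1 chi_inv \<otimes>\<^bsub>R\<^esub> z) = inf_class (d * 1) (\<lambda>h. kron (\<rho> h) (chi_inv h)) \<otimes>\<^bsub>R\<^esub> z"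
      unfolding inf_class_mult[OF q chi_inv_quot, symmetric]
      using zc xc inf_class_closed[OF q] by (simp only: R.m_assoc)
    moreover have "pos_comb (inf_class (d * 1) (\<lambda>h. kron (\<rho> h) (chi_inv h)) \<otimes>\<^bsub>R\<^esub> z) (real (d * 1) * w)"
      using z infl_tensor(1)[OF q chi_inv_quot] unfolding pos_mult_def by blast
    ultimately show ?thesis by (simp only: mult_1_right)
  qed
  then show ?thesis using R.m_closed[OF xc zc] unfolding pos_mult_def by blast
qed

lemma pos_mult_chi_pow: "pos_mult z w \<Longrightarrow> pos_mult (inf_class 1 chi_inv [^]\<^bsub>R\<^esub> (m::nat) \<otimes>\<^bsub>R\<^esub> z) w"
proof (induction m)
  case 0
  interpret R: ring R by (rule stable_green_ring_ring)
  show ?case using 0 by (simp add: pos_mult_def)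
next
  case (Suc m)
  interpret R: ring R by (rule stable_green_ring_ring)
  have "inf_class 1 chi_inv \<in> carrier R" "z \<in> carrier R"
    using inf_class_closed[OF chi_inv_quot] Suc.prems by (simp_all add: pos_mult_def)
  then have "inf_class 1 chi_inv [^]\<^bsub>R\<^esub> Suc m \<otimes>\<^bsub>R\<^esub> z = inf_class 1 chi_inv \<otimes>\<^bsub>R\<^esub> (inf_class 1 chi_inv [^]\<^bsub>R\<^esub> m \<otimes>\<^bsub>R\<^esub> z)"
    by (simp only: R.nat_pow_Suc2 R.m_assoc R.nat_pow_closed)
  then show ?case using pos_mult_chi[OF Suc.IH[OF Suc.prems]] by simp
qed

text \<open>The zero classes at k = 0 and k = n are matched by the zeros of \<open>qnum\<close>, so
  the fusion rules can be used up to both ends of the chain.\<close>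

lemma pos_mult_jor: "k \<le> n \<Longrightarrow> pos_mult (jor k) (qnum n k)"
proof -
  assume k: "k \<le> n"
  consider "k = 0" | "k = n" | "0 < k" "k < n" using k by linarith
  then show ?thesis
  proof cases
    case 3
    then show ?thesis using pos_comb_inf_jor[OF 3] jor_closed[OF k] by (simp add: pos_mult_def)
  qed (simp_all add: jor_0 jor_n qnum_n pos_mult_zero)
qed

text \<open>\<open>fusion_low\<close> reduces the product to one with a smaller first index and only
  adds terms; the weights follow by \<open>qnum_fusion\<close>.\<close>

lemma pos_mult_jor_low: "j + k \<le> n \<Longrightarrow> pos_mult (jor j \<otimes>\<^bsub>R\<^esub> jor k) (qnum n j * qnum n k)"
proof (induction j arbitrary: k)
  case 0
  interpret R: ring R by (rule stable_green_ring_ring)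
  show ?case using 0 by (simp add: jor_0 jor_closed pos_mult_zero)
next
  case (Suc j)
  interpret F: fusion_chain R "jor 2" "inf_class 1 chi_inv" jor n by (rule jor_fusion_chain)
  show ?case
  proof (cases "k = 0")
    case True
    then show ?thesis using Suc.prems by (simp add: jor_0 jor_closed pos_mult_zero)
  next
    case False
    have "jor (j + 1) \<otimes>\<^bsub>R\<^esub> jor k = inf_class 1 chi_inv \<otimes>\<^bsub>R\<^esub> (jor j \<otimes>\<^bsub>R\<^esub> jor (k - 1)) \<oplus>\<^bsub>R\<^esub> jor (j + k)"
      using False Suc.prems by (intro F.fusion_low) auto
    moreover have "pos_mult (inf_class 1 chi_inv \<otimes>\<^bsub>R\<^esub> (jor j \<otimes>\<^bsub>R\<^esub> jor (k - 1)) \<oplus>\<^bsub>R\<^esub> jor (j + k))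
      (qnum n j * qnum n (k - 1) + qnum n (j + k))"
      using Suc.prems by (intro pos_mult_add pos_mult_chi Suc.IH pos_mult_jor) auto
    ultimately show ?thesis using qnum_fusion[OF n_ge_2, of k j] False by simp
  qed
qed

lemma pos_mult_jor_jor:
  assumes "j \<le> n" "k \<le> n"
  shows "pos_mult (jor j \<otimes>\<^bsub>R\<^esub> jor k) (qnum n j * qnum n k)"
proof (cases "j + k \<le> n")
  case False
  interpret F: fusion_chain R "jor 2" "inf_class 1 chi_inv" jor n by (rule jor_fusion_chain)
  have "pos_mult (inf_class 1 chi_inv [^]\<^bsub>R\<^esub> (j + k - n) \<otimes>\<^bsub>R\<^esub> (jor (n - j) \<otimes>\<^bsub>R\<^esub> jor (n - k))) (qnum n (n - j) * qnum n (n - k))"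
    using False by (intro pos_mult_chi_pow pos_mult_jor_low) auto
  then show ?thesis
    using F.fusion_high[OF assms(2,1)] False assms n_ge_2 by (simp add: qnum_reflect)
qed (rule pos_mult_jor_low)

text \<open>Moving the chain part of the first factor past the group part of the second separates
  the product into v_i v_l times f_j f_k.\<close>

lemma pos_comb_mult:
  assumes p: "(j, i) \<in> stable_index" and q: "(k, l) \<in> stable_index"
  shows "pos_comb (M_stable V (j, i) \<otimes>\<^bsub>R\<^esub> M_stable V (k, l)) (weight (j, i) * weight (k, l))"
proof -
  interpret R: ring R by (rule stable_green_ring_ring)
  have b: "i \<in> Omega0 \<Omega> V" "l \<in> Omega0 \<Omega> V" "j \<le> n" "k \<le> n" using p q by (auto simp: stable_index_def)
  let ?v = "inf_class (mdim (V i)) (gact (V i))" and ?w = "inf_class (mdim (V l)) (gact (V l))"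
  note qv = Omega0D(5)[OF b(1)] and qw = Omega0D(5)[OF b(2)]
  note c = inf_class_closed[OF qv] inf_class_closed[OF qw] jor_closed[OF b(3)] jor_closed[OF b(4)]
  have "M_stable V (j, i) \<otimes>\<^bsub>R\<^esub> M_stable V (k, l) = ?v \<otimes>\<^bsub>R\<^esub> (jor j \<otimes>\<^bsub>R\<^esub> ?w) \<otimes>\<^bsub>R\<^esub> jor k"
    unfolding M_stable_mult[OF b(1,3)] M_stable_mult[OF b(2,4)] using c by (simp add: R.m_assoc)
  also have "\<dots> = ?v \<otimes>\<^bsub>R\<^esub> ?w \<otimes>\<^bsub>R\<^esub> (jor j \<otimes>\<^bsub>R\<^esub> jor k)"
    unfolding jor_commute_inf_class[OF qw b(3), symmetric] using c by (simp add: R.m_assoc)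
  finally have e: "M_stable V (j, i) \<otimes>\<^bsub>R\<^esub> M_stable V (k, l)
      = inf_class (mdim (V i) * mdim (V l)) (\<lambda>h. kron (gact (V i) h) (gact (V l) h)) \<otimes>\<^bsub>R\<^esub> (jor j \<otimes>\<^bsub>R\<^esub> jor k)"
    by (simp add: inf_class_mult[OF qv qw])
  have "pos_comb (M_stable V (j, i) \<otimes>\<^bsub>R\<^esub> M_stable V (k, l)) (real (mdim (V i) * mdim (V l)) * (qnum n j * qnum n k))"
    unfolding e using pos_mult_jor_jor[OF b(3,4)] infl_tensor(1)[OF qv qw] unfolding pos_mult_def by blast
  then show ?thesis by (simp add: weight_def mult_ac)
qed

end

end

end

section \<open>Perron eigenvalue from a positive left eigenvector\<close>

lemma eigenvalue_transpose_mat: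
  fixes A :: "complex mat"
  assumes "A \<in> carrier_mat m m"
  shows "eigenvalue (transpose_mat A) t \<longleftrightarrow> eigenvalue A t"
  using assms eigenvalue_root_char_poly[OF assms] eigenvalue_root_char_poly[of "transpose_mat A" m]
  by (simp add: char_poly_transpose_mat)

text \<open>Pair the entrywise modulus of an eigenvector v with the weights: t <w, |v|> \<le> <w,
  A|v|> = l <w, |v|>, where <w, |v|> is positive.\<close>

lemma eigenvalue_le_positive_left_eigenvector:
  fixes A :: "nat \<Rightarrow> nat \<Rightarrow> real" and w :: "nat \<Rightarrow> real"
  assumes nonneg: "\<And>r s. r < m \<Longrightarrow> s < m \<Longrightarrow> 0 \<le> A r s" and w: "\<And>r. r < m \<Longrightarrow> 0 < w r"
    and left: "\<And>s. s < m \<Longrightarrow> (\<Sum>r<m. A r s * w r) = l * w s"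
    and t: "eigenvalue (mat m m (\<lambda>(r, s). complex_of_real (A r s))) (complex_of_real t)" "0 \<le> t"
  shows "t \<le> l"
proof -
  let ?A = "mat m m (\<lambda>(r, s). complex_of_real (A r s))"
  obtain v where v: "v \<in> carrier_vec m" "v \<noteq> 0\<^sub>v m" "?A *\<^sub>v v = complex_of_real t \<cdot>\<^sub>v v"
    using t(1) by (auto simp: eigenvalue_def eigenvector_def)
  have le: "t * cmod (v $ r) \<le> (\<Sum>s<m. A r s * cmod (v $ s))" if r: "r < m" for r
  proof -
    have "complex_of_real t * v $ r = (\<Sum>s<m. complex_of_real (A r s) * v $ s)"
      using arg_cong[OF v(3), of "\<lambda>u. u $ r"] v(1) r by (simp add: scalar_prod_def atLeast0LessThan)
    then have "cmod (complex_of_real t * v $ r) \<le> (\<Sum>s<m. cmod (complex_of_real (A r s) * v $ s))"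
      by (simp add: norm_sum)
    then show ?thesis using t(2) nonneg r by (simp add: norm_mult)
  qed
  define S where "S = (\<Sum>r<m. w r * cmod (v $ r))"
  have "t * S = (\<Sum>r<m. w r * (t * cmod (v $ r)))" by (simp add: S_def sum_distrib_left mult_ac)
  also have "\<dots> \<le> (\<Sum>r<m. w r * (\<Sum>s<m. A r s * cmod (v $ s)))"
    using w le by (intro sum_mono mult_left_mono) (auto intro: less_imp_le)
  also have "\<dots> = (\<Sum>s<m. cmod (v $ s) * (\<Sum>r<m. A r s * w r))"
    by (simp add: sum_distrib_left mult_ac) (rule sum.swap)
  also have "\<dots> = (\<Sum>s<m. cmod (v $ s) * (l * w s))" by (intro sum.cong) (simp_all add: left)
  also have "\<dots> = l * S" by (simp add: S_def sum_distrib_left mult_ac)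
  finally have "t * S \<le> l * S" .
  moreover have "0 < S"
  proof -
    obtain r where r: "r < m" "v $ r \<noteq> 0" using v(1,2) by (metis carrier_vecD eq_vecI index_zero_vec)
    then have "0 < w r * cmod (v $ r)" using w by simp
    also have "\<dots> \<le> S" unfolding S_def using w r by (intro member_le_sum) (auto intro!: mult_nonneg_nonneg intro: less_imp_le)
    finally show ?thesis .
  qed
  ultimately show ?thesis by simp
qed

text \<open>\<open>uniq\<close> makes the description in \<open>coords\<close> determinate. The
  weights form a left eigenvector, so l is an eigenvalue of the transpose and thus of the matrix
  itself, and the preceding bound shows that it is the largest.\<close>

lemma (in ring) FPdim_eqI:
  fixes c :: "'p \<Rightarrow> 'p \<Rightarrow> int" and w :: "'p \<Rightarrow> real"
  assumes I: "finite I" "I \<noteq> {}"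
    and uniq: "\<And>c c'. c \<in> I \<rightarrow>\<^sub>E UNIV \<Longrightarrow> c' \<in> I \<rightarrow>\<^sub>E UNIV \<Longrightarrow>
      (\<Oplus>p\<in>I. add_pow R (c p :: int) (b p)) = (\<Oplus>p\<in>I. add_pow R (c' p) (b p)) \<Longrightarrow> c = c'"
    and c: "\<And>q. q \<in> I \<Longrightarrow> x \<otimes> b q = (\<Oplus>p\<in>I. add_pow R (c q p) (b p))" "\<And>q. q \<in> I \<Longrightarrow> c q \<in> I \<rightarrow>\<^sub>E UNIV"
    and nonneg: "\<And>q p. q \<in> I \<Longrightarrow> p \<in> I \<Longrightarrow> 0 \<le> c q p"
    and w: "\<And>p. p \<in> I \<Longrightarrow> 0 < w p"
    and left: "\<And>q. q \<in> I \<Longrightarrow> (\<Sum>p\<in>I. real_of_int (c q p) * w p) = l * w q"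
  shows "FPdim R I b x = l"
proof -
  let ?m = "card I" and ?e = "from_nat_into I"
  have bij: "bij_betw ?e {..<?m} I" using I(1) by (rule bij_betw_from_nat_into_finite)
  have e: "?e r \<in> I" if "r < ?m" for r using bij that by (auto simp: bij_betw_def)
  have co: "coords R I b (x \<otimes> b q) = c q" if q: "q \<in> I" for q
    unfolding coords_def
  proof (rule the_equality)
    fix d assume "d \<in> I \<rightarrow>\<^sub>E UNIV \<and> x \<otimes> b q = (\<Oplus>p\<in>I. add_pow R (d p :: int) (b p))"
    then show "d = c q" using uniq[of d "c q"] c[OF q] by metis
  qed (use c q in auto)
  define A where "A r s = real_of_int (c (?e s) (?e r))" for r s
  let ?A = "mat ?m ?m (\<lambda>(r, s). complex_of_real (A r s))"
  have M: "map_mat complex_of_int (left_mult_mat R I b x) = ?A"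
    by (rule eq_matI) (auto simp: left_mult_mat_def co e A_def)
  have Ac: "?A \<in> carrier_mat ?m ?m" by simp
  have lf: "(\<Sum>r<?m. A r s * w (?e r)) = l * w (?e s)" if s: "s < ?m" for s
    unfolding A_def left[OF e[OF s], symmetric] by (rule sum.reindex_bij_betw[OF bij])
  have m: "0 < ?m" using I by (simp add: card_gt_0_iff)
  have l: "0 \<le> l"
  proof -
    have "0 \<le> (\<Sum>r<?m. A r 0 * w (?e r))"
      using nonneg w e m by (intro sum_nonneg mult_nonneg_nonneg) (auto simp: A_def intro: less_imp_le)
    then show ?thesis using lf[OF m] w[OF e[OF m]] by (simp add: zero_le_mult_iff)
  qed
  have "eigenvalue (transpose_mat ?A) (complex_of_real l)"
    unfolding eigenvalue_def eigenvector_def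
  proof (intro exI conjI)
    let ?w = "vec ?m (\<lambda>r. complex_of_real (w (?e r)))"
    show "?w \<in> carrier_vec (dim_row (transpose_mat ?A))" by simp
    show "?w \<noteq> 0\<^sub>v (dim_row (transpose_mat ?A))"
    proof
      assume "?w = 0\<^sub>v (dim_row (transpose_mat ?A))"
      then have "?w $ 0 = 0\<^sub>v ?m $ 0" by simp
      then show False using m w[OF e[OF m]] by simp
    qed
    show "transpose_mat ?A *\<^sub>v ?w = complex_of_real l \<cdot>\<^sub>v ?w"
      using lf by (intro eq_vecI) (auto simp: scalar_prod_def atLeast0LessThan simp flip: of_real_mult of_real_sum)
  qed
  then have el: "eigenvalue ?A (complex_of_real l)" by (simp only: eigenvalue_transpose_mat[OF Ac])
  \<comment> \<open>\<open>Max\<close> is meaningful only for a finite set; the candidates are roots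
    of the characteristic polynomial.\<close>
  have "char_poly ?A \<noteq> 0" using degree_monic_char_poly[OF Ac] by auto
  then have "finite {z. poly (char_poly ?A) z = 0}" by (rule poly_roots_finite)
  then have "finite (complex_of_real -` {z. poly (char_poly ?A) z = 0})" by (rule finite_vimageI) (simp add: inj_on_def)
  then have fin: "finite {t. 0 \<le> t \<and> eigenvalue ?A (complex_of_real t)}"
    by (rule rev_finite_subset) (auto simp: eigenvalue_root_char_poly[OF Ac])
  show ?thesis
    unfolding FPdim_def M
  proof (rule Max_eqI[OF fin])
    show "l \<in> {t. 0 \<le> t \<and> eigenvalue ?A (complex_of_real t)}" using el l by simp
    fix t assume "t \<in> {t. 0 \<le> t \<and> eigenvalue ?A (complex_of_real t)}"
    then show "t \<le> l"
      using eigenvalue_le_positive_left_eigenvector[of ?m A "\<lambda>r. w (?e r)" l t] lf nonneg w e by (auto simp: A_def)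
  qed
qed

lemma frag_eval_sum: "frag_eval f (\<Sum>p\<in>I. x p) = (\<Sum>p\<in>I. frag_eval f (x p))"
  by (induction I rule: infinite_finite_induct) (simp_all add: frag_eval_add)

context non_nilpotent_group_datum
begin

section \<open>Uniqueness of coordinates\<close>

lemma stab_closed: "x \<in> carrier free_green \<Longrightarrow> stab x \<in> carrier R"
  by (rule ring_hom_closed[OF stab_hom])

lemma stab_add: "x \<in> carrier free_green \<Longrightarrow> y \<in> carrier free_green \<Longrightarrow> stab (x + y) = stab x \<oplus>\<^bsub>R\<^esub> stab y"
  using ring_hom_add[OF stab_hom] by (simp add: free_green_simps)

lemma stab_zero: "stab 0 = \<zero>\<^bsub>R\<^esub>"
  using ring_hom_zero[OF stab_hom free_green_ring stable_green_ring_ring] by (simp add: free_green_simps)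

lemma free_green_cmul_closed: "x \<in> carrier free_green \<Longrightarrow> frag_cmul k x \<in> carrier free_green"
  using keys_cmul[of k x] by (auto simp: free_green_simps)

lemma free_green_sum_closed: "(\<And>p. p \<in> I \<Longrightarrow> x p \<in> carrier free_green) \<Longrightarrow> (\<Sum>p\<in>I. x p) \<in> carrier free_green"
proof (induction I rule: infinite_finite_induct)
  case (insert p I)
  then show ?case using keys_add[of "x p" "\<Sum>p\<in>I. x p"] by (auto simp: free_green_simps)
qed (simp_all add: free_green_simps)

lemma stab_cmul:
  assumes x: "x \<in> carrier free_green"
  shows "stab (frag_cmul k x) = add_pow R k (stab x)"
proof -
  interpret R: ring R by (rule stable_green_ring_ring)
  note c = stab_closed[OF x]
  have cl: "add_pow R (k :: int) (stab x) \<in> carrier R" for k using c by (rule R.add.int_pow_closed)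
  have n: "stab (frag_cmul (int m) x) = add_pow R (int m) (stab x)" for m
  proof (induction m)
    case (Suc m)
    have "stab (frag_cmul (int (Suc m)) x) = stab (frag_cmul (int m) x + x)" by (simp add: frag_cmul_distrib add.commute)
    also have "\<dots> = add_pow R (int m) (stab x) \<oplus>\<^bsub>R\<^esub> add_pow R (1 :: int) (stab x)"
      using x Suc by (simp add: stab_add free_green_cmul_closed R.add_pow_int_one c)
    also have "\<dots> = add_pow R (int m + 1) (stab x)" by (rule R.add.int_pow_mult[symmetric, OF c])
    finally show ?case by (simp add: add.commute)
  qed (simp add: stab_zero R.add_pow_int_zero)
  show ?thesis
  proof (cases "0 \<le> k")
    case True
    then show ?thesis using n[of "nat k"] by simp
  next
    case False
    have e: "stab (frag_cmul (- k) x) = add_pow R (- k) (stab x)" using n[of "nat (- k)"] False by simp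
    have "stab (frag_cmul k x) \<oplus>\<^bsub>R\<^esub> stab (frag_cmul (- k) x) = \<zero>\<^bsub>R\<^esub>"
      using x by (simp add: free_green_cmul_closed stab_zero flip: stab_add frag_cmul_distrib)
    moreover have "add_pow R k (stab x) \<oplus>\<^bsub>R\<^esub> add_pow R (- k) (stab x) = \<zero>\<^bsub>R\<^esub>"
      using R.add.int_pow_mult[OF c, of k "- k"] by (simp add: R.add_pow_int_zero)
    ultimately have "stab (frag_cmul k x) \<oplus>\<^bsub>R\<^esub> add_pow R (- k) (stab x) = add_pow R k (stab x) \<oplus>\<^bsub>R\<^esub> add_pow R (- k) (stab x)"
      by (simp only: e)
    then show ?thesis
      using cl stab_closed[OF free_green_cmul_closed[OF x]] by (simp add: R.add.right_cancel)
  qed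
qed

lemma stab_sum:
  "finite I \<Longrightarrow> (\<And>p. p \<in> I \<Longrightarrow> x p \<in> carrier free_green) \<Longrightarrow> stab (\<Sum>p\<in>I. x p) = (\<Oplus>\<^bsub>R\<^esub>p\<in>I. stab (x p))"
proof (induction I rule: finite_induct)
  case empty
  interpret R: ring R by (rule stable_green_ring_ring)
  show ?case by (simp add: stab_zero)
next
  case (insert p I)
  interpret R: ring R by (rule stable_green_ring_ring)
  have "stab (\<Sum>p\<in>insert p I. x p) = stab (x p) \<oplus>\<^bsub>R\<^esub> (\<Oplus>\<^bsub>R\<^esub>p\<in>I. stab (x p))"
    using insert by (simp add: stab_add free_green_sum_closed)
  also have "\<dots> = (\<Oplus>\<^bsub>R\<^esub>p\<in>insert p I. stab (x p))"
    using insert by (subst R.finsum_insert) (auto simp: stab_closed)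
  finally show ?case .
qed

context
  fixes \<Omega> :: "'i set" and V :: "'i \<Rightarrow> ('a \<Rightarrow> complex) fdmod"
  assumes cs: "complete_simples kG \<Omega> V"
begin

lemmas Omega0_facts = Omega0D[OF cs]

abbreviation basis_mod :: "nat \<times> 'i \<Rightarrow> (nat \<times> 'a \<Rightarrow> complex) fdmod" where
  "basis_mod p \<equiv> lad (fst p) (mdim (V (snd p))) (gact (V (snd p)))"

lemma basis_mod_fdmod: "p \<in> stable_index \<Omega> V \<Longrightarrow> is_fdmod H (basis_mod p)"
  using Omega0_facts(5) by (auto simp: stable_index_def intro!: lad_fdmod)

lemma M_stable_basis_mod: "p \<in> stable_index \<Omega> V \<Longrightarrow> M_stable V p = stab (fcl (basis_mod p))"
  by (cases p) (auto simp: stable_index_def M_stable_lad[OF cs] stable_class_eq)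

lemma comb_stab: "comb \<Omega> V c = stab (\<Sum>p\<in>stable_index \<Omega> V. frag_cmul (c p) (fcl (basis_mod p)))"
proof -
  interpret R: ring R by (rule stable_green_ring_ring)
  have c: "fcl (basis_mod p) \<in> carrier free_green" if "p \<in> stable_index \<Omega> V" for p
    using basis_mod_fdmod[OF that] by (rule fcl_closed)
  have "stab (\<Sum>p\<in>stable_index \<Omega> V. frag_cmul (c p) (fcl (basis_mod p)))
      = (\<Oplus>\<^bsub>R\<^esub>p\<in>stable_index \<Omega> V. stab (frag_cmul (c p) (fcl (basis_mod p))))"
    by (rule stab_sum[OF finite_stable_index[OF cs] free_green_cmul_closed[OF c]])
  also have "\<dots> = (\<Oplus>\<^bsub>R\<^esub>p\<in>stable_index \<Omega> V. add_pow R (c p) (M_stable V p))"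
    using c stab_closed[OF c] by (intro R.finsum_cong') (auto simp: stab_cmul M_stable_basis_mod intro!: R.add.int_pow_closed)
  finally show ?thesis by (simp add: comb_def)
qed

lemma phi_basis_mod:
  assumes "p \<in> stable_index \<Omega> V" "h \<in> carrier G"
  shows "phi s h (basis_mod p) = (if fst p = Suc s then inverse (\<chi> h) ^ s * grp_char (V (snd p)) h else 0)"
  using assms Omega0_facts(5) by (cases p) (auto simp: stable_index_def phi_lad grp_char_def)

text \<open>The functional with index k - 1 discards all chain lengths other than k and leaves a
  vanishing combination of the characters of the V_m, whose coefficients are read off by
  orthogonality.\<close>

lemma comb_inj:
  assumes e: "comb \<Omega> V c = comb \<Omega> V c'" and p: "(k, l) \<in> stable_index \<Omega> V"
  shows "c (k, l) = c' (k, l)"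
proof -
  interpret R: ring R by (rule stable_green_ring_ring)
  let ?I = "stable_index \<Omega> V" and ?O = "Omega0 \<Omega> V"
  have k: "0 < k" "k < n" "l \<in> ?O" using p by (auto simp: stable_index_def)
  then obtain s where s: "k = Suc s" by (cases k) auto
  define d where "d p = c p - c' p" for p
  define X where "X = (\<Sum>p\<in>?I. frag_cmul (d p) (fcl (basis_mod p)))"
  have Xc: "X \<in> carrier free_green"
    unfolding X_def by (intro free_green_sum_closed free_green_cmul_closed fcl_closed basis_mod_fdmod)
  have cc: "comb \<Omega> V f \<in> carrier R" for f
    unfolding comb_stab by (intro stab_closed free_green_sum_closed free_green_cmul_closed fcl_closed basis_mod_fdmod)
  have "comb \<Omega> V c = comb \<Omega> V d \<oplus>\<^bsub>R\<^esub> comb \<Omega> V c'"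
    using R.finsum_add_pow_add[OF M_stable_closed[OF cs], of d c'] by (simp add: comb_def d_def)
  then have "comb \<Omega> V d = \<zero>\<^bsub>R\<^esub>" using e cc by (simp add: R.add.r_cancel_one)
  then have Xz: "stab X = \<zero>\<^bsub>R\<^esub>" by (simp add: comb_stab X_def)
  have z: "(\<Sum>m\<in>?O. of_int (d (k, m)) * grp_char (V m) h) = 0" if h: "h \<in> carrier G" for h
  proof -
    \<comment> \<open>The functional vanishes on stable zero classes when s + 1 < n, and s + 1 = k
      \<le> n - 1 because the index set omits n.\<close>
    have "0 = frag_eval (phi_class s h) X" using stab_zero_phi[OF Xc Xz _ h, of s] k s by simp
    also have "\<dots> = (\<Sum>p\<in>?I. of_int (d p) * phi s h (basis_mod p))"
      unfolding X_def frag_eval_sum frag_eval_cmul frag_eval_of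
      by (intro sum.cong refl) (simp add: phi_class_eq basis_mod_fdmod h)
    also have "\<dots> = (\<Sum>p\<in>?I. of_int (d p) * (if fst p = k then inverse (\<chi> h) ^ s * grp_char (V (snd p)) h else 0))"
      by (intro sum.cong refl) (simp add: phi_basis_mod h s)
    also have "\<dots> = (\<Sum>p\<in>{k} \<times> ?O. of_int (d p) * (if fst p = k then inverse (\<chi> h) ^ s * grp_char (V (snd p)) h else 0))"
      using k finite_stable_index[OF cs] by (intro sum.mono_neutral_right) (auto simp: stable_index_def)
    also have "\<dots> = (\<Sum>m\<in>?O. of_int (d (k, m)) * (inverse (\<chi> h) ^ s * grp_char (V m) h))"
      by (simp add: sum.cartesian_product')
    also have "\<dots> = inverse (\<chi> h) ^ s * (\<Sum>m\<in>?O. of_int (d (k, m)) * grp_char (V m) h)"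
      by (simp add: sum_distrib_left mult_ac)
    finally show ?thesis using chi_nonzero[OF h] by simp
  qed
  have "0 = (\<Sum>h\<in>carrier G. (\<Sum>m\<in>?O. of_int (d (k, m)) * grp_char (V m) h) * grp_char (V l) (inv h))"
    by (simp add: z)
  also have "\<dots> = (\<Sum>m\<in>?O. of_int (d (k, m)) * (\<Sum>h\<in>carrier G. grp_char (V m) h * grp_char (V l) (inv h)))"
    unfolding sum_distrib_right sum_distrib_left by (subst sum.swap) (simp add: mult_ac)
  also have "\<dots> = (\<Sum>m\<in>?O. if m = l then of_int (d (k, l)) * of_nat (card (carrier G)) else 0)"
  proof (intro sum.cong refl)
    fix m assume m: "m \<in> ?O"
    show "of_int (d (k, m)) * (\<Sum>h\<in>carrier G. grp_char (V m) h * grp_char (V l) (inv h))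
      = (if m = l then of_int (d (k, l)) * of_nat (card (carrier G)) else 0)"
    proof (cases "m = l")
      case False
      then have "\<not> mod_iso kG (V l) (V m)"
        using cs Omega0_facts(1)[OF m] Omega0_facts(1)[OF k(3)] by (auto simp: complete_simples_def)
      then show ?thesis using char_orthogonal(1)[OF Omega0_facts(2)[OF k(3)] Omega0_facts(2)[OF m]] False by simp
    qed (use char_orthogonal(2)[OF Omega0_facts(2)[OF k(3)] Omega0_facts(2)[OF k(3)]] in simp)
  qed
  also have "\<dots> = of_int (d (k, l)) * of_nat (card (carrier G))"
    using k(3) finite_stable_index[OF cs] simples_finite[OF cs] by (simp add: Omega0_def)
  finally show ?thesis using card_G_pos by (simp add: d_def)
qed

lemma stable_FPdim_M_stable:
  assumes p: "(j, i) \<in> stable_index \<Omega> V"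
  shows "stable_FPdim \<Omega> V (M_stable V (j, i)) = real (mdim (V i)) * qnum n j"
proof -
  interpret R: ring R by (rule stable_green_ring_ring)
  let ?I = "stable_index \<Omega> V"
  define P where "P q c \<longleftrightarrow> c \<in> ?I \<rightarrow>\<^sub>E UNIV \<and> (\<forall>p\<in>?I. 0 \<le> c p) \<and>
    M_stable V (j, i) \<otimes>\<^bsub>R\<^esub> M_stable V q = comb \<Omega> V c \<and>
    (\<Sum>p\<in>?I. real_of_int (c p) * weight V p) = weight V (j, i) * weight V q" for q and c :: "nat \<times> 'i \<Rightarrow> int"
  have "\<exists>c. P q c" if q: "q \<in> ?I" for q
  proof -
    obtain k l where kl: "q = (k, l)" by (cases q) auto
    obtain c where c: "\<forall>p\<in>?I. 0 \<le> c p" "M_stable V (j, i) \<otimes>\<^bsub>R\<^esub> M_stable V q = comb \<Omega> V c"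
      "weight V (j, i) * weight V q = (\<Sum>p\<in>?I. real_of_int (c p) * weight V p)"
      using pos_comb_mult[OF cs p, of k l] q unfolding kl pos_comb_def by blast
    \<comment> \<open>\<open>coords\<close> ranges over extensional functions, so the coefficients
      are cut off outside the index set.\<close>
    have "comb \<Omega> V (restrict c ?I) = comb \<Omega> V c"
      unfolding comb_def using funcset_mem[OF M_stable_closed[OF cs]]
      by (intro R.finsum_cong') (auto intro!: R.add.int_pow_closed)
    then show ?thesis using c by (intro exI[of _ "restrict c ?I"]) (simp add: P_def)
  qed
  then obtain c where "\<And>q. q \<in> ?I \<Longrightarrow> P q (c q)" by metis
  then have c: "\<And>q. q \<in> ?I \<Longrightarrow> c q \<in> ?I \<rightarrow>\<^sub>E UNIV" "\<And>q p. q \<in> ?I \<Longrightarrow> p \<in> ?I \<Longrightarrow> 0 \<le> c q p"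
    "\<And>q. q \<in> ?I \<Longrightarrow> M_stable V (j, i) \<otimes>\<^bsub>R\<^esub> M_stable V q = comb \<Omega> V (c q)"
    "\<And>q. q \<in> ?I \<Longrightarrow> (\<Sum>p\<in>?I. real_of_int (c q p) * weight V p) = weight V (j, i) * weight V q"
    unfolding P_def by blast+
  have "FPdim R ?I (M_stable V) (M_stable V (j, i)) = weight V (j, i)"
  proof (rule R.FPdim_eqI[where c = c and w = "weight V"])
    show "finite ?I" by (rule finite_stable_index[OF cs])
    show "?I \<noteq> {}" using p by auto
    show "d = d'" if "d \<in> ?I \<rightarrow>\<^sub>E UNIV" "d' \<in> ?I \<rightarrow>\<^sub>E UNIV"
      "(\<Oplus>\<^bsub>R\<^esub>p\<in>?I. add_pow R (d p :: int) (M_stable V p)) = (\<Oplus>\<^bsub>R\<^esub>p\<in>?I. add_pow R (d' p) (M_stable V p))" for d d'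
    proof (rule PiE_ext[OF that(1,2)])
      fix q assume "q \<in> ?I"
      then show "d q = d' q" using comb_inj[of d d' "fst q" "snd q"] that(3) by (simp add: comb_def)
    qed
    show "0 < weight V q" if "q \<in> ?I" for q
      using that Omega0_facts(4) qnum_pos[OF n_ge_2] by (auto simp: stable_index_def weight_def)
    show "M_stable V (j, i) \<otimes>\<^bsub>R\<^esub> M_stable V q = (\<Oplus>\<^bsub>R\<^esub>p\<in>?I. add_pow R (c q p) (M_stable V p))" if "q \<in> ?I" for q
      using c(3)[OF that] by (simp only: comb_def)
  qed (rule c; assumption)+
  then show ?thesis by (simp add: stable_FPdim_def stable_index_def weight_def)
qed

end

end

theorem theorem7p3:
  fixes G :: "('g, 'm) monoid_scheme" (structure)
    and \<chi> :: "'g \<Rightarrow> complex" and g :: 'g and n :: nat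
    and \<Omega> :: "'i set" and V :: "'i \<Rightarrow> ('g \<Rightarrow> complex) fdmod"
    and i :: 'i and j :: nat
  assumes "non_nilpotent_group_datum G \<chi> g n"
    and "complete_simples (non_nilpotent_group_datum.kG G) \<Omega> V"
    and "i \<in> non_nilpotent_group_datum.Omega0 G g n \<Omega> V"
    and "1 \<le> j" and "j \<le> n - 1"
  shows "non_nilpotent_group_datum.stable_FPdim G \<chi> g n \<Omega> V (non_nilpotent_group_datum.M_stable G \<chi> g n V (j, i)) =
           real (mdim (V i)) * dickson j 1 (2 * cos (pi / real n))"
proof -
  interpret non_nilpotent_group_datum G \<chi> g n by fact
  have "(j, i) \<in> stable_index \<Omega> V"
    using assms(3-5) by (simp add: stable_index_def)
  then show ?thesis
    using stable_FPdim_M_stable[OF assms(2)] by (simp add: dickson_qnum[OF n_ge_2])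
qed

end
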